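(* Let $s\ge1$. Then there exist $\delta>0$ and $C>0$ such that $$\|\partial_x(uv)\|_{X^{s,-\frac12+2\delta}}\le C\,\|u\|_{X^{s,\frac12+\delta}}\|v\|_{X^{s,\frac12+\delta}}$$ for all $u,v:\mathbb R\times\mathbb T\times\mathbb R\to\mathbb R$ such that $u,v\in X^{s,\frac12+\delta}$.
   Context: $\mathbb T=\mathbb R/2\pi\mathbb Z$. Functions depend on $(x,y,t)\in\mathbb R\times\mathbb T\times\mathbb R$ with dual Fourier variables $(\xi,q,\tau)\in\mathbb R\times\mathbb Z\times\mathbb R$. $|(\xi,q)|=\sqrt{3\xi^2+q^2}$, $\langle x\rangle=1+|x|$, $w(\xi,q)=\xi^3+\xi q^2$. For $s,b\in\mathbb R$, $X^{s,b}$ is the completion of the Schwartz-type functions on $\mathbb R\times\mathbb T\times\mathbb R$ under $$\|u\|_{X^{s,b}}=\Big(\sum_{q\in\mathbb Z}\int_{\mathbb R^2}\langle\tau-w(\xi,q)\rangle^{2b}\langle|(\xi,q)|\rangle^{2s}|\widehat u(\xi,q,\tau)|^2\,d\xi\,d\tau\Big)^{1/2},$$ where $\widehat u$ is the space-time Fourier transform. *)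

theory Defs
  imports "HOL-Analysis.Analysis"
begin

text \<open>
  Functions on \<open>\<real> \<times> \<real>/2\<pi>\<int> \<times> \<real>\<close> are functions of \<open>(x, y, t)\<close> on \<open>\<real> \<times> \<real> \<times> \<real>\<close> that are
  \<open>2\<pi>\<close>-periodic in \<open>y\<close>; integrals over the quotient are integrals over \<open>period_cell\<close>.
\<close>

type_synonym point = "real \<times> real \<times> real"
type_synonym freq = "real \<times> int \<times> real"

definition y_periodic :: "(point \<Rightarrow> 'a) \<Rightarrow> bool" where
  "y_periodic f \<longleftrightarrow> (\<forall>x y t. f (x, y + 2 * pi, t) = f (x, y, t))"

definition period_cell :: "point set" where
  "period_cell = UNIV \<times> {0..2 * pi} \<times> UNIV"

definition dir_deriv :: "point \<Rightarrow> (point \<Rightarrow> complex) \<Rightarrow> point \<Rightarrow> complex" where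
  "dir_deriv e f z = frechet_derivative f (at z) e"

definition partial_x :: "(point \<Rightarrow> complex) \<Rightarrow> point \<Rightarrow> complex" where
  "partial_x = dir_deriv (1, 0, 0)"

text \<open>
  Schwartz-type functions: all iterated partial derivatives exist, are differentiable, and decay
  faster than any power of \<open>(x, t)\<close>. The list \<open>es\<close> ranges over sequences of coordinate directions.
\<close>

definition schwartz :: "(point \<Rightarrow> complex) \<Rightarrow> bool" where
  "schwartz f \<longleftrightarrow> y_periodic f \<and>
     (\<forall>es. set es \<subseteq> Basis \<longrightarrow>
        (\<forall>z. foldr dir_deriv es f differentiable (at z)) \<and>
        (\<forall>k::nat. \<exists>M. \<forall>x y t.
           (1 + \<bar>x\<bar> + \<bar>t\<bar>) ^ k * cmod (foldr dir_deriv es f (x, y, t)) \<le> M))"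

text \<open>The measure \<open>\<Sum>\<^sub>q \<integral>\<integral> d\<xi> d\<tau>\<close> on the dual group.\<close>

definition freq_measure :: "freq measure" where
  "freq_measure = lborel \<Otimes>\<^sub>M (count_space UNIV \<Otimes>\<^sub>M lborel)"

text \<open>
  Unnormalized Fourier transform; another normalization rescales all norms below by the same
  positive factor.
\<close>

definition fourier :: "(point \<Rightarrow> complex) \<Rightarrow> freq \<Rightarrow> complex" where
  "fourier f = (\<lambda>(\<xi>, q, \<tau>).
     LINT z:period_cell|lborel.
       f z * exp (- \<i> * complex_of_real
         (\<xi> * fst z + real_of_int q * fst (snd z) + \<tau> * snd (snd z))))"

definition bracket :: "real \<Rightarrow> real" where
  "bracket x = 1 + \<bar>x\<bar>"

definition freq_size :: "real \<Rightarrow> int \<Rightarrow> real" where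
  "freq_size \<xi> q = sqrt (3 * \<xi>\<^sup>2 + (real_of_int q)\<^sup>2)"

definition dispersion :: "real \<Rightarrow> int \<Rightarrow> real" where
  "dispersion \<xi> q = \<xi> ^ 3 + \<xi> * (real_of_int q)\<^sup>2"

text \<open>
  The \<open>X\<^sup>s\<^sup>,\<^sup>b\<close> norm of a Schwartz-type function, for which the integrand is always integrable.
\<close>

definition schwartz_norm :: "real \<Rightarrow> real \<Rightarrow> (point \<Rightarrow> complex) \<Rightarrow> real" where
  "schwartz_norm s b f = sqrt (LINT (\<xi>, q, \<tau>)|freq_measure.
     bracket (\<tau> - dispersion \<xi> q) powr (2 * b) * bracket (freq_size \<xi> q) powr (2 * s)
       * (cmod (fourier f (\<xi>, q, \<tau>)))\<^sup>2)"

text \<open>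
  Distributions are functionals that are only ever applied to Schwartz-type functions.
\<close>

type_synonym distribution = "(point \<Rightarrow> complex) \<Rightarrow> complex"

definition dist_of :: "(point \<Rightarrow> complex) \<Rightarrow> distribution" where
  "dist_of f = (\<lambda>\<psi>. LINT z:period_cell|lebesgue. f z * \<psi> z)"

definition dist_dx :: "distribution \<Rightarrow> distribution" where
  "dist_dx T = (\<lambda>\<psi>. - T (partial_x \<psi>))"

text \<open>
  The completion \<open>X\<^sup>s\<^sup>,\<^sup>b\<close> of the Schwartz-type functions, realized inside the distributions: an
  element is the distributional limit of a sequence that is Cauchy for the norm. A Cauchy
  sequence tending to 0 as distributions also tends to 0 in norm, so this identification
  is injective, and the limit of the norms does not depend on the approximating sequence:
  the infimum in \<open>X_norm\<close> is over a single value.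
\<close>

definition X_approx ::
  "real \<Rightarrow> real \<Rightarrow> (nat \<Rightarrow> point \<Rightarrow> complex) \<Rightarrow> distribution \<Rightarrow> bool" where
  "X_approx s b \<phi> T \<longleftrightarrow>
     (\<forall>n. schwartz (\<phi> n)) \<and>
     (\<forall>\<epsilon>>0. \<exists>N. \<forall>m\<ge>N. \<forall>n\<ge>N. schwartz_norm s b (\<lambda>z. \<phi> m z - \<phi> n z) < \<epsilon>) \<and>
     (\<forall>\<psi>. schwartz \<psi> \<longrightarrow> (\<lambda>n. dist_of (\<phi> n) \<psi>) \<longlonglongrightarrow> T \<psi>)"

definition X_space :: "real \<Rightarrow> real \<Rightarrow> distribution set" where
  "X_space s b = {T. \<exists>\<phi>. X_approx s b \<phi> T}"

definition X_norm :: "real \<Rightarrow> real \<Rightarrow> distribution \<Rightarrow> real" where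
  "X_norm s b T =
     Inf {r. \<exists>\<phi>. X_approx s b \<phi> T \<and> (\<lambda>n. schwartz_norm s b (\<phi> n)) \<longlonglongrightarrow> r}"

text \<open>
  A real-valued function belongs to \<open>X\<^sup>s\<^sup>,\<^sup>b\<close> if it can be paired with every Schwartz-type function
  and the resulting distribution is in \<open>X_space s b\<close>. For \<open>s, b \<ge> 0\<close> such a function is
  square integrable over \<open>period_cell\<close>, so the product of two of them is integrable there.
\<close>

definition real_dist :: "(point \<Rightarrow> real) \<Rightarrow> distribution" where
  "real_dist u = dist_of (\<lambda>z. complex_of_real (u z))"

definition X_fun :: "real \<Rightarrow> real \<Rightarrow> (point \<Rightarrow> real) set" where
  "X_fun s b = {u. y_periodic u \<and> u \<in> borel_measurable lebesgue \<and>
     (\<forall>\<psi>. schwartz \<psi> \<longrightarrow>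
        set_integrable lebesgue period_cell (\<lambda>z. complex_of_real (u z) * \<psi> z)) \<and>
     real_dist u \<in> X_space s b}"

end

theory Submission
  imports Defs "HOL-Probability.Probability" "HOL-Real_Asymp.Real_Asymp"
begin

text \<open>
  We take \<open>\<delta> = 1/72\<close>. In Fourier variables the estimate is a weighted convolution estimate whose
  weight reduces, since \<open>s \<ge> 1\<close>, to \<open>s = 1\<close>. By Cauchy-Schwarz it is enough to bound the squared
  kernel integrated in one variable with another one fixed; the modulation integral leaves a sum
  over \<open>q\<^sub>1\<close> and an integral over \<open>\<xi>\<^sub>1\<close> of a function of the phase \<open>w(\<zeta>\<^sub>1) + w(\<zeta> - \<zeta>\<^sub>1)\<close>. Its
  \<open>\<xi>\<^sub>1\<close>-derivative is \<open>|\<zeta>\<^sub>1|\<^sup>2 - |\<zeta> - \<zeta>\<^sub>1|\<^sup>2\<close>. If the inputs have different sizes, this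
  derivative is large and we fix the output frequency. Otherwise we fix an input: either its size
  is controlled by the corresponding difference, or the triangle of frequencies is nearly
  equilateral, where the second derivatives of the phase are large.

  The estimate passes to the completion because Cauchy sequences for \<open>s, b \<ge> 0\<close> converge in
  \<open>L\<^sup>2\<close> by Plancherel. The \<open>L\<^sup>2\<close> limit represents the given distribution because Schwartz-type
  functions separate integrable functions, by Stone-Weierstrass in
  \<open>(tanh x, cos y, sin y, tanh t)\<close>.
\<close>


section \<open>One-dimensional integrals\<close>

text \<open>The lattice variable admits no change of variables, so every sum over \<open>q\<close>
  has to converge absolutely and every integral over \<xi> has to be bounded uniformly in the
  lattice points. With an input frozen, the modulation left over is that of the output, with
  exponent 1 - 4\<delta> < 1, too small for a change of variables in \<xi>. For \<delta> = 1/72 the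
  price is N^(1/4), and all later sums can afford it.

  The Hessian of the phase at a frozen frequency degenerates only for \<xi> = 0 and for 3\<xi>^2 =
  q^2. In the coordinates (sqrt 3 \<xi>, q) these are three lines at mutual angles of 45 and 90
  degrees, whereas the two inputs of an equilateral triangle span lines at 60 degrees. So at most
  one input is degenerate, and the other one can be frozen.\<close>

lemma bracket_ge_1: "1 \<le> bracket x"
  by (simp add: bracket_def)

lemma bracket_pos [simp]: "0 < bracket x"
  by (simp add: bracket_def add_pos_nonneg)

lemma bracket_nonneg [simp]: "0 \<le> bracket x"
  by (simp add: bracket_def)

lemma bracket_nz [simp]: "bracket x \<noteq> 0"
  using bracket_pos[of x] by linarith

lemma bracket_minus [simp]: "bracket (- x) = bracket x"
  by (simp add: bracket_def)

lemma bracket_minus_commute: "bracket (x - y) = bracket (y - x)"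
  by (simp add: bracket_def abs_minus_commute)

lemma bracket_measurable [measurable]: "bracket \<in> borel_measurable borel"
  unfolding bracket_def[abs_def] by measurable

lemma bracket_powr_le_1: "e \<ge> 0 \<Longrightarrow> bracket x powr (- e) \<le> 1"
  using bracket_ge_1[of x] powr_mono[of "-e" 0 "bracket x"] by simp

lemma bracket_powr_antimono:
  assumes "bracket y \<le> k * bracket x" "0 \<le> e" "0 < k"
  shows "bracket x powr (- e) \<le> k powr e * bracket y powr (- e)"
proof -
  have "bracket x powr (-e) = k powr e * (k * bracket x) powr (- e)"
    using assms by (simp add: powr_mult powr_minus field_simps)
  also have "(k * bracket x) powr (- e) \<le> bracket y powr (- e)"
    using assms by (intro powr_mono2') auto
  finally show ?thesis using assms by (simp add: mult_left_mono)
qed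

lemma nn_integral_shift_real:
  assumes "f \<in> borel_measurable borel"
  shows "(\<integral>\<^sup>+x. f (x + t) \<partial>lborel) = (\<integral>\<^sup>+x. f x \<partial>(lborel :: real measure))"
  using nn_integral_real_affine[OF assms, of 1 t] by (simp add: add.commute)

lemma nn_integral_reflect_real:
  assumes "f \<in> borel_measurable borel"
  shows "(\<integral>\<^sup>+x. f (t - x) \<partial>lborel) = (\<integral>\<^sup>+x. f x \<partial>(lborel :: real measure))"
  using nn_integral_real_affine[OF assms, of "-1" t] by simp

lemma nn_integral_real_halves:
  assumes [measurable]: "f \<in> borel_measurable borel"
  shows "(\<integral>\<^sup>+x. f x \<partial>lborel) \<le>
    (\<integral>\<^sup>+x. f x * indicator {0..} x \<partial>lborel) + (\<integral>\<^sup>+x. f (- x) * indicator {0..} x \<partial>(lborel :: real measure))"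
proof -
  have "(\<integral>\<^sup>+x. f x \<partial>lborel) \<le> (\<integral>\<^sup>+x. f x * indicator {0..} x + f x * indicator {..0} x \<partial>lborel)"
    by (intro nn_integral_mono) (auto simp: indicator_def)
  also have "\<dots> = (\<integral>\<^sup>+x. f x * indicator {0..} x \<partial>lborel) + (\<integral>\<^sup>+x. f x * indicator {..0} x \<partial>lborel)"
    by (rule nn_integral_add) auto
  also have "(\<integral>\<^sup>+x. f x * indicator {..0} x \<partial>lborel) = (\<integral>\<^sup>+x. f (- x) * indicator {..0} (- x) \<partial>lborel)"
    using nn_integral_reflect_real[of "\<lambda>x. f x * indicator {..0} x" 0] by simp
  also have "\<dots> = (\<integral>\<^sup>+x. f (- x) * indicator {0..} x \<partial>lborel)"
    by (intro nn_integral_cong) (auto simp: indicator_def)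
  finally show ?thesis .
qed

lemma nn_integral_atLeast_0_le:
  fixes f :: "real \<Rightarrow> ennreal"
  assumes [measurable]: "f \<in> borel_measurable borel"
    and le: "\<And>n::nat. (\<integral>\<^sup>+x. f x * indicator {0..real n} x \<partial>lborel) \<le> B"
  shows "(\<integral>\<^sup>+x. f x * indicator {0..} x \<partial>lborel) \<le> B"
proof -
  have "(\<integral>\<^sup>+x. f x * indicator {0..} x \<partial>lborel) = (\<integral>\<^sup>+x. (SUP n. f x * indicator {0..real n} x) \<partial>lborel)"
  proof (rule nn_integral_cong)
    fix x :: real
    obtain m where "x \<le> real m" using real_arch_simple by blast
    then have "f x * indicator {0..} x = f x * indicator {0..real m} x"
      by (auto simp: indicator_def)
    also have "\<dots> \<le> (SUP n. f x * indicator {0..real n} x)"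
      by (rule SUP_upper) simp
    finally show "f x * indicator {0..} x = (SUP n. f x * indicator {0..real n} x)"
      by (intro antisym SUP_least) (auto simp: indicator_def)
  qed
  also have "\<dots> = (SUP n. \<integral>\<^sup>+x. f x * indicator {0..real n} x \<partial>lborel)"
    by (rule nn_integral_monotone_convergence_SUP)
       (auto simp: incseq_def le_fun_def indicator_def)
  also have "\<dots> \<le> B" by (rule SUP_least) (rule le)
  finally show ?thesis .
qed

lemma nn_integral_bracket_powr_atLeast_0:
  assumes "e > 1"
  shows "(\<integral>\<^sup>+x. ennreal (bracket x powr (- e)) * indicator {0..} x \<partial>lborel) = ennreal (1 / (e - 1))"
proof -
  have "(\<integral>\<^sup>+x. ennreal (bracket x powr (- e)) * indicator {0..} x \<partial>lborel) =
        0 - (- ((1 + (0::real)) powr (1 - e)) / (e - 1))"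
  proof (rule nn_integral_FTC_atLeast)
    show "(\<lambda>x. bracket x powr (- e)) \<in> borel_measurable borel" by measurable
    show "((\<lambda>x. - ((1 + x) powr (1 - e)) / (e - 1)) has_real_derivative bracket x powr (- e)) (at x)"
      if "0 \<le> x" for x :: real
      using that assms
      by (auto intro!: derivative_eq_intros simp: bracket_def divide_simps)
         (auto simp: algebra_simps powr_diff powr_minus divide_simps)
    show "((\<lambda>x::real. - ((1 + x) powr (1 - e)) / (e - 1)) \<longlongrightarrow> 0) at_top"
      using assms by real_asymp
  qed auto
  then show ?thesis by simp
qed

text \<open>The exact integral of \<open>bracket x powr (- e)\<close> over the line for
  \<open>e > 1\<close>.\<close>

definition bracket_int :: "real \<Rightarrow> real" where
  "bracket_int e = 2 / (e - 1)"

lemma bracket_int_nonneg: "e > 1 \<Longrightarrow> 0 \<le> bracket_int e"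
  by (simp add: bracket_int_def)

lemma nn_integral_bracket_powr:
  assumes "e > 1"
  shows "(\<integral>\<^sup>+x. ennreal (bracket x powr (- e)) \<partial>lborel) \<le> ennreal (bracket_int e)"
proof -
  have "(\<integral>\<^sup>+x. ennreal (bracket x powr (- e)) \<partial>lborel) \<le> ennreal (1 / (e - 1)) + ennreal (1 / (e - 1))"
    using nn_integral_real_halves[of "\<lambda>x. ennreal (bracket x powr (- e))"]
    by (simp add: nn_integral_bracket_powr_atLeast_0[OF assms])
  also have "\<dots> = ennreal (bracket_int e)"
    using assms by (simp add: ennreal_plus[symmetric] bracket_int_def del: ennreal_plus)
  finally show ?thesis .
qed

lemma nn_integral_bracket_powr_shift:
  assumes "e > 1"
  shows "(\<integral>\<^sup>+x. ennreal (bracket (x - c) powr (- e)) \<partial>lborel) \<le> ennreal (bracket_int e)"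
  using nn_integral_shift_real[of "\<lambda>x. ennreal (bracket x powr (- e))" "- c"]
    nn_integral_bracket_powr[OF assms] by simp

text \<open>The factor \<open>2 * \<alpha> * \<bar>x\<bar>\<close> is the Jacobian of
  \<open>v = \<alpha> * x\<^sup>2 - c\<close>, which is injective on each half line; hence the bound
  depends neither on \<alpha> nor on \<open>c\<close>.\<close>

lemma nn_integral_parabola_pos:
  assumes "e > 1" "\<alpha> > 0"
  shows "(\<integral>\<^sup>+x. ennreal (2 * \<alpha> * \<bar>x\<bar> * bracket (\<alpha> * x\<^sup>2 - c) powr (- e)) \<partial>lborel) \<le> ennreal (2 * bracket_int e)"
proof -
  let ?g = "\<lambda>x. \<alpha> * x\<^sup>2 - c" and ?f = "\<lambda>v. bracket v powr (- e)"
  have half: "(\<integral>\<^sup>+x. ennreal (2 * \<alpha> * \<bar>x\<bar> * ?f (?g x)) * indicator {0..} x \<partial>lborel) \<le> ennreal (bracket_int e)"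
  proof (rule nn_integral_atLeast_0_le)
    fix n :: nat
    have subst: "(\<integral>\<^sup>+x. ?f x * indicator {?g 0..?g (real n)} x \<partial>lborel) =
       (\<integral>\<^sup>+x. ennreal (?f (?g x) * (2 * \<alpha> * x) * indicator {0..real n} x) \<partial>lborel)"
    proof (rule nn_integral_substitution)
      show "set_borel_measurable borel {?g 0..?g (real n)} ?f"
        unfolding set_borel_measurable_def by measurable
      show "(?g has_real_derivative 2 * \<alpha> * x) (at x)" for x
        by (auto intro!: derivative_eq_intros)
    qed (use assms in \<open>auto intro!: continuous_intros\<close>)
    have "(\<integral>\<^sup>+x. ennreal (2 * \<alpha> * \<bar>x\<bar> * ?f (?g x)) * indicator {0..real n} x \<partial>lborel) =
      (\<integral>\<^sup>+x. ennreal (?f (?g x) * (2 * \<alpha> * x) * indicator {0..real n} x) \<partial>lborel)"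
      by (intro nn_integral_cong) (auto simp: indicator_def mult_ac)
    also have "\<dots> = (\<integral>\<^sup>+x. ?f x * indicator {?g 0..?g (real n)} x \<partial>lborel)"
      by (rule subst[symmetric])
    also have "\<dots> \<le> (\<integral>\<^sup>+x. ennreal (?f x) \<partial>lborel)"
      by (intro nn_integral_mono) (auto simp: indicator_def)
    also note nn_integral_bracket_powr[OF assms(1)]
    finally show "(\<integral>\<^sup>+x. ennreal (2 * \<alpha> * \<bar>x\<bar> * ?f (?g x)) * indicator {0..real n} x \<partial>lborel) \<le> ennreal (bracket_int e)" .
  qed measurable
  have "(\<integral>\<^sup>+x. ennreal (2 * \<alpha> * \<bar>x\<bar> * ?f (?g x)) \<partial>lborel) \<le> ennreal (bracket_int e) + ennreal (bracket_int e)"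
    by (rule order.trans[OF nn_integral_real_halves]) (use half in \<open>auto intro: add_mono\<close>)
  also have "\<dots> = ennreal (2 * bracket_int e)"
    using bracket_int_nonneg[OF assms(1)] by (simp add: ennreal_plus[symmetric] del: ennreal_plus)
  finally show ?thesis .
qed

text \<open>A quadratic takes each value at most twice, so weighted by its own derivative it gives a
  bound that is uniform in the coefficients. This uniformity is what the later sums over the lattice
  rely on. Completing the square reduces to the parabola, apart from the linear case.\<close>

lemma nn_integral_quadratic:
  assumes e: "e > 1"
  shows "(\<integral>\<^sup>+x. ennreal (\<bar>2 * \<alpha> * x + \<beta>\<bar> * bracket (\<alpha> * x\<^sup>2 + \<beta> * x + \<gamma>) powr (- e)) \<partial>lborel)
    \<le> ennreal (2 * bracket_int e)"
proof (cases "\<alpha> = 0")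
  case True
  show ?thesis
  proof (cases "\<beta> = 0")
    case False
    have "ennreal \<bar>\<beta>\<bar> * (\<integral>\<^sup>+x. ennreal (bracket (\<gamma> + \<beta> * x) powr (- e)) \<partial>lborel) \<le> ennreal (bracket_int e)"
      by (subst nn_integral_real_affine[symmetric, of "\<lambda>x. ennreal (bracket x powr (- e))" \<beta> \<gamma>])
         (use False nn_integral_bracket_powr[OF e] in auto)
    also have "ennreal \<bar>\<beta>\<bar> * (\<integral>\<^sup>+x. ennreal (bracket (\<gamma> + \<beta> * x) powr (- e)) \<partial>lborel)
       = (\<integral>\<^sup>+x. ennreal (\<bar>\<beta>\<bar> * bracket (\<gamma> + \<beta> * x) powr (- e)) \<partial>lborel)"
      by (subst nn_integral_cmult[symmetric]) (auto simp: ennreal_mult)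
    also have "ennreal (bracket_int e) \<le> ennreal (2 * bracket_int e)"
      using bracket_int_nonneg[OF e] by (intro ennreal_leI) auto
    finally show ?thesis using True by (simp add: add.commute)
  qed (use True in simp)
next
  case False
  define x0 where "x0 = - \<beta> / (2 * \<alpha>)"
  define c where "c = \<alpha> * x0\<^sup>2 - \<gamma>"
  have eq: "\<alpha> * x\<^sup>2 + \<beta> * x + \<gamma> = \<alpha> * (x - x0)\<^sup>2 - c" "2 * \<alpha> * x + \<beta> = 2 * \<alpha> * (x - x0)" for x
    using False by (auto simp: x0_def c_def field_simps power2_eq_square)
  define s where "s = sgn \<alpha>"
  have s: "\<bar>\<alpha>\<bar> > 0" using False by simp
  \<comment> \<open>\<open>bracket\<close> is even, so the sign of \<alpha> can be moved to the
    constant.\<close>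
  have br: "bracket (\<alpha> * y\<^sup>2 - c) = bracket (\<bar>\<alpha>\<bar> * y\<^sup>2 - s * c)" for y
  proof (cases "\<alpha> > 0")
    case False
    then have "\<bar>\<alpha>\<bar> * y\<^sup>2 - s * c = - (\<alpha> * y\<^sup>2 - c)" using \<open>\<alpha> \<noteq> 0\<close> by (simp add: s_def)
    then show ?thesis by (simp only: bracket_minus)
  qed (simp add: s_def)
  have "(\<integral>\<^sup>+x. ennreal (\<bar>2 * \<alpha> * x + \<beta>\<bar> * bracket (\<alpha> * x\<^sup>2 + \<beta> * x + \<gamma>) powr (- e)) \<partial>lborel) =
     (\<integral>\<^sup>+x. ennreal (2 * \<bar>\<alpha>\<bar> * \<bar>x + - x0\<bar> * bracket (\<bar>\<alpha>\<bar> * (x + - x0)\<^sup>2 - s * c) powr (- e)) \<partial>lborel)"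
    unfolding eq by (simp add: br abs_mult)
  also have "\<dots> = (\<integral>\<^sup>+x. ennreal (2 * \<bar>\<alpha>\<bar> * \<bar>x\<bar> * bracket (\<bar>\<alpha>\<bar> * x\<^sup>2 - s * c) powr (- e)) \<partial>lborel)"
    by (rule nn_integral_shift_real) measurable
  finally show ?thesis using nn_integral_parabola_pos[OF e s, of "s * c"] by simp
qed

text \<open>Here the Jacobian is absent. For \<open>\<bar>a\<bar> \<ge> r\<close> with r half the
  root of \<open>bracket c\<close> it can be inserted at the cost 1/r. For smaller \<open>a\<close>
  the phase is of size at least \<open>bracket c / 2\<close>, and this interval has length 2r. Both
  parts are of order \<open>bracket c powr (- 1/2)\<close>.\<close>

lemma nn_integral_square_phase:
  assumes e: "e > 1"
  shows "(\<integral>\<^sup>+a. ennreal (bracket (a\<^sup>2 - c) powr (- e)) \<partial>lborel)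
     \<le> ennreal ((2 * bracket_int e + 2 powr e) * bracket c powr (- 1/2))"
proof -
  define r where "r = sqrt (bracket c) / 2"
  have r: "r > 0" by (simp add: r_def)
  have r2: "r\<^sup>2 = bracket c / 4" by (simp add: r_def power_divide)
  have rr: "bracket c powr (- 1/2) = 1 / (2 * r)"
    by (simp add: r_def powr_minus_divide powr_half_sqrt)
  have pt: "bracket (a\<^sup>2 - c) powr (- e) \<le>
      (1 / (2 * r)) * (2 * 1 * \<bar>a\<bar> * bracket (1 * a\<^sup>2 - c) powr (- e)) +
      2 powr e * bracket c powr (- 1) * indicator {-r..r} a" (is "_ \<le> ?A + ?B") for a
  proof (cases "\<bar>a\<bar> \<ge> r")
    case True
    have "1 * bracket (a\<^sup>2 - c) powr (- e) \<le> (\<bar>a\<bar> / r) * bracket (a\<^sup>2 - c) powr (- e)"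
      using True r by (intro mult_right_mono) auto
    also have "\<dots> = ?A" by simp
    also have "\<dots> \<le> ?A + ?B" by (simp add: indicator_def)
    finally show ?thesis by simp
  next
    case False
    then have "\<bar>a\<bar>\<^sup>2 \<le> r\<^sup>2" by (intro power_mono) auto
    then have "4 * a\<^sup>2 \<le> bracket c" by (simp add: r2)
    then have "bracket c \<le> 2 * bracket (a\<^sup>2 - c)"
      unfolding bracket_def by (smt (verit) zero_le_power2)
    then have "bracket (a\<^sup>2 - c) powr (- e) \<le> 2 powr e * bracket c powr (- e)"
      using e by (intro bracket_powr_antimono) auto
    also have "bracket c powr (- e) \<le> bracket c powr (- 1)"
      using e bracket_ge_1 by (intro powr_mono) auto
    finally have "bracket (a\<^sup>2 - c) powr (- e) \<le> ?B"
      using False by (simp add: indicator_def) (smt (verit))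
    moreover have "0 \<le> ?A" using r by simp
    ultimately show ?thesis by linarith
  qed
  have "(\<integral>\<^sup>+a. ennreal (bracket (a\<^sup>2 - c) powr (- e)) \<partial>lborel) \<le>
     (\<integral>\<^sup>+a. ennreal (1 / (2 * r)) * ennreal (2 * 1 * \<bar>a\<bar> * bracket (1 * a\<^sup>2 - c) powr (- e))
       + ennreal (2 powr e * bracket c powr (- 1)) * indicator {-r..r} a \<partial>lborel)"
  proof (rule nn_integral_mono)
    fix a
    show "ennreal (bracket (a\<^sup>2 - c) powr (- e)) \<le> ennreal (1 / (2 * r)) * ennreal (2 * 1 * \<bar>a\<bar> * bracket (1 * a\<^sup>2 - c) powr (- e))
       + ennreal (2 powr e * bracket c powr (- 1)) * indicator {-r..r} a"
      using ennreal_leI[OF pt[of a]] r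
      by (subst (asm) ennreal_plus) (auto simp: ennreal_mult[symmetric] ennreal_indicator[symmetric] split: split_indicator)
  qed
  also have "\<dots> = ennreal (1 / (2 * r)) * (\<integral>\<^sup>+a. ennreal (2 * 1 * \<bar>a\<bar> * bracket (1 * a\<^sup>2 - c) powr (- e)) \<partial>lborel)
       + ennreal (2 powr e * bracket c powr (- 1)) * (\<integral>\<^sup>+a. indicator {-r..r} a \<partial>lborel)"
    by (subst nn_integral_add) (auto simp: nn_integral_cmult)
  also have "(\<integral>\<^sup>+a. indicator {-r..r} a \<partial>lborel) = ennreal (2 * r)"
    using r by simp
  also have "ennreal (1 / (2 * r)) * (\<integral>\<^sup>+a. ennreal (2 * 1 * \<bar>a\<bar> * bracket (1 * a\<^sup>2 - c) powr (- e)) \<partial>lborel)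
     \<le> ennreal (1 / (2 * r)) * ennreal (2 * bracket_int e)"
    by (intro mult_left_mono nn_integral_parabola_pos e) auto
  also have "ennreal (1 / (2 * r)) * ennreal (2 * bracket_int e) + ennreal (2 powr e * bracket c powr (- 1)) * ennreal (2 * r)
    = ennreal (1 / (2 * r) * (2 * bracket_int e) + 2 powr e * bracket c powr (- 1) * (2 * r))"
    using r bracket_int_nonneg[OF e] by (simp add: ennreal_mult[symmetric] ennreal_plus[symmetric] del: ennreal_plus)
  also have "1 / (2 * r) * (2 * bracket_int e) + 2 powr e * bracket c powr (- 1) * (2 * r)
     = (2 * bracket_int e + 2 powr e) * bracket c powr (- 1/2)"
  proof -
    have "bracket c powr (- 1) * (2 * r) = 1 / (2 * r)"
      using r r2 by (simp add: powr_minus_divide field_simps power2_eq_square)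
    then show ?thesis unfolding rr by (simp only: mult.assoc) (simp add: algebra_simps)
  qed
  finally show ?thesis by (simp add: add_right_mono)
qed

text \<open>Rescaling by \<open>sqrt \<bar>\<alpha>\<bar>\<close>. The decay in \<open>c\<close> is
  recorded because \<open>c\<close> will depend on the lattice variable in
  \<open>hessian_bound\<close>, where it drives the sum.\<close>

lemma nn_integral_scaled_square_phase:
  assumes e: "e > 1" and \<alpha>: "\<alpha> \<noteq> 0"
  shows "(\<integral>\<^sup>+a. ennreal (bracket (\<alpha> * (a - a0)\<^sup>2 - c) powr (- e)) \<partial>lborel)
     \<le> ennreal ((2 * bracket_int e + 2 powr e) * \<bar>\<alpha>\<bar> powr (- 1/2) * bracket c powr (- 1/2))"
proof -
  define t where "t = sqrt \<bar>\<alpha>\<bar>"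
  have t: "t > 0" "t\<^sup>2 = \<bar>\<alpha>\<bar>" using \<alpha> by (auto simp: t_def)
  define d where "d = sgn \<alpha> * c"
  have d: "bracket d = bracket c" using \<alpha> by (auto simp: d_def bracket_def abs_mult)
  have br: "bracket (\<alpha> * y\<^sup>2 - c) = bracket ((t * y)\<^sup>2 - d)" for y
  proof (cases "\<alpha> > 0")
    case False
    then have "(t * y)\<^sup>2 - d = - (\<alpha> * y\<^sup>2 - c)" using \<open>\<alpha> \<noteq> 0\<close> by (simp add: d_def power_mult_distrib t)
    then show ?thesis by (simp only: bracket_minus)
  qed (simp add: d_def power_mult_distrib t)
  have "(\<integral>\<^sup>+a. ennreal (bracket (\<alpha> * (a - a0)\<^sup>2 - c) powr (- e)) \<partial>lborel)
    = (\<integral>\<^sup>+a. ennreal (bracket ((t * (a - a0))\<^sup>2 - d) powr (- e)) \<partial>lborel)"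
    by (simp add: br)
  also have "\<dots> = (\<integral>\<^sup>+a. ennreal (bracket ((- t * a0 + t * a)\<^sup>2 - d) powr (- e)) \<partial>lborel)"
    by (simp add: algebra_simps)
  also have "\<dots> = ennreal (1/t) * (ennreal \<bar>t\<bar> * (\<integral>\<^sup>+a. ennreal (bracket ((- t * a0 + t * a)\<^sup>2 - d) powr (- e)) \<partial>lborel))"
    using t by (simp add: mult.assoc[symmetric] ennreal_mult[symmetric])
  also have "\<dots> = ennreal (1/t) * (\<integral>\<^sup>+a. ennreal (bracket (a\<^sup>2 - d) powr (- e)) \<partial>lborel)"
    by (subst nn_integral_real_affine[symmetric, of "\<lambda>a. ennreal (bracket (a\<^sup>2 - d) powr (- e))"]) (use t in auto)
  also have "\<dots> \<le> ennreal (1/t) * ennreal ((2 * bracket_int e + 2 powr e) * bracket d powr (- 1/2))"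
    by (intro mult_left_mono nn_integral_square_phase e) auto
  also have "\<dots> = ennreal ((2 * bracket_int e + 2 powr e) * \<bar>\<alpha>\<bar> powr (- 1/2) * bracket c powr (- 1/2))"
    using t bracket_int_nonneg[OF e]
    by (simp add: ennreal_mult[symmetric] d t_def powr_minus_divide powr_half_sqrt field_simps)
  finally show ?thesis .
qed

section \<open>Convolutions of brackets and lattice sums\<close>

text \<open>If \<open>\<bar>y\<bar> \<le> 2 * \<bar>x - y\<bar>\<close>, the second factor carries
  the decay in \<open>y\<close>. Otherwise \<open>\<bar>x\<bar>\<close> exceeds both
  \<open>\<bar>y\<bar> / 2\<close> and \<open>\<bar>x - y\<bar>\<close>: of the \<open>e\<close>
  powers of \<open>bracket x\<close>, \<open>b\<close> give the decay in \<open>y\<close> and the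
  others pass to \<open>bracket (x - y)\<close>.\<close>

lemma bracket_convolution_pointwise:
  assumes "0 \<le> b" "b \<le> e"
  shows "bracket x powr (- e) * bracket (x - y) powr (- b)
    \<le> 2 powr b * bracket y powr (- b) * (bracket x powr (- e) + bracket (x - y) powr (- e))"
proof (cases "\<bar>y\<bar> \<le> 2 * \<bar>x - y\<bar>")
  case True
  then have "bracket (x - y) powr (- b) \<le> 2 powr b * bracket y powr (- b)"
    using assms by (intro bracket_powr_antimono) (auto simp: bracket_def)
  then have "bracket x powr (- e) * bracket (x - y) powr (- b) \<le> bracket x powr (- e) * (2 powr b * bracket y powr (- b))"
    by (intro mult_left_mono) auto
  also have "\<dots> \<le> (bracket x powr (- e) + bracket (x - y) powr (- e)) * (2 powr b * bracket y powr (- b))"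
    by (intro mult_right_mono) auto
  finally show ?thesis by (simp add: mult_ac)
next
  case False
  then have le: "\<bar>y\<bar> \<le> 2 * \<bar>x\<bar>" "bracket (x - y) \<le> bracket x" by (auto simp: bracket_def, (smt (verit))+)
  have "bracket x powr (- e) = bracket x powr (- b) * bracket x powr (- (e - b))"
    by (simp add: powr_add[symmetric])
  also have "\<dots> \<le> (2 powr b * bracket y powr (- b)) * bracket (x - y) powr (- (e - b))"
    using assms le
    by (intro mult_mono bracket_powr_antimono powr_mono2') (auto simp: bracket_def)
  finally have "bracket x powr (- e) * bracket (x - y) powr (- b) \<le>
    (2 powr b * bracket y powr (- b)) * bracket (x - y) powr (- (e - b)) * bracket (x - y) powr (- b)"
    by (intro mult_right_mono) auto
  also have "\<dots> = (2 powr b * bracket y powr (- b)) * bracket (x - y) powr (- e)"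
    by (simp add: powr_add[symmetric] mult.assoc)
  also have "\<dots> \<le> (2 powr b * bracket y powr (- b)) * (bracket x powr (- e) + bracket (x - y) powr (- e))"
    by (intro mult_left_mono) auto
  finally show ?thesis .
qed

lemma nn_integral_bracket_convolution:
  assumes e: "e > 1" and b: "0 \<le> b" "b \<le> e"
  shows "(\<integral>\<^sup>+x. ennreal (bracket (x - u) powr (- e) * bracket (x - v) powr (- b)) \<partial>lborel)
     \<le> ennreal (2 * 2 powr b * bracket_int e * bracket (v - u) powr (- b))"
proof -
  let ?k = "2 powr b * bracket (v - u) powr (- b)"
  have "(\<integral>\<^sup>+x. ennreal (bracket (x - u) powr (- e) * bracket (x - v) powr (- b)) \<partial>lborel)
    \<le> (\<integral>\<^sup>+x. ennreal ?k * (ennreal (bracket (x - u) powr (- e)) + ennreal (bracket (x - v) powr (- e))) \<partial>lborel)"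
  proof (rule nn_integral_mono)
    fix x
    show "ennreal (bracket (x - u) powr (- e) * bracket (x - v) powr (- b))
      \<le> ennreal ?k * (ennreal (bracket (x - u) powr (- e)) + ennreal (bracket (x - v) powr (- e)))"
      using ennreal_leI[OF bracket_convolution_pointwise[OF b, of "x - u" "v - u"]]
      by (simp add: ennreal_mult ennreal_plus[symmetric] del: ennreal_plus)
  qed
  also have "\<dots> = ennreal ?k * ((\<integral>\<^sup>+x. ennreal (bracket (x - u) powr (- e)) \<partial>lborel) + (\<integral>\<^sup>+x. ennreal (bracket (x - v) powr (- e)) \<partial>lborel))"
    by (subst nn_integral_cmult) (auto simp: nn_integral_add)
  also have "\<dots> \<le> ennreal ?k * (ennreal (bracket_int e) + ennreal (bracket_int e))"
    by (intro mult_left_mono add_mono nn_integral_bracket_powr_shift e) auto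
  also have "\<dots> = ennreal (2 * 2 powr b * bracket_int e * bracket (v - u) powr (- b))"
    using bracket_int_nonneg[OF e]
    by (simp add: ennreal_mult[symmetric] ennreal_plus[symmetric] mult_ac del: ennreal_plus)
  finally show ?thesis .
qed

text \<open>Comparison with the integral: points of [n, n + 1) have distance at most 1 from n, which
  costs a factor \<open>2 powr e\<close>. The centre \<open>y\<close> is an arbitrary real because
  the sums below are not centred at integers.\<close>

lemma nn_integral_int_bracket:
  assumes e: "e > 1"
  shows "(\<integral>\<^sup>+n. ennreal (bracket (real_of_int n - y) powr (- e)) \<partial>count_space UNIV)
     \<le> ennreal (2 powr e * bracket_int e)"
proof -
  let ?I = "\<lambda>n::int. \<lambda>x::real. indicator {x. \<lfloor>x\<rfloor> = n} x :: ennreal"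
  interpret c: sigma_finite_measure "count_space (UNIV :: int set)"
    by (rule sigma_finite_measure_count_space_countable) auto
  interpret p: pair_sigma_finite "lborel :: real measure" "count_space (UNIV :: int set)" ..
  have le: "ennreal (bracket (real_of_int n - y) powr (- e)) \<le>
     (\<integral>\<^sup>+x. ennreal (2 powr e * bracket (x - y) powr (- e)) * ?I n x \<partial>lborel)" for n
  proof -
    have em: "(\<integral>\<^sup>+x. ?I n x \<partial>lborel) = 1"
    proof -
      have "{x. \<lfloor>x\<rfloor> = n} = {real_of_int n..<real_of_int n + 1}"
        by (auto simp: floor_eq_iff)
      then show ?thesis by simp
    qed
    have "ennreal (bracket (real_of_int n - y) powr (- e)) = (\<integral>\<^sup>+x. ennreal (bracket (real_of_int n - y) powr (- e)) * ?I n x \<partial>lborel)"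
      by (subst nn_integral_cmult) (auto simp: em)
    also have "\<dots> \<le> (\<integral>\<^sup>+x. ennreal (2 powr e * bracket (x - y) powr (- e)) * ?I n x \<partial>lborel)"
    proof (intro nn_integral_mono, cases)
      fix x :: real assume "\<lfloor>x\<rfloor> = n"
      then have "\<bar>x - real_of_int n\<bar> \<le> 1" by linarith
      then have "bracket (real_of_int n - y) powr (- e) \<le> 2 powr e * bracket (x - y) powr (- e)"
        using e by (intro bracket_powr_antimono) (auto simp: bracket_def, smt (verit))
      then show "ennreal (bracket (real_of_int n - y) powr (- e)) * ?I n x \<le> ennreal (2 powr e * bracket (x - y) powr (- e)) * ?I n x"
        by (intro mult_right_mono ennreal_leI) auto
    qed (auto simp: indicator_def)
    finally show ?thesis .
  qed
  have "(\<integral>\<^sup>+n. ennreal (bracket (real_of_int n - y) powr (- e)) \<partial>count_space UNIV) \<le>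
     (\<integral>\<^sup>+n. \<integral>\<^sup>+x. ennreal (2 powr e * bracket (x - y) powr (- e)) * ?I n x \<partial>lborel \<partial>count_space UNIV)"
    by (intro nn_integral_mono le)
  also have "\<dots> = (\<integral>\<^sup>+x. \<integral>\<^sup>+n. ennreal (2 powr e * bracket (x - y) powr (- e)) * ?I n x \<partial>count_space UNIV \<partial>lborel)"
  proof (rule p.Fubini')
    have [measurable]: "(\<lambda>z::real \<times> int. ?I (snd z) (fst z)) \<in> borel_measurable (lborel \<Otimes>\<^sub>M count_space UNIV)"
      by (rule measurable_compose_countable'[where I=UNIV and f="\<lambda>n z. ?I n (fst z)" and g=snd]) auto
    show "(\<lambda>(x, n). ennreal (2 powr e * bracket (x - y) powr (- e)) * ?I n x) \<in> borel_measurable (lborel \<Otimes>\<^sub>M count_space UNIV)"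
      by (simp add: case_prod_beta')
  qed
  also have "\<dots> = (\<integral>\<^sup>+x. ennreal (2 powr e * bracket (x - y) powr (- e)) \<partial>lborel)"
  proof (rule nn_integral_cong)
    fix x :: real
    have "(\<integral>\<^sup>+n. ?I n x \<partial>count_space UNIV) = (\<integral>\<^sup>+n. indicator {\<lfloor>x\<rfloor>} n \<partial>count_space UNIV)"
      by (intro nn_integral_cong) (auto simp: indicator_def)
    also have "\<dots> = 1" by (subst nn_integral_indicator) auto
    finally show "(\<integral>\<^sup>+n. ennreal (2 powr e * bracket (x - y) powr (- e)) * ?I n x \<partial>count_space UNIV) = ennreal (2 powr e * bracket (x - y) powr (- e))"
      by (subst nn_integral_cmult) auto
  qed
  also have "\<dots> = ennreal (2 powr e) * (\<integral>\<^sup>+x. ennreal (bracket (x - y) powr (- e)) \<partial>lborel)"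
    by (subst nn_integral_cmult[symmetric]) (auto simp: ennreal_mult)
  also have "\<dots> \<le> ennreal (2 powr e) * ennreal (bracket_int e)"
    by (intro mult_left_mono nn_integral_bracket_powr_shift e) auto
  finally show ?thesis using bracket_int_nonneg[OF e] by (simp add: ennreal_mult[symmetric])
qed

section \<open>Geometry of the phase\<close>

text \<open>This is both the squared size of a frequency and the \<xi>-derivative of
  \<open>dispersion\<close>; the coincidence turns phase derivatives into differences of squared
  sizes.\<close>

definition freq_sq :: "real \<Rightarrow> int \<Rightarrow> real" where
  "freq_sq \<xi> q = 3 * \<xi>\<^sup>2 + (real_of_int q)\<^sup>2"

definition phase :: "real \<Rightarrow> int \<Rightarrow> real \<Rightarrow> int \<Rightarrow> real" where
  "phase \<xi> q x p = dispersion x p + dispersion (\<xi> - x) (q - p)"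

definition phase_deriv :: "real \<Rightarrow> int \<Rightarrow> real \<Rightarrow> int \<Rightarrow> real" where
  "phase_deriv \<xi> q x p = freq_sq x p - freq_sq (\<xi> - x) (q - p)"

text \<open>The cubic terms of the two dispersions cancel, so for fixed lattice points the phase is
  quadratic in \<open>x\<close>, with derivative \<open>phase_deriv\<close>, and
  \<open>nn_integral_quadratic\<close> applies.\<close>

lemma phase_quadratic:
  "phase \<xi> q x p = (3 * \<xi>) * x\<^sup>2 + ((real_of_int p)\<^sup>2 - 3 * \<xi>\<^sup>2 - (real_of_int (q - p))\<^sup>2) * x
     + (\<xi> ^ 3 + \<xi> * (real_of_int (q - p))\<^sup>2)"
  "phase_deriv \<xi> q x p = 2 * (3 * \<xi>) * x + ((real_of_int p)\<^sup>2 - 3 * \<xi>\<^sup>2 - (real_of_int (q - p))\<^sup>2)"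
  by (auto simp: phase_def phase_deriv_def dispersion_def freq_sq_def power2_eq_square power3_eq_cube algebra_simps)

text \<open>After completing the square in \<open>x\<close>, what remains is a parabola in
  \<open>p\<close> centred at \<open>q / 2\<close>. Its coefficient is the determinant
  \<open>3 * \<xi>\<^sup>2 - q\<^sup>2\<close> of the quadratic form divided by the leading
  coefficient \<open>3 * \<xi>\<close>, so the phase is nondegenerate exactly when neither
  vanishes.\<close>

lemma phase_centred:
  assumes "\<xi> \<noteq> 0"
  shows "phase \<xi> q x p =
    3 * \<xi> * (x - (\<xi> / 2 - real_of_int q * (real_of_int p - real_of_int q / 2) / (3 * \<xi>)))\<^sup>2
    - (- ((3 * \<xi>\<^sup>2 - (real_of_int q)\<^sup>2) / (3 * \<xi>)) * (real_of_int p - real_of_int q / 2)\<^sup>2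
        - \<xi> ^ 3 / 4 - \<xi> * (real_of_int q)\<^sup>2 / 4)"
  using assms unfolding phase_def dispersion_def
  by (simp add: field_simps) (simp add: eval_nat_numeral algebra_simps)

lemma nn_integral_phase:
  assumes "e > 1"
  shows "(\<integral>\<^sup>+x. ennreal (\<bar>phase_deriv \<xi> q x p\<bar> * bracket (phase \<xi> q x p - c) powr (- e)) \<partial>lborel)
    \<le> ennreal (2 * bracket_int e)"
  using nn_integral_quadratic[OF assms, of "3 * \<xi>" "(real_of_int p)\<^sup>2 - 3 * \<xi>\<^sup>2 - (real_of_int (q - p))\<^sup>2"
      "\<xi> ^ 3 + \<xi> * (real_of_int (q - p))\<^sup>2 - c"]
  unfolding phase_quadratic by (simp add: algebra_simps)

lemma freq_sq_nonneg [simp]: "0 \<le> freq_sq \<xi> q"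
  by (simp add: freq_sq_def)

lemma freq_size_sqrt: "freq_size \<xi> q = sqrt (freq_sq \<xi> q)"
  by (simp add: freq_size_def freq_sq_def)

lemma freq_size_nonneg [simp]: "0 \<le> freq_size \<xi> q"
  by (simp add: freq_size_sqrt)

lemma freq_size_power2: "(freq_size \<xi> q)\<^sup>2 = freq_sq \<xi> q"
  by (simp add: freq_size_sqrt)

lemma freq_sq_uminus [simp]: "freq_sq (- \<xi>) (- q) = freq_sq \<xi> q"
  by (simp add: freq_sq_def)

lemma freq_sq_minus_commute: "freq_sq (\<xi> - x) (q - p) = freq_sq (x - \<xi>) (p - q)"
  using freq_sq_uminus[of "\<xi> - x" "q - p"] by simp

lemma abs_le_freq_size: "\<bar>real_of_int q\<bar> \<le> freq_size \<xi> q" "\<bar>\<xi>\<bar> \<le> freq_size \<xi> q"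
  unfolding freq_size_def by (auto intro!: real_le_rsqrt)

lemma freq_size_triangle: "freq_size (\<xi> + x) (q + p) \<le> freq_size \<xi> q + freq_size x p"
proof -
  have eq: "freq_size \<xi> q = norm (sqrt 3 * \<xi>, real_of_int q)" for \<xi> q
    by (simp add: freq_size_def norm_Pair power_mult_distrib)
  have "(sqrt 3 * (\<xi> + x), real_of_int (q + p)) = (sqrt 3 * \<xi>, real_of_int q) + (sqrt 3 * x, real_of_int p)"
    by (simp add: algebra_simps)
  then show ?thesis unfolding eq by (metis norm_triangle_ineq)
qed

lemma freq_sq_add_le: "freq_sq (\<xi> + x) (q + p) \<le> 2 * (freq_sq \<xi> q + freq_sq x p)"
proof -
  have "freq_sq (\<xi> + x) (q + p) + freq_sq (\<xi> - x) (q - p) = 2 * (freq_sq \<xi> q + freq_sq x p)"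
    by (simp add: freq_sq_def power2_eq_square algebra_simps)
  then show ?thesis using freq_sq_nonneg[of "\<xi> - x" "q - p"] by linarith
qed

text \<open>
  The transversal region and, outside of it, the region in which the first factor is frozen.
  The second alternative in \<open>freezable\<close> covers nearly equilateral triangles of frequencies: there
  the gradient of the phase may vanish, but its Hessian is well conditioned.
\<close>

definition transversal :: "real \<Rightarrow> real \<Rightarrow> bool" where
  "transversal n1 n2 \<longleftrightarrow> n1 + n2 \<le> 100 * \<bar>n1 - n2\<bar>"

definition freezable :: "real \<Rightarrow> int \<Rightarrow> real \<Rightarrow> real \<Rightarrow> bool" where
  "freezable \<xi>1 q1 n0 n2 \<longleftrightarrow> freq_sq \<xi>1 q1 \<le> 100 * \<bar>n0 - n2\<bar> \<or>
     freq_sq \<xi>1 q1 \<le> 1000 * \<xi>1\<^sup>2 \<and>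
     (freq_sq \<xi>1 q1)\<^sup>2 \<le> 1000 * (3 * \<xi>1\<^sup>2 - (real_of_int q1)\<^sup>2)\<^sup>2"

text \<open>The pairs are cosine and sine of twice the angle of a frequency in the coordinates (sqrt
  3 \<xi>, q). The exceptional directions have doubled angle near 180 or near 90 or -90 degrees, so
  the cosine of the difference of two of them is near 1, 0 or -1 and never near -1/2.\<close>

lemma unit_vectors_doubled_angle:
  fixes u1 u2 s1 s2 :: real
  assumes "u1\<^sup>2 + s1\<^sup>2 = 1" "u2\<^sup>2 + s2\<^sup>2 = 1"
    and R: "- 0.52 \<le> u1 * u2 + s1 * s2" "u1 * u2 + s1 * s2 \<le> - 0.48"
    and b1: "u1 < - 0.994 \<or> u1\<^sup>2 < 0.001" and b2: "u2 < - 0.994 \<or> u2\<^sup>2 < 0.001"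
  shows False
proof -
  have A: "\<bar>s\<bar> < 0.11" if "u < - 0.994" "u\<^sup>2 + s\<^sup>2 = 1" for u s :: real
  proof -
    have "(0.994)\<^sup>2 \<le> (- u)\<^sup>2" using that by (intro power_mono) auto
    then have "s\<^sup>2 < 0.11\<^sup>2" using that by (simp add: power2_eq_square)
    then show ?thesis using power_less_imp_less_base[of "\<bar>s\<bar>" 2 "0.11"] by simp
  qed
  have le1: "\<bar>u\<bar> \<le> 1 \<and> \<bar>s\<bar> \<le> 1" if "u\<^sup>2 + s\<^sup>2 = 1" for u s :: real
  proof -
    have "u\<^sup>2 \<le> 1" using that zero_le_power2[of s] by linarith
    moreover have "s\<^sup>2 \<le> 1" using that zero_le_power2[of u] by linarith
    ultimately show ?thesis by (simp add: abs_square_le_1)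
  qed
  have B: "\<bar>u\<bar> < 0.032" if "u\<^sup>2 < 0.001" for u :: real
  proof -
    have "\<bar>u\<bar>\<^sup>2 < 0.032\<^sup>2" using that by (simp add: power2_eq_square)
    then show ?thesis using power_less_imp_less_base[of "\<bar>u\<bar>" 2 "0.032"] by simp
  qed
  have C: "\<bar>s\<bar> > 0.99" if "u\<^sup>2 < 0.001" "u\<^sup>2 + s\<^sup>2 = 1" for u s :: real
  proof -
    have "0.99\<^sup>2 < \<bar>s\<bar>\<^sup>2" using that by (simp add: power2_eq_square)
    then show ?thesis using power_less_imp_less_base[of "0.99" 2 "\<bar>s\<bar>"] by simp
  qed
  have M: "\<bar>a * b\<bar> \<le> k * l" if "\<bar>a\<bar> \<le> k" "\<bar>b\<bar> \<le> l" for a b k l :: real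
    using that unfolding abs_mult by (intro mult_mono) auto
  note l1 = le1[OF assms(1)] note l2 = le1[OF assms(2)]
  from b1 b2 show False
  proof (elim disjE)
    assume h: "u1 < - 0.994" "u2 < - 0.994"
    have "0.994 * 0.994 \<le> (- u1) * (- u2)" using h by (intro mult_mono) auto
    moreover have "\<bar>s1 * s2\<bar> \<le> 0.11 * 0.11"
      using A[OF h(1) assms(1)] A[OF h(2) assms(2)] by (intro M) auto
    ultimately show False using R by (simp add: abs_le_iff)
  next
    assume h: "u1 < - 0.994" "u2\<^sup>2 < 0.001"
    have "\<bar>u1 * u2\<bar> \<le> 1 * 0.032" using l1 B[OF h(2)] by (intro M) auto
    moreover have "\<bar>s1 * s2\<bar> \<le> 0.11 * 1" using A[OF h(1) assms(1)] l2 by (intro M) auto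
    ultimately show False using R by (simp add: abs_le_iff)
  next
    assume h: "u1\<^sup>2 < 0.001" "u2 < - 0.994"
    have "\<bar>u1 * u2\<bar> \<le> 0.032 * 1" using l2 B[OF h(1)] by (intro M) auto
    moreover have "\<bar>s1 * s2\<bar> \<le> 1 * 0.11" using A[OF h(2) assms(2)] l1 by (intro M) auto
    ultimately show False using R by (simp add: abs_le_iff)
  next
    assume h: "u1\<^sup>2 < 0.001" "u2\<^sup>2 < 0.001"
    have "\<bar>u1 * u2\<bar> \<le> 0.032 * 0.032" using B[OF h(1)] B[OF h(2)] by (intro M) auto
    moreover have "0.99 * 0.99 \<le> \<bar>s1\<bar> * \<bar>s2\<bar>"
      using C[OF h(1) assms(1)] C[OF h(2) assms(2)] by (intro mult_mono) auto
    ultimately show False using R by (simp add: abs_mult[symmetric] abs_le_iff abs_if split: if_splits)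
  qed
qed

text \<open>
  If both alternatives of \<open>freezable\<close> fail for both factors, the three frequencies nearly form an
  equilateral triangle while two of them lie near the exceptional directions. The proof writes
  the doubled angles of the two frequencies as unit vectors.
\<close>

lemma transversal_or_freezable:
  assumes nt: "\<not> transversal (freq_sq \<xi>1 q1) (freq_sq \<xi>2 q2)"
    and n0: "n0 = freq_sq (\<xi>1 + \<xi>2) (q1 + q2)"
  shows "freezable \<xi>1 q1 n0 (freq_sq \<xi>2 q2) \<or> freezable \<xi>2 q2 n0 (freq_sq \<xi>1 q1)"
proof (rule ccontr)
  assume "\<not> ?thesis"
  then have nf: "\<not> freezable \<xi>1 q1 n0 (freq_sq \<xi>2 q2)" "\<not> freezable \<xi>2 q2 n0 (freq_sq \<xi>1 q1)" by auto
  define n1 where "n1 = freq_sq \<xi>1 q1" define n2 where "n2 = freq_sq \<xi>2 q2"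
  define d1 where "d1 = 3 * \<xi>1\<^sup>2 - (real_of_int q1)\<^sup>2" define d2 where "d2 = 3 * \<xi>2\<^sup>2 - (real_of_int q2)\<^sup>2"
  define s1 where "s1 = 2 * sqrt 3 * \<xi>1 * real_of_int q1" define s2 where "s2 = 2 * sqrt 3 * \<xi>2 * real_of_int q2"
  define P where "P = n0 - n1 - n2"
  have B1: "100 * \<bar>n0 - n2\<bar> < n1" and E1: "1000 * \<xi>1\<^sup>2 < n1 \<or> 1000 * d1\<^sup>2 < n1\<^sup>2"
    using nf(1) by (auto simp: freezable_def n1_def n2_def d1_def)
  have B2: "100 * \<bar>n0 - n1\<bar> < n2" and E2: "1000 * \<xi>2\<^sup>2 < n2 \<or> 1000 * d2\<^sup>2 < n2\<^sup>2"
    using nf(2) by (auto simp: freezable_def n1_def n2_def d2_def)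
  have pos1: "n1 > 0" using B1 by (smt (verit))
  have pos2: "n2 > 0" using B2 by (smt (verit))
  note pos = pos1 pos2
  have x: "6 * \<xi>1\<^sup>2 = n1 + d1" "6 * \<xi>2\<^sup>2 = n2 + d2"
    by (auto simp: n1_def n2_def d1_def d2_def freq_sq_def)
  have c: "(sqrt 3 * x) * (sqrt 3 * y) = 3 * (x * y)" for x y :: real
    by (simp add: algebra_simps)
  have sq: "d1\<^sup>2 + s1\<^sup>2 = n1\<^sup>2" "d2\<^sup>2 + s2\<^sup>2 = n2\<^sup>2"
    by (auto simp: n1_def n2_def d1_def d2_def s1_def s2_def freq_sq_def power_mult_distrib)
       (auto simp: power2_eq_square algebra_simps)
  have ss: "s1 * s2 = 12 * \<xi>1 * q1 * \<xi>2 * q2"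
    by (simp add: s1_def s2_def algebra_simps)
  \<comment> \<open>\<open>P\<close> is twice the inner product of the two frequencies, so this is
    cos 2t = 2 (cos t)^2 - 1 for the angle t between them, multiplied by
    \<open>n1 * n2\<close>.\<close>
  have R: "d1 * d2 + s1 * s2 = P * P / 2 - n1 * n2"
    unfolding ss P_def n0 n1_def n2_def d1_def d2_def freq_sq_def
    by (simp add: power2_eq_square field_simps)
  \<comment> \<open>Since \<open>P + n1 = n0 - n2\<close>, the failure of the first alternative puts
    \<open>- P\<close> within one percent of \<open>n1\<close>, and likewise of \<open>n2\<close>;
    the angle between the inputs is near 120 degrees.\<close>
  have P1: "0.99 * n1 \<le> - P" "- P \<le> 1.01 * n1" using B1 by (auto simp: P_def abs_if split: if_splits)
  have P2: "0.99 * n2 \<le> - P" "- P \<le> 1.01 * n2" using B2 by (auto simp: P_def abs_if split: if_splits)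
  have "(0.99 * n1) * (0.99 * n2) \<le> (- P) * (- P)" "(- P) * (- P) \<le> (1.01 * n1) * (1.01 * n2)"
    using P1 P2 pos by (intro mult_mono; linarith)+
  then have PP: "0.98 * (n1 * n2) \<le> P * P" "P * P \<le> 1.03 * (n1 * n2)"
    using pos mult_pos_pos[OF pos] by (auto simp: algebra_simps)
  have r1: "d1 / n1 < - 0.994 \<or> (d1 / n1)\<^sup>2 < 0.001"
    using E1 x pos by (auto simp: field_simps power_divide)
  have r2: "d2 / n2 < - 0.994 \<or> (d2 / n2)\<^sup>2 < 0.001"
    using E2 x pos by (auto simp: field_simps power_divide)
  have eq: "d1 / n1 * (d2 / n2) + s1 / n1 * (s2 / n2) = (P * P / 2 - n1 * n2) / (n1 * n2)"
    unfolding R[symmetric] using pos by (simp add: field_simps)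
  show False
  proof (rule unit_vectors_doubled_angle[OF _ _ _ _ r1 r2])
    show "(d1 / n1)\<^sup>2 + (s1 / n1)\<^sup>2 = 1" "(d2 / n2)\<^sup>2 + (s2 / n2)\<^sup>2 = 1"
      using sq pos by (simp_all add: power_divide add_divide_distrib[symmetric])
    show "- 0.52 \<le> d1 / n1 * (d2 / n2) + s1 / n1 * (s2 / n2)"
      "d1 / n1 * (d2 / n2) + s1 / n1 * (s2 / n2) \<le> - 0.48"
      unfolding eq using PP mult_pos_pos[OF pos] by (simp_all add: field_simps)
  qed
qed

lemma phase_measurable [measurable]:
  "(\<lambda>x. phase \<xi> q x p) \<in> borel_measurable borel" "(\<lambda>x. phase_deriv \<xi> q x p) \<in> borel_measurable borel"
  unfolding phase_quadratic by measurable

text \<open>Transversality gives \<open>3 * \<xi>\<^sup>2 \<le> 200 * \<bar>phase_deriv \<xi> q x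
  p\<bar>\<close>, so the squared multiplier is absorbed by the Jacobian in
  \<open>nn_integral_phase\<close>, uniformly in \<open>p\<close>. The two weights are then
  estimated by their lattice components alone, which makes the sum over \<open>p\<close>
  converge.\<close>

lemma transversal_bound:
  shows "\<exists>C\<ge>0. \<forall>\<xi> q c. (\<integral>\<^sup>+p. \<integral>\<^sup>+x. ennreal (of_bool (transversal (freq_sq x p) (freq_sq (\<xi> - x) (q - p))) *
      \<xi>\<^sup>2 * (bracket (freq_size x p) powr (- 2) + bracket (freq_size (\<xi> - x) (q - p)) powr (- 2)) *
      bracket (phase \<xi> q x p - c) powr (- (37/36))) \<partial>lborel \<partial>count_space UNIV) \<le> ennreal C"
proof -
  let ?e = "37/36 :: real"
  define I where "I = 2 powr 2 * bracket_int 2"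
  define K where "K = 200/3 * (2 * bracket_int ?e)"
  have K: "0 \<le> K" "0 \<le> I" by (auto simp: bracket_int_def I_def K_def)
  have br: "bracket (freq_size x p) powr (- 2) \<le> bracket (real_of_int p) powr (- 2)" for x p
    using abs_le_freq_size(1)[of p x] by (intro powr_mono2') (auto simp: bracket_def)
  have pt: "of_bool (transversal (freq_sq x p) (freq_sq (\<xi> - x) (q - p))) *
      \<xi>\<^sup>2 * (bracket (freq_size x p) powr (- 2) + bracket (freq_size (\<xi> - x) (q - p)) powr (- 2)) *
      bracket (phase \<xi> q x p - c) powr (- ?e) \<le>
      (200/3 * (bracket (real_of_int p) powr (- 2) + bracket (real_of_int p - real_of_int q) powr (- 2))) *
      (\<bar>phase_deriv \<xi> q x p\<bar> * bracket (phase \<xi> q x p - c) powr (- ?e))" for \<xi> q c x p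
  proof (cases "transversal (freq_sq x p) (freq_sq (\<xi> - x) (q - p))")
    case True
    have "3 * \<xi>\<^sup>2 \<le> freq_sq (x + (\<xi> - x)) (p + (q - p))" by (simp add: freq_sq_def)
    also have "\<dots> \<le> 2 * (freq_sq x p + freq_sq (\<xi> - x) (q - p))" by (rule freq_sq_add_le)
    also have "\<dots> \<le> 200 * \<bar>phase_deriv \<xi> q x p\<bar>"
      using True by (simp add: transversal_def phase_deriv_def)
    finally have x: "\<xi>\<^sup>2 \<le> 200/3 * \<bar>phase_deriv \<xi> q x p\<bar>" by simp
    have "\<xi>\<^sup>2 * (bracket (freq_size x p) powr (- 2) + bracket (freq_size (\<xi> - x) (q - p)) powr (- 2)) \<le>
      (200/3 * \<bar>phase_deriv \<xi> q x p\<bar>) * (bracket (real_of_int p) powr (- 2) + bracket (real_of_int p - real_of_int q) powr (- 2))"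
      using x br[of x p] br[of "\<xi> - x" "q - p"]
      by (intro mult_mono add_mono) (auto simp: bracket_minus_commute[of "real_of_int q"])
    then have "\<xi>\<^sup>2 * (bracket (freq_size x p) powr (- 2) + bracket (freq_size (\<xi> - x) (q - p)) powr (- 2)) *
       bracket (phase \<xi> q x p - c) powr (- ?e) \<le>
      (200/3 * \<bar>phase_deriv \<xi> q x p\<bar>) * (bracket (real_of_int p) powr (- 2) + bracket (real_of_int p - real_of_int q) powr (- 2)) *
       bracket (phase \<xi> q x p - c) powr (- ?e)"
      by (rule mult_right_mono) auto
    then show ?thesis using True by (simp add: mult_ac)
  qed auto
  show ?thesis
  proof (intro exI[of _ "K * (I + I)"] conjI allI)
    show "0 \<le> K * (I + I)" using K by (intro mult_nonneg_nonneg add_nonneg_nonneg)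
    fix \<xi> q c
    have "(\<integral>\<^sup>+x. ennreal (of_bool (transversal (freq_sq x p) (freq_sq (\<xi> - x) (q - p))) *
      \<xi>\<^sup>2 * (bracket (freq_size x p) powr (- 2) + bracket (freq_size (\<xi> - x) (q - p)) powr (- 2)) *
      bracket (phase \<xi> q x p - c) powr (- ?e)) \<partial>lborel) \<le>
      ennreal K * (ennreal (bracket (real_of_int p - 0) powr (- 2)) + ennreal (bracket (real_of_int p - real_of_int q) powr (- 2)))" for p
    proof -
      let ?w = "200/3 * (bracket (real_of_int p) powr (- 2) + bracket (real_of_int p - real_of_int q) powr (- 2))"
      have "(\<integral>\<^sup>+x. ennreal (of_bool (transversal (freq_sq x p) (freq_sq (\<xi> - x) (q - p))) *
        \<xi>\<^sup>2 * (bracket (freq_size x p) powr (- 2) + bracket (freq_size (\<xi> - x) (q - p)) powr (- 2)) *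
        bracket (phase \<xi> q x p - c) powr (- ?e)) \<partial>lborel) \<le>
        (\<integral>\<^sup>+x. ennreal ?w * ennreal (\<bar>phase_deriv \<xi> q x p\<bar> * bracket (phase \<xi> q x p - c) powr (- ?e)) \<partial>lborel)"
        by (subst ennreal_mult[symmetric]; (intro nn_integral_mono ennreal_leI pt | simp))
      also have "\<dots> = ennreal ?w * (\<integral>\<^sup>+x. ennreal (\<bar>phase_deriv \<xi> q x p\<bar> * bracket (phase \<xi> q x p - c) powr (- ?e)) \<partial>lborel)"
        by (rule nn_integral_cmult) measurable
      also have "\<dots> \<le> ennreal ?w * ennreal (2 * bracket_int ?e)"
        by (intro mult_left_mono nn_integral_phase) auto
      also have "\<dots> = ennreal (?w * (2 * bracket_int ?e))"
        by (rule ennreal_mult[symmetric]) (auto simp: bracket_int_def)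
      also have "?w * (2 * bracket_int ?e) = K * (bracket (real_of_int p - 0) powr (- 2) + bracket (real_of_int p - real_of_int q) powr (- 2))"
        by (simp add: K_def algebra_simps)
      also have "ennreal \<dots> = ennreal K * (ennreal (bracket (real_of_int p - 0) powr (- 2)) + ennreal (bracket (real_of_int p - real_of_int q) powr (- 2)))"
        using K by (subst ennreal_mult) auto
      finally show ?thesis .
    qed
    then have "(\<integral>\<^sup>+p. \<integral>\<^sup>+x. ennreal (of_bool (transversal (freq_sq x p) (freq_sq (\<xi> - x) (q - p))) *
      \<xi>\<^sup>2 * (bracket (freq_size x p) powr (- 2) + bracket (freq_size (\<xi> - x) (q - p)) powr (- 2)) *
      bracket (phase \<xi> q x p - c) powr (- ?e)) \<partial>lborel \<partial>count_space UNIV) \<le>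
      (\<integral>\<^sup>+p. ennreal K * (ennreal (bracket (real_of_int p - 0) powr (- 2)) + ennreal (bracket (real_of_int p - real_of_int q) powr (- 2))) \<partial>count_space UNIV)"
      by (intro nn_integral_mono)
    also have "\<dots> = ennreal K * ((\<integral>\<^sup>+p. ennreal (bracket (real_of_int p - 0) powr (- 2)) \<partial>count_space UNIV) +
        (\<integral>\<^sup>+p. ennreal (bracket (real_of_int p - real_of_int q) powr (- 2)) \<partial>count_space UNIV))"
      by (simp add: nn_integral_cmult nn_integral_add)
    also have "\<dots> \<le> ennreal K * (ennreal I + ennreal I)"
      unfolding I_def by (intro mult_left_mono add_mono nn_integral_int_bracket) auto
    also have "\<dots> = ennreal (K * (I + I))"
      using K by (subst ennreal_plus[symmetric], simp, simp, subst ennreal_mult) auto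
    finally show "(\<integral>\<^sup>+p. \<integral>\<^sup>+x. ennreal (of_bool (transversal (freq_sq x p) (freq_sq (\<xi> - x) (q - p))) *
      \<xi>\<^sup>2 * (bracket (freq_size x p) powr (- 2) + bracket (freq_size (\<xi> - x) (q - p)) powr (- 2)) *
      bracket (phase \<xi> q x p - c) powr (- ?e)) \<partial>lborel \<partial>count_space UNIV) \<le> ennreal (K * (I + I))" .
  qed
qed

section \<open>Estimates with one input frequency frozen\<close>

lemma powr_split_level:
  fixes t N :: real
  assumes "t > 0" "N \<ge> 1"
  shows "t powr (- (17/18)) \<le> N powr (1/4) * t powr (- (37/36)) + N powr (- (17/6))"
proof (cases "t \<le> N powr 3")
  case True
  have "t powr (- (17/18)) = t powr (1/12) * t powr (- (37/36))"
    by (simp add: powr_add[symmetric])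
  also have "\<dots> \<le> (N powr 3) powr (1/12) * t powr (- (37/36))"
    using assms True by (intro mult_right_mono powr_mono2) auto
  also have "\<dots> = N powr (1/4) * t powr (- (37/36))" by (simp add: powr_powr)
  finally show ?thesis by (smt (verit) powr_ge_zero)
next
  case False
  then have "t powr (- (17/18)) \<le> (N powr 3) powr (- (17/18))"
    using assms by (intro powr_mono2') auto
  also have "\<dots> = N powr (- (17/6))" by (simp add: powr_powr)
  finally show ?thesis by (smt (verit) mult_nonneg_nonneg powr_ge_zero)
qed

lemma bracket_powr_2: "bracket y powr (- 2) = 1 / (bracket y)\<^sup>2"
  by (simp add: powr_minus_divide)

lemma four_powr: "(4::real) powr (3/2) = 8"
proof -
  have "(4::real) powr (3/2) = (2 powr 2) powr (3/2)" by simp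
  also have "\<dots> = 2 powr 3" by (simp add: powr_powr del: powr_numeral)
  finally show ?thesis by simp
qed

text \<open>Away from \<open>y = 0\<close> the left side is of order N^(-3/4) / |y|, and the
  inequality between arithmetic and geometric means separates it into N^(-3/2) and y^(-2). Both can
  be summed: \<open>b\<close> will be the bracket of the lattice point, which is at most
  \<open>4 * N\<close>, and \<open>y\<close> its offset from a fixed point.\<close>

lemma lattice_weight_bound:
  fixes N \<kappa> y b :: real
  assumes N: "N \<ge> 1" and \<kappa>: "N / 120 \<le> \<kappa>" and b: "0 < b" "b \<le> 4 * N"
  shows "N powr (- (1/4)) * (1 + \<kappa> * y\<^sup>2) powr (- (1/2)) \<le> 44 * (b powr (- (3/2)) + bracket y powr (- 2))"
proof -
  have \<kappa>0: "\<kappa> \<ge> 0" using N \<kappa> by linarith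
  have N32: "N powr (- (3/2)) \<le> 8 * b powr (- (3/2))"
  proof -
    have "(4 * N) powr (- (3/2)) \<le> b powr (- (3/2))"
      using b by (intro powr_mono2') auto
    then show ?thesis using N by (simp add: powr_mult powr_minus four_powr field_simps)
  qed
  show ?thesis
  proof (cases "\<bar>y\<bar> \<le> 1")
    case True
    have "N powr (- (1/4)) * (1 + \<kappa> * y\<^sup>2) powr (- (1/2)) \<le> 1 * 1"
      using N \<kappa>0 powr_mono[of "-(1/4)" 0 N] powr_mono[of "-(1/2)" 0 "1 + \<kappa> * y\<^sup>2"]
      by (intro mult_mono) (auto split: if_splits)
    moreover have "(bracket y)\<^sup>2 \<le> 2\<^sup>2" using True by (intro power_mono) (auto simp: bracket_def)
    then have "1 \<le> 4 * bracket y powr (- 2)" by (simp add: bracket_powr_2 field_simps)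
    ultimately show ?thesis by (smt (verit) powr_ge_zero)
  next
    case False
    let ?n = "N powr (- (3/4))"
    have y: "\<bar>y\<bar> > 1" using False by simp
    have "sqrt N * \<bar>y\<bar> \<le> 11 * sqrt (1 + \<kappa> * y\<^sup>2)"
    proof -
      have "N * y\<^sup>2 \<le> 121 * (1 + \<kappa> * y\<^sup>2)"
      proof -
        have "N * y\<^sup>2 \<le> (120 * \<kappa>) * y\<^sup>2" using \<kappa> by (intro mult_right_mono) auto
        moreover have "0 \<le> \<kappa> * y\<^sup>2" using \<kappa>0 by simp
        ultimately show ?thesis by simp
      qed
      then have "sqrt (N * y\<^sup>2) \<le> sqrt (11\<^sup>2 * (1 + \<kappa> * y\<^sup>2))" by simp
      then show ?thesis by (simp only: real_sqrt_mult real_sqrt_abs abs_numeral)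
    qed
    moreover have "1 + \<kappa> * y\<^sup>2 > 0" using \<kappa>0 by (simp add: add_pos_nonneg)
    ultimately have "(1 + \<kappa> * y\<^sup>2) powr (- (1/2)) \<le> 11 * (N powr (- (1/2)) * (1 / \<bar>y\<bar>))"
      using N y \<kappa>0 by (simp add: powr_minus_divide powr_half_sqrt field_simps)
    then have "N powr (- (1/4)) * (1 + \<kappa> * y\<^sup>2) powr (- (1/2)) \<le> N powr (- (1/4)) * (11 * (N powr (- (1/2)) * (1 / \<bar>y\<bar>)))"
      by (intro mult_left_mono) auto
    also have "\<dots> = 11 * ((N powr (- (1/4)) * N powr (- (1/2))) * (1 / \<bar>y\<bar>))" by simp
    also have "N powr (- (1/4)) * N powr (- (1/2)) = ?n" by (simp add: powr_add[symmetric])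
    also have "11 * (?n * (1 / \<bar>y\<bar>)) \<le> 11/2 * (?n\<^sup>2 + (1 / \<bar>y\<bar>)\<^sup>2)"
      using sum_squares_bound[of ?n "1 / \<bar>y\<bar>"] by simp
    also have "?n\<^sup>2 = N powr (- (3/2))" by (simp add: power2_eq_square powr_add[symmetric])
    also have "(1 / \<bar>y\<bar>)\<^sup>2 \<le> 4 * bracket y powr (- 2)"
    proof -
      have "(bracket y)\<^sup>2 \<le> (2 * \<bar>y\<bar>)\<^sup>2" using y by (intro power_mono) (auto simp: bracket_def)
      then show ?thesis using y by (simp add: bracket_powr_2 field_simps)
    qed
    finally have "N powr (- (1/4)) * (1 + \<kappa> * y\<^sup>2) powr (- (1/2)) \<le>
       11/2 * (N powr (- (3/2)) + 4 * bracket y powr (- 2))" by simp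
    moreover have "L \<le> 44 * (b' + z)" if "L \<le> 11/2 * (n + 4 * z)" "n \<le> 8 * b'" "0 \<le> z" for L n z b' :: real
      using that by (simp add: algebra_simps)
    ultimately show ?thesis using N32 by (meson powr_ge_zero)
  qed
qed

text \<open>For \<open>a > 0\<close> the difference factors as (m - r)(m + r), and the square of the
  smaller factor is at most the product. For \<open>a \<le> 0\<close> the value \<open>r = 0\<close>
  works because then \<open>m\<^sup>2 \<le> m\<^sup>2 - a\<close>.\<close>

lemma square_minus_ge_min:
  fixes m a :: real
  defines "r \<equiv> sqrt (max 0 a)"
  shows "\<exists>y\<in>{m - r, m + r}. y\<^sup>2 \<le> \<bar>m\<^sup>2 - a\<bar>"
proof (cases "a \<le> 0")
  case True
  then show ?thesis by (auto simp: r_def)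
next
  case False
  then have r: "r\<^sup>2 = a" "r \<ge> 0" by (auto simp: r_def)
  have "m\<^sup>2 - a = (m - r) * (m + r)" by (simp add: r(1)[symmetric] power2_eq_square algebra_simps)
  then have eq: "\<bar>m\<^sup>2 - a\<bar> = \<bar>m - r\<bar> * \<bar>m + r\<bar>" by (simp add: abs_mult)
  show ?thesis
  proof (cases "m \<ge> 0")
    case True
    then have "\<bar>m - r\<bar> * \<bar>m - r\<bar> \<le> \<bar>m - r\<bar> * \<bar>m + r\<bar>" using r by (intro mult_left_mono) auto
    then show ?thesis unfolding eq by (intro bexI[of _ "m - r"]) (auto simp: power2_eq_square)
  next
    case False
    then have "\<bar>m + r\<bar> * \<bar>m + r\<bar> \<le> \<bar>m - r\<bar> * \<bar>m + r\<bar>" using r by (intro mult_right_mono) auto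
    then show ?thesis unfolding eq by (intro bexI[of _ "m + r"]) (auto simp: power2_eq_square)
  qed
qed

text \<open>Two translates suffice for every \<open>m\<close>: on each half line the parabola is comparable to a shifted one.\<close>

lemma bracket_parabola_le:
  fixes \<kappa> c :: real
  assumes "\<kappa> \<noteq> 0"
  shows "\<exists>r. \<forall>m. bracket (\<kappa> * m\<^sup>2 - c) powr (- (1/2)) \<le>
     (1 + \<bar>\<kappa>\<bar> * (m - r)\<^sup>2) powr (- (1/2)) + (1 + \<bar>\<kappa>\<bar> * (m + r)\<^sup>2) powr (- (1/2))"
proof (intro exI allI)
  fix m
  define r where "r = sqrt (max 0 (c / \<kappa>))"
  obtain y where y: "y \<in> {m - r, m + r}" "y\<^sup>2 \<le> \<bar>m\<^sup>2 - c / \<kappa>\<bar>"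
    using square_minus_ge_min[of m "c / \<kappa>"] unfolding r_def by blast
  have "\<kappa> * m\<^sup>2 - c = \<kappa> * (m\<^sup>2 - c / \<kappa>)" using assms by (simp add: field_simps)
  then have "1 + \<bar>\<kappa>\<bar> * y\<^sup>2 \<le> bracket (\<kappa> * m\<^sup>2 - c)"
    using y(2) by (simp add: bracket_def abs_mult mult_left_mono)
  then have "bracket (\<kappa> * m\<^sup>2 - c) powr (- (1/2)) \<le> (1 + \<bar>\<kappa>\<bar> * y\<^sup>2) powr (- (1/2))"
    by (intro powr_mono2') (auto simp: add_pos_nonneg)
  then show "bracket (\<kappa> * m\<^sup>2 - c) powr (- (1/2)) \<le>
     (1 + \<bar>\<kappa>\<bar> * (m - r)\<^sup>2) powr (- (1/2)) + (1 + \<bar>\<kappa>\<bar> * (m + r)\<^sup>2) powr (- (1/2))"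
    using y(1) by (smt (verit) insertE powr_ge_zero singletonD)
qed

definition hessian_region :: "real \<Rightarrow> int \<Rightarrow> int \<Rightarrow> bool" where
  "hessian_region \<xi>1 q1 p \<longleftrightarrow> 1 \<le> freq_sq \<xi>1 q1 \<and> freq_sq \<xi>1 q1 \<le> 1000 * \<xi>1\<^sup>2 \<and>
     (freq_sq \<xi>1 q1)\<^sup>2 \<le> 1000 * (3 * \<xi>1\<^sup>2 - (real_of_int q1)\<^sup>2)\<^sup>2 \<and>
     bracket (real_of_int p) \<le> 4 * bracket (freq_size \<xi>1 q1)"

lemma frozen_pointwise:
  fixes \<xi>1 x t :: real and q1 p :: int
  defines "n1 \<equiv> freq_sq \<xi>1 q1" and "n2 \<equiv> freq_sq (\<xi>1 - x) (q1 - p)" and "n0 \<equiv> freq_sq x p"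
  defines "N \<equiv> bracket (freq_size \<xi>1 q1)"
  assumes nt: "\<not> transversal n1 n2" and fr: "freezable \<xi>1 q1 n0 n2" and t: "t \<ge> 1"
  shows "x\<^sup>2 * (N powr (- 2) + bracket (freq_size (\<xi>1 - x) (q1 - p)) powr (- 2)) * t powr (- (17/18)) \<le>
    40 * (4 powr (4/3))\<^sup>2 * (bracket (real_of_int p) powr (- (4/3)) * bracket x powr (- (4/3))) +
    3360 * bracket (real_of_int p) powr (- (3/2)) * (\<bar>n0 - n2\<bar> * t powr (- (37/36))) +
    of_bool (hessian_region \<xi>1 q1 p) * (5 * N powr (1/4) * t powr (- (37/36)))" (is "?L \<le> ?A + ?B + ?C")
proof -
  define r1 where "r1 = freq_size \<xi>1 q1" define r2 where "r2 = freq_size (\<xi>1 - x) (q1 - p)"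
  have r: "r1 \<ge> 0" "r2 \<ge> 0" "r1\<^sup>2 = n1" "r2\<^sup>2 = n2"
    by (auto simp: r1_def r2_def n1_def n2_def freq_size_power2)
  have Nr: "N = 1 + r1" using r by (simp add: N_def bracket_def r1_def)
  have N1: "N \<ge> 1" using Nr r by simp
  have nn: "n1 \<ge> 0" "n2 \<ge> 0" by (auto simp: n1_def n2_def)
  have cmp: "100 * \<bar>n1 - n2\<bar> < n1 + n2" using nt by (simp add: transversal_def)
  have "99 * n2 \<le> 101 * n1" using cmp by (smt (verit))
  then have n21: "n2 \<le> (103/100) * n1" using nn by simp
  have "99 * n1 \<le> 101 * n2" using cmp by (smt (verit))
  then have n12: "n1 \<le> (103/100) * n2" using nn by simp
  have n2': "n2 = freq_sq (x - \<xi>1) (p - q1)" by (simp add: n2_def freq_sq_minus_commute)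
  have "n0 \<le> 2 * (n1 + n2)"
    using freq_sq_add_le[of \<xi>1 "x - \<xi>1" q1 "p - q1"] by (simp add: n0_def n1_def n2')
  then have n0: "n0 \<le> (406/100) * n1" using n21 by simp
  have p2: "(real_of_int p)\<^sup>2 \<le> (406/100) * n1"
    using n0 zero_le_power2[of x] unfolding n0_def freq_sq_def by linarith
  have "3 * x\<^sup>2 \<le> (406/100) * n1"
    using n0 zero_le_power2[of "real_of_int p"] unfolding n0_def freq_sq_def by linarith
  then have x2: "x\<^sup>2 \<le> (14/10) * n1" using nn by simp
  have r9: "(3 * r1)\<^sup>2 = 9 * n1" unfolding power_mult_distrib r(3) by simp
  have p: "bracket (real_of_int p) \<le> 4 * N"
  proof -
    have "\<bar>real_of_int p\<bar>\<^sup>2 \<le> (3 * r1)\<^sup>2" unfolding r9 power2_abs using p2 nn by linarith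
    then have "\<bar>real_of_int p\<bar> \<le> 3 * r1" by (rule power2_le_imp_le) (use r(1,2) in simp)
    then show ?thesis using r by (simp add: bracket_def Nr)
  qed
  have x: "bracket x \<le> 4 * N"
  proof -
    have "\<bar>x\<bar>\<^sup>2 \<le> (3 * r1)\<^sup>2" unfolding r9 power2_abs using x2 nn by linarith
    then have "\<bar>x\<bar> \<le> 3 * r1" by (rule power2_le_imp_le) (use r(1,2) in simp)
    then show ?thesis using r by (simp add: bracket_def Nr)
  qed
  have "r1\<^sup>2 \<le> ((102/100) * r2)\<^sup>2" unfolding power_mult_distrib r(3,4) using n12 nn by (simp add: power2_eq_square)
  then have "r1 \<le> (102/100) * r2" by (rule power2_le_imp_le) (use r(1,2) in simp)
  then have "N \<le> (102/100) * bracket r2" using r by (simp add: Nr bracket_def)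
  then have "bracket r2 powr (- 2) \<le> (102/100) powr 2 * N powr (- 2)"
    unfolding N_def r1_def by (intro bracket_powr_antimono) auto
  then have "N powr (- 2) + bracket r2 powr (- 2) \<le> 3 * N powr (- 2)"
    by (simp add: power2_eq_square) (smt (verit) powr_ge_zero)
  then have W: "x\<^sup>2 * (N powr (- 2) + bracket r2 powr (- 2)) \<le> 3 * x\<^sup>2 * N powr (- 2)"
    using mult_left_mono[of "N powr (- 2) + bracket r2 powr (- 2)" "3 * N powr (- 2)" "x\<^sup>2"] by simp
  have W5: "x\<^sup>2 * (N powr (- 2) + bracket r2 powr (- 2)) \<le> 5"
  proof -
    have "n1 \<le> N\<^sup>2" using r by (simp add: Nr r(3)[symmetric])
    then have "3 * x\<^sup>2 \<le> 5 * N\<^sup>2" using x2 nn by linarith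
    then have "3 * x\<^sup>2 * N powr (- 2) \<le> 5" using N1 by (simp add: powr_minus_divide field_simps)
    with W show ?thesis by simp
  qed
  have W0: "0 \<le> x\<^sup>2 * (N powr (- 2) + bracket r2 powr (- 2))" by simp
  have A0: "0 \<le> ?A" and B0: "0 \<le> ?B" and C0: "0 \<le> ?C" by auto
  have N43: "N powr (- (4/3)) \<le> 4 powr (4/3) * b powr (- (4/3))" if "0 < b" "b \<le> 4 * N" for b
  proof -
    have "(4 * N) powr (- (4/3)) \<le> b powr (- (4/3))"
      using that by (intro powr_mono2') auto
    then show ?thesis using N1 by (simp add: powr_mult powr_minus field_simps)
  qed
  have N83: "N powr (- (8/3)) \<le> (4 powr (4/3))\<^sup>2 * (bracket (real_of_int p) powr (- (4/3)) * bracket x powr (- (4/3)))"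
  proof -
    have "N powr (- (8/3)) = N powr (- (4/3)) * N powr (- (4/3))" by (simp add: powr_add[symmetric])
    also have "\<dots> \<le> (4 powr (4/3) * bracket (real_of_int p) powr (- (4/3))) * (4 powr (4/3) * bracket x powr (- (4/3)))"
      using p x by (intro mult_mono N43) auto
    finally show ?thesis by (simp add: power2_eq_square mult_ac)
  qed
  have N32: "N powr (- (3/2)) \<le> 8 * bracket (real_of_int p) powr (- (3/2))"
  proof -
    have "(4 * N) powr (- (3/2)) \<le> bracket (real_of_int p) powr (- (3/2))"
      using p by (intro powr_mono2') auto
    then show ?thesis using N1 by (simp add: powr_mult powr_minus four_powr field_simps)
  qed
  have split: "?L \<le> x\<^sup>2 * (N powr (- 2) + bracket r2 powr (- 2)) * (N powr (1/4) * t powr (- (37/36))) + ?A"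
  proof -
    have "?L \<le> x\<^sup>2 * (N powr (- 2) + bracket r2 powr (- 2)) * (N powr (1/4) * t powr (- (37/36)) + N powr (- (17/6)))"
      unfolding r2_def[symmetric] using W0 t N1 by (intro mult_left_mono powr_split_level) auto
    also have "\<dots> = x\<^sup>2 * (N powr (- 2) + bracket r2 powr (- 2)) * (N powr (1/4) * t powr (- (37/36))) +
      x\<^sup>2 * (N powr (- 2) + bracket r2 powr (- 2)) * N powr (- (17/6))"
      by (simp add: algebra_simps)
    \<comment> \<open>The exponent is weakened to 8/3 = 4/3 + 4/3: one half is summable in
      \<open>p\<close>, the other integrable in \<open>x\<close>.\<close>
    also have "x\<^sup>2 * (N powr (- 2) + bracket r2 powr (- 2)) * N powr (- (17/6)) \<le> 5 * N powr (- (8/3))"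
      using W5 N1 by (intro mult_mono powr_mono) auto
    also have "5 * N powr (- (8/3)) \<le> ?A" using N83 powr_ge_zero[of N "- (8/3)"] by linarith
    finally show ?thesis by simp
  qed
  \<comment> \<open>The case \<open>low\<close> is split off because \<open>hessian_region\<close>
    requires \<open>1 \<le> freq_sq \<xi>1 q1\<close>.\<close>
  consider (B) "n1 \<le> 100 * \<bar>n0 - n2\<bar>" | (low) "n1 < 1" | (E) "hessian_region \<xi>1 q1 p"
    using fr p unfolding freezable_def hessian_region_def n1_def[symmetric] N_def[symmetric] by linarith
  then show ?thesis
  proof cases
    case B
    \<comment> \<open>Origin of 3360: \<open>x\<^sup>2 \<le> 1.4 * n1\<close> and the case
      hypothesis give 420, and \<open>N32\<close> contributes a factor 8.\<close>
    have "3 * x\<^sup>2 \<le> 420 * \<bar>n0 - n2\<bar>" using B x2 by linarith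
    then have "x\<^sup>2 * (N powr (- 2) + bracket r2 powr (- 2)) * (N powr (1/4) * t powr (- (37/36))) \<le>
      (420 * \<bar>n0 - n2\<bar>) * N powr (- 2) * (N powr (1/4) * t powr (- (37/36)))"
      by (intro mult_right_mono order.trans[OF W]) auto
    also have "\<dots> = 420 * \<bar>n0 - n2\<bar> * t powr (- (37/36)) * (N powr (- 2) * N powr (1/4))" by simp
    also have "\<dots> \<le> 420 * \<bar>n0 - n2\<bar> * t powr (- (37/36)) * (8 * bracket (real_of_int p) powr (- (3/2)))"
    proof (rule mult_left_mono)
      have "N powr (- 2) * N powr (1/4) = N powr (- (7/4))" by (simp add: powr_add[symmetric])
      also have "\<dots> \<le> N powr (- (3/2))" using N1 by (intro powr_mono) auto
      finally show "N powr (- 2) * N powr (1/4) \<le> 8 * bracket (real_of_int p) powr (- (3/2))"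
        using N32 by linarith
    qed auto
    finally have "x\<^sup>2 * (N powr (- 2) + bracket r2 powr (- 2)) * (N powr (1/4) * t powr (- (37/36))) \<le> ?B"
      by (simp add: mult_ac)
    then show ?thesis using split C0 by linarith
  next
    case low
    have "r1 \<le> 1"
    proof (rule power2_le_imp_le)
      show "r1\<^sup>2 \<le> 1\<^sup>2" unfolding r(3) using low by simp
    qed simp
    then have "N \<le> 2" by (simp add: Nr)
    have "?L \<le> 5 * 1" unfolding r2_def[symmetric]
      using W5 t powr_mono[of "-(17/18)" 0 t] by (intro mult_mono) auto
    \<comment> \<open>Origin of the factor 40 in the first term: \<open>N \<le> 2\<close> and 5 = 40
      / 2^3.\<close>
    also have "5 * 1 \<le> 40 * N powr (- (8/3))"
    proof -
      have "N powr (8/3) \<le> 2 powr (8/3)" using \<open>N \<le> 2\<close> N1 by (intro powr_mono2) auto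
      also have "\<dots> \<le> 2 powr 3" by (intro powr_mono) auto
      finally show ?thesis using N1 by (simp add: powr_minus_divide field_simps)
    qed
    also have "\<dots> \<le> ?A" using N83 by linarith
    finally show ?thesis using B0 C0 by linarith
  next
    case E
    have "x\<^sup>2 * (N powr (- 2) + bracket r2 powr (- 2)) * (N powr (1/4) * t powr (- (37/36))) \<le> 5 * (N powr (1/4) * t powr (- (37/36)))"
      using W5 by (intro mult_right_mono) auto
    moreover have "?C = 5 * (N powr (1/4) * t powr (- (37/36)))" using E by simp
    ultimately show ?thesis using split B0 by linarith
  qed
qed

text \<open>The integral over \<open>x\<close> gains
  \<open>\<bar>3 * \<xi>\<bar> powr (- 1/2)\<close>, hence N^(-1/2), and leaves a parabola in
  \<open>p\<close> with coefficient \<kappa>. Altogether N^(1/4 - 1/2) = N^(-1/4), and |\<kappa>| is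
  at least N / 120, so \<open>bracket_parabola_le\<close> and \<open>lattice_weight_bound\<close>
  control the lattice sum.\<close>

lemma hessian_bound:
  "\<exists>C\<ge>0. \<forall>\<xi> q c. (\<integral>\<^sup>+p. \<integral>\<^sup>+x. ennreal (of_bool (hessian_region \<xi> q p) *
      (5 * bracket (freq_size \<xi> q) powr (1/4) * bracket (phase \<xi> q x p - c) powr (- (37/36)))) \<partial>lborel \<partial>count_space UNIV) \<le> ennreal C"
proof -
  let ?e = "37/36 :: real"
  define K where "K = 2 * bracket_int ?e + 2 powr ?e"
  define I where "I = 2 powr (3/2) * bracket_int (3/2)"
  define J where "J = 2 powr 2 * bracket_int 2"
  have K: "0 \<le> K" "0 \<le> I" "0 \<le> J" by (auto simp: K_def I_def J_def bracket_int_def)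
  have "(\<integral>\<^sup>+p. \<integral>\<^sup>+x. ennreal (of_bool (hessian_region \<xi> q p) *
      (5 * bracket (freq_size \<xi> q) powr (1/4) * bracket (phase \<xi> q x p - c) powr (- ?e))) \<partial>lborel \<partial>count_space UNIV)
      \<le> ennreal (25 * K * 44 * (2 * I + 2 * J))" for \<xi> q c
  proof (cases "\<exists>p. hessian_region \<xi> q p")
    case True
    define N where "N = bracket (freq_size \<xi> q)"
    define n where "n = freq_sq \<xi> q"
    define D where "D = 3 * \<xi>\<^sup>2 - (real_of_int q)\<^sup>2"
    define \<kappa> where "\<kappa> = D / (3 * \<xi>)"
    have h: "1 \<le> n" "n \<le> 1000 * \<xi>\<^sup>2" "n\<^sup>2 \<le> 1000 * D\<^sup>2"
      using True by (auto simp: hessian_region_def n_def D_def)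
    define r where "r = freq_size \<xi> q"
    have r: "r\<^sup>2 = n" "r \<ge> 0" by (auto simp: r_def n_def freq_size_power2)
    have r1: "1 \<le> r"
    proof (rule power2_le_imp_le)
      show "1\<^sup>2 \<le> r\<^sup>2" using h(1) by (simp only: r(1) one_power2)
    qed (rule r(2))
    have N: "N = 1 + r" "N \<le> 2 * r" "N \<ge> 1" using r1 by (auto simp: N_def r_def bracket_def)
    have xi: "r \<le> 32 * \<bar>\<xi>\<bar>"
    proof (rule power2_le_imp_le)
      \<comment> \<open>The constant 1000 is enlarged to the square 1024 = 32^2 before taking roots;
        the same is done for \<open>D\<close> below.\<close>
      have "n \<le> 1024 * \<xi>\<^sup>2" using h(2) by (smt (verit) zero_le_power2)
      then show "r\<^sup>2 \<le> (32 * \<bar>\<xi>\<bar>)\<^sup>2" by (simp add: r(1) power_mult_distrib)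
    qed simp
    have xi0: "\<xi> \<noteq> 0" using xi r1 by auto
    have D: "n \<le> 32 * \<bar>D\<bar>"
    proof (rule power2_le_imp_le)
      have "n\<^sup>2 \<le> 1024 * D\<^sup>2" using h(3) by (smt (verit) zero_le_power2)
      then show "n\<^sup>2 \<le> (32 * \<bar>D\<bar>)\<^sup>2" by (simp add: power_mult_distrib)
    qed simp
    have xr: "3 * \<bar>\<xi>\<bar> \<le> (18/10) * r"
    proof (rule power2_le_imp_le)
      have "3 * \<xi>\<^sup>2 \<le> n" by (simp add: n_def freq_sq_def)
      then have "9 * \<xi>\<^sup>2 \<le> (324/100) * n" using h(1) by simp
      then show "(3 * \<bar>\<xi>\<bar>)\<^sup>2 \<le> ((18/10) * r)\<^sup>2"
        unfolding power_mult_distrib r(1) by (simp add: power2_eq_square)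
    qed (use r in simp)
    \<comment> \<open>From \<open>N \<le> 2 * r\<close>,
      \<open>3 * \<bar>\<xi>\<bar> \<le> 1.8 * r\<close> and
      \<open>n \<le> 32 * \<bar>D\<bar>\<close> one gets 3.6 * 32 = 115.2, rounded up to
      120.\<close>
    have kap: "N / 120 \<le> \<bar>\<kappa>\<bar>"
    proof -
      have "N * (3 * \<bar>\<xi>\<bar>) \<le> (2 * r) * ((18/10) * r)" using N xr r1 by (intro mult_mono[of N "2 * r" "3 * \<bar>\<xi>\<bar>" "(18/10) * r"]) auto
      also have "\<dots> = (36/10) * n" by (simp add: r(1)[symmetric] power2_eq_square)
      also have "\<dots> \<le> 120 * \<bar>D\<bar>" using D by linarith
      finally show ?thesis using xi0 by (simp add: \<kappa>_def abs_mult field_simps)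
    qed
    have kap0: "\<kappa> \<noteq> 0" using kap N by auto
    have a: "\<bar>3 * \<xi>\<bar> powr (- 1/2) \<le> 5 * N powr (- (1/2))"
    proof -
      have "N \<le> 25 * \<bar>3 * \<xi>\<bar>" using N xi by (simp add: abs_mult)
      then have "sqrt N \<le> sqrt (5\<^sup>2 * \<bar>3 * \<xi>\<bar>)" by simp
      also have "\<dots> = 5 * sqrt \<bar>3 * \<xi>\<bar>" by (simp only: real_sqrt_mult real_sqrt_abs abs_numeral)
      finally have "sqrt N \<le> 5 * sqrt \<bar>3 * \<xi>\<bar>" .
      then have "1 / sqrt \<bar>3 * \<xi>\<bar> \<le> 5 * (1 / sqrt N)" using xi0 N by (simp add: field_simps)
      moreover have "\<bar>3 * \<xi>\<bar> powr (- 1/2) = 1 / sqrt \<bar>3 * \<xi>\<bar>" using xi0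
        by (simp add: powr_minus_divide powr_half_sqrt)
      moreover have "N powr (- (1/2)) = 1 / sqrt N" using N
        by (simp add: powr_minus_divide powr_half_sqrt)
      ultimately show ?thesis by simp
    qed
    \<comment> \<open>Collects the shift \<open>c\<close> and the terms of
      \<open>phase_centred\<close> that depend on neither \<open>x\<close> nor
      \<open>p\<close>.\<close>
    define c' where "c' = c - \<xi> ^ 3 / 4 - \<xi> * (real_of_int q)\<^sup>2 / 4"
    obtain s where s: "\<And>m. bracket (\<kappa> * m\<^sup>2 - c') powr (- (1/2)) \<le>
     (1 + \<bar>\<kappa>\<bar> * (m - s)\<^sup>2) powr (- (1/2)) + (1 + \<bar>\<kappa>\<bar> * (m + s)\<^sup>2) powr (- (1/2))"
      using bracket_parabola_le[OF kap0] by blast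
    let ?m = "\<lambda>p. real_of_int p - real_of_int q / 2"
    let ?b = "\<lambda>p. 2 * bracket (real_of_int p) powr (- (3/2)) + (bracket (?m p - s) powr (- 2) + bracket (?m p + s) powr (- 2))"
    have inner: "(\<integral>\<^sup>+x. ennreal (of_bool (hessian_region \<xi> q p) *
      (5 * N powr (1/4) * bracket (phase \<xi> q x p - c) powr (- ?e))) \<partial>lborel) \<le>
      ennreal (25 * K * 44) * ennreal (?b p)" for p
    proof (cases "hessian_region \<xi> q p")
      case True
      then have p: "bracket (real_of_int p) \<le> 4 * N" by (simp add: hessian_region_def N_def)
      have I1: "(\<integral>\<^sup>+x. ennreal (bracket (phase \<xi> q x p - c) powr (- ?e)) \<partial>lborel) \<le> ennreal (K * \<bar>3 * \<xi>\<bar> powr (- 1/2) * bracket (c' - \<kappa> * (?m p)\<^sup>2) powr (- 1/2))"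
      proof -
      have "(\<integral>\<^sup>+x. ennreal (bracket (phase \<xi> q x p - c) powr (- ?e)) \<partial>lborel) =
        (\<integral>\<^sup>+x. ennreal (bracket (3 * \<xi> * (x - (\<xi> / 2 - real_of_int q * ?m p / (3 * \<xi>)))\<^sup>2
             - (c' - \<kappa> * (?m p)\<^sup>2)) powr (- ?e)) \<partial>lborel)"
        unfolding phase_centred[OF xi0] c'_def \<kappa>_def D_def
        by (intro nn_integral_cong arg_cong[where f=ennreal] arg_cong2[where f="(powr)"] arg_cong[where f=bracket]) (simp_all add: algebra_simps)
      also have "\<dots> \<le> ennreal (K * \<bar>3 * \<xi>\<bar> powr (- 1/2) * bracket (c' - \<kappa> * (?m p)\<^sup>2) powr (- 1/2))"
        unfolding K_def by (rule nn_integral_scaled_square_phase) (use xi0 in auto)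
      finally show ?thesis .
      qed
      have "(\<integral>\<^sup>+x. ennreal (of_bool (hessian_region \<xi> q p) *
        (5 * N powr (1/4) * bracket (phase \<xi> q x p - c) powr (- ?e))) \<partial>lborel) =
        ennreal (5 * N powr (1/4)) * (\<integral>\<^sup>+x. ennreal (bracket (phase \<xi> q x p - c) powr (- ?e)) \<partial>lborel)"
        using True by (subst nn_integral_cmult[symmetric]) (auto simp: ennreal_mult)
      also have "\<dots> \<le> ennreal (5 * N powr (1/4)) * ennreal (K * \<bar>3 * \<xi>\<bar> powr (- 1/2) * bracket (c' - \<kappa> * (?m p)\<^sup>2) powr (- 1/2))"
        by (intro mult_left_mono I1) auto
      also have "\<dots> = ennreal (5 * N powr (1/4) * (K * \<bar>3 * \<xi>\<bar> powr (- 1/2) * bracket (c' - \<kappa> * (?m p)\<^sup>2) powr (- 1/2)))"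
        using K by (intro ennreal_mult[symmetric]) auto
      also have "\<dots> \<le> ennreal (25 * K * 44 * ?b p)"
      proof (rule ennreal_leI)
        have "5 * N powr (1/4) * (K * \<bar>3 * \<xi>\<bar> powr (- 1/2) * bracket (c' - \<kappa> * (?m p)\<^sup>2) powr (- 1/2))
          \<le> 5 * N powr (1/4) * (K * (5 * N powr (- (1/2))) * bracket (c' - \<kappa> * (?m p)\<^sup>2) powr (- 1/2))"
          using a K by (intro mult_left_mono mult_right_mono) auto
        also have "\<dots> = 25 * K * ((N powr (1/4) * N powr (- (1/2))) * bracket (\<kappa> * (?m p)\<^sup>2 - c') powr (- (1/2)))"
          by (simp add: bracket_minus_commute[of c'])
        also have "N powr (1/4) * N powr (- (1/2)) = N powr (- (1/4))" by (simp add: powr_add[symmetric])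
        also have "25 * K * (N powr (- (1/4)) * bracket (\<kappa> * (?m p)\<^sup>2 - c') powr (- (1/2))) \<le>
           25 * K * (N powr (- (1/4)) * ((1 + \<bar>\<kappa>\<bar> * (?m p - s)\<^sup>2) powr (- (1/2)) + (1 + \<bar>\<kappa>\<bar> * (?m p + s)\<^sup>2) powr (- (1/2))))"
          using K by (intro mult_left_mono s) auto
        also have "\<dots> = 25 * K * (N powr (- (1/4)) * (1 + \<bar>\<kappa>\<bar> * (?m p - s)\<^sup>2) powr (- (1/2)) + N powr (- (1/4)) * (1 + \<bar>\<kappa>\<bar> * (?m p + s)\<^sup>2) powr (- (1/2)))"
          by (simp add: algebra_simps)
        also have "\<dots> \<le> 25 * K * (44 * (bracket (real_of_int p) powr (- (3/2)) + bracket (?m p - s) powr (- 2)) +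
          44 * (bracket (real_of_int p) powr (- (3/2)) + bracket (?m p + s) powr (- 2)))"
          using K kap p N by (intro mult_left_mono add_mono lattice_weight_bound) auto
        also have "\<dots> = 25 * K * 44 * ?b p" by (simp add: algebra_simps)
        finally show "5 * N powr (1/4) * (K * \<bar>3 * \<xi>\<bar> powr (- 1/2) * bracket (c' - \<kappa> * (?m p)\<^sup>2) powr (- 1/2)) \<le> 25 * K * 44 * ?b p" .
      qed
      also have "\<dots> = ennreal (25 * K * 44) * ennreal (?b p)"
        using K by (intro ennreal_mult) auto
      finally show ?thesis by (simp add: mult_left_mono)
    qed simp
    have "(\<integral>\<^sup>+p. \<integral>\<^sup>+x. ennreal (of_bool (hessian_region \<xi> q p) *
      (5 * bracket (freq_size \<xi> q) powr (1/4) * bracket (phase \<xi> q x p - c) powr (- ?e))) \<partial>lborel \<partial>count_space UNIV)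
      \<le> (\<integral>\<^sup>+p. ennreal (25 * K * 44) * ennreal (?b p) \<partial>count_space UNIV)"
      unfolding N_def[symmetric] by (intro nn_integral_mono inner)
    also have "\<dots> = ennreal (25 * K * 44) * (\<integral>\<^sup>+p. ennreal (?b p) \<partial>count_space UNIV)"
      by (rule nn_integral_cmult) auto
    also have "(\<integral>\<^sup>+p. ennreal (?b p) \<partial>count_space UNIV) =
      (\<integral>\<^sup>+p. 2 * ennreal (bracket (real_of_int p - 0) powr (- (3/2))) +
        (ennreal (bracket (real_of_int p - (real_of_int q / 2 + s)) powr (- 2)) + ennreal (bracket (real_of_int p - (real_of_int q / 2 - s)) powr (- 2))) \<partial>count_space UNIV)"
      by (intro nn_integral_cong) (simp add: ennreal_mult algebra_simps)
    also have "\<dots> = 2 * (\<integral>\<^sup>+p. ennreal (bracket (real_of_int p - 0) powr (- (3/2))) \<partial>count_space UNIV) +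
       ((\<integral>\<^sup>+p. ennreal (bracket (real_of_int p - (real_of_int q / 2 + s)) powr (- 2)) \<partial>count_space UNIV) +
        (\<integral>\<^sup>+p. ennreal (bracket (real_of_int p - (real_of_int q / 2 - s)) powr (- 2)) \<partial>count_space UNIV))"
      by (subst nn_integral_add; (subst nn_integral_add)?) (auto simp: nn_integral_cmult)
    also have "\<dots> \<le> 2 * ennreal I + (ennreal J + ennreal J)"
      unfolding I_def J_def by (intro add_mono mult_left_mono nn_integral_int_bracket) auto
    also have "2 * ennreal I = ennreal (2 * I)"
      using ennreal_mult[of 2 I] K by simp
    also have "ennreal J + ennreal J = ennreal (2 * J)"
      using ennreal_plus[of J J] K by simp
    also have "ennreal (2 * I) + ennreal (2 * J) = ennreal (2 * I + 2 * J)"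
      using ennreal_plus[of "2 * I" "2 * J"] K by simp
    also have "ennreal (25 * K * 44) * ennreal (2 * I + 2 * J) = ennreal (25 * K * 44 * (2 * I + 2 * J))"
      using K by (intro ennreal_mult[symmetric]) auto
    finally show ?thesis by (simp add: mult_left_mono)
  qed (use K in auto)
  then show ?thesis using K by (intro exI[of _ "25 * K * 44 * (2 * I + 2 * J)"]) auto
qed

section \<open>The convolution kernel\<close>

text \<open>The pair (\<xi>, q) is now an input and (x, p) runs over the outputs. Since the
  dispersion is odd, the same function \<open>phase\<close> describes this configuration, and its
  derivative compares the output with the other input.\<close>

lemma frozen_bound:
  "\<exists>C\<ge>0. \<forall>\<xi> q c. (\<integral>\<^sup>+p. \<integral>\<^sup>+x. ennreal (of_bool (\<not> transversal (freq_sq \<xi> q) (freq_sq (\<xi> - x) (q - p)) \<and>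
        freezable \<xi> q (freq_sq x p) (freq_sq (\<xi> - x) (q - p))) *
      (x\<^sup>2 * (bracket (freq_size \<xi> q) powr (- 2) + bracket (freq_size (\<xi> - x) (q - p)) powr (- 2)) *
      bracket (phase \<xi> q x p - c) powr (- (17/18)))) \<partial>lborel \<partial>count_space UNIV) \<le> ennreal C"
proof -
  obtain C3 where C3: "C3 \<ge> 0" "\<And>\<xi> q c. (\<integral>\<^sup>+p. \<integral>\<^sup>+x. ennreal (of_bool (hessian_region \<xi> q p) *
      (5 * bracket (freq_size \<xi> q) powr (1/4) * bracket (phase \<xi> q x p - c) powr (- (37/36)))) \<partial>lborel \<partial>count_space UNIV) \<le> ennreal C3"
    using hessian_bound by blast
  define k where "k = 40 * ((4::real) powr (4/3))\<^sup>2"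
  define I where "I = bracket_int (4/3)"
  define J where "J = 2 powr (4/3) * bracket_int (4/3)"
  define B where "B = 2 * bracket_int (37/36)"
  define L where "L = 2 powr (3/2) * bracket_int (3/2)"
  have nn: "0 \<le> k" "0 \<le> I" "0 \<le> J" "0 \<le> B" "0 \<le> L"
    by (auto simp: k_def I_def J_def B_def L_def bracket_int_def)
  have "(\<integral>\<^sup>+p. \<integral>\<^sup>+x. ennreal (of_bool (\<not> transversal (freq_sq \<xi> q) (freq_sq (\<xi> - x) (q - p)) \<and>
        freezable \<xi> q (freq_sq x p) (freq_sq (\<xi> - x) (q - p))) *
      (x\<^sup>2 * (bracket (freq_size \<xi> q) powr (- 2) + bracket (freq_size (\<xi> - x) (q - p)) powr (- 2)) *
      bracket (phase \<xi> q x p - c) powr (- (17/18)))) \<partial>lborel \<partial>count_space UNIV)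
     \<le> ennreal (k * J * I + 3360 * L * B + C3)" (is "(\<integral>\<^sup>+p. \<integral>\<^sup>+x. ennreal (?f p x) \<partial>_ \<partial>_) \<le> _") for \<xi> q c
  proof -
    let ?a = "\<lambda>p. bracket (real_of_int p) powr (- (4/3))" and ?b = "\<lambda>p. bracket (real_of_int p) powr (- (3/2))"
    let ?A = "\<lambda>p x. ennreal (k * ?a p) * ennreal (bracket x powr (- (4/3)))"
    let ?B = "\<lambda>p x. ennreal (3360 * ?b p) * ennreal (\<bar>phase_deriv \<xi> q x p\<bar> * bracket (phase \<xi> q x p - c) powr (- (37/36)))"
    let ?C = "\<lambda>p x. ennreal (of_bool (hessian_region \<xi> q p) *
      (5 * bracket (freq_size \<xi> q) powr (1/4) * bracket (phase \<xi> q x p - c) powr (- (37/36))))"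
    have pt: "ennreal (?f p x) \<le> ?A p x + ?B p x + ?C p x" for p x
    proof (cases "\<not> transversal (freq_sq \<xi> q) (freq_sq (\<xi> - x) (q - p)) \<and> freezable \<xi> q (freq_sq x p) (freq_sq (\<xi> - x) (q - p))")
      case True
      then have "?f p x \<le> (k * ?a p) * bracket x powr (- (4/3)) +
         (3360 * ?b p) * (\<bar>phase_deriv \<xi> q x p\<bar> * bracket (phase \<xi> q x p - c) powr (- (37/36))) +
         of_bool (hessian_region \<xi> q p) * (5 * bracket (freq_size \<xi> q) powr (1/4) * bracket (phase \<xi> q x p - c) powr (- (37/36)))"
        using frozen_pointwise[of \<xi> q x p "bracket (phase \<xi> q x p - c)"] bracket_ge_1
        by (simp add: k_def phase_deriv_def mult.assoc)
      then have "ennreal (?f p x) \<le> ennreal ((k * ?a p) * bracket x powr (- (4/3)) +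
         (3360 * ?b p) * (\<bar>phase_deriv \<xi> q x p\<bar> * bracket (phase \<xi> q x p - c) powr (- (37/36))) +
         of_bool (hessian_region \<xi> q p) * (5 * bracket (freq_size \<xi> q) powr (1/4) * bracket (phase \<xi> q x p - c) powr (- (37/36))))"
        by (rule ennreal_leI)
      also have "\<dots> = ?A p x + ?B p x + ?C p x"
        using nn by (subst ennreal_plus, simp, simp, subst ennreal_plus, simp, simp, subst ennreal_mult, simp, simp, subst ennreal_mult) auto
      finally show ?thesis .
    qed auto
    have "(\<integral>\<^sup>+p. \<integral>\<^sup>+x. ennreal (?f p x) \<partial>lborel \<partial>count_space UNIV) \<le> (\<integral>\<^sup>+p. \<integral>\<^sup>+x. ?A p x + ?B p x + ?C p x \<partial>lborel \<partial>count_space UNIV)"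
      by (intro nn_integral_mono pt)
    also have "\<dots> = (\<integral>\<^sup>+p. (\<integral>\<^sup>+x. ?A p x \<partial>lborel) + (\<integral>\<^sup>+x. ?B p x \<partial>lborel) + (\<integral>\<^sup>+x. ?C p x \<partial>lborel) \<partial>count_space UNIV)"
      by (intro nn_integral_cong) (simp add: nn_integral_add)
    also have "\<dots> \<le> (\<integral>\<^sup>+p. ennreal (k * I) * ennreal (bracket (real_of_int p - 0) powr (- (4/3))) + ennreal (3360 * B) * ennreal (bracket (real_of_int p - 0) powr (- (3/2))) +
         (\<integral>\<^sup>+x. ?C p x \<partial>lborel) \<partial>count_space UNIV)"
    proof (intro nn_integral_mono add_mono order.refl)
      fix p
      have "(\<integral>\<^sup>+x. ?A p x \<partial>lborel) \<le> ennreal (k * ?a p) * ennreal I"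
        unfolding I_def by (subst nn_integral_cmult) (auto intro!: mult_left_mono nn_integral_bracket_powr)
      then show "(\<integral>\<^sup>+x. ?A p x \<partial>lborel) \<le> ennreal (k * I) * ennreal (bracket (real_of_int p - 0) powr (- (4/3)))"
        using nn by (simp add: ennreal_mult mult_ac)
      have "(\<integral>\<^sup>+x. ?B p x \<partial>lborel) \<le> ennreal (3360 * ?b p) * ennreal B"
        unfolding B_def by (subst nn_integral_cmult) (auto intro!: mult_left_mono nn_integral_phase)
      then show "(\<integral>\<^sup>+x. ?B p x \<partial>lborel) \<le> ennreal (3360 * B) * ennreal (bracket (real_of_int p - 0) powr (- (3/2)))"
        using nn by (simp add: ennreal_mult mult_ac)
    qed
    also have "\<dots> = ennreal (k * I) * (\<integral>\<^sup>+p. ennreal (bracket (real_of_int p - 0) powr (- (4/3))) \<partial>count_space UNIV)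
       + ennreal (3360 * B) * (\<integral>\<^sup>+p. ennreal (bracket (real_of_int p - 0) powr (- (3/2))) \<partial>count_space UNIV) +
       (\<integral>\<^sup>+p. \<integral>\<^sup>+x. ?C p x \<partial>lborel \<partial>count_space UNIV)"
      by (subst nn_integral_add, simp, simp, subst nn_integral_add) (auto simp: nn_integral_cmult)
    also have "\<dots> \<le> ennreal (k * I) * ennreal J + ennreal (3360 * B) * ennreal L + ennreal C3"
      unfolding J_def L_def by (intro add_mono mult_left_mono nn_integral_int_bracket C3) auto
    also have "\<dots> = ennreal (k * J * I + 3360 * L * B + C3)"
      using nn C3(1) by (simp add: ennreal_mult[symmetric] ennreal_plus[symmetric] mult_ac del: ennreal_plus)
    finally show ?thesis .
  qed
  then show ?thesis using nn C3(1)
    by (intro exI[of _ "k * J * I + 3360 * L * B + C3"]) auto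
qed

section \<open>The frequency space and its invariant measure\<close>

interpretation int_count: sigma_finite_measure "count_space (UNIV :: int set)"
  by (rule sigma_finite_measure_count_space_countable) auto

interpretation int_real: pair_sigma_finite "count_space (UNIV :: int set)" "lborel :: real measure" ..

interpretation real_int_real: pair_sigma_finite "lborel :: real measure" "count_space (UNIV :: int set) \<Otimes>\<^sub>M (lborel :: real measure)"
  by (intro pair_sigma_finite.intro lborel.sigma_finite_measure_axioms int_real.sigma_finite_measure_axioms)

interpretation real_int: pair_sigma_finite "lborel :: real measure" "count_space (UNIV :: int set)" ..

interpretation freq: sigma_finite_measure freq_measure
  unfolding freq_measure_def by (rule real_int_real.sigma_finite_measure_axioms)

interpretation freq_pair: pair_sigma_finite freq_measure freq_measure ..

lemma sets_freq_measure [measurable_cong]: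
  "sets freq_measure = sets (borel \<Otimes>\<^sub>M (count_space UNIV \<Otimes>\<^sub>M borel))"
  unfolding freq_measure_def by (intro sets_pair_measure_cong) auto

lemma space_freq_measure [simp]: "space freq_measure = UNIV"
  by (simp add: freq_measure_def space_pair_measure)

text \<open>The lattice is put outermost, which is the order of integration in the bounds
  above.\<close>

lemma nn_integral_freq:
  assumes [measurable]: "f \<in> borel_measurable freq_measure"
  shows "(\<integral>\<^sup>+z. f z \<partial>freq_measure) =
    (\<integral>\<^sup>+q. \<integral>\<^sup>+\<xi>. \<integral>\<^sup>+\<tau>. f (\<xi>, q, \<tau>) \<partial>lborel \<partial>lborel \<partial>count_space UNIV)"
proof -
  have [measurable]: "f \<in> borel_measurable (lborel \<Otimes>\<^sub>M (count_space UNIV \<Otimes>\<^sub>M lborel))"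
    using assms unfolding freq_measure_def .
  have "(\<integral>\<^sup>+z. f z \<partial>freq_measure) = (\<integral>\<^sup>+\<xi>. \<integral>\<^sup>+y. f (\<xi>, y) \<partial>(count_space UNIV \<Otimes>\<^sub>M lborel) \<partial>lborel)"
    unfolding freq_measure_def by (rule int_real.nn_integral_fst[symmetric]) measurable
  also have "\<dots> = (\<integral>\<^sup>+\<xi>. \<integral>\<^sup>+q. \<integral>\<^sup>+\<tau>. f (\<xi>, q, \<tau>) \<partial>lborel \<partial>count_space UNIV \<partial>lborel)"
    by (intro nn_integral_cong) (simp add: lborel.nn_integral_fst[symmetric])
  also have "\<dots> = (\<integral>\<^sup>+q. \<integral>\<^sup>+\<xi>. \<integral>\<^sup>+\<tau>. f (\<xi>, q, \<tau>) \<partial>lborel \<partial>lborel \<partial>count_space UNIV)"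
    by (rule real_int.Fubini'[symmetric]) measurable
  finally show ?thesis .
qed

lemma measurable_int_minus [measurable]:
  assumes [measurable]: "f \<in> measurable M (count_space UNIV)" "g \<in> measurable M (count_space (UNIV :: int set))"
  shows "(\<lambda>x. f x - g x) \<in> measurable M (count_space UNIV)"
  by (rule measurable_compose_countable[where g=f and f="\<lambda>i x. i - g x"]) auto

lemma measurable_real_of_int [measurable]:
  assumes [measurable]: "f \<in> measurable M (count_space (UNIV :: int set))"
  shows "(\<lambda>x. real_of_int (f x)) \<in> borel_measurable M"
  by (rule measurable_compose[OF assms]) simp

lemma measurable_freq_minus [measurable]:
  assumes [measurable]: "f \<in> measurable M freq_measure" "g \<in> measurable M freq_measure"
  shows "(\<lambda>x. f x - g x) \<in> measurable M freq_measure"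
proof -
  have [measurable]: "f \<in> measurable M (borel \<Otimes>\<^sub>M (count_space UNIV \<Otimes>\<^sub>M borel))"
    "g \<in> measurable M (borel \<Otimes>\<^sub>M (count_space UNIV \<Otimes>\<^sub>M borel))"
    using assms by (simp_all only: measurable_cong_sets[OF refl sets_freq_measure])
  have "(\<lambda>x. f x - g x) = (\<lambda>x. (fst (f x) - fst (g x), fst (snd (f x)) - fst (snd (g x)), snd (snd (f x)) - snd (snd (g x))))"
    by (auto simp: fun_eq_iff prod_eq_iff)
  also have "\<dots> \<in> measurable M (borel \<Otimes>\<^sub>M (count_space UNIV \<Otimes>\<^sub>M borel))" by measurable
  finally show ?thesis by (simp only: measurable_cong_sets[OF refl sets_freq_measure])
qed

lemma nn_integral_freq_reflect:
  assumes [measurable]: "f \<in> borel_measurable freq_measure"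
  shows "(\<integral>\<^sup>+w. f (z - w) \<partial>freq_measure) = (\<integral>\<^sup>+w. f w \<partial>freq_measure)"
proof -
  obtain x p t where z: "z = (x, p, t)" by (cases z) auto
  have [measurable]: "f \<in> borel_measurable (borel \<Otimes>\<^sub>M (count_space UNIV \<Otimes>\<^sub>M borel))" using assms by simp
  have "(\<integral>\<^sup>+w. f (z - w) \<partial>freq_measure) =
     (\<integral>\<^sup>+q. \<integral>\<^sup>+\<xi>. \<integral>\<^sup>+\<tau>. f (x - \<xi>, p - q, t - \<tau>) \<partial>lborel \<partial>lborel \<partial>count_space UNIV)"
    by (subst nn_integral_freq) (auto simp: z)
  also have "\<dots> = (\<integral>\<^sup>+q. \<integral>\<^sup>+\<xi>. \<integral>\<^sup>+\<tau>. f (x - \<xi>, p - q, \<tau>) \<partial>lborel \<partial>lborel \<partial>count_space UNIV)"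
    by (intro nn_integral_cong nn_integral_reflect_real[where f="\<lambda>\<tau>. f (_, _, \<tau>)"]) measurable
  also have "\<dots> = (\<integral>\<^sup>+q. \<integral>\<^sup>+\<xi>. \<integral>\<^sup>+\<tau>. f (\<xi>, p - q, \<tau>) \<partial>lborel \<partial>lborel \<partial>count_space UNIV)"
    by (intro nn_integral_cong nn_integral_reflect_real[where f="\<lambda>\<xi>. \<integral>\<^sup>+\<tau>. f (\<xi>, _, \<tau>) \<partial>lborel"]) measurable
  also have "\<dots> = (\<integral>\<^sup>+q. \<integral>\<^sup>+\<xi>. \<integral>\<^sup>+\<tau>. f (\<xi>, q, \<tau>) \<partial>lborel \<partial>lborel \<partial>count_space UNIV)"
  proof (rule nn_integral_bij_count_space[where g="\<lambda>q. p - q" and f="\<lambda>q. \<integral>\<^sup>+\<xi>. \<integral>\<^sup>+\<tau>. f (\<xi>, q, \<tau>) \<partial>lborel \<partial>lborel"])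
    show "bij (\<lambda>q. p - q)" by (rule bij_betw_byWitness[where f'="\<lambda>q. p - q"]) auto
  qed
  also have "\<dots> = (\<integral>\<^sup>+w. f w \<partial>freq_measure)" by (rule nn_integral_freq[symmetric]) simp
  finally show ?thesis .
qed

lemma nn_integral_freq_shift:
  assumes [measurable]: "f \<in> borel_measurable freq_measure"
  shows "(\<integral>\<^sup>+w. f (w - z) \<partial>freq_measure) = (\<integral>\<^sup>+w. f w \<partial>freq_measure)"
proof -
  have "(\<integral>\<^sup>+w. f (w - z) \<partial>freq_measure) = (\<integral>\<^sup>+w. (\<lambda>u. f (0 - u)) (z - w) \<partial>freq_measure)" by simp
  also have "\<dots> = (\<integral>\<^sup>+w. f (0 - w) \<partial>freq_measure)" by (rule nn_integral_freq_reflect) measurable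
  also have "\<dots> = (\<integral>\<^sup>+w. f w \<partial>freq_measure)" by (rule nn_integral_freq_reflect) measurable
  finally show ?thesis .
qed

lemma freq_sq_measurable [measurable]:
  assumes [measurable]: "f \<in> borel_measurable M" "q \<in> measurable M (count_space UNIV)"
  shows "(\<lambda>x. freq_sq (f x) (q x)) \<in> borel_measurable M"
  unfolding freq_sq_def by measurable

lemma freq_size_measurable [measurable]:
  assumes [measurable]: "f \<in> borel_measurable M" "q \<in> measurable M (count_space UNIV)"
  shows "(\<lambda>x. freq_size (f x) (q x)) \<in> borel_measurable M"
  unfolding freq_size_sqrt by measurable

lemma transversal_measurable [measurable]:
  assumes [measurable]: "f \<in> borel_measurable M" "g \<in> borel_measurable M"
  shows "Measurable.pred M (\<lambda>x. transversal (f x) (g x))"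
  unfolding transversal_def by measurable

lemma freezable_measurable [measurable]:
  assumes [measurable]: "f \<in> borel_measurable M" "q \<in> measurable M (count_space UNIV)"
    "g \<in> borel_measurable M" "h \<in> borel_measurable M"
  shows "Measurable.pred M (\<lambda>x. freezable (f x) (q x) (g x) (h x))"
proof -
  have [measurable]: "(\<lambda>x. 3 * (f x)\<^sup>2 - (real_of_int (q x))\<^sup>2) \<in> borel_measurable M" by measurable
  have [measurable]: "Measurable.pred M (\<lambda>x. freq_sq (f x) (q x) \<le> 100 * \<bar>g x - h x\<bar>)"
    "Measurable.pred M (\<lambda>x. freq_sq (f x) (q x) \<le> 1000 * (f x)\<^sup>2)" by measurable
  have [measurable]: "Measurable.pred M (\<lambda>x. (freq_sq (f x) (q x))\<^sup>2 \<le> 1000 * (3 * (f x)\<^sup>2 - (real_of_int (q x))\<^sup>2)\<^sup>2)"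
    unfolding pred_def by (rule borel_measurable_le) measurable
  show ?thesis unfolding freezable_def by measurable
qed

section \<open>The squared kernel and its bounds\<close>

definition modulation :: "freq \<Rightarrow> real" where
  "modulation z = bracket (snd (snd z) - dispersion (fst z) (fst (snd z)))"

definition japanese :: "freq \<Rightarrow> real" where
  "japanese z = bracket (freq_size (fst z) (fst (snd z)))"

definition fsq :: "freq \<Rightarrow> real" where
  "fsq z = freq_sq (fst z) (fst (snd z))"

lemma measurable_fst_freq [measurable]: "fst \<in> borel_measurable freq_measure"
  and measurable_int_freq [measurable]: "(\<lambda>z. fst (snd z)) \<in> measurable freq_measure (count_space UNIV)"
  and measurable_time_freq [measurable]: "(\<lambda>z. snd (snd z)) \<in> borel_measurable freq_measure"
  by measurable

lemma modulation_measurable [measurable]: "modulation \<in> borel_measurable freq_measure"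
  unfolding modulation_def[abs_def] dispersion_def by measurable

lemma japanese_measurable [measurable]: "japanese \<in> borel_measurable freq_measure"
  unfolding japanese_def[abs_def] freq_size_def by measurable

lemma fsq_measurable [measurable]: "fsq \<in> borel_measurable freq_measure"
  unfolding fsq_def[abs_def] freq_sq_def by measurable

lemma modulation_pos [simp]: "0 < modulation z" and japanese_pos [simp]: "0 < japanese z"
  by (auto simp: modulation_def japanese_def)

text \<open>The square of the multiplier |\<xi>| times the output weight over the two input weights,
  for \<open>s = 1\<close> and up to a constant: the quotient of the squared sizes is dominated by
  the sum in the last factor. The exponents are 1 - 4\<delta> = 17/18 and 1 + 2\<delta> =
  37/36.\<close>

definition kernel_sq :: "freq \<Rightarrow> freq \<Rightarrow> real" where
  "kernel_sq z w = (fst z)\<^sup>2 * modulation z powr (- (17/18)) * modulation w powr (- (37/36)) *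
     modulation (z - w) powr (- (37/36)) * (japanese w powr (- 2) + japanese (z - w) powr (- 2))"

lemma kernel_sq_nonneg [simp]: "0 \<le> kernel_sq z w"
  by (simp add: kernel_sq_def)

lemma kernel_sq_commute: "kernel_sq z (z - w) = kernel_sq z w"
  by (simp add: kernel_sq_def mult_ac add.commute)

definition region0 :: "freq \<Rightarrow> freq \<Rightarrow> bool" where
  "region0 z w \<longleftrightarrow> transversal (fsq w) (fsq (z - w))"

definition region1 :: "freq \<Rightarrow> freq \<Rightarrow> bool" where
  "region1 z w \<longleftrightarrow> \<not> transversal (fsq w) (fsq (z - w)) \<and> freezable (fst w) (fst (snd w)) (fsq z) (fsq (z - w))"

lemma transversal_commute: "transversal a b = transversal b a"
  by (simp add: transversal_def add.commute abs_minus_commute)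

text \<open>This is \<open>transversal_or_freezable\<close> for the inputs \<open>w\<close> and
  \<open>z - w\<close>. The third alternative is \<open>region1\<close> with the inputs exchanged,
  under which \<open>kernel_sq\<close> is symmetric by \<open>kernel_sq_commute\<close>.\<close>

lemma regions_cover: "region0 z w \<or> region1 z w \<or> region1 z (z - w)"
proof (cases "region0 z w")
  case False
  obtain x p t y q r where w: "w = (x, p, t)" and zw: "z - w = (y, q, r)" by (metis prod_cases3)
  then have z: "z = (x + y, p + q, t + r)" by (auto simp: prod_eq_iff algebra_simps)
  have "freezable x p (fsq z) (freq_sq y q) \<or> freezable y q (fsq z) (freq_sq x p)"
    using False by (intro transversal_or_freezable) (auto simp: region0_def fsq_def w zw z)
  moreover have "region1 z w \<longleftrightarrow> \<not> region0 z w \<and> freezable x p (fsq z) (freq_sq y q)"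
    by (simp add: region1_def region0_def zw fsq_def) (simp add: w)
  moreover have "region1 z (z - w) \<longleftrightarrow> \<not> transversal (fsq (z - w)) (fsq w) \<and> freezable (fst (z - w)) (fst (snd (z - w))) (fsq z) (fsq w)"
    unfolding region1_def by (simp only: diff_diff_eq2 add_diff_cancel_left')
  then have "region1 z (z - w) \<longleftrightarrow> \<not> region0 z w \<and> freezable y q (fsq z) (freq_sq x p)"
    unfolding zw region0_def by (simp add: fsq_def w transversal_commute)
  ultimately show ?thesis using False by blast
qed simp

lemma measurable_region [measurable]:
  assumes [measurable]: "f \<in> measurable M freq_measure" "g \<in> measurable M freq_measure"
  shows "Measurable.pred M (\<lambda>x. region0 (f x) (g x))" "Measurable.pred M (\<lambda>x. region1 (f x) (g x))"
    "(\<lambda>x. kernel_sq (f x) (g x)) \<in> borel_measurable M"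
proof -
  have [measurable]: "(\<lambda>x. fst (g x)) \<in> borel_measurable M" "(\<lambda>x. fst (f x)) \<in> borel_measurable M"
     "(\<lambda>x. real_of_int (fst (snd (g x)))) \<in> borel_measurable M"
    using measurable_compose[OF assms(1) measurable_fst_freq] measurable_compose[OF assms(2) measurable_fst_freq]
      measurable_real_of_int[OF measurable_compose[OF assms(2) measurable_int_freq]] by auto
  have d: "(\<lambda>x. f x - g x) \<in> measurable M freq_measure" by measurable
  note [measurable] = measurable_compose[OF assms(1) modulation_measurable] measurable_compose[OF assms(2) modulation_measurable]
    measurable_compose[OF d modulation_measurable] measurable_compose[OF assms(2) japanese_measurable]
    measurable_compose[OF d japanese_measurable] measurable_compose[OF assms(1) fsq_measurable]
    measurable_compose[OF assms(2) fsq_measurable] measurable_compose[OF d fsq_measurable]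
  show "Measurable.pred M (\<lambda>x. region0 (f x) (g x))" unfolding region0_def by measurable
  show "Measurable.pred M (\<lambda>x. region1 (f x) (g x))" unfolding region1_def by measurable
  show "(\<lambda>x. kernel_sq (f x) (g x)) \<in> borel_measurable M" unfolding kernel_sq_def by measurable
qed

text \<open>With the output fixed its modulation weight is estimated by 1. The time integral
  convolves the two input weights, and since both exponents exceed 1 the phase inherits the exponent
  37/36 required by \<open>transversal_bound\<close>.\<close>

lemma kernel_bound0:
  "\<exists>C\<ge>0. \<forall>z. (\<integral>\<^sup>+w. ennreal (of_bool (region0 z w) * kernel_sq z w) \<partial>freq_measure) \<le> ennreal C"
proof -
  let ?e = "37/36 :: real"
  define K where "K = 2 * 2 powr ?e * bracket_int ?e"
  have K: "K \<ge> 0" by (simp add: K_def bracket_int_def)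
  obtain C where C: "C \<ge> 0" "\<And>\<xi> q c. (\<integral>\<^sup>+p. \<integral>\<^sup>+x. ennreal (of_bool (transversal (freq_sq x p) (freq_sq (\<xi> - x) (q - p))) *
      \<xi>\<^sup>2 * (bracket (freq_size x p) powr (- 2) + bracket (freq_size (\<xi> - x) (q - p)) powr (- 2)) *
      bracket (phase \<xi> q x p - c) powr (- ?e)) \<partial>lborel \<partial>count_space UNIV) \<le> ennreal C"
    using transversal_bound by blast
  have "(\<integral>\<^sup>+w. ennreal (of_bool (region0 z w) * kernel_sq z w) \<partial>freq_measure) \<le> ennreal (K * C)" for z
  proof -
    obtain \<xi> q \<tau> where z: "z = (\<xi>, q, \<tau>)" by (metis prod_cases3)
    let ?G = "\<lambda>x p. of_bool (transversal (freq_sq x p) (freq_sq (\<xi> - x) (q - p))) *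
      \<xi>\<^sup>2 * (bracket (freq_size x p) powr (- 2) + bracket (freq_size (\<xi> - x) (q - p)) powr (- 2))"
    have inner: "(\<integral>\<^sup>+t. ennreal (of_bool (region0 z (x, p, t)) * kernel_sq z (x, p, t)) \<partial>lborel) \<le>
      ennreal K * ennreal (?G x p * bracket (phase \<xi> q x p - \<tau>) powr (- ?e))" for x p
    proof -
      have "(\<integral>\<^sup>+t. ennreal (of_bool (region0 z (x, p, t)) * kernel_sq z (x, p, t)) \<partial>lborel) \<le>
        (\<integral>\<^sup>+t. ennreal (?G x p) * ennreal (bracket (t - dispersion x p) powr (- ?e) * bracket (t - (\<tau> - dispersion (\<xi> - x) (q - p))) powr (- ?e)) \<partial>lborel)"
      proof (rule nn_integral_mono)
        fix t
        have m: "modulation z powr (- (17/18)) \<le> 1" unfolding modulation_def by (rule bracket_powr_le_1) simp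
        have "bracket (\<tau> - t - dispersion (\<xi> - x) (q - p)) = bracket (t - (\<tau> - dispersion (\<xi> - x) (q - p)))"
          by (subst bracket_minus_commute) (simp add: algebra_simps)
        then have "of_bool (region0 z (x, p, t)) * kernel_sq z (x, p, t) =
          (?G x p * (bracket (t - dispersion x p) powr (- ?e) * bracket (t - (\<tau> - dispersion (\<xi> - x) (q - p))) powr (- ?e)))
          * modulation z powr (- (17/18))"
          by (simp add: kernel_sq_def region0_def fsq_def japanese_def modulation_def z)
        also have "\<dots> \<le> (?G x p * (bracket (t - dispersion x p) powr (- ?e) * bracket (t - (\<tau> - dispersion (\<xi> - x) (q - p))) powr (- ?e))) * 1"
          by (intro mult_left_mono m) auto
        finally show "ennreal (of_bool (region0 z (x, p, t)) * kernel_sq z (x, p, t)) \<le> ennreal (?G x p) * ennreal (bracket (t - dispersion x p) powr (- ?e) * bracket (t - (\<tau> - dispersion (\<xi> - x) (q - p))) powr (- ?e))"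
          by (subst ennreal_mult[symmetric]) (auto intro!: ennreal_leI)
      qed
      also have "\<dots> = ennreal (?G x p) * (\<integral>\<^sup>+t. ennreal (bracket (t - dispersion x p) powr (- ?e) * bracket (t - (\<tau> - dispersion (\<xi> - x) (q - p))) powr (- ?e)) \<partial>lborel)"
        by (rule nn_integral_cmult) measurable
      also have "\<dots> \<le> ennreal (?G x p) * ennreal (2 * 2 powr ?e * bracket_int ?e * bracket (\<tau> - dispersion (\<xi> - x) (q - p) - dispersion x p) powr (- ?e))"
        by (intro mult_left_mono nn_integral_bracket_convolution) auto
      also have "bracket (\<tau> - dispersion (\<xi> - x) (q - p) - dispersion x p) = bracket (phase \<xi> q x p - \<tau>)"
        by (subst bracket_minus_commute) (simp add: phase_def algebra_simps)
      also have "ennreal (?G x p) * ennreal (2 * 2 powr ?e * bracket_int ?e * bracket (phase \<xi> q x p - \<tau>) powr (- ?e)) =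
         ennreal K * ennreal (?G x p * bracket (phase \<xi> q x p - \<tau>) powr (- ?e))"
        using K unfolding K_def[symmetric] by (simp add: ennreal_mult[symmetric] mult_ac)
      finally show ?thesis .
    qed
    have "(\<integral>\<^sup>+w. ennreal (of_bool (region0 z w) * kernel_sq z w) \<partial>freq_measure) =
      (\<integral>\<^sup>+p. \<integral>\<^sup>+x. \<integral>\<^sup>+t. ennreal (of_bool (region0 z (x, p, t)) * kernel_sq z (x, p, t)) \<partial>lborel \<partial>lborel \<partial>count_space UNIV)"
      by (rule nn_integral_freq) measurable
    also have "\<dots> \<le> (\<integral>\<^sup>+p. \<integral>\<^sup>+x. ennreal K * ennreal (?G x p * bracket (phase \<xi> q x p - \<tau>) powr (- ?e)) \<partial>lborel \<partial>count_space UNIV)"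
      by (intro nn_integral_mono inner)
    also have "\<dots> = (\<integral>\<^sup>+p. ennreal K * (\<integral>\<^sup>+x. ennreal (?G x p * bracket (phase \<xi> q x p - \<tau>) powr (- ?e)) \<partial>lborel) \<partial>count_space UNIV)"
      by (intro nn_integral_cong nn_integral_cmult) measurable
    also have "\<dots> = ennreal K * (\<integral>\<^sup>+p. \<integral>\<^sup>+x. ennreal (?G x p * bracket (phase \<xi> q x p - \<tau>) powr (- ?e)) \<partial>lborel \<partial>count_space UNIV)"
      by (rule nn_integral_cmult) simp
    also have "\<dots> \<le> ennreal K * ennreal C"
      by (intro mult_left_mono C) auto
    finally show ?thesis using K C(1) by (simp add: ennreal_mult)
  qed
  then show ?thesis using K C(1) by (intro exI[of _ "K * C"]) auto
qed

text \<open>With the input \<open>w\<close> fixed its modulation weight is estimated by 1. The time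
  integral convolves the weights of the other input and of the output, and the smaller exponent
  17/18 survives; hence the exponent in \<open>frozen_bound\<close>.\<close>

lemma kernel_bound1:
  "\<exists>C\<ge>0. \<forall>w. (\<integral>\<^sup>+z. ennreal (of_bool (region1 z w) * kernel_sq z w) \<partial>freq_measure) \<le> ennreal C"
proof -
  let ?e = "37/36 :: real" and ?b = "17/18 :: real"
  define K where "K = 2 * 2 powr ?b * bracket_int ?e"
  have K: "K \<ge> 0" by (simp add: K_def bracket_int_def)
  obtain C where C: "C \<ge> 0" "\<And>\<xi> q c. (\<integral>\<^sup>+p. \<integral>\<^sup>+x. ennreal (of_bool (\<not> transversal (freq_sq \<xi> q) (freq_sq (\<xi> - x) (q - p)) \<and>
        freezable \<xi> q (freq_sq x p) (freq_sq (\<xi> - x) (q - p))) *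
      (x\<^sup>2 * (bracket (freq_size \<xi> q) powr (- 2) + bracket (freq_size (\<xi> - x) (q - p)) powr (- 2)) *
      bracket (phase \<xi> q x p - c) powr (- ?b))) \<partial>lborel \<partial>count_space UNIV) \<le> ennreal C"
    using frozen_bound by blast
  have "(\<integral>\<^sup>+z. ennreal (of_bool (region1 z w) * kernel_sq z w) \<partial>freq_measure) \<le> ennreal (K * C)" for w
  proof -
    obtain \<xi> q \<tau> where w: "w = (\<xi>, q, \<tau>)" by (metis prod_cases3)
    let ?R = "\<lambda>x p. of_bool (\<not> transversal (freq_sq \<xi> q) (freq_sq (\<xi> - x) (q - p)) \<and>
        freezable \<xi> q (freq_sq x p) (freq_sq (\<xi> - x) (q - p))) :: real"
    let ?G = "\<lambda>x p. x\<^sup>2 * (bracket (freq_size \<xi> q) powr (- 2) + bracket (freq_size (\<xi> - x) (q - p)) powr (- 2))"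
    have fs: "freq_size (x - \<xi>) (p - q) = freq_size (\<xi> - x) (q - p)" for x p
      by (simp add: freq_size_sqrt freq_sq_minus_commute[of \<xi>])
    have dis: "dispersion (x - \<xi>) (p - q) = - dispersion (\<xi> - x) (q - p)" for x p
      by (simp add: dispersion_def power2_eq_square power3_eq_cube algebra_simps)
    have inner: "(\<integral>\<^sup>+t. ennreal (of_bool (region1 (x, p, t) w) * kernel_sq (x, p, t) w) \<partial>lborel) \<le>
      ennreal K * ennreal (?R x p * (?G x p * bracket (phase \<xi> q x p - \<tau>) powr (- ?b)))" for x p
    proof -
      have "(\<integral>\<^sup>+t. ennreal (of_bool (region1 (x, p, t) w) * kernel_sq (x, p, t) w) \<partial>lborel) \<le>
        (\<integral>\<^sup>+t. ennreal (?R x p * ?G x p) * ennreal (bracket (t - (\<tau> - dispersion (\<xi> - x) (q - p))) powr (- ?e) * bracket (t - dispersion x p) powr (- ?b)) \<partial>lborel)"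
      proof (rule nn_integral_mono)
        fix t
        have m: "modulation w powr (- ?e) \<le> 1" unfolding modulation_def by (rule bracket_powr_le_1) simp
        have "of_bool (region1 (x, p, t) w) * kernel_sq (x, p, t) w =
          (?R x p * ?G x p * (bracket (t - (\<tau> - dispersion (\<xi> - x) (q - p))) powr (- ?e) * bracket (t - dispersion x p) powr (- ?b)))
          * modulation w powr (- ?e)"
          by (simp add: kernel_sq_def region1_def fsq_def japanese_def modulation_def w fs dis freq_sq_minus_commute[of \<xi>] algebra_simps)
        also have "\<dots> \<le> (?R x p * ?G x p * (bracket (t - (\<tau> - dispersion (\<xi> - x) (q - p))) powr (- ?e) * bracket (t - dispersion x p) powr (- ?b))) * 1"
          by (intro mult_left_mono m) auto
        finally show "ennreal (of_bool (region1 (x, p, t) w) * kernel_sq (x, p, t) w) \<le> ennreal (?R x p * ?G x p) * ennreal (bracket (t - (\<tau> - dispersion (\<xi> - x) (q - p))) powr (- ?e) * bracket (t - dispersion x p) powr (- ?b))"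
          by (subst ennreal_mult[symmetric]) (auto intro!: ennreal_leI)
      qed
      also have "\<dots> = ennreal (?R x p * ?G x p) * (\<integral>\<^sup>+t. ennreal (bracket (t - (\<tau> - dispersion (\<xi> - x) (q - p))) powr (- ?e) * bracket (t - dispersion x p) powr (- ?b)) \<partial>lborel)"
        by (rule nn_integral_cmult) measurable
      also have "\<dots> \<le> ennreal (?R x p * ?G x p) * ennreal (2 * 2 powr ?b * bracket_int ?e * bracket (dispersion x p - (\<tau> - dispersion (\<xi> - x) (q - p))) powr (- ?b))"
        by (intro mult_left_mono nn_integral_bracket_convolution) auto
      also have "dispersion x p - (\<tau> - dispersion (\<xi> - x) (q - p)) = phase \<xi> q x p - \<tau>"
        by (simp add: phase_def)
      also have "ennreal (?R x p * ?G x p) * ennreal (2 * 2 powr ?b * bracket_int ?e * bracket (phase \<xi> q x p - \<tau>) powr (- ?b)) =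
         ennreal K * ennreal (?R x p * (?G x p * bracket (phase \<xi> q x p - \<tau>) powr (- ?b)))"
        using K unfolding K_def[symmetric] by (subst (1 2) ennreal_mult[symmetric]) (auto simp: mult_ac)
      finally show ?thesis .
    qed
    have "(\<integral>\<^sup>+z. ennreal (of_bool (region1 z w) * kernel_sq z w) \<partial>freq_measure) =
      (\<integral>\<^sup>+p. \<integral>\<^sup>+x. \<integral>\<^sup>+t. ennreal (of_bool (region1 (x, p, t) w) * kernel_sq (x, p, t) w) \<partial>lborel \<partial>lborel \<partial>count_space UNIV)"
      by (rule nn_integral_freq) measurable
    also have "\<dots> \<le> (\<integral>\<^sup>+p. \<integral>\<^sup>+x. ennreal K * ennreal (?R x p * (?G x p * bracket (phase \<xi> q x p - \<tau>) powr (- ?b))) \<partial>lborel \<partial>count_space UNIV)"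
      by (intro nn_integral_mono inner)
    also have "\<dots> = (\<integral>\<^sup>+p. ennreal K * (\<integral>\<^sup>+x. ennreal (?R x p * (?G x p * bracket (phase \<xi> q x p - \<tau>) powr (- ?b))) \<partial>lborel) \<partial>count_space UNIV)"
      by (intro nn_integral_cong nn_integral_cmult) measurable
    also have "\<dots> = ennreal K * (\<integral>\<^sup>+p. \<integral>\<^sup>+x. ennreal (?R x p * (?G x p * bracket (phase \<xi> q x p - \<tau>) powr (- ?b))) \<partial>lborel \<partial>count_space UNIV)"
      by (rule nn_integral_cmult) simp
    also have "\<dots> \<le> ennreal K * ennreal C"
      by (intro mult_left_mono C) auto
    finally show ?thesis using K C(1) by (simp add: ennreal_mult)
  qed
  then show ?thesis using K C(1) by (intro exI[of _ "K * C"]) auto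
qed

section \<open>The bilinear estimate in Fourier variables\<close>

lemma ennreal_sqrt_square: "0 \<le> x \<Longrightarrow> ennreal (sqrt x) ^ 2 = ennreal x"
  by (simp add: ennreal_power)

lemma square_add3_le: "((a::ennreal) + b + c)\<^sup>2 \<le> 3 * (a\<^sup>2 + b\<^sup>2 + c\<^sup>2)"
proof -
  have r: "((x::real) + y + z)\<^sup>2 \<le> 3 * (x\<^sup>2 + y\<^sup>2 + z\<^sup>2)" for x y z
    using zero_le_power2[of "x - y"] zero_le_power2[of "x - z"] zero_le_power2[of "y - z"]
    by (simp add: power2_eq_square algebra_simps)
  show ?thesis
  proof (cases "a = \<infinity> \<or> b = \<infinity> \<or> c = \<infinity>")
    case True
    then show ?thesis by (auto simp: ennreal_mult_eq_top_iff power_eq_top_ennreal)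
  next
    case False
    then obtain x y z where "a = ennreal x" "b = ennreal y" "c = ennreal z" "x \<ge> 0" "y \<ge> 0" "z \<ge> 0"
      by (metis ennreal_cases infinity_ennreal_def)
    moreover have "3 * ennreal t = ennreal (3 * t)" if "t \<ge> 0" for t :: real
      using ennreal_mult[of 3 t] that by simp
    ultimately show ?thesis using ennreal_leI[OF r[of x y z]]
      by (simp add: ennreal_power ennreal_plus[symmetric] del: ennreal_plus distrib_left_numeral)
  qed
qed

lemma Cauchy_Schwarz_nn_integral_freq:
  assumes [measurable]: "case_prod a \<in> borel_measurable (freq_measure \<Otimes>\<^sub>M freq_measure)"
    "case_prod b \<in> borel_measurable (freq_measure \<Otimes>\<^sub>M freq_measure)"
  shows "(\<integral>\<^sup>+z. \<integral>\<^sup>+w. a z w * b z w \<partial>freq_measure \<partial>freq_measure)\<^sup>2 \<le>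
    (\<integral>\<^sup>+z. \<integral>\<^sup>+w. (a z w)\<^sup>2 \<partial>freq_measure \<partial>freq_measure) *
    (\<integral>\<^sup>+z. \<integral>\<^sup>+w. (b z w)\<^sup>2 \<partial>freq_measure \<partial>freq_measure)"
  using Cauchy_Schwarz_nn_integral[OF assms]
    freq.nn_integral_fst[of "\<lambda>(z, w). a z w * b z w" freq_measure, symmetric]
    freq.nn_integral_fst[of "\<lambda>(z, w). (a z w)\<^sup>2" freq_measure, symmetric]
    freq.nn_integral_fst[of "\<lambda>(z, w). (b z w)\<^sup>2" freq_measure, symmetric]
  by (simp add: case_prod_beta')

text \<open>In Cauchy-Schwarz the kernel is grouped with the function of the fixed variable: with
  \<open>h\<close> on \<open>region0\<close>, with \<open>f\<close> on \<open>region1\<close>, and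
  with \<open>g\<close> on the mirror image of \<open>region1\<close>. The inner integral of the
  squared kernel is then bounded uniformly, and the other two functions decouple by translation
  invariance.\<close>

theorem bilinear_nn_integral:
  "\<exists>C\<ge>0. \<forall>f g h. f \<in> borel_measurable freq_measure \<longrightarrow> g \<in> borel_measurable freq_measure \<longrightarrow> h \<in> borel_measurable freq_measure \<longrightarrow>
    (\<integral>\<^sup>+z. \<integral>\<^sup>+w. h z * f w * g (z - w) * ennreal (sqrt (kernel_sq z w)) \<partial>freq_measure \<partial>freq_measure)\<^sup>2 \<le>
    ennreal C * (\<integral>\<^sup>+z. (h z)\<^sup>2 \<partial>freq_measure) * (\<integral>\<^sup>+z. (f z)\<^sup>2 \<partial>freq_measure) * (\<integral>\<^sup>+z. (g z)\<^sup>2 \<partial>freq_measure)"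
proof -
  obtain C0 where C0: "C0 \<ge> 0" "\<And>z. (\<integral>\<^sup>+w. ennreal (of_bool (region0 z w) * kernel_sq z w) \<partial>freq_measure) \<le> ennreal C0"
    using kernel_bound0 by blast
  obtain C1 where C1: "C1 \<ge> 0" "\<And>w. (\<integral>\<^sup>+z. ennreal (of_bool (region1 z w) * kernel_sq z w) \<partial>freq_measure) \<le> ennreal C1"
    using kernel_bound1 by blast
  have "(\<integral>\<^sup>+z. \<integral>\<^sup>+w. h z * f w * g (z - w) * ennreal (sqrt (kernel_sq z w)) \<partial>freq_measure \<partial>freq_measure)\<^sup>2 \<le>
    ennreal (3 * (C0 + C1 + C1)) * (\<integral>\<^sup>+z. (h z)\<^sup>2 \<partial>freq_measure) * (\<integral>\<^sup>+z. (f z)\<^sup>2 \<partial>freq_measure) * (\<integral>\<^sup>+z. (g z)\<^sup>2 \<partial>freq_measure)"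
    if [measurable]: "f \<in> borel_measurable freq_measure" "g \<in> borel_measurable freq_measure" "h \<in> borel_measurable freq_measure"
    for f g h
  proof -
    define F where "F = (\<integral>\<^sup>+z. (f z)\<^sup>2 \<partial>freq_measure)"
    define G where "G = (\<integral>\<^sup>+z. (g z)\<^sup>2 \<partial>freq_measure)"
    define H where "H = (\<integral>\<^sup>+z. (h z)\<^sup>2 \<partial>freq_measure)"
    let ?k = "\<lambda>z w. ennreal (sqrt (kernel_sq z w))"
    have k2: "(of_bool P * ?k z w)\<^sup>2 = ennreal (of_bool P * kernel_sq z w)" for P z w
      by (cases P) (auto simp: ennreal_sqrt_square)
    have sq: "(of_bool P * x * ?k z w)\<^sup>2 = x\<^sup>2 * ennreal (of_bool P * kernel_sq z w)" for P z w x
      using k2[of P z w] by (simp add: power_mult_distrib mult_ac)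
    let ?I = "\<lambda>R. \<integral>\<^sup>+z. \<integral>\<^sup>+w. of_bool (R z w) * (h z * f w * g (z - w) * ?k z w) \<partial>freq_measure \<partial>freq_measure"
    let ?J = "\<lambda>a b. (\<integral>\<^sup>+z. \<integral>\<^sup>+w. (a z w :: ennreal) * b z w \<partial>freq_measure \<partial>freq_measure)"
    let ?S = "\<lambda>a. (\<integral>\<^sup>+z. \<integral>\<^sup>+w. (a z w :: ennreal)\<^sup>2 \<partial>freq_measure \<partial>freq_measure)"
    have I0: "(?I region0)\<^sup>2 \<le> ennreal C0 * (H * F * G)"
    proof -
      have "?I region0 = ?J (\<lambda>z w. of_bool (region0 z w) * h z * ?k z w) (\<lambda>z w. f w * g (z - w))"
        by (intro nn_integral_cong) (simp add: mult_ac)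
      then have "(?I region0)\<^sup>2 \<le> ?S (\<lambda>z w. of_bool (region0 z w) * h z * ?k z w) * ?S (\<lambda>z w. f w * g (z - w))"
        using Cauchy_Schwarz_nn_integral_freq[of "\<lambda>z w. of_bool (region0 z w) * h z * ?k z w" "\<lambda>z w. f w * g (z - w)"]
        by simp
      also have "?S (\<lambda>z w. of_bool (region0 z w) * h z * ?k z w) \<le> ennreal C0 * H"
      proof -
        have "?S (\<lambda>z w. of_bool (region0 z w) * h z * ?k z w) =
          (\<integral>\<^sup>+z. (h z)\<^sup>2 * (\<integral>\<^sup>+w. ennreal (of_bool (region0 z w) * kernel_sq z w) \<partial>freq_measure) \<partial>freq_measure)"
          unfolding sq by (intro nn_integral_cong nn_integral_cmult) measurable
        also have "\<dots> \<le> (\<integral>\<^sup>+z. (h z)\<^sup>2 * ennreal C0 \<partial>freq_measure)"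
          by (intro nn_integral_mono mult_left_mono C0) auto
        also have "\<dots> = ennreal C0 * H" unfolding H_def
          by (subst nn_integral_cmult[symmetric]) (auto simp: mult.commute)
        finally show ?thesis .
      qed
      also have "?S (\<lambda>z w. f w * g (z - w)) = F * G"
      proof -
        have "?S (\<lambda>z w. f w * g (z - w)) = (\<integral>\<^sup>+w. \<integral>\<^sup>+z. (f w)\<^sup>2 * (g (z - w))\<^sup>2 \<partial>freq_measure \<partial>freq_measure)"
          unfolding power_mult_distrib by (rule freq_pair.Fubini'[symmetric]) measurable
        also have "\<dots> = (\<integral>\<^sup>+w. (f w)\<^sup>2 * (\<integral>\<^sup>+z. (g (z - w))\<^sup>2 \<partial>freq_measure) \<partial>freq_measure)"
          by (intro nn_integral_cong nn_integral_cmult) measurable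
        also have "\<dots> = (\<integral>\<^sup>+w. (f w)\<^sup>2 * G \<partial>freq_measure)"
          unfolding G_def by (subst nn_integral_freq_shift[where f="\<lambda>z. (g z)\<^sup>2"]) auto
        also have "\<dots> = F * G" unfolding F_def by (rule nn_integral_multc) measurable
        finally show ?thesis .
      qed
      finally show ?thesis by (simp add: mult_right_mono mult_ac)
    qed
    have I1: "(?I region1)\<^sup>2 \<le> ennreal C1 * (H * F * G)"
    proof -
      have "?I region1 = ?J (\<lambda>z w. of_bool (region1 z w) * f w * ?k z w) (\<lambda>z w. h z * g (z - w))"
        by (intro nn_integral_cong) (simp add: mult_ac)
      then have "(?I region1)\<^sup>2 \<le> ?S (\<lambda>z w. of_bool (region1 z w) * f w * ?k z w) * ?S (\<lambda>z w. h z * g (z - w))"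
        using Cauchy_Schwarz_nn_integral_freq[of "\<lambda>z w. of_bool (region1 z w) * f w * ?k z w" "\<lambda>z w. h z * g (z - w)"]
        by simp
      also have "?S (\<lambda>z w. of_bool (region1 z w) * f w * ?k z w) \<le> ennreal C1 * F"
      proof -
        have "?S (\<lambda>z w. of_bool (region1 z w) * f w * ?k z w) =
          (\<integral>\<^sup>+w. \<integral>\<^sup>+z. (f w)\<^sup>2 * ennreal (of_bool (region1 z w) * kernel_sq z w) \<partial>freq_measure \<partial>freq_measure)"
          unfolding sq by (rule freq_pair.Fubini'[symmetric]) measurable
        also have "\<dots> = (\<integral>\<^sup>+w. (f w)\<^sup>2 * (\<integral>\<^sup>+z. ennreal (of_bool (region1 z w) * kernel_sq z w) \<partial>freq_measure) \<partial>freq_measure)"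
          by (intro nn_integral_cong nn_integral_cmult) measurable
        also have "\<dots> \<le> (\<integral>\<^sup>+w. (f w)\<^sup>2 * ennreal C1 \<partial>freq_measure)"
          by (intro nn_integral_mono mult_left_mono C1) auto
        also have "\<dots> = ennreal C1 * F" unfolding F_def
          by (subst nn_integral_cmult[symmetric]) (auto simp: mult.commute)
        finally show ?thesis .
      qed
      also have "?S (\<lambda>z w. h z * g (z - w)) = H * G"
      proof -
        have "?S (\<lambda>z w. h z * g (z - w)) = (\<integral>\<^sup>+z. (h z)\<^sup>2 * (\<integral>\<^sup>+w. (g (z - w))\<^sup>2 \<partial>freq_measure) \<partial>freq_measure)"
          unfolding power_mult_distrib by (intro nn_integral_cong nn_integral_cmult) measurable
        also have "\<dots> = (\<integral>\<^sup>+z. (h z)\<^sup>2 * G \<partial>freq_measure)"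
          unfolding G_def by (subst nn_integral_freq_reflect[where f="\<lambda>z. (g z)\<^sup>2"]) auto
        also have "\<dots> = H * G" unfolding H_def by (rule nn_integral_multc) measurable
        finally show ?thesis .
      qed
      finally show ?thesis by (simp add: mult_right_mono mult_ac)
    qed
    have I2: "(?I (\<lambda>z w. region1 z (z - w)))\<^sup>2 \<le> ennreal C1 * (H * F * G)"
    proof -
      have "?I (\<lambda>z w. region1 z (z - w)) = ?J (\<lambda>z w. of_bool (region1 z (z - w)) * g (z - w) * ?k z w) (\<lambda>z w. h z * f w)"
        by (intro nn_integral_cong) (simp add: mult_ac)
      then have "(?I (\<lambda>z w. region1 z (z - w)))\<^sup>2 \<le> ?S (\<lambda>z w. of_bool (region1 z (z - w)) * g (z - w) * ?k z w) * ?S (\<lambda>z w. h z * f w)"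
        using Cauchy_Schwarz_nn_integral_freq[of "\<lambda>z w. of_bool (region1 z (z - w)) * g (z - w) * ?k z w" "\<lambda>z w. h z * f w"]
        by simp
      also have "?S (\<lambda>z w. of_bool (region1 z (z - w)) * g (z - w) * ?k z w) \<le> ennreal C1 * G"
      proof -
        \<comment> \<open>Reflecting \<open>w\<close> to \<open>z - w\<close> reduces this integral
          to the one already met for \<open>region1\<close>, with \<open>g\<close> in place of
          \<open>f\<close>.\<close>
        let ?P = "\<lambda>z w. (g w)\<^sup>2 * ennreal (of_bool (region1 z w) * kernel_sq z w)"
        have "?S (\<lambda>z w. of_bool (region1 z (z - w)) * g (z - w) * ?k z w) = (\<integral>\<^sup>+z. \<integral>\<^sup>+w. ?P z (z - w) \<partial>freq_measure \<partial>freq_measure)"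
          unfolding sq by (simp add: kernel_sq_commute)
        also have "\<dots> = (\<integral>\<^sup>+z. \<integral>\<^sup>+w. ?P z w \<partial>freq_measure \<partial>freq_measure)"
          by (intro nn_integral_cong nn_integral_freq_reflect[where f="?P _"]) measurable
        also have "\<dots> = (\<integral>\<^sup>+w. \<integral>\<^sup>+z. ?P z w \<partial>freq_measure \<partial>freq_measure)"
          by (rule freq_pair.Fubini'[symmetric]) measurable
        also have "\<dots> = (\<integral>\<^sup>+w. (g w)\<^sup>2 * (\<integral>\<^sup>+z. ennreal (of_bool (region1 z w) * kernel_sq z w) \<partial>freq_measure) \<partial>freq_measure)"
          by (intro nn_integral_cong nn_integral_cmult) measurable
        also have "\<dots> \<le> (\<integral>\<^sup>+w. (g w)\<^sup>2 * ennreal C1 \<partial>freq_measure)"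
          by (intro nn_integral_mono mult_left_mono C1) auto
        also have "\<dots> = ennreal C1 * G" unfolding G_def
          by (subst nn_integral_cmult[symmetric]) (auto simp: mult.commute)
        finally show ?thesis .
      qed
      also have "?S (\<lambda>z w. h z * f w) = H * F"
      proof -
        have "?S (\<lambda>z w. h z * f w) = (\<integral>\<^sup>+z. (h z)\<^sup>2 * F \<partial>freq_measure)"
          unfolding power_mult_distrib F_def by (intro nn_integral_cong nn_integral_cmult) measurable
        also have "\<dots> = H * F" unfolding H_def by (rule nn_integral_multc) measurable
        finally show ?thesis .
      qed
      finally show ?thesis by (simp add: mult_right_mono mult_ac)
    qed
    have "(\<integral>\<^sup>+z. \<integral>\<^sup>+w. h z * f w * g (z - w) * ?k z w \<partial>freq_measure \<partial>freq_measure) \<le>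
      (\<integral>\<^sup>+z. \<integral>\<^sup>+w. of_bool (region0 z w) * (h z * f w * g (z - w) * ?k z w) +
         of_bool (region1 z w) * (h z * f w * g (z - w) * ?k z w) +
         of_bool (region1 z (z - w)) * (h z * f w * g (z - w) * ?k z w) \<partial>freq_measure \<partial>freq_measure)"
    proof (intro nn_integral_mono)
      fix z w :: freq
      show "h z * f w * g (z - w) * ?k z w \<le> of_bool (region0 z w) * (h z * f w * g (z - w) * ?k z w) +
         of_bool (region1 z w) * (h z * f w * g (z - w) * ?k z w) +
         of_bool (region1 z (z - w)) * (h z * f w * g (z - w) * ?k z w)"
        using regions_cover[of z w] by (auto simp: add_increasing add_increasing2)
    qed
    also have "\<dots> = ?I region0 + ?I region1 + ?I (\<lambda>z w. region1 z (z - w))"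
      by (simp add: nn_integral_add)
    finally have "(\<integral>\<^sup>+z. \<integral>\<^sup>+w. h z * f w * g (z - w) * ?k z w \<partial>freq_measure \<partial>freq_measure)\<^sup>2 \<le>
      (?I region0 + ?I region1 + ?I (\<lambda>z w. region1 z (z - w)))\<^sup>2" by (intro power_mono) auto
    also have "\<dots> \<le> 3 * ((?I region0)\<^sup>2 + (?I region1)\<^sup>2 + (?I (\<lambda>z w. region1 z (z - w)))\<^sup>2)"
      by (rule square_add3_le)
    also have "\<dots> \<le> 3 * (ennreal C0 * (H * F * G) + ennreal C1 * (H * F * G) + ennreal C1 * (H * F * G))"
      by (intro mult_left_mono add_mono I0 I1 I2) auto
    also have "\<dots> = ennreal (3 * (C0 + C1 + C1)) * H * F * G"
    proof -
      have "ennreal (3 * (C0 + C1 + C1)) = 3 * (ennreal C0 + ennreal C1 + ennreal C1)"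
        using C0(1) C1(1)
        by (subst ennreal_mult, simp, simp, subst ennreal_plus, simp, simp, subst ennreal_plus) simp_all
      then show ?thesis by (simp add: distrib_left distrib_right mult_ac)
    qed
    finally show ?thesis unfolding F_def G_def H_def .
  qed
  then show ?thesis using C0(1) C1(1) by (intro exI[of _ "3 * (C0 + C1 + C1)"]) auto
qed

section \<open>Schwartz-type functions\<close>

lemma Basis_point: "(Basis :: point set) = {(1, 0, 0), (0, 1, 0), (0, 0, 1)}"
  by (auto simp: Basis_prod_def zero_prod_def)

lemma dir_deriv_eqI: "(f has_derivative f') (at z) \<Longrightarrow> dir_deriv e f z = f' e"
  by (simp add: dir_deriv_def frechet_derivative_at[symmetric])

lemma has_derivative_frechet: "f differentiable (at z) \<Longrightarrow> (f has_derivative frechet_derivative f (at z)) (at z)"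
  by (simp add: frechet_derivative_works)

lemma dir_deriv_add:
  assumes "\<And>z. f differentiable (at z)" "\<And>z. g differentiable (at z)"
  shows "dir_deriv e (\<lambda>z. f z + g z) = (\<lambda>z. dir_deriv e f z + dir_deriv e g z)"
  by (rule ext, subst dir_deriv_eqI[OF has_derivative_add[OF has_derivative_frechet[OF assms(1)] has_derivative_frechet[OF assms(2)]]])
     (simp add: dir_deriv_def)

lemma dir_deriv_diff:
  assumes "\<And>z. f differentiable (at z)" "\<And>z. g differentiable (at z)"
  shows "dir_deriv e (\<lambda>z. f z - g z) = (\<lambda>z. dir_deriv e f z - dir_deriv e g z)"
  by (rule ext, subst dir_deriv_eqI[OF has_derivative_diff[OF has_derivative_frechet[OF assms(1)] has_derivative_frechet[OF assms(2)]]])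
     (simp add: dir_deriv_def)

lemma dir_deriv_mult:
  assumes "\<And>z. f differentiable (at z)" "\<And>z. g differentiable (at z)"
  shows "dir_deriv e (\<lambda>z. f z * g z) = (\<lambda>z. f z * dir_deriv e g z + dir_deriv e f z * g z)"
  by (rule ext, subst dir_deriv_eqI[OF has_derivative_mult[OF has_derivative_frechet[OF assms(1)] has_derivative_frechet[OF assms(2)]]])
     (simp add: dir_deriv_def)

lemma dir_deriv_const: "dir_deriv e (\<lambda>z. c) = (\<lambda>z. 0)"
  by (rule ext) (rule dir_deriv_eqI[OF has_derivative_const])

definition weight :: "point \<Rightarrow> real" where
  "weight z = 1 + \<bar>fst z\<bar> + \<bar>snd (snd z)\<bar>"

lemma weight_ge_1: "1 \<le> weight z"
  by (simp add: weight_def)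

lemma schwartz_alt: "schwartz f \<longleftrightarrow> y_periodic f \<and>
     (\<forall>es. set es \<subseteq> Basis \<longrightarrow> (\<forall>z. foldr dir_deriv es f differentiable (at z)) \<and>
        (\<forall>k. \<exists>M. \<forall>z. weight z ^ k * cmod (foldr dir_deriv es f z) \<le> M))"
  by (auto simp: schwartz_def weight_def)

text \<open>Multipliers of the Schwartz-type functions. Characters and the functions used for
  separation belong here although they do not decay.\<close>

definition bounded_smooth :: "(point \<Rightarrow> complex) \<Rightarrow> bool" where
  "bounded_smooth f \<longleftrightarrow> y_periodic f \<and>
     (\<forall>es. set es \<subseteq> Basis \<longrightarrow> (\<forall>z. foldr dir_deriv es f differentiable (at z)) \<and>
        (\<exists>M. \<forall>z. cmod (foldr dir_deriv es f z) \<le> M))"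

lemma foldr_dir_deriv_closed:
  assumes "f \<in> S" "\<And>f e. f \<in> S \<Longrightarrow> e \<in> Basis \<Longrightarrow> dir_deriv e f \<in> S" "set es \<subseteq> Basis"
  shows "foldr dir_deriv es f \<in> S"
  using assms(3) by (induction es) (auto intro: assms(1,2))

text \<open>Saves formulas for iterated derivatives: it is enough to place \<open>f\<close> in a
  class that is closed under coordinate derivatives and whose members satisfy the bounds.\<close>

lemma schwartz_coinduct:
  assumes "f \<in> S" and d: "\<And>f e. f \<in> S \<Longrightarrow> e \<in> Basis \<Longrightarrow> dir_deriv e f \<in> S"
    and "\<And>f. f \<in> S \<Longrightarrow> y_periodic f" "\<And>f z. f \<in> S \<Longrightarrow> f differentiable (at z)"
    and "\<And>f k. f \<in> S \<Longrightarrow> \<exists>M. \<forall>z. weight z ^ k * cmod (f z) \<le> M"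
  shows "schwartz f"
proof -
  have "foldr dir_deriv es f \<in> S" if "set es \<subseteq> Basis" for es
    using foldr_dir_deriv_closed[of f S es] assms(1) d that by blast
  then show ?thesis unfolding schwartz_alt using assms by blast
qed

lemma bounded_smooth_coinduct:
  assumes "f \<in> S" and d: "\<And>f e. f \<in> S \<Longrightarrow> e \<in> Basis \<Longrightarrow> dir_deriv e f \<in> S"
    and "\<And>f. f \<in> S \<Longrightarrow> y_periodic f" "\<And>f z. f \<in> S \<Longrightarrow> f differentiable (at z)"
    and "\<And>f. f \<in> S \<Longrightarrow> \<exists>M. \<forall>z. cmod (f z) \<le> M"
  shows "bounded_smooth f"
proof -
  have "foldr dir_deriv es f \<in> S" if "set es \<subseteq> Basis" for es
    using foldr_dir_deriv_closed[of f S es] assms(1) d that by blast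
  then show ?thesis unfolding bounded_smooth_def using assms by blast
qed

lemma schwartzD:
  assumes "schwartz f"
  shows "y_periodic f" "f differentiable (at z)" "\<exists>M. \<forall>z. weight z ^ k * cmod (f z) \<le> M"
proof -
  from assms show "y_periodic f" by (simp add: schwartz_alt)
  from assms have "set [] \<subseteq> (Basis :: point set) \<longrightarrow> (\<forall>z. foldr dir_deriv [] f differentiable (at z)) \<and>
        (\<forall>k. \<exists>M. \<forall>z. weight z ^ k * cmod (foldr dir_deriv [] f z) \<le> M)"
    unfolding schwartz_alt by blast
  then have *: "(\<forall>z. f differentiable (at z)) \<and> (\<forall>k. \<exists>M. \<forall>z. weight z ^ k * cmod (f z) \<le> M)"
    by (simp only: foldr.simps list.set empty_subsetI simp_thms id_apply)
  show "f differentiable (at z)" using * by blast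
  show "\<exists>M. \<forall>z. weight z ^ k * cmod (f z) \<le> M" using * by blast
qed

lemma bounded_smoothD:
  assumes "bounded_smooth f"
  shows "y_periodic f" "f differentiable (at z)" "\<exists>M. \<forall>z. cmod (f z) \<le> M"
proof -
  from assms show "y_periodic f" by (simp add: bounded_smooth_def)
  from assms have "set [] \<subseteq> (Basis :: point set) \<longrightarrow> (\<forall>z. foldr dir_deriv [] f differentiable (at z)) \<and>
        (\<exists>M. \<forall>z. cmod (foldr dir_deriv [] f z) \<le> M)"
    unfolding bounded_smooth_def by blast
  then have *: "(\<forall>z. f differentiable (at z)) \<and> (\<exists>M. \<forall>z. cmod (f z) \<le> M)"
    by (simp only: foldr.simps list.set empty_subsetI simp_thms id_apply)
  show "f differentiable (at z)" using * by blast
  show "\<exists>M. \<forall>z. cmod (f z) \<le> M" using * by blast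
qed

lemma y_periodic_dir_deriv:
  assumes "y_periodic f" "\<And>z. f differentiable (at z)"
  shows "y_periodic (dir_deriv e f)"
  unfolding y_periodic_def
proof (intro allI)
  fix x y t
  have "(\<lambda>z. f (z + (0, 2 * pi, 0))) = f"
    using assms(1) by (auto simp: y_periodic_def fun_eq_iff)
  moreover have "((\<lambda>z. f (z + (0, 2 * pi, 0))) has_derivative frechet_derivative f (at (x, y + 2 * pi, t))) (at (x, y, t))"
  proof -
    have 1: "((\<lambda>z. z + (0, 2 * pi, 0)) has_derivative (\<lambda>h. h)) (at (x, y, t))"
      by (auto intro!: derivative_eq_intros)
    have "(f has_derivative frechet_derivative f (at (x, y + 2 * pi, t))) (at ((x, y, t) + (0, 2 * pi, 0)))"
      using has_derivative_frechet[OF assms(2)[of "(x, y + 2 * pi, t)"]] by simp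
    from has_derivative_compose[OF 1 this] show ?thesis .
  qed
  ultimately have "(f has_derivative frechet_derivative f (at (x, y + 2 * pi, t))) (at (x, y, t))" by simp
  then show "dir_deriv e f (x, y + 2 * pi, t) = dir_deriv e f (x, y, t)"
    by (simp add: dir_deriv_eqI) (simp add: dir_deriv_def)
qed

lemma schwartz_dir_deriv:
  assumes "schwartz f" "e \<in> Basis"
  shows "schwartz (dir_deriv e f)"
proof -
  have "foldr dir_deriv es (dir_deriv e f) = foldr dir_deriv (es @ [e]) f" for es by simp
  moreover have "set (es @ [e]) \<subseteq> Basis \<longleftrightarrow> set es \<subseteq> Basis" for es using assms by auto
  moreover have "y_periodic (dir_deriv e f)"
    using schwartzD[OF assms(1)] by (intro y_periodic_dir_deriv) auto
  ultimately show ?thesis using assms(1) unfolding schwartz_alt by metis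
qed

lemma bounded_smooth_dir_deriv:
  assumes "bounded_smooth f" "e \<in> Basis"
  shows "bounded_smooth (dir_deriv e f)"
proof -
  have "foldr dir_deriv es (dir_deriv e f) = foldr dir_deriv (es @ [e]) f" for es by simp
  moreover have "set (es @ [e]) \<subseteq> Basis \<longleftrightarrow> set es \<subseteq> Basis" for es using assms by auto
  moreover have "y_periodic (dir_deriv e f)"
    using bounded_smoothD[OF assms(1)] by (intro y_periodic_dir_deriv) auto
  ultimately show ?thesis using assms(1) unfolding bounded_smooth_def by metis
qed

lemma schwartz_bounded_smooth:
  assumes "schwartz f" shows "bounded_smooth f"
proof (rule bounded_smooth_coinduct[of f "Collect schwartz"])
  fix g assume "g \<in> Collect schwartz"
  then show "\<exists>M. \<forall>z. cmod (g z) \<le> M" using schwartzD(3)[of g 0] by simp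
qed (use assms in \<open>auto intro: schwartz_dir_deriv schwartzD\<close>)

lemma schwartz_diff:
  assumes "schwartz f" "schwartz g"
  shows "schwartz (\<lambda>z. f z - g z)"
proof (rule schwartz_coinduct[of _ "{\<lambda>z. f z - g z | f g. schwartz f \<and> schwartz g}"])
  show "(\<lambda>z. f z - g z) \<in> {\<lambda>z. f z - g z | f g. schwartz f \<and> schwartz g}" using assms by blast
next
  fix h e assume "h \<in> {\<lambda>z. f z - g z | f g. schwartz f \<and> schwartz g}" and e: "e \<in> (Basis :: point set)"
  then obtain f g where h: "h = (\<lambda>z. f z - g z)" "schwartz f" "schwartz g" by blast
  then have "dir_deriv e h = (\<lambda>z. dir_deriv e f z - dir_deriv e g z)"
    using schwartzD(2) by (simp add: dir_deriv_diff)
  then show "dir_deriv e h \<in> {\<lambda>z. f z - g z | f g. schwartz f \<and> schwartz g}"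
    using h schwartz_dir_deriv[OF _ e] by blast
next
  fix h assume "h \<in> {\<lambda>z. f z - g z | f g. schwartz f \<and> schwartz g}"
  then obtain f g where h: "h = (\<lambda>z. f z - g z)" "schwartz f" "schwartz g" by blast
  show "y_periodic h" using schwartzD(1)[OF h(2)] schwartzD(1)[OF h(3)] by (simp add: h y_periodic_def)
  show "h differentiable (at z)" for z
    using schwartzD(2)[OF h(2)] schwartzD(2)[OF h(3)] unfolding h by (rule differentiable_diff)
  show "\<exists>M. \<forall>z. weight z ^ k * cmod (h z) \<le> M" for k
  proof -
    obtain M N where "\<And>z. weight z ^ k * cmod (f z) \<le> M" "\<And>z. weight z ^ k * cmod (g z) \<le> N"
      using schwartzD(3)[OF h(2)] schwartzD(3)[OF h(3)] by metis
    moreover have "weight z ^ k * cmod (f z - g z) \<le> weight z ^ k * cmod (f z) + weight z ^ k * cmod (g z)" for z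
      using weight_ge_1[of z] norm_triangle_ineq4[of "f z" "g z"]
      by (simp add: distrib_left[symmetric] mult_left_mono)
    ultimately have "weight z ^ k * cmod (f z - g z) \<le> M + N" for z
      by (meson add_mono order_trans)
    then show ?thesis unfolding h by blast
  qed
qed

text \<open>By the Leibniz rule the derivative of a product is a sum of products. The span is
  therefore closed under derivatives, which the set of products is not, and it fits the coinduction
  rules.\<close>

inductive_set product_span :: "((point \<Rightarrow> complex) \<Rightarrow> bool) \<Rightarrow> (point \<Rightarrow> complex) set" for P where
  product: "P f \<Longrightarrow> bounded_smooth g \<Longrightarrow> (\<lambda>z. f z * g z) \<in> product_span P"
| add: "h \<in> product_span P \<Longrightarrow> h' \<in> product_span P \<Longrightarrow> (\<lambda>z. h z + h' z) \<in> product_span P"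

lemma product_span_smooth:
  assumes "h \<in> product_span P" and P: "\<And>f. P f \<Longrightarrow> bounded_smooth f" "\<And>f e. P f \<Longrightarrow> e \<in> Basis \<Longrightarrow> P (dir_deriv e f)"
  shows "y_periodic h \<and> (\<forall>z. h differentiable (at z)) \<and> (\<forall>e\<in>Basis. dir_deriv e h \<in> product_span P)"
  using assms(1)
proof induction
  case (product f g)
  have d: "\<And>z. f differentiable (at z)" "\<And>z. g differentiable (at z)" "y_periodic f" "y_periodic g"
    using bounded_smoothD[OF P(1)[OF product(1)]] bounded_smoothD[OF product(2)] by auto
  show ?case
  proof (intro conjI allI ballI)
    fix e :: point assume e: "e \<in> Basis"
    show "dir_deriv e (\<lambda>z. f z * g z) \<in> product_span P"
      unfolding dir_deriv_mult[OF d(1,2)]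
      by (intro product_span.intros product P e bounded_smooth_dir_deriv)
  qed (use d in \<open>auto simp: y_periodic_def\<close>)
next
  case (add h h')
  then have "dir_deriv e (\<lambda>z. h z + h' z) = (\<lambda>z. dir_deriv e h z + dir_deriv e h' z)" for e
    by (intro dir_deriv_add) auto
  with add show ?case by (auto simp: y_periodic_def intro!: product_span.add)
qed

lemma schwartz_mult:
  assumes "schwartz f" "bounded_smooth g"
  shows "schwartz (\<lambda>z. f z * g z)"
proof (rule schwartz_coinduct[of _ "product_span schwartz"])
  note sm = product_span_smooth[of _ schwartz, OF _ schwartz_bounded_smooth schwartz_dir_deriv]
  fix h :: "point \<Rightarrow> complex" assume h: "h \<in> product_span schwartz"
  show "y_periodic h" using sm[OF h] by blast
  show "h differentiable (at z)" for z using sm[OF h] by blast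
  show "dir_deriv e h \<in> product_span schwartz" if "e \<in> Basis" for e using sm[OF h] that by auto
  show "\<exists>M. \<forall>z. weight z ^ k * cmod (h z) \<le> M" for k
    using h
  proof induction
    case (product f g)
    obtain M N where M: "\<And>z. weight z ^ k * cmod (f z) \<le> M" and N: "\<And>z. cmod (g z) \<le> N"
      using schwartzD(3)[OF product(1)] bounded_smoothD(3)[OF product(2)] by metis
    have "weight z ^ k * cmod (f z * g z) \<le> M * N" for z
    proof -
      have "0 \<le> weight z ^ k * cmod (f z)" using weight_ge_1[of z] by simp
      then show ?thesis using mult_mono[OF M[of z] N[of z]] order_trans[OF _ M[of z]]
        by (simp add: norm_mult mult.assoc)
    qed
    then show ?case by blast
  next
    case (add h h')
    then obtain M N where "\<And>z. weight z ^ k * cmod (h z) \<le> M" "\<And>z. weight z ^ k * cmod (h' z) \<le> N" by metis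
    moreover have "weight z ^ k * cmod (h z + h' z) \<le> weight z ^ k * cmod (h z) + weight z ^ k * cmod (h' z)" for z
      using weight_ge_1[of z] norm_triangle_ineq[of "h z" "h' z"]
      by (simp add: distrib_left[symmetric] mult_left_mono)
    ultimately have "weight z ^ k * cmod (h z + h' z) \<le> M + N" for z
      by (meson add_mono order_trans)
    then show ?case by blast
  qed
qed (use assms product_span.product in auto)

definition character :: "real \<Rightarrow> int \<Rightarrow> real \<Rightarrow> point \<Rightarrow> complex" where
  "character \<xi> q \<tau> z = exp (\<i> * complex_of_real (\<xi> * fst z + real_of_int q * fst (snd z) + \<tau> * snd (snd z)))"

lemma norm_character [simp]: "cmod (character \<xi> q \<tau> z) = 1"
  by (simp add: character_def)

lemma character_has_derivative:
  "(character \<xi> q \<tau> has_derivative (\<lambda>h. \<i> * complex_of_real (\<xi> * fst h + real_of_int q * fst (snd h) + \<tau> * snd (snd h)) * character \<xi> q \<tau> z)) (at z)"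
proof -
  let ?L = "\<lambda>z :: point. \<i> * complex_of_real (\<xi> * fst z + real_of_int q * fst (snd z) + \<tau> * snd (snd z))"
  have "bounded_linear (\<lambda>z :: point. \<xi> * fst z + real_of_int q * fst (snd z) + \<tau> * snd (snd z))"
    by (intro bounded_linear_intros)
  then have "bounded_linear ?L"
    by (intro bounded_linear_const_mult bounded_linear_compose[OF bounded_linear_of_real])
  then have "(?L has_derivative ?L) (at z)" by (rule bounded_linear_imp_has_derivative)
  from has_derivative_compose[OF this DERIV_exp[THEN has_field_derivative_imp_has_derivative]]
  show ?thesis by (simp add: character_def[abs_def] mult.commute)
qed

lemma dir_deriv_character:
  "dir_deriv e (character \<xi> q \<tau>) = (\<lambda>z. \<i> * complex_of_real (\<xi> * fst e + real_of_int q * fst (snd e) + \<tau> * snd (snd e)) * character \<xi> q \<tau> z)"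
  by (rule ext) (rule dir_deriv_eqI[OF character_has_derivative])

lemma y_periodic_character: "y_periodic (character \<xi> q \<tau>)"
proof -
  have "exp (\<i> * complex_of_real (a + real_of_int q * (2 * pi))) = exp (\<i> * complex_of_real a)" for a
    using exp_integer_2pi[of "of_int q"] by (simp add: distrib_left exp_add mult_ac)
  moreover have "\<xi> * x + real_of_int q * (y + 2 * pi) + \<tau> * t = (\<xi> * x + real_of_int q * y + \<tau> * t) + real_of_int q * (2 * pi)" for x y t
    by (simp add: algebra_simps)
  ultimately show ?thesis unfolding y_periodic_def character_def fst_conv snd_conv by metis
qed

lemma bounded_smooth_character: "bounded_smooth (character \<xi> q \<tau>)"
proof (rule bounded_smooth_coinduct[of _ "range (\<lambda>c z. c * character \<xi> q \<tau> z)"])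
  have diff: "character \<xi> q \<tau> differentiable (at z)" for z
    using character_has_derivative by (rule differentiableI)
  show "character \<xi> q \<tau> \<in> range (\<lambda>c z. c * character \<xi> q \<tau> z)" by (rule range_eqI[of _ _ 1]) simp
  fix f assume "f \<in> range (\<lambda>c z. c * character \<xi> q \<tau> z)"
  then obtain c where f: "f = (\<lambda>z. c * character \<xi> q \<tau> z)" by blast
  show "dir_deriv e f \<in> range (\<lambda>c z. c * character \<xi> q \<tau> z)" for e
  proof -
    have "dir_deriv e f = (\<lambda>z. c * (\<i> * complex_of_real (\<xi> * fst e + real_of_int q * fst (snd e) + \<tau> * snd (snd e))) * character \<xi> q \<tau> z)"
      unfolding f by (subst dir_deriv_mult) (auto simp: diff dir_deriv_const dir_deriv_character)
    then show ?thesis by blast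
  qed
  show "y_periodic f" using y_periodic_character by (simp add: f y_periodic_def)
  show "f differentiable (at z)" for z unfolding f by (intro derivative_intros diff)
  show "\<exists>M. \<forall>z. cmod (f z) \<le> M" by (auto simp: f norm_mult)
qed

lemma exp_fourier: "exp (- \<i> * complex_of_real (\<xi> * fst z + real_of_int q * fst (snd z) + \<tau> * snd (snd z))) = character (- \<xi>) (- q) (- \<tau>) z"
  unfolding character_def by (rule arg_cong[of _ _ exp]) (simp add: algebra_simps)

lemma fourier_eq: "fourier f (\<xi>, q, \<tau>) = (LINT z:period_cell|lborel. f z * character (- \<xi>) (- q) (- \<tau>) z)"
  unfolding fourier_def by (simp only: prod.case exp_fourier)

section \<open>Fourier transform of Schwartz-type functions\<close>

lemma period_cell_sets [measurable]: "period_cell \<in> sets borel"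
proof -
  have "closed period_cell" unfolding period_cell_def by (intro closed_Times) auto
  then show ?thesis by simp
qed

lemma mem_period_cell: "(x, y, t) \<in> period_cell \<longleftrightarrow> 0 \<le> y \<and> y \<le> 2 * pi"
  by (auto simp: period_cell_def)

lemma lborel_point: "(lborel :: point measure) = lborel \<Otimes>\<^sub>M lborel"
  by (simp add: lborel_prod)

lemma nn_integral_point:
  assumes [measurable]: "f \<in> borel_measurable (borel :: point measure)"
  shows "(\<integral>\<^sup>+z. f z \<partial>lborel) = (\<integral>\<^sup>+x. \<integral>\<^sup>+y. \<integral>\<^sup>+t. f (x, y, t) \<partial>lborel \<partial>lborel \<partial>lborel)"
proof -
  have [measurable]: "f \<in> borel_measurable (borel \<Otimes>\<^sub>M (borel \<Otimes>\<^sub>M borel))"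
    by (simp add: borel_prod)
  have "(\<integral>\<^sup>+z. f z \<partial>lborel) = (\<integral>\<^sup>+x. \<integral>\<^sup>+y. f (x, y) \<partial>lborel \<partial>lborel)"
    unfolding lborel_point
    by (rule lborel.nn_integral_fst[symmetric]) (simp add: borel_prod lborel_prod)
  also have "\<dots> = (\<integral>\<^sup>+x. \<integral>\<^sup>+y. \<integral>\<^sup>+t. f (x, y, t) \<partial>lborel \<partial>lborel \<partial>lborel)"
  proof (rule nn_integral_cong)
    fix x
    show "(\<integral>\<^sup>+y. f (x, y) \<partial>lborel) = (\<integral>\<^sup>+y. \<integral>\<^sup>+t. f (x, y, t) \<partial>lborel \<partial>lborel)"
      by (subst lborel_prod[symmetric], rule lborel.nn_integral_fst[symmetric]) measurable
  qed
  finally show ?thesis .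
qed

text \<open>An integrable majorant on the period cell. The cell is bounded in \<open>y\<close>, so
  decay in \<open>x\<close> and \<open>t\<close> suffices.\<close>

definition decay :: "point \<Rightarrow> real" where
  "decay z = bracket (fst z) powr (- 2) * bracket (snd (snd z)) powr (- 2)"

lemma decay_pos: "0 < decay z"
  by (simp add: decay_def)

lemma decay_measurable [measurable]: "decay \<in> borel_measurable borel"
proof -
  have "decay \<in> borel_measurable (borel \<Otimes>\<^sub>M (borel \<Otimes>\<^sub>M borel))"
    unfolding decay_def[abs_def] by measurable
  then show ?thesis by (simp add: borel_prod)
qed

lemma decay_integrable: "set_integrable lborel period_cell decay"
  unfolding set_integrable_def
proof (rule integrableI_bounded)
  show "(\<lambda>z. indicator period_cell z *\<^sub>R decay z) \<in> borel_measurable lborel" by measurable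
  let ?a = "\<lambda>x. ennreal (bracket x powr (- 2))"
  have "(\<integral>\<^sup>+z. ennreal (norm (indicator period_cell z *\<^sub>R decay z)) \<partial>lborel) =
     (\<integral>\<^sup>+x. \<integral>\<^sup>+y. \<integral>\<^sup>+t. (?a x * indicator {0..2 * pi} y) * ?a t \<partial>lborel \<partial>lborel \<partial>lborel)"
    by (subst nn_integral_point, measurable)
       (auto intro!: nn_integral_cong simp: decay_def indicator_def mem_period_cell ennreal_mult)
  also have "\<dots> = (\<integral>\<^sup>+x. \<integral>\<^sup>+y. (?a x * indicator {0..2 * pi} y) * (\<integral>\<^sup>+t. ?a t \<partial>lborel) \<partial>lborel \<partial>lborel)"
    by (intro nn_integral_cong nn_integral_cmult) auto
  also have "\<dots> = (\<integral>\<^sup>+x. ?a x * (\<integral>\<^sup>+y. indicator {0..2 * pi} y \<partial>lborel) * (\<integral>\<^sup>+t. ?a t \<partial>lborel) \<partial>lborel)"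
    by (intro nn_integral_cong) (simp add: nn_integral_multc nn_integral_cmult)
  also have "\<dots> = (\<integral>\<^sup>+x. ?a x \<partial>lborel) * (\<integral>\<^sup>+y. indicator {0..2 * pi} y \<partial>lborel) * (\<integral>\<^sup>+t. ?a t \<partial>lborel)"
    by (subst nn_integral_multc[symmetric], simp, subst nn_integral_multc[symmetric]) simp_all
  also have "\<dots> \<le> ennreal (bracket_int 2) * ennreal (2 * pi) * ennreal (bracket_int 2)"
    using nn_integral_bracket_powr[of 2] by (intro mult_mono) auto
  also have "\<dots> < \<infinity>" by (simp add: ennreal_mult_less_top)
  finally show "(\<integral>\<^sup>+z. ennreal (norm (indicator period_cell z *\<^sub>R decay z)) \<partial>lborel) < \<infinity>" .
qed

lemma weight_decay: "1 \<le> weight z ^ 4 * decay z"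
proof -
  have "bracket (fst z) ^ 2 * bracket (snd (snd z)) ^ 2 \<le> weight z ^ 2 * weight z ^ 2"
    by (intro mult_mono power_mono) (auto simp: weight_def bracket_def)
  also have "\<dots> = weight z ^ 4" by (simp add: power_add[symmetric])
  finally show ?thesis by (simp add: decay_def bracket_powr_2 field_simps)
qed

lemma schwartz_decay:
  assumes "schwartz f"
  shows "\<exists>M\<ge>0. \<forall>z. cmod (f z) \<le> M * decay z"
proof -
  obtain M where M: "\<And>z. weight z ^ 4 * cmod (f z) \<le> M" using schwartzD(3)[OF assms] by blast
  have "cmod (f z) \<le> M * decay z" for z
  proof -
    have "cmod (f z) * 1 \<le> cmod (f z) * (weight z ^ 4 * decay z)"
      by (intro mult_left_mono weight_decay) auto
    also have "\<dots> = (weight z ^ 4 * cmod (f z)) * decay z" by simp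
    also have "\<dots> \<le> M * decay z" using decay_pos[of z] by (intro mult_right_mono M) auto
    finally show ?thesis by simp
  qed
  moreover have "M \<ge> 0" using M[of 0] weight_ge_1[of 0] by (smt (verit) mult_nonneg_nonneg norm_ge_zero zero_le_power)
  ultimately show ?thesis by blast
qed

lemma bounded_smooth_continuous: "bounded_smooth f \<Longrightarrow> continuous_on UNIV f"
  by (meson bounded_smoothD(2) differentiable_at_imp_differentiable_on differentiable_imp_continuous_on)

lemma schwartz_continuous: "schwartz f \<Longrightarrow> continuous_on UNIV f"
  by (intro bounded_smooth_continuous schwartz_bounded_smooth)

lemma schwartz_measurable: "schwartz f \<Longrightarrow> f \<in> borel_measurable borel"
  by (intro borel_measurable_continuous_onI schwartz_continuous)

lemma bounded_smooth_measurable: "bounded_smooth f \<Longrightarrow> f \<in> borel_measurable borel"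
  by (intro borel_measurable_continuous_onI bounded_smooth_continuous)

lemma schwartz_integrable:
  assumes "schwartz f" shows "set_integrable lborel period_cell f"
proof -
  obtain M where M: "\<And>z. cmod (f z) \<le> M * decay z" using schwartz_decay[OF assms] by blast
  have "set_integrable lborel period_cell (\<lambda>z. M * decay z)"
    using decay_integrable by (rule set_integrable_mult_right)
  moreover have [measurable]: "f \<in> borel_measurable borel" by (rule schwartz_measurable[OF assms])
  then have "set_borel_measurable lborel period_cell f"
    unfolding set_borel_measurable_def by measurable
  ultimately show ?thesis
    by (rule set_integrable_bound) (rule AE_I2, rule impI, rule order.trans[OF M], simp only: real_norm_def abs_ge_self)
qed

lemma lborel_measurable_point: "integrable lborel (g :: point \<Rightarrow> complex) \<Longrightarrow> integrable (lborel \<Otimes>\<^sub>M lborel) g"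
  by (simp add: lborel_prod)

lemma integral_point_zero_x:
  assumes g: "integrable lborel (g :: point \<Rightarrow> complex)" and z: "\<And>y t. (\<integral>x. g (x, y, t) \<partial>lborel) = 0"
  shows "integral\<^sup>L lborel g = 0"
proof -
  have "integrable (lborel \<Otimes>\<^sub>M lborel) (\<lambda>(x, w). g (x, w))" using lborel_measurable_point[OF g] by simp
  then have "(\<integral>w. \<integral>x. g (x, w) \<partial>lborel \<partial>lborel) = (\<integral>(x, w). g (x, w) \<partial>(lborel \<Otimes>\<^sub>M lborel))"
    by (rule lborel_pair.integral_snd)
  moreover have "(\<integral>x. g (x, w) \<partial>lborel) = 0" for w using z by (cases w) simp
  ultimately show ?thesis by (simp add: lborel_prod)
qed

lemma integral_point_zero_yt:
  assumes g: "integrable lborel (g :: point \<Rightarrow> complex)"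
    and z: "\<And>x. integrable lborel (\<lambda>w. g (x, w)) \<Longrightarrow> (\<integral>w. g (x, w) \<partial>lborel) = 0"
  shows "integral\<^sup>L lborel g = 0"
proof -
  have "(\<integral>x. \<integral>w. g (x, w) \<partial>lborel \<partial>lborel) = integral\<^sup>L (lborel \<Otimes>\<^sub>M lborel) g"
    by (rule lborel_pair.integral_fst'[OF lborel_measurable_point[OF g]])
  \<comment> \<open>A slice that is not integrable has Bochner integral 0 by convention.\<close>
  moreover have "(\<integral>w. g (x, w) \<partial>lborel) = 0" for x
    using z by (cases "integrable lborel (\<lambda>w. g (x, w))") (auto simp: not_integrable_integral_eq)
  ultimately show ?thesis by (simp add: lborel_prod)
qed

lemma integral_point_zero_y:
  assumes g: "integrable lborel (g :: point \<Rightarrow> complex)" and z: "\<And>x t. (\<integral>y. g (x, y, t) \<partial>lborel) = 0"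
  shows "integral\<^sup>L lborel g = 0"
proof (rule integral_point_zero_yt[OF g])
  fix x assume "integrable lborel (\<lambda>w :: real \<times> real. g (x, w))"
  then have "integrable (lborel \<Otimes>\<^sub>M lborel) (\<lambda>(y, t). g (x, y, t))" by (simp add: lborel_prod case_prod_beta')
  then have "(\<integral>t. \<integral>y. g (x, y, t) \<partial>lborel \<partial>lborel) = (\<integral>(y, t). g (x, y, t) \<partial>(lborel \<Otimes>\<^sub>M lborel))"
    by (rule lborel_pair.integral_snd)
  then show "(\<integral>w. g (x, w) \<partial>lborel) = 0" using z by (simp add: lborel_prod case_prod_beta')
qed

lemma integral_point_zero_t:
  assumes g: "integrable lborel (g :: point \<Rightarrow> complex)" and z: "\<And>x y. (\<integral>t. g (x, y, t) \<partial>lborel) = 0"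
  shows "integral\<^sup>L lborel g = 0"
proof (rule integral_point_zero_yt[OF g])
  fix x assume "integrable lborel (\<lambda>w :: real \<times> real. g (x, w))"
  then have "integrable (lborel \<Otimes>\<^sub>M lborel) (\<lambda>w. g (x, w))" by (simp add: lborel_prod)
  then have "(\<integral>y. \<integral>t. g (x, y, t) \<partial>lborel \<partial>lborel) = (\<integral>w. g (x, w) \<partial>(lborel \<Otimes>\<^sub>M lborel))"
    by (rule lborel_pair.integral_fst')
  then show "(\<integral>w. g (x, w) \<partial>lborel) = 0" using z by (simp add: lborel_prod)
qed

lemma integral_derivative_zero:
  fixes F f :: "real \<Rightarrow> complex"
  assumes F: "\<And>x. (F has_vector_derivative f x) (at x)" and f: "\<And>x. isCont f x"
    and "integrable lborel f" and lim: "(F \<longlongrightarrow> 0) at_top" "(F \<longlongrightarrow> 0) at_bot"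
  shows "integral\<^sup>L lborel f = 0"
proof -
  have "(LBINT x=-\<infinity>..\<infinity>. f x) = 0 - 0"
    by (rule interval_integral_FTC_integrable[where F=F])
       (use assms in \<open>auto simp: ereal_tendsto_simps set_integrable_def\<close>)
  then show ?thesis by (simp add: interval_lebesgue_integral_def set_lebesgue_integral_def)
qed

lemma has_vector_derivative_line:
  assumes "\<And>z. f differentiable (at z)"
  shows "((\<lambda>s. f (z + s *\<^sub>R e)) has_vector_derivative dir_deriv e f (z + s *\<^sub>R e)) (at s)"
proof -
  have 1: "((\<lambda>s. z + s *\<^sub>R e) has_derivative (\<lambda>h. h *\<^sub>R e)) (at s)"
    by (auto intro!: derivative_eq_intros)
  have lin: "linear (frechet_derivative f (at (z + s *\<^sub>R e)))"
    by (rule linear_frechet_derivative[OF assms])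
  have "((\<lambda>s. f (z + s *\<^sub>R e)) has_derivative (\<lambda>h. frechet_derivative f (at (z + s *\<^sub>R e)) (h *\<^sub>R e))) (at s)"
    by (rule has_derivative_compose[OF 1 has_derivative_frechet[OF assms]])
  then show ?thesis unfolding has_vector_derivative_def dir_deriv_def linear_scale[OF lin] .
qed

lemma tendsto_bracket_powr: "((\<lambda>x. bracket x powr (- 2)) \<longlongrightarrow> 0) at_top" "((\<lambda>x. bracket x powr (- 2)) \<longlongrightarrow> 0) at_bot"
  unfolding bracket_def by real_asymp+

lemma bounded_decay_integrable:
  fixes f :: "real \<Rightarrow> complex"
  assumes "continuous_on UNIV f" "\<And>x. cmod (f x) \<le> M * bracket x powr (- 2)"
  shows "integrable lborel f"
proof (rule Bochner_Integration.integrable_bound)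
  have "integrable lborel (\<lambda>x. bracket x powr (- 2))"
  proof (rule integrableI_bounded)
    show "(\<integral>\<^sup>+x. ennreal (norm (bracket x powr (- 2))) \<partial>lborel) < \<infinity>"
      using nn_integral_bracket_powr[of 2] by (simp add: ennreal_less_top order.strict_trans1)
  qed measurable
  then show "integrable lborel (\<lambda>x. M * bracket x powr (- 2))" by simp
  show "f \<in> borel_measurable lborel" using borel_measurable_continuous_onI[OF assms(1)] by simp
  show "AE x in lborel. norm (f x) \<le> norm (M * bracket x powr (- 2))"
    using assms(2) by (auto intro!: AE_I2 order.trans[OF assms(2)])
qed

lemma integral_line_derivative_zero:
  fixes F f :: "real \<Rightarrow> complex"
  assumes F: "\<And>x. (F has_vector_derivative f x) (at x)" and f: "continuous_on UNIV f"
    and M: "\<And>x. cmod (f x) \<le> M * bracket x powr (- 2)" "\<And>x. cmod (F x) \<le> N * bracket x powr (- 2)"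
  shows "integral\<^sup>L lborel f = 0"
proof (rule integral_derivative_zero[OF F])
  show "isCont f x" for x using f by (simp add: continuous_on_eq_continuous_at)
  show "integrable lborel f" by (rule bounded_decay_integrable[OF f M(1)])
  have "((\<lambda>x. N * bracket x powr (- 2)) \<longlongrightarrow> 0) at_top" "((\<lambda>x. N * bracket x powr (- 2)) \<longlongrightarrow> 0) at_bot"
    using tendsto_bracket_powr[THEN tendsto_mult_right_zero] by auto
  then show "(F \<longlongrightarrow> 0) at_top" "(F \<longlongrightarrow> 0) at_bot"
    using M(2) by (auto elim!: Lim_null_comparison[rotated])
qed

text \<open>In the unbounded directions \<open>x\<close> and \<open>t\<close> the boundary terms
  vanish by decay; in \<open>y\<close> the values at 0 and \<open>2 * pi\<close> cancel by
  periodicity.\<close>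

lemma integral_dir_deriv_zero:
  assumes f: "schwartz f" and e: "e \<in> Basis"
  shows "(LINT z:period_cell|lborel. dir_deriv e f z) = 0"
proof -
  define g where "g z = indicator period_cell z *\<^sub>R dir_deriv e f z" for z
  have sd: "schwartz (dir_deriv e f)" by (rule schwartz_dir_deriv[OF f e])
  have g: "integrable lborel g"
    using schwartz_integrable[OF sd] unfolding set_integrable_def g_def .
  have diff: "\<And>z. f differentiable (at z)" by (rule schwartzD(2)[OF f])
  have cont: "continuous_on UNIV (dir_deriv e f)" by (rule schwartz_continuous[OF sd])
  obtain M where M: "M \<ge> 0" "\<And>z. cmod (dir_deriv e f z) \<le> M * decay z" using schwartz_decay[OF sd] by blast
  obtain N where N: "N \<ge> 0" "\<And>z. cmod (f z) \<le> N * decay z" using schwartz_decay[OF f] by blast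
  have dx: "decay z \<le> bracket (fst z) powr (- 2)" and dt: "decay z \<le> bracket (snd (snd z)) powr (- 2)" for z
    using bracket_powr_le_1[of 2 "fst z"] bracket_powr_le_1[of 2 "snd (snd z)"]
    by (auto simp: decay_def mult_left_le mult_right_le_one_le mult_left_le_one_le)
  consider "e = (1, 0, 0)" | "e = (0, 1, 0)" | "e = (0, 0, 1)" using e by (auto simp: Basis_point)
  then have "integral\<^sup>L lborel g = 0"
  proof cases
    case 1
    show ?thesis
    proof (rule integral_point_zero_x[OF g])
      fix y t
      have "integral\<^sup>L lborel (\<lambda>x. dir_deriv e f (x, y, t)) = 0"
      proof (rule integral_line_derivative_zero)
        show "((\<lambda>x. f (x, y, t)) has_vector_derivative dir_deriv e f (x, y, t)) (at x)" for x
          using has_vector_derivative_line[OF diff, of "(0, y, t)" e x] by (simp add: 1)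
        show "continuous_on UNIV (\<lambda>x. dir_deriv e f (x, y, t))"
          by (intro continuous_on_compose2[OF cont] continuous_intros) auto
        show "cmod (dir_deriv e f (x, y, t)) \<le> M * bracket x powr (- 2)" for x
          using M(2)[of "(x, y, t)"] mult_left_mono[OF dx[of "(x, y, t)"] M(1)] by simp
        show "cmod (f (x, y, t)) \<le> N * bracket x powr (- 2)" for x
          using N(2)[of "(x, y, t)"] mult_left_mono[OF dx[of "(x, y, t)"] N(1)] by simp
      qed
      then show "(\<integral>x. g (x, y, t) \<partial>lborel) = 0"
        by (cases "0 \<le> y \<and> y \<le> 2 * pi") (simp_all add: g_def mem_period_cell indicator_def)
    qed
  next
    case 2
    show ?thesis
    proof (rule integral_point_zero_y[OF g])
      fix x t
      have "(LBINT y=ereal 0..ereal (2 * pi). dir_deriv e f (x, y, t)) = f (x, 2 * pi, t) - f (x, 0, t)"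
      proof (rule interval_integral_FTC_finite)
        show "continuous_on {min 0 (2 * pi)..max 0 (2 * pi)} (\<lambda>y. dir_deriv e f (x, y, t))"
          by (intro continuous_on_compose2[OF cont] continuous_intros) auto
        show "((\<lambda>y. f (x, y, t)) has_vector_derivative dir_deriv e f (x, y, t)) (at y within {min 0 (2 * pi)..max 0 (2 * pi)})" for y
          using has_vector_derivative_line[OF diff, of "(x, 0, t)" e y]
          by (simp add: 2 has_vector_derivative_at_within)
      qed
      also have "f (x, 2 * pi, t) - f (x, 0, t) = 0"
      proof -
        have "f (x, 0 + 2 * pi, t) = f (x, 0, t)" using schwartzD(1)[OF f] unfolding y_periodic_def by blast
        then show ?thesis by simp
      qed
      also have "(LBINT y=ereal 0..ereal (2 * pi). dir_deriv e f (x, y, t)) = (LBINT y:{0..2 * pi}. dir_deriv e f (x, y, t))"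
        using interval_integral_Icc[of 0 "2 * pi" "\<lambda>y. dir_deriv e f (x, y, t)"] by simp
      finally show "(\<integral>y. g (x, y, t) \<partial>lborel) = 0"
        by (simp add: g_def set_lebesgue_integral_def mem_period_cell indicator_def)
    qed
  next
    case 3
    show ?thesis
    proof (rule integral_point_zero_t[OF g])
      fix x y
      have "integral\<^sup>L lborel (\<lambda>t. dir_deriv e f (x, y, t)) = 0"
      proof (rule integral_line_derivative_zero)
        show "((\<lambda>t. f (x, y, t)) has_vector_derivative dir_deriv e f (x, y, t)) (at t)" for t
          using has_vector_derivative_line[OF diff, of "(x, y, 0)" e t] by (simp add: 3)
        show "continuous_on UNIV (\<lambda>t. dir_deriv e f (x, y, t))"
          by (intro continuous_on_compose2[OF cont] continuous_intros) auto
        show "cmod (dir_deriv e f (x, y, t)) \<le> M * bracket t powr (- 2)" for t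
          using M(2)[of "(x, y, t)"] mult_left_mono[OF dt[of "(x, y, t)"] M(1)] by simp
        show "cmod (f (x, y, t)) \<le> N * bracket t powr (- 2)" for t
          using N(2)[of "(x, y, t)"] mult_left_mono[OF dt[of "(x, y, t)"] N(1)] by simp
      qed
      then show "(\<integral>t. g (x, y, t) \<partial>lborel) = 0"
        by (cases "0 \<le> y \<and> y \<le> 2 * pi") (simp_all add: g_def mem_period_cell indicator_def)
    qed
  qed
  then show ?thesis unfolding set_lebesgue_integral_def g_def[symmetric] .
qed

text \<open>The derivative of \<open>f\<close> times a character has integral 0, and differentiating
  the character only produces a scalar factor.\<close>

lemma fourier_dir_deriv:
  assumes f: "schwartz f" and e: "e \<in> Basis"
  shows "fourier (dir_deriv e f) (\<xi>, q, \<tau>) =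
    \<i> * complex_of_real (\<xi> * fst e + real_of_int q * fst (snd e) + \<tau> * snd (snd e)) * fourier f (\<xi>, q, \<tau>)"
proof -
  let ?E = "character (- \<xi>) (- q) (- \<tau>)"
  let ?c = "\<i> * complex_of_real (\<xi> * fst e + real_of_int q * fst (snd e) + \<tau> * snd (snd e))"
  have E: "bounded_smooth ?E" by (rule bounded_smooth_character)
  have s1: "schwartz (\<lambda>z. f z * ?E z)" by (rule schwartz_mult[OF f E])
  have s2: "schwartz (\<lambda>z. dir_deriv e f z * ?E z)" by (rule schwartz_mult[OF schwartz_dir_deriv[OF f e] E])
  have "dir_deriv e (\<lambda>z. f z * ?E z) = (\<lambda>z. dir_deriv e f z * ?E z - ?c * (f z * ?E z))"
    by (subst dir_deriv_mult)
       (auto simp: schwartzD(2)[OF f] bounded_smoothD(2)[OF E] dir_deriv_character fun_eq_iff algebra_simps)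
  then have "0 = (LINT z:period_cell|lborel. dir_deriv e f z * ?E z - ?c * (f z * ?E z))"
    using integral_dir_deriv_zero[OF s1 e] by simp
  also have "\<dots> = (LINT z:period_cell|lborel. dir_deriv e f z * ?E z) - (LINT z:period_cell|lborel. ?c * (f z * ?E z))"
    by (rule set_integral_diff(2)[OF schwartz_integrable[OF s2] set_integrable_mult_right[OF schwartz_integrable[OF s1]]])
  also have "(LINT z:period_cell|lborel. ?c * (f z * ?E z)) = ?c * (LINT z:period_cell|lborel. f z * ?E z)"
    by (rule set_integral_mult_right)
  finally have "(LINT z:period_cell|lborel. dir_deriv e f z * ?E z) = ?c * (LINT z:period_cell|lborel. f z * ?E z)"
    by (simp only: eq_iff_diff_eq_0 [of "LINT z:period_cell|lborel. dir_deriv e f z * ?E z"])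
  then show ?thesis by (simp only: fourier_eq)
qed

lemma fourier_partial_x: "schwartz f \<Longrightarrow> fourier (partial_x f) z = \<i> * complex_of_real (fst z) * fourier f z"
  unfolding partial_x_def by (cases z) (simp add: fourier_dir_deriv Basis_point)

lemma fourier_diff:
  assumes "schwartz f" "schwartz g"
  shows "fourier (\<lambda>z. f z - g z) w = fourier f w - fourier g w"
proof -
  obtain \<xi> q \<tau> where w: "w = (\<xi>, q, \<tau>)" by (metis prod_cases3)
  let ?E = "character (- \<xi>) (- q) (- \<tau>)"
  have "set_integrable lborel period_cell (\<lambda>z. f z * ?E z)" "set_integrable lborel period_cell (\<lambda>z. g z * ?E z)"
    using assms by (auto intro!: schwartz_integrable schwartz_mult bounded_smooth_character)
  then show ?thesis unfolding w fourier_eq by (simp add: left_diff_distrib set_integral_diff)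
qed

lemma fourier_bounded:
  assumes "schwartz f" shows "\<exists>C. \<forall>w. cmod (fourier f w) \<le> C"
proof (intro exI allI)
  fix w :: freq
  obtain \<xi> q \<tau> where w: "w = (\<xi>, q, \<tau>)" by (metis prod_cases3)
  show "cmod (fourier f w) \<le> (LINT z:period_cell|lborel. cmod (f z))"
    unfolding w fourier_eq set_lebesgue_integral_def
    by (rule order.trans[OF integral_norm_bound]) (simp add: norm_mult)
qed

text \<open>Integration by parts trades each factor of the weight for a derivative.\<close>

lemma fourier_decay_step:
  fixes m :: "freq \<Rightarrow> real" and e :: point
  assumes "\<And>f. schwartz f \<Longrightarrow> \<exists>C. \<forall>w. m w * cmod (fourier f w) \<le> C" "e \<in> Basis" and m: "\<And>w. 0 \<le> m w"
    and f: "schwartz f"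
  shows "\<exists>C. \<forall>w :: freq. m w * (1 + \<bar>fst w * fst e + real_of_int (fst (snd w)) * fst (snd e) + snd (snd w) * snd (snd e)\<bar>) * cmod (fourier f w) \<le> C"
proof -
  obtain C D where C: "\<And>w. m w * cmod (fourier f w) \<le> C" and D: "\<And>w. m w * cmod (fourier (dir_deriv e f) w) \<le> D"
    using assms(1)[OF f] assms(1)[OF schwartz_dir_deriv[OF f assms(2)]] by metis
  have "m w * (1 + \<bar>fst w * fst e + real_of_int (fst (snd w)) * fst (snd e) + snd (snd w) * snd (snd e)\<bar>) * cmod (fourier f w) \<le> C + D" for w :: freq
  proof -
    obtain \<xi> q \<tau> where w: "w = (\<xi>, q, \<tau>)" by (metis prod_cases3)
    have "cmod (fourier (dir_deriv e f) w) = \<bar>\<xi> * fst e + real_of_int q * fst (snd e) + \<tau> * snd (snd e)\<bar> * cmod (fourier f w)"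
      unfolding w fourier_dir_deriv[OF f assms(2)] by (simp add: norm_mult del: of_real_add of_real_mult)
    then show ?thesis using C[of w] D[of w] by (simp add: w algebra_simps)
  qed
  then show ?thesis by blast
qed

definition freq_weight :: "freq \<Rightarrow> real" where
  "freq_weight w = bracket (fst w) * bracket (real_of_int (fst (snd w))) * bracket (snd (snd w))"

lemma freq_weight_ge_1: "1 \<le> freq_weight w"
proof -
  have "1 * 1 * 1 \<le> freq_weight w"
    unfolding freq_weight_def by (intro mult_mono bracket_ge_1) auto
  then show ?thesis by simp
qed

text \<open>Each power of \<open>freq_weight\<close> takes three uses of
  \<open>fourier_decay_step\<close>, one per coordinate direction. The induction is for all
  \<open>f\<close> at once because derivatives of \<open>f\<close> enter.\<close>

lemma fourier_decay: "schwartz f \<Longrightarrow> \<exists>C. \<forall>w. freq_weight w ^ k * cmod (fourier f w) \<le> C"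
proof (induction k arbitrary: f)
  case 0
  then show ?case using fourier_bounded by simp
next
  case (Suc k)
  have fw: "0 \<le> freq_weight w" for w by (simp add: freq_weight_def)
  let ?m0 = "\<lambda>w. freq_weight w ^ k"
  have 1: "\<exists>C. \<forall>w. ?m0 w * bracket (fst w) * cmod (fourier f w) \<le> C" if "schwartz f" for f
    using fourier_decay_step[of ?m0 "(1, 0, 0)" f] Suc.IH that fw by (simp add: bracket_def Basis_point)
  have 2: "\<exists>C. \<forall>w. ?m0 w * bracket (fst w) * bracket (real_of_int (fst (snd w))) * cmod (fourier f w) \<le> C" if "schwartz f" for f
    using fourier_decay_step[of "\<lambda>w. ?m0 w * bracket (fst w)" "(0, 1, 0)" f] 1 that fw
    by (simp add: bracket_def[of "real_of_int _"] Basis_point)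
  have 3: "\<exists>C. \<forall>w. ?m0 w * bracket (fst w) * bracket (real_of_int (fst (snd w))) * bracket (snd (snd w)) * cmod (fourier f w) \<le> C" if "schwartz f" for f
    using fourier_decay_step[of "\<lambda>w. ?m0 w * bracket (fst w) * bracket (real_of_int (fst (snd w)))" "(0, 0, 1)" f] 2 that fw
    by (simp add: bracket_def[of "snd _"] Basis_point)
  show ?case using 3[OF Suc.prems] by (simp add: freq_weight_def mult_ac)
qed

section \<open>Fourier inversion\<close>

lemma lborel_integrable_affine:
  fixes f :: "'a::euclidean_space \<Rightarrow> complex"
  assumes "integrable lborel f" "c \<noteq> 0"
  shows "integrable lborel (\<lambda>x. f (t + c *\<^sub>R x))"
proof -
  have [measurable]: "f \<in> borel_measurable borel" using assms(1) by auto
  have "integrable (density (distr lborel borel (\<lambda>x. t + c *\<^sub>R x)) (\<lambda>_. ennreal (\<bar>c\<bar> ^ DIM('a)))) f"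
    using assms lborel_affine[of c t] by (simp add: ennreal_power)
  then have "integrable lborel (\<lambda>x. (\<bar>c\<bar> ^ DIM('a)) *\<^sub>R f (t + c *\<^sub>R x))"
    by (subst (asm) integrable_density) (auto simp: integrable_distr_eq)
  then have "integrable lborel (\<lambda>x. (1 / \<bar>c\<bar> ^ DIM('a)) *\<^sub>R ((\<bar>c\<bar> ^ DIM('a)) *\<^sub>R f (t + c *\<^sub>R x)))"
    by (rule integrable_scaleR_right)
  then show ?thesis using assms(2) by simp
qed

lemma lborel_integral_affine:
  fixes f :: "'a::euclidean_space \<Rightarrow> complex"
  assumes [measurable]: "f \<in> borel_measurable borel" and c: "c \<noteq> 0"
  shows "integral\<^sup>L lborel f = (\<bar>c\<bar> ^ DIM('a)) *\<^sub>R (\<integral>x. f (t + c *\<^sub>R x) \<partial>lborel)"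
proof -
  have "integral\<^sup>L lborel f = integral\<^sup>L (density (distr lborel borel (\<lambda>x. t + c *\<^sub>R x)) (\<lambda>_. ennreal (\<bar>c\<bar> ^ DIM('a)))) f"
    using lborel_affine[OF c, of t] by (simp add: ennreal_power)
  then show ?thesis by (simp add: integral_density integral_distr)
qed

section \<open>Inversion on the plane by Gaussian regularisation\<close>

text \<open>The product form lets the transform be computed from the characteristic function of the
  standard normal distribution, one variable at a time.\<close>

definition gauss2 :: "real \<times> real \<Rightarrow> real" where
  "gauss2 s = std_normal_density (fst s) * std_normal_density (snd s)"

lemma gauss2_eq: "gauss2 s = exp (- (norm s)\<^sup>2 / 2) / (2 * pi)"
  by (simp add: gauss2_def std_normal_density_def norm_prod_def exp_add[symmetric] mult_exp_exp add_divide_distrib)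

lemma gauss2_nonneg: "0 \<le> gauss2 s"
  by (simp add: gauss2_eq)

lemma gauss2_continuous: "continuous_on UNIV gauss2"
  unfolding gauss2_eq by (intro continuous_intros) auto

lemma gauss2_measurable [measurable]: "gauss2 \<in> borel_measurable borel"
  by (intro borel_measurable_continuous_onI gauss2_continuous)

lemma gauss2_integrable: "integrable lborel gauss2"
proof (rule integrableI_bounded)
  have "(\<integral>\<^sup>+s. ennreal (norm (gauss2 s)) \<partial>lborel) = (\<integral>\<^sup>+x. \<integral>\<^sup>+y. ennreal (norm (gauss2 (x, y))) \<partial>lborel \<partial>lborel)"
    by (subst lborel_prod[symmetric], rule lborel.nn_integral_fst[symmetric]) (simp add: lborel_prod)
  also have "\<dots> = (\<integral>\<^sup>+x. \<integral>\<^sup>+y. ennreal (std_normal_density x) * ennreal (std_normal_density y) \<partial>lborel \<partial>lborel)"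
    by (simp add: gauss2_def ennreal_mult)
  also have "\<dots> = (\<integral>\<^sup>+x. ennreal (std_normal_density x) * (\<integral>\<^sup>+y. ennreal (std_normal_density y) \<partial>lborel) \<partial>lborel)"
    by (intro nn_integral_cong nn_integral_cmult) auto
  also have "(\<integral>\<^sup>+y. ennreal (std_normal_density y) \<partial>lborel) = 1"
    using prob_space.emeasure_space_1[OF prob_space_normal_density[of 1 0]] by (simp add: emeasure_density)
  finally show "(\<integral>\<^sup>+s. ennreal (norm (gauss2 s)) \<partial>lborel) < \<infinity>"
    using prob_space.emeasure_space_1[OF prob_space_normal_density[of 1 0]] by (simp add: emeasure_density)
qed measurable

lemma gauss2_fourier:
  "(\<integral>s. exp (- \<i> * complex_of_real (s \<bullet> u)) * complex_of_real (gauss2 s) \<partial>lborel) = 2 * pi * gauss2 u"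
proof -
  let ?\<phi> = "\<lambda>a x. exp (- \<i> * complex_of_real (x * a)) * complex_of_real (std_normal_density x)"
  have one: "(\<integral>x. ?\<phi> a x \<partial>lborel) = complex_of_real (exp (- a\<^sup>2 / 2))" for a
  proof -
    have "complex_of_real (exp (- (- a)\<^sup>2 / 2)) = (CLINT x|std_normal_distribution. iexp (- a * x))"
      using fun_cong[OF char_std_normal_distribution, of "- a"] by (simp add: char_def)
    also have "\<dots> = (\<integral>x. std_normal_density x *\<^sub>R iexp (- a * x) \<partial>lborel)"
      by (subst integral_density) auto
    finally show ?thesis by (simp add: scaleR_conv_of_real mult_ac)
  qed
  have "integrable lborel (\<lambda>s. exp (- \<i> * complex_of_real (s \<bullet> u)) * complex_of_real (gauss2 s))"
  proof (rule Bochner_Integration.integrable_bound[OF gauss2_integrable])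
    have "continuous_on UNIV (\<lambda>s. exp (- \<i> * complex_of_real (s \<bullet> u)) * complex_of_real (gauss2 s))"
      by (intro continuous_intros gauss2_continuous)
    then show "(\<lambda>s. exp (- \<i> * complex_of_real (s \<bullet> u)) * complex_of_real (gauss2 s)) \<in> borel_measurable lborel"
      using borel_measurable_continuous_onI by simp
  qed (simp add: norm_mult)
  then have "(\<integral>s. exp (- \<i> * complex_of_real (s \<bullet> u)) * complex_of_real (gauss2 s) \<partial>lborel) =
     (\<integral>x. \<integral>y. exp (- \<i> * complex_of_real ((x, y) \<bullet> u)) * complex_of_real (gauss2 (x, y)) \<partial>lborel \<partial>lborel)"
    by (subst (asm) lborel_prod[symmetric], subst lborel_prod[symmetric]) (rule lborel_pair.integral_fst'[symmetric])
  also have "\<dots> = (\<integral>x. \<integral>y. ?\<phi> (fst u) x * ?\<phi> (snd u) y \<partial>lborel \<partial>lborel)"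
    by (intro Bochner_Integration.integral_cong refl)
       (simp add: gauss2_def inner_prod_def exp_add[symmetric] algebra_simps flip: exp_minus)
  also have "\<dots> = complex_of_real (exp (- (fst u)\<^sup>2 / 2)) * complex_of_real (exp (- (snd u)\<^sup>2 / 2))"
    by (simp only: integral_mult_right_zero integral_mult_left_zero one)
  also have "\<dots> = 2 * pi * gauss2 u"
    by (simp add: gauss2_eq norm_prod_def exp_add[symmetric] add_divide_distrib flip: of_real_mult)
  finally show ?thesis .
qed

lemma gauss2_integral: "(\<integral>s. complex_of_real (gauss2 s) \<partial>lborel) = 1"
  using gauss2_fourier[of 0] by (simp add: gauss2_eq)

text \<open>The left integral is regularised by a wide Gaussian factor that tends to 1. Since the
  Gaussian is its own transform up to scaling, Fubini turns the regularised integral into an average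
  of \<open>A\<close> around \<open>p0\<close> with a Gaussian of width \<open>\<epsilon> n\<close>.
  Both expressions converge by domination: the first because \<open>B\<close> is integrable, the
  second because \<open>A\<close> is bounded and continuous.\<close>

lemma plane_inversion:
  fixes A :: "real \<times> real \<Rightarrow> complex"
  assumes cont: "continuous_on UNIV A" and bdd: "\<And>p. cmod (A p) \<le> M" and int: "integrable lborel A"
    and hat: "\<And>s. B s = (\<integral>p. A p * exp (- \<i> * complex_of_real (s \<bullet> p)) \<partial>lborel)" and intB: "integrable lborel B"
  shows "(\<integral>s. B s * exp (\<i> * complex_of_real (s \<bullet> p0)) \<partial>lborel) = 4 * pi\<^sup>2 * A p0"
proof -
  define \<epsilon> where "\<epsilon> n = 1 / real (Suc n)" for n
  have \<epsilon>: "\<epsilon> n > 0" "\<epsilon> n \<noteq> 0" for n by (auto simp: \<epsilon>_def)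
  have \<epsilon>0: "\<epsilon> \<longlonglongrightarrow> 0" unfolding \<epsilon>_def by (rule lim_1_over_n[THEN LIMSEQ_Suc])
  have [measurable]: "A \<in> borel_measurable borel" "B \<in> borel_measurable borel"
    using int intB by auto
  have [measurable]: "(\<lambda>s. exp (\<i> * complex_of_real (s \<bullet> p0))) \<in> borel_measurable borel"
    by (intro borel_measurable_continuous_onI continuous_intros)
  define I where "I n = (\<integral>s. B s * exp (\<i> * complex_of_real (s \<bullet> p0)) * complex_of_real (2 * pi * gauss2 (\<epsilon> n *\<^sub>R s)) \<partial>lborel)" for n
  have "I \<longlonglongrightarrow> (\<integral>s. B s * exp (\<i> * complex_of_real (s \<bullet> p0)) \<partial>lborel)"
    unfolding I_def
  proof (rule integral_dominated_convergence[where w="\<lambda>s. norm (B s)"])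
    show "AE s in lborel. (\<lambda>n. B s * exp (\<i> * complex_of_real (s \<bullet> p0)) * complex_of_real (2 * pi * gauss2 (\<epsilon> n *\<^sub>R s)))
       \<longlonglongrightarrow> B s * exp (\<i> * complex_of_real (s \<bullet> p0))"
    proof (rule AE_I2)
      fix s
      have "(\<lambda>n. gauss2 (\<epsilon> n *\<^sub>R s)) \<longlonglongrightarrow> gauss2 (0 *\<^sub>R s)"
        by (rule continuous_on_tendsto_compose[OF gauss2_continuous tendsto_scaleR[OF \<epsilon>0 tendsto_const]]) auto
      then have "(\<lambda>n. B s * exp (\<i> * complex_of_real (s \<bullet> p0)) * complex_of_real (2 * pi * gauss2 (\<epsilon> n *\<^sub>R s)))
       \<longlonglongrightarrow> B s * exp (\<i> * complex_of_real (s \<bullet> p0)) * complex_of_real (2 * pi * gauss2 (0 *\<^sub>R s))"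
        by (intro tendsto_intros)
      then show "(\<lambda>n. B s * exp (\<i> * complex_of_real (s \<bullet> p0)) * complex_of_real (2 * pi * gauss2 (\<epsilon> n *\<^sub>R s)))
       \<longlonglongrightarrow> B s * exp (\<i> * complex_of_real (s \<bullet> p0))" by (simp add: gauss2_eq)
    qed
    show "AE s in lborel. norm (B s * exp (\<i> * complex_of_real (s \<bullet> p0)) * complex_of_real (2 * pi * gauss2 (\<epsilon> n *\<^sub>R s))) \<le> norm (B s)" for n
      by (auto simp: norm_mult gauss2_eq intro!: mult_left_le)
  qed (use intB in auto)
  moreover have "I \<longlonglongrightarrow> 4 * pi\<^sup>2 * A p0"
  proof -
    have kernel: "(\<integral>s. exp (- \<i> * complex_of_real (s \<bullet> (p - p0))) * complex_of_real (2 * pi * gauss2 (\<epsilon> n *\<^sub>R s)) \<partial>lborel)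
      = complex_of_real (4 * pi\<^sup>2 / (\<epsilon> n)\<^sup>2 * gauss2 ((1 / \<epsilon> n) *\<^sub>R (p - p0)))" for p n
    proof -
      let ?f = "\<lambda>s. exp (- \<i> * complex_of_real (s \<bullet> (p - p0))) * complex_of_real (2 * pi * gauss2 (\<epsilon> n *\<^sub>R s))"
      have "?f \<in> borel_measurable borel"
        by (intro borel_measurable_continuous_onI continuous_intros continuous_on_compose2[OF gauss2_continuous]) auto
      then have "integral\<^sup>L lborel ?f = (\<bar>1 / \<epsilon> n\<bar> ^ DIM(real \<times> real)) *\<^sub>R (\<integral>x. ?f (0 + (1 / \<epsilon> n) *\<^sub>R x) \<partial>lborel)"
        using \<epsilon>[of n] by (intro lborel_integral_affine) auto
      also have "(\<integral>x. ?f (0 + (1 / \<epsilon> n) *\<^sub>R x) \<partial>lborel) =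
        (\<integral>x. complex_of_real (2 * pi) * (exp (- \<i> * complex_of_real (x \<bullet> ((1 / \<epsilon> n) *\<^sub>R (p - p0)))) * complex_of_real (gauss2 x)) \<partial>lborel)"
        using \<epsilon>[of n] by (intro Bochner_Integration.integral_cong refl) (simp add: mult_ac)
      also have "\<dots> = complex_of_real (2 * pi) * (2 * pi * gauss2 ((1 / \<epsilon> n) *\<^sub>R (p - p0)))"
        by (subst integral_mult_right_zero) (simp only: gauss2_fourier)
      finally show ?thesis using \<epsilon>[of n] by (simp add: scaleR_conv_of_real power2_eq_square power_divide field_simps)
    qed
    \<comment> \<open>Fubini, then the substitution
      \<open>p = p0 + \<epsilon> n *\<^sub>R u\<close>, whose Jacobian cancels the factor in
      \<open>kernel\<close>.\<close>
    have Ieq: "I n = (\<integral>u. A (p0 + \<epsilon> n *\<^sub>R u) * complex_of_real (4 * pi\<^sup>2 * gauss2 u) \<partial>lborel)" for n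
    proof -
      let ?G = "\<lambda>s. complex_of_real (2 * pi * gauss2 (\<epsilon> n *\<^sub>R s))"
      let ?F = "\<lambda>s p. A p * exp (- \<i> * complex_of_real (s \<bullet> (p - p0))) * ?G s"
      have Gint: "integrable lborel ?G"
        using lborel_integrable_affine[of "\<lambda>s. complex_of_real (2 * pi * gauss2 s)" "\<epsilon> n" 0] gauss2_integrable \<epsilon>[of n] by simp
      have [measurable]: "?G \<in> borel_measurable borel" using Gint by auto
      have E: "(\<lambda>z :: (real \<times> real) \<times> (real \<times> real). exp (- \<i> * complex_of_real (fst z \<bullet> (snd z - p0)))) \<in> borel_measurable (lborel \<Otimes>\<^sub>M lborel)"
      proof -
        have "continuous_on UNIV (\<lambda>z :: (real \<times> real) \<times> (real \<times> real). exp (- \<i> * complex_of_real (fst z \<bullet> (snd z - p0))))"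
          by (intro continuous_intros)
        from borel_measurable_continuous_onI[OF this] show ?thesis unfolding lborel_prod by simp
      qed
      have Fint: "integrable (lborel \<Otimes>\<^sub>M lborel) (\<lambda>(s, p). ?F s p)"
      proof (rule lborel_pair.Fubini_integrable)
        show "(\<lambda>(s, p). ?F s p) \<in> borel_measurable (lborel \<Otimes>\<^sub>M lborel)"
          using E by (simp add: case_prod_beta')
        have "(\<lambda>s. \<integral>p. cmod (?F s p) \<partial>lborel) = (\<lambda>s. cmod (?G s) * (\<integral>p. cmod (A p) \<partial>lborel))"
          by (simp add: norm_mult mult.commute fun_eq_iff)
        then show "integrable lborel (\<lambda>s. \<integral>p. cmod (case (s, p) of (s, p) \<Rightarrow> ?F s p) \<partial>lborel)"
          using Gint by (simp only: prod.case) (intro integrable_mult_left integrable_norm)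
        show "AE s in lborel. integrable lborel (\<lambda>p. case (s, p) of (s, p) \<Rightarrow> ?F s p)"
        proof (rule AE_I2, simp only: prod.case)
          fix s
          have "continuous_on UNIV (\<lambda>p. exp (- \<i> * complex_of_real (s \<bullet> (p - p0))))" by (intro continuous_intros)
          then have [measurable]: "(\<lambda>p. exp (- \<i> * complex_of_real (s \<bullet> (p - p0)))) \<in> borel_measurable borel"
            by (rule borel_measurable_continuous_onI)
          have "integrable lborel (\<lambda>p. A p * exp (- \<i> * complex_of_real (s \<bullet> (p - p0))))"
            by (rule Bochner_Integration.integrable_bound[OF int]) (auto simp: norm_mult)
          then show "integrable lborel (\<lambda>p. ?F s p)" by (rule integrable_mult_left)
        qed
      qed
      have "I n = (\<integral>s. \<integral>p. ?F s p \<partial>lborel \<partial>lborel)"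
      proof -
        have slice: "B s * exp (\<i> * complex_of_real (s \<bullet> p0)) * ?G s = (\<integral>p. ?F s p \<partial>lborel)" for s
        proof -
          have "(\<integral>p. ?F s p \<partial>lborel) = (\<integral>p. (A p * exp (- \<i> * complex_of_real (s \<bullet> p))) * (exp (\<i> * complex_of_real (s \<bullet> p0)) * ?G s) \<partial>lborel)"
            by (intro Bochner_Integration.integral_cong refl)
               (simp add: inner_diff_right exp_add[symmetric] exp_diff[symmetric] algebra_simps flip: exp_minus)
          also have "\<dots> = B s * (exp (\<i> * complex_of_real (s \<bullet> p0)) * ?G s)"
            unfolding hat by (rule integral_mult_left_zero)
          finally show ?thesis by (simp add: mult_ac)
        qed
        show ?thesis unfolding I_def slice ..
      qed
      also have "\<dots> = (\<integral>p. \<integral>s. ?F s p \<partial>lborel \<partial>lborel)"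
        using lborel_pair.Fubini_integral[OF Fint] by simp
      also have "\<dots> = (\<integral>p. A p * complex_of_real (4 * pi\<^sup>2 / (\<epsilon> n)\<^sup>2 * gauss2 ((1 / \<epsilon> n) *\<^sub>R (p - p0))) \<partial>lborel)"
      proof (rule Bochner_Integration.integral_cong[OF refl])
        fix p
        show "(\<integral>s. ?F s p \<partial>lborel) = A p * complex_of_real (4 * pi\<^sup>2 / (\<epsilon> n)\<^sup>2 * gauss2 ((1 / \<epsilon> n) *\<^sub>R (p - p0)))"
          unfolding mult.assoc[of "A p"] integral_mult_right_zero kernel ..
      qed
      also have "\<dots> = (\<bar>\<epsilon> n\<bar> ^ DIM(real \<times> real)) *\<^sub>R (\<integral>u. A (p0 + \<epsilon> n *\<^sub>R u) * complex_of_real (4 * pi\<^sup>2 / (\<epsilon> n)\<^sup>2 * gauss2 ((1 / \<epsilon> n) *\<^sub>R ((p0 + \<epsilon> n *\<^sub>R u) - p0))) \<partial>lborel)"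
        by (rule lborel_integral_affine) (use \<epsilon>[of n] in measurable)
      also have "\<dots> = (\<integral>u. A (p0 + \<epsilon> n *\<^sub>R u) * complex_of_real (4 * pi\<^sup>2 * gauss2 u) \<partial>lborel)"
        using \<epsilon>[of n] by (subst integral_scaleR_right[symmetric], intro Bochner_Integration.integral_cong refl)
           (simp add: scaleR_conv_of_real power2_eq_square field_simps)
      finally show ?thesis .
    qed
    have lim: "(\<lambda>n. \<integral>u. A (p0 + \<epsilon> n *\<^sub>R u) * complex_of_real (4 * pi\<^sup>2 * gauss2 u) \<partial>lborel) \<longlonglongrightarrow>
       (\<integral>u. A p0 * complex_of_real (4 * pi\<^sup>2 * gauss2 u) \<partial>lborel)"
    proof (rule integral_dominated_convergence[where w="\<lambda>u. M * (4 * pi\<^sup>2 * gauss2 u)"])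
      show "integrable lborel (\<lambda>u. M * (4 * pi\<^sup>2 * gauss2 u))" using gauss2_integrable by simp
      show "AE u in lborel. (\<lambda>n. A (p0 + \<epsilon> n *\<^sub>R u) * complex_of_real (4 * pi\<^sup>2 * gauss2 u)) \<longlonglongrightarrow> A p0 * complex_of_real (4 * pi\<^sup>2 * gauss2 u)"
      proof (rule AE_I2)
        fix u
        have "(\<lambda>n. A (p0 + \<epsilon> n *\<^sub>R u)) \<longlonglongrightarrow> A (p0 + 0 *\<^sub>R u)"
          by (rule continuous_on_tendsto_compose[OF cont tendsto_add[OF tendsto_const tendsto_scaleR[OF \<epsilon>0 tendsto_const]]]) auto
        then show "(\<lambda>n. A (p0 + \<epsilon> n *\<^sub>R u) * complex_of_real (4 * pi\<^sup>2 * gauss2 u)) \<longlonglongrightarrow> A p0 * complex_of_real (4 * pi\<^sup>2 * gauss2 u)"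
          by (intro tendsto_intros) simp
      qed
      show "AE u in lborel. norm (A (p0 + \<epsilon> n *\<^sub>R u) * complex_of_real (4 * pi\<^sup>2 * gauss2 u)) \<le> M * (4 * pi\<^sup>2 * gauss2 u)" for n
      proof (rule AE_I2)
        fix u
        have k0: "0 \<le> 4 * pi\<^sup>2 * gauss2 u" by (simp add: gauss2_nonneg)
        show "norm (A (p0 + \<epsilon> n *\<^sub>R u) * complex_of_real (4 * pi\<^sup>2 * gauss2 u)) \<le> M * (4 * pi\<^sup>2 * gauss2 u)"
          unfolding norm_mult norm_of_real abs_of_nonneg[OF k0] by (rule mult_right_mono[OF bdd k0])
      qed
    qed measurable
    have val: "(\<integral>u. A p0 * complex_of_real (4 * pi\<^sup>2 * gauss2 u) \<partial>lborel) = 4 * pi\<^sup>2 * A p0"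
      using gauss2_integral by simp
    have "I = (\<lambda>n. \<integral>u. A (p0 + \<epsilon> n *\<^sub>R u) * complex_of_real (4 * pi\<^sup>2 * gauss2 u) \<partial>lborel)"
      by (rule ext) (rule Ieq)
    then show ?thesis using lim unfolding val by (simp only:)
  qed
  ultimately show ?thesis by (rule LIMSEQ_unique)
qed

section \<open>Fourier series on the circle\<close>

text \<open>The chord has length 2 sin a with a = |\<theta>| / 2 at most 1.6. There the Taylor bound
  gives sin a >= a - a^3 / 6 >= a / 2, because a^2 <= 3.\<close>

lemma abs_le_norm_exp_i_minus_1:
  assumes "\<bar>\<theta>\<bar> \<le> pi"
  shows "\<bar>\<theta>\<bar> \<le> 2 * cmod (exp (\<i> * complex_of_real \<theta>) - 1)"
proof -
  define a where "a = \<bar>\<theta>\<bar> / 2"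
  have a: "0 \<le> a" "a \<le> 1.6" using assms pi_less_4 pi_approx by (auto simp: a_def)
  have "a * a \<le> 1.6 * 1.6" using a by (intro mult_mono) auto
  then have "a * (a * a) \<le> a * 3" using a by (intro mult_left_mono) auto
  moreover have "\<bar>sin a - a\<bar> \<le> a ^ 3 / 6"
    using Maclaurin_sin_bound[of a 3] a by (simp add: numeral_eq_Suc sin_coeff_def fact_numeral)
  ultimately have "a / 2 \<le> sin a" by (simp add: power3_eq_cube abs_if split: if_splits)
  also have "sin a \<le> \<bar>sin (\<theta> / 2)\<bar>" by (cases "\<theta> \<ge> 0") (auto simp: a_def)
  finally show ?thesis unfolding dist_exp_i_1 by (simp add: a_def)
qed

lemma periodic_int:
  fixes h :: "real \<Rightarrow> 'a"
  assumes "\<And>y. h (y + 2 * pi) = h y"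
  shows "h (y + 2 * pi * real_of_int k) = h y"
proof (induction k rule: int_induct[where k=0])
  case (step1 i)
  have "y + 2 * pi * real_of_int (i + 1) = (y + 2 * pi * real_of_int i) + 2 * pi" by (simp add: algebra_simps)
  then show ?case using assms step1 by metis
next
  case (step2 i)
  have "y + 2 * pi * real_of_int i = (y + 2 * pi * real_of_int (i - 1)) + 2 * pi" by (simp add: algebra_simps)
  then show ?case using assms step2 by metis
qed simp

lemma exp_i_periodic: "exp (\<i> * complex_of_real (y + 2 * pi)) = exp (\<i> * complex_of_real y)"
  by (simp add: distrib_left exp_add mult_ac)

text \<open>Makes the quotient in \<open>Fourier_series_tendsto\<close> bounded. A shift by a
  multiple of the period moves \<open>y - y0\<close> into [-pi, pi], where arc and chord are
  comparable.\<close>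

lemma periodic_Lipschitz_bound:
  fixes h :: "real \<Rightarrow> complex"
  assumes per: "\<And>y. h (y + 2 * pi) = h y" and lip: "\<And>y y'. cmod (h y - h y') \<le> M * \<bar>y - y'\<bar>"
  shows "cmod (h y - h y0) \<le> 2 * M * cmod (exp (\<i> * complex_of_real (y - y0)) - 1)"
proof -
  define k where "k = round ((y - y0) / (2 * pi))"
  define \<theta> where "\<theta> = y - y0 + 2 * pi * real_of_int (- k)"
  have M: "0 \<le> M" using order.trans[OF norm_ge_zero lip[of 1 0]] by simp
  have "\<bar>(y - y0) / (2 * pi) - real_of_int k\<bar> \<le> 1 / 2"
    unfolding k_def using of_int_round_abs_le[of "(y - y0) / (2 * pi)"] by (simp add: abs_minus_commute)
  then have "2 * pi * \<bar>(y - y0) / (2 * pi) - real_of_int k\<bar> \<le> pi"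
    using pi_gt_zero mult_left_mono[of _ "1/2" "2 * pi"] by simp
  moreover have "2 * pi * \<bar>(y - y0) / (2 * pi) - real_of_int k\<bar> = \<bar>\<theta>\<bar>"
  proof -
    have "\<theta> = 2 * pi * ((y - y0) / (2 * pi) - real_of_int k)" by (simp add: \<theta>_def field_simps)
    then show ?thesis by (simp add: abs_mult)
  qed
  ultimately have th: "\<bar>\<theta>\<bar> \<le> pi" by simp
  have "h (y + 2 * pi * real_of_int (- k)) = h y" by (rule periodic_int[of h, OF per])
  then have "cmod (h y - h y0) \<le> M * \<bar>\<theta>\<bar>"
    using lip[of "y + 2 * pi * real_of_int (- k)" y0] by (simp add: \<theta>_def algebra_simps)
  also have "\<dots> \<le> M * (2 * cmod (exp (\<i> * complex_of_real \<theta>) - 1))"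
    using M by (intro mult_left_mono abs_le_norm_exp_i_minus_1 th)
  also have "exp (\<i> * complex_of_real \<theta>) = exp (\<i> * complex_of_real (y - y0))"
    unfolding \<theta>_def using periodic_int[of "\<lambda>y. exp (\<i> * complex_of_real y)", OF exp_i_periodic] .
  finally show ?thesis by simp
qed

definition circle :: "real measure" where
  "circle = restrict_space lborel {0..2 * pi}"

lemma space_circle: "space circle = {0..2 * pi}"
  by (simp add: circle_def space_restrict_space)

interpretation circle: finite_measure circle
  by (rule finite_measureI) (simp add: circle_def emeasure_restrict_space space_restrict_space)

lemma measurable_circle [measurable (raw)]: "f \<in> borel_measurable borel \<Longrightarrow> f \<in> borel_measurable circle"
  unfolding circle_def by (rule measurable_restrict_space1) simp

lemma circle_integral: "integral\<^sup>L circle f = (LINT y:{0..2 * pi}|lborel. f y)" for f :: "real \<Rightarrow> complex"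
  unfolding circle_def by (subst integral_restrict_space) (auto simp: set_lebesgue_integral_def)

lemma integrable_circle_bounded:
  fixes f :: "real \<Rightarrow> complex"
  assumes "f \<in> borel_measurable borel" "\<And>y. cmod (f y) \<le> M"
  shows "integrable circle f"
  by (rule circle.integrable_const_bound[of _ M]) (use assms in auto)

text \<open>Centred at \<open>y0\<close>, so that the Fourier series evaluated at \<open>y0\<close>
  is the plain sum of the coefficients.\<close>

definition harmonic :: "real \<Rightarrow> int \<Rightarrow> real \<Rightarrow> complex" where
  "harmonic y0 q y = exp (\<i> * complex_of_real (real_of_int q * (y - y0)))"

lemma harmonic_measurable [measurable]: "harmonic y0 q \<in> borel_measurable borel"
  unfolding harmonic_def by (intro borel_measurable_continuous_onI continuous_intros)

lemma norm_harmonic [simp]: "cmod (harmonic y0 q y) = 1"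
  by (simp add: harmonic_def)

lemma harmonic_mult: "harmonic y0 p y * harmonic y0 q y = harmonic y0 (p + q) y"
  by (simp add: harmonic_def exp_add[symmetric] algebra_simps)

lemma cnj_harmonic: "cnj (harmonic y0 q y) = harmonic y0 (- q) y"
  by (simp add: harmonic_def exp_cnj)

lemma harmonic_0 [simp]: "harmonic y0 0 y = 1"
  by (simp add: harmonic_def)

lemma integral_harmonic: "integral\<^sup>L circle (harmonic y0 q) = (if q = 0 then 2 * pi else 0)"
proof (cases "q = 0")
  case True
  have "measure circle (space circle) = 2 * pi"
    unfolding space_circle by (simp add: circle_def measure_restrict_space)
  moreover have "harmonic y0 q = (\<lambda>_. 1)" using True by (auto simp: fun_eq_iff)
  ultimately show ?thesis using True by (simp add: scaleR_conv_of_real)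
next
  case False
  define F where "F y = harmonic y0 q y / (\<i> * of_int q)" for y
  have "(LBINT y=ereal 0..ereal (2 * pi). harmonic y0 q y) = F (2 * pi) - F 0"
  proof (rule interval_integral_FTC_finite)
    show "continuous_on {min 0 (2 * pi)..max 0 (2 * pi)} (harmonic y0 q)"
      unfolding harmonic_def by (intro continuous_intros)
    fix y
    have "((\<lambda>y. \<i> * complex_of_real (real_of_int q * (y - y0))) has_vector_derivative \<i> * of_int q) (at y)"
      by (auto intro!: derivative_eq_intros)
    then have "(exp \<circ> (\<lambda>y. \<i> * complex_of_real (real_of_int q * (y - y0))) has_vector_derivative \<i> * of_int q * harmonic y0 q y) (at y)"
      unfolding harmonic_def by (rule field_vector_diff_chain_at) (rule DERIV_exp)
    then have "(harmonic y0 q has_vector_derivative \<i> * of_int q * harmonic y0 q y) (at y)"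
      by (simp add: o_def harmonic_def[abs_def])
    then have "((\<lambda>y. (1 / (\<i> * of_int q)) * harmonic y0 q y) has_vector_derivative (1 / (\<i> * of_int q)) * (\<i> * of_int q * harmonic y0 q y)) (at y)"
      by (rule has_vector_derivative_mult_right)
    then show "(F has_vector_derivative harmonic y0 q y) (at y within {min 0 (2 * pi)..max 0 (2 * pi)})"
      using False by (simp add: F_def[abs_def] has_vector_derivative_at_within)
  qed
  also have "F (2 * pi) - F 0 = 0"
    using periodic_int[of "\<lambda>y. exp (\<i> * complex_of_real y)" "- real_of_int q * y0" q, OF exp_i_periodic]
    by (simp add: F_def harmonic_def algebra_simps)
  also have "(LBINT y=ereal 0..ereal (2 * pi). harmonic y0 q y) = integral\<^sup>L circle (harmonic y0 q)"
    unfolding circle_integral by (rule interval_integral_Icc) simp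
  finally show ?thesis using False by simp
qed

text \<open>\<open>P\<close> is the orthogonal projection of \<open>g\<close> onto the harmonics in
  \<open>F\<close>. The inner products of \<open>P\<close> with \<open>g\<close> and with itself
  both equal \<open>K\<close>, so the squared distance from \<open>g\<close> to \<open>P\<close> is
  the squared norm of \<open>g\<close> minus \<open>K\<close>, and it is nonnegative.\<close>

lemma Bessel:
  assumes [measurable]: "g \<in> borel_measurable borel" and bd: "\<And>y. cmod (g y) \<le> M" and F: "finite F"
  shows "(\<Sum>q\<in>F. (cmod (integral\<^sup>L circle (\<lambda>y. harmonic y0 (- q) y * g y)))\<^sup>2) \<le> 2 * pi * (\<integral>y. (cmod (g y))\<^sup>2 \<partial>circle)"
proof -
  define c where "c q = integral\<^sup>L circle (\<lambda>y. harmonic y0 (- q) y * g y)" for q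
  define P where "P y = (\<Sum>q\<in>F. c q / (2 * pi) * harmonic y0 q y)" for y
  define K where "K = (\<Sum>q\<in>F. (cmod (c q))\<^sup>2) / (2 * pi)"
  have [measurable]: "P \<in> borel_measurable borel" unfolding P_def by measurable
  have cP: "cnj (P y) = (\<Sum>q\<in>F. cnj (c q) / (2 * pi) * harmonic y0 (- q) y)" for y
    by (simp add: P_def cnj_harmonic)
  have M: "M \<ge> 0" using bd[of 0] norm_ge_zero order_trans by blast
  define N where "N = (\<Sum>q\<in>F. cmod (c q / (2 * pi)))"
  have PN: "cmod (P y) \<le> N" for y
    unfolding P_def N_def by (rule order.trans[OF norm_sum]) (simp add: norm_mult norm_divide)
  have N: "N \<ge> 0" using PN[of 0] norm_ge_zero order_trans by blast
  have hg: "integrable circle (\<lambda>y. harmonic y0 q y * g y)" for q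
    by (rule integrable_circle_bounded[of _ M]) (auto simp: norm_mult bd)
  have hP: "integrable circle (\<lambda>y. harmonic y0 q y * P y)" for q
    by (rule integrable_circle_bounded[of _ N]) (auto simp: norm_mult PN)
  have cc: "cnj z * z = complex_of_real ((cmod z)\<^sup>2)" for z
    by (simp only: complex_norm_square mult.commute)
  have i1: "(\<integral>y. cnj (P y) * g y \<partial>circle) = K"
  proof -
    have "(\<integral>y. cnj (P y) * g y \<partial>circle) = (\<integral>y. (\<Sum>q\<in>F. cnj (c q) / (2 * pi) * (harmonic y0 (- q) y * g y)) \<partial>circle)"
      by (simp add: cP sum_distrib_left mult_ac)
    also have "\<dots> = (\<Sum>q\<in>F. cnj (c q) / (2 * pi) * c q)"
      by (subst Bochner_Integration.integral_sum) (auto simp: c_def hg)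
    also have "\<dots> = K" by (simp add: K_def cc sum_divide_distrib)
    finally show ?thesis .
  qed
  have i2: "(\<integral>y. cnj (P y) * P y \<partial>circle) = K"
  proof -
    have hP': "(\<integral>y. harmonic y0 (- q) y * P y \<partial>circle) = c q" if "q \<in> F" for q
    proof -
      have "(\<integral>y. harmonic y0 (- q) y * P y \<partial>circle) = (\<integral>y. (\<Sum>p\<in>F. c p / (2 * pi) * harmonic y0 (p - q) y) \<partial>circle)"
      proof (rule Bochner_Integration.integral_cong[OF refl])
        fix y
        have "harmonic y0 (- q) y * (c p / (2 * pi) * harmonic y0 p y) = c p / (2 * pi) * harmonic y0 (p - q) y" for p
          using harmonic_mult[of y0 "- q" y p] by (simp add: mult_ac)
        then show "harmonic y0 (- q) y * P y = (\<Sum>p\<in>F. c p / (2 * pi) * harmonic y0 (p - q) y)"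
          unfolding P_def sum_distrib_left by (intro sum.cong refl)
      qed
      also have "\<dots> = (\<Sum>p\<in>F. c p / (2 * pi) * (if p - q = 0 then 2 * pi else 0))"
        by (subst Bochner_Integration.integral_sum, intro integrable_mult_right integrable_circle_bounded[of _ 1])
           (simp_all add: integral_harmonic)
      also have "\<dots> = (\<Sum>p\<in>F. if p = q then c p else 0)" by (intro sum.cong) auto
      also have "\<dots> = c q" using F that by simp
      finally show ?thesis .
    qed
    have "cnj (P y) * P y = (\<Sum>q\<in>F. cnj (c q) / (2 * pi) * (harmonic y0 (- q) y * P y))" for y
      unfolding cP by (simp add: sum_distrib_right mult.assoc)
    then have "(\<integral>y. cnj (P y) * P y \<partial>circle) = (\<integral>y. (\<Sum>q\<in>F. cnj (c q) / (2 * pi) * (harmonic y0 (- q) y * P y)) \<partial>circle)"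
      by simp
    also have "\<dots> = (\<Sum>q\<in>F. cnj (c q) / (2 * pi) * c q)"
      by (subst Bochner_Integration.integral_sum) (auto simp: hP' hP)
    also have "\<dots> = K" by (simp add: K_def cc sum_divide_distrib)
    finally show ?thesis .
  qed
  have "(\<integral>y. cnj (g y) * P y \<partial>circle) = cnj (\<integral>y. cnj (P y) * g y \<partial>circle)"
    by (subst Bochner_Integration.integral_cnj[symmetric]) (simp add: mult.commute)
  then have i3: "(\<integral>y. cnj (g y) * P y \<partial>circle) = K" unfolding i1 by simp
  have intab: "integrable circle (\<lambda>y. cnj (a y) * b y)"
    if [measurable]: "a \<in> borel_measurable borel" "b \<in> borel_measurable borel"
      and "\<And>y. cmod (a y) \<le> A" "\<And>y. cmod (b y) \<le> B" "0 \<le> A" for a b A B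
  proof (rule integrable_circle_bounded[of _ "A * B"])
    have "cnj \<in> borel_measurable borel"
      by (intro borel_measurable_continuous_onI continuous_intros)
    from measurable_compose[OF that(1) this] show "(\<lambda>y. cnj (a y) * b y) \<in> borel_measurable borel" by measurable
  qed (use that in \<open>auto simp: norm_mult intro!: mult_mono\<close>)
  have int1: "integrable circle (\<lambda>y. cnj (P y) * g y)" by (rule intab[of _ _ N M]) (use PN bd N in auto)
  have int2: "integrable circle (\<lambda>y. cnj (P y) * P y)" by (rule intab[of _ _ N N]) (use PN N in auto)
  have int3: "integrable circle (\<lambda>y. cnj (g y) * P y)" by (rule intab[of _ _ M N]) (use PN bd M in auto)
  have int4: "integrable circle (\<lambda>y. cnj (g y) * g y)" by (rule intab[of _ _ M M]) (use bd M in auto)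
  note int = int1 int2 int3 int4
  have "complex_of_real (\<integral>y. (cmod (g y - P y))\<^sup>2 \<partial>circle) = (\<integral>y. cnj (g y - P y) * (g y - P y) \<partial>circle)"
    unfolding cc by (rule integral_complex_of_real[symmetric])
  also have "\<dots> = (\<integral>y. (cnj (g y) * g y - cnj (g y) * P y) - (cnj (P y) * g y - cnj (P y) * P y) \<partial>circle)"
    by (simp add: algebra_simps)
  also have "\<dots> = (\<integral>y. cnj (g y) * g y \<partial>circle) - K"
    using int by (subst Bochner_Integration.integral_diff, simp, simp, subst (1 2) Bochner_Integration.integral_diff) (auto simp: i1 i2 i3)
  also have "(\<integral>y. cnj (g y) * g y \<partial>circle) = complex_of_real (\<integral>y. (cmod (g y))\<^sup>2 \<partial>circle)"
    unfolding cc by (rule integral_complex_of_real)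
  finally have "(\<integral>y. (cmod (g y - P y))\<^sup>2 \<partial>circle) = (\<integral>y. (cmod (g y))\<^sup>2 \<partial>circle) - K"
    by (simp flip: of_real_diff)
  moreover have "0 \<le> (\<integral>y. (cmod (g y - P y))\<^sup>2 \<partial>circle)" by simp
  ultimately have "K \<le> (\<integral>y. (cmod (g y))\<^sup>2 \<partial>circle)" by linarith
  then show ?thesis unfolding K_def c_def[symmetric] by (simp add: divide_le_eq mult.commute)
qed

text \<open>Along distinct indices the Bessel bound makes the squared coefficients summable, so they
  tend to 0.\<close>

lemma Riemann_Lebesgue_circle:
  assumes "g \<in> borel_measurable borel" "\<And>y. cmod (g y) \<le> M" and \<sigma>: "inj \<sigma>"
  shows "(\<lambda>n :: nat. integral\<^sup>L circle (\<lambda>y. harmonic y0 (- \<sigma> n) y * g y)) \<longlonglongrightarrow> 0"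
proof -
  let ?c = "\<lambda>q. integral\<^sup>L circle (\<lambda>y. harmonic y0 (- q) y * g y)"
  have "summable (\<lambda>n. (cmod (?c (\<sigma> n)))\<^sup>2)"
  proof (rule summableI_nonneg_bounded)
    fix n
    have "(\<Sum>i<n. (cmod (?c (\<sigma> i)))\<^sup>2) = (\<Sum>q\<in>\<sigma> ` {..<n}. (cmod (?c q))\<^sup>2)"
      by (subst sum.reindex) (auto intro: inj_on_subset[OF \<sigma>])
    also have "\<dots> \<le> 2 * pi * (\<integral>y. (cmod (g y))\<^sup>2 \<partial>circle)"
      by (rule Bessel[OF assms(1,2)]) auto
    finally show "(\<Sum>i<n. (cmod (?c (\<sigma> i)))\<^sup>2) \<le> 2 * pi * (\<integral>y. (cmod (g y))\<^sup>2 \<partial>circle)" .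
  qed simp
  then have "(\<lambda>n. (cmod (?c (\<sigma> n)))\<^sup>2) \<longlonglongrightarrow> 0" by (rule summable_LIMSEQ_zero)
  then have "(\<lambda>n. sqrt ((cmod (?c (\<sigma> n)))\<^sup>2)) \<longlonglongrightarrow> sqrt 0" by (rule tendsto_real_sqrt)
  then have "(\<lambda>n. cmod (?c (\<sigma> n))) \<longlonglongrightarrow> 0" by simp
  then show ?thesis by (rule tendsto_norm_zero_cancel)
qed

text \<open>
  Dividing the increment of \<open>h\<close> by that of the first harmonic makes the partial sums telescope.
\<close>

lemma Fourier_series_tendsto:
  fixes h :: "real \<Rightarrow> complex"
  assumes per: "\<And>y. h (y + 2 * pi) = h y" and lip: "\<And>y y'. cmod (h y - h y') \<le> M * \<bar>y - y'\<bar>"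
    and cont: "continuous_on UNIV h"
  shows "(\<lambda>n. \<Sum>q\<in>{- int n..int n}. integral\<^sup>L circle (\<lambda>y. harmonic y0 (- q) y * h y)) \<longlonglongrightarrow> 2 * pi * h y0"
proof -
  \<comment> \<open>Where \<open>harmonic y0 1 y = 1\<close>, division by zero gives
    \<open>g y = 0\<close>. The factorisation of \<open>h\<close> still holds there, since the
    Lipschitz bound forces \<open>h y = h y0\<close>.\<close>
  define g where "g y = (h y - h y0) / (harmonic y0 1 y - 1)" for y
  define c where "c q = integral\<^sup>L circle (\<lambda>y. harmonic y0 (- q) y * g y)" for q
  have [measurable]: "h \<in> borel_measurable borel" by (rule borel_measurable_continuous_onI[OF cont])
  have [measurable]: "g \<in> borel_measurable borel" unfolding g_def by measurable
  have b: "cmod (h y - h y0) \<le> 2 * M * cmod (harmonic y0 1 y - 1)" for y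
    using periodic_Lipschitz_bound[OF per lip, of y y0] by (simp add: harmonic_def)
  have M: "0 \<le> M" using order.trans[OF norm_ge_zero lip[of 1 0]] by simp
  have gM: "cmod (g y) \<le> 2 * M" for y
    using b[of y] M by (cases "harmonic y0 1 y = 1") (auto simp: g_def norm_divide field_simps)
  have h: "h y = h y0 + (harmonic y0 1 y - 1) * g y" for y
    using b[of y] by (cases "harmonic y0 1 y = 1") (auto simp: g_def)
  have ig: "integrable circle (\<lambda>y. harmonic y0 q y * g y)" for q
    by (rule integrable_circle_bounded[of _ "2 * M"]) (auto simp: norm_mult gM)
  have ih: "integrable circle (harmonic y0 q)" for q
    by (rule integrable_circle_bounded[of _ 1]) auto
  \<comment> \<open>Multiplication by the first harmonic shifts the index of a coefficient by one,
    whence the difference of neighbouring values of \<open>c\<close>.\<close>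
  have coeff: "integral\<^sup>L circle (\<lambda>y. harmonic y0 (- q) y * h y) = (if q = 0 then 2 * pi * h y0 else 0) + (c (q - 1) - c q)" for q
  proof -
    have eq: "harmonic y0 (- q) y * h y = h y0 * harmonic y0 (- q) y + (harmonic y0 (- (q - 1)) y * g y - harmonic y0 (- q) y * g y)" for y
      unfolding h[of y] using harmonic_mult[of y0 "- q" y 1] by (simp add: algebra_simps)
    have "integral\<^sup>L circle (\<lambda>y. harmonic y0 (- q) y * h y) = integral\<^sup>L circle (\<lambda>y. h y0 * harmonic y0 (- q) y) + (c (q - 1) - c q)"
      unfolding eq c_def
      by (subst Bochner_Integration.integral_add[OF integrable_mult_right[OF ih] Bochner_Integration.integrable_diff[OF ig ig]],
          subst Bochner_Integration.integral_diff[OF ig ig]) (rule refl)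
    also have "integral\<^sup>L circle (\<lambda>y. h y0 * harmonic y0 (- q) y) = (if q = 0 then 2 * pi * h y0 else 0)"
      unfolding integral_mult_right_zero integral_harmonic by simp
    finally show ?thesis .
  qed
  have "(\<Sum>q\<in>{- int n..int n}. integral\<^sup>L circle (\<lambda>y. harmonic y0 (- q) y * h y)) = 2 * pi * h y0 + (c (- int n - 1) - c (int n))" for n
  proof -
    have "(\<Sum>q\<in>{- int n..int n}. c (q - 1) - c q) = c (- int n - 1) - c (int n)"
    proof (induction n)
      case (Suc n)
      have "{- int (Suc n)..int (Suc n)} = insert (- int (Suc n)) (insert (int (Suc n)) {- int n..int n})" by auto
      moreover have "c (- int n - 1) = c (- 1 - int n)" by (rule arg_cong[of _ _ c]) simp
      ultimately show ?case using Suc by (simp add: algebra_simps)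
    qed simp
    then show ?thesis unfolding coeff by (simp add: sum.distrib)
  qed
  moreover have "(\<lambda>n. c (- int n - 1)) \<longlonglongrightarrow> 0" "(\<lambda>n. c (int n)) \<longlonglongrightarrow> 0"
    unfolding c_def by (rule Riemann_Lebesgue_circle[of g "2 * M" "\<lambda>n. - int n - 1"] Riemann_Lebesgue_circle[of g "2 * M" int]; simp add: gM inj_def)+
  ultimately show ?thesis using tendsto_add[OF tendsto_const tendsto_diff[of "\<lambda>n. c (- int n - 1)" 0 sequentially "\<lambda>n. c (int n)" 0]] by fastforce
qed

section \<open>Combining the plane and the circle\<close>

lemma nn_integral_plane:
  assumes [measurable]: "f \<in> borel_measurable (borel :: (real \<times> real) measure)"
  shows "(\<integral>\<^sup>+p. f p \<partial>lborel) = (\<integral>\<^sup>+x. \<integral>\<^sup>+t. f (x, t) \<partial>lborel \<partial>lborel)"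
  by (subst lborel_prod[symmetric], rule lborel.nn_integral_fst[symmetric]) (simp add: lborel_prod)

lemma pair_borel_measurable [measurable]:
  "fst \<in> borel_measurable (borel :: ('a::second_countable_topology \<times> 'b::second_countable_topology) measure)"
  "snd \<in> borel_measurable (borel :: ('a \<times> 'b) measure)"
  by (simp_all flip: borel_prod)

lemma plane_decay_integrable: "integrable lborel (\<lambda>p. bracket (fst p) powr (- 2) * bracket (snd p) powr (- 2))"
proof (rule integrableI_bounded)
  let ?a = "\<lambda>x. ennreal (bracket x powr (- 2))"
  have "(\<integral>\<^sup>+p. ennreal (norm (bracket (fst p) powr (- 2) * bracket (snd p) powr (- 2))) \<partial>lborel) =
    (\<integral>\<^sup>+x. \<integral>\<^sup>+t. ?a x * ?a t \<partial>lborel \<partial>lborel)"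
    by (subst nn_integral_plane) (auto simp: ennreal_mult)
  also have "\<dots> = (\<integral>\<^sup>+x. ?a x * (\<integral>\<^sup>+t. ?a t \<partial>lborel) \<partial>lborel)"
    by (intro nn_integral_cong nn_integral_cmult) auto
  also have "\<dots> = (\<integral>\<^sup>+x. ?a x \<partial>lborel) * (\<integral>\<^sup>+t. ?a t \<partial>lborel)"
    by (rule nn_integral_multc) auto
  also have "\<dots> \<le> ennreal (bracket_int 2) * ennreal (bracket_int 2)"
    using nn_integral_bracket_powr[of 2] by (intro mult_mono) auto
  also have "\<dots> < \<infinity>" by (simp add: ennreal_mult_less_top)
  finally show "(\<integral>\<^sup>+p. ennreal (norm (bracket (fst p) powr (- 2) * bracket (snd p) powr (- 2))) \<partial>lborel) < \<infinity>" .
qed measurable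

text \<open>Counterpart of \<open>decay\<close> on the dual group, where the lattice variable is
  unbounded and has to decay as well.\<close>

definition freq_decay :: "freq \<Rightarrow> real" where
  "freq_decay w = bracket (fst w) powr (- 2) * bracket (real_of_int (fst (snd w))) powr (- 2) * bracket (snd (snd w)) powr (- 2)"

lemma freq_decay_weight: "freq_decay w = 1 / (freq_weight w)\<^sup>2"
  by (simp add: freq_decay_def freq_weight_def bracket_powr_2 power_mult_distrib)

lemma freq_decay_pos: "0 < freq_decay w"
  by (simp add: freq_decay_def)

lemma freq_decay_measurable [measurable]: "freq_decay \<in> borel_measurable freq_measure"
  unfolding freq_decay_def[abs_def] by measurable

lemma freq_decay_integrable: "integrable freq_measure freq_decay"
proof (rule integrableI_bounded)
  let ?a = "\<lambda>x. ennreal (bracket x powr (- 2))"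
  have "(\<integral>\<^sup>+w. ennreal (norm (freq_decay w)) \<partial>freq_measure) =
    (\<integral>\<^sup>+q. \<integral>\<^sup>+x. \<integral>\<^sup>+t. (?a (real_of_int q) * ?a x) * ?a t \<partial>lborel \<partial>lborel \<partial>count_space UNIV)"
    by (subst nn_integral_freq) (auto simp: freq_decay_def ennreal_mult mult_ac)
  also have "\<dots> = (\<integral>\<^sup>+q. \<integral>\<^sup>+x. (?a (real_of_int q) * ?a x) * (\<integral>\<^sup>+t. ?a t \<partial>lborel) \<partial>lborel \<partial>count_space UNIV)"
    by (intro nn_integral_cong nn_integral_cmult) auto
  also have "\<dots> = (\<integral>\<^sup>+q. ?a (real_of_int q) * (\<integral>\<^sup>+x. ?a x \<partial>lborel) * (\<integral>\<^sup>+t. ?a t \<partial>lborel) \<partial>count_space UNIV)"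
    by (intro nn_integral_cong) (simp add: nn_integral_multc nn_integral_cmult)
  also have "\<dots> = (\<integral>\<^sup>+q. ?a (real_of_int q - 0) \<partial>count_space UNIV) * (\<integral>\<^sup>+x. ?a x \<partial>lborel) * (\<integral>\<^sup>+t. ?a t \<partial>lborel)"
    by (simp add: nn_integral_multc)
  also have "\<dots> \<le> ennreal (2 powr 2 * bracket_int 2) * ennreal (bracket_int 2) * ennreal (bracket_int 2)"
    using nn_integral_bracket_powr[of 2] nn_integral_int_bracket[of 2 0] by (intro mult_mono) auto
  also have "\<dots> < \<infinity>" by (simp add: ennreal_mult_less_top)
  finally show "(\<integral>\<^sup>+w. ennreal (norm (freq_decay w)) \<partial>freq_measure) < \<infinity>" .
qed measurable

lemma fourier_freq_decay:
  assumes "schwartz f"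
  shows "\<exists>C\<ge>0. \<forall>w. freq_weight w ^ k * cmod (fourier f w) \<le> C * freq_decay w"
proof -
  obtain C where C: "\<And>w. freq_weight w ^ (k + 2) * cmod (fourier f w) \<le> C" using fourier_decay[OF assms] by blast
  have p: "freq_weight w > 0" for w using freq_weight_ge_1[of w] by linarith
  have "freq_weight w ^ k * cmod (fourier f w) \<le> C * freq_decay w" for w
    using C[of w] p[of w] by (simp add: freq_decay_weight power_add power2_eq_square field_simps)
  moreover have "C \<ge> 0"
    using C[of 0] p[of 0] by (smt (verit) mult_nonneg_nonneg norm_ge_zero zero_le_power)
  ultimately show ?thesis by blast
qed

lemma character_pair_measurable:
  "(\<lambda>(w :: freq, z). character (- fst w) (- fst (snd w)) (- snd (snd w)) z) \<in> borel_measurable (freq_measure \<Otimes>\<^sub>M lborel)"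
  "(\<lambda>(w :: freq, z). character (fst w) (fst (snd w)) (snd (snd w)) z) \<in> borel_measurable (freq_measure \<Otimes>\<^sub>M lborel)"
proof -
  have [measurable]: "(\<lambda>a. fst (fst a)) \<in> borel_measurable (freq_measure \<Otimes>\<^sub>M (lborel :: point measure))"
    "(\<lambda>a. real_of_int (fst (snd (fst a)))) \<in> borel_measurable (freq_measure \<Otimes>\<^sub>M (lborel :: point measure))"
    "(\<lambda>a. snd (snd (fst a))) \<in> borel_measurable (freq_measure \<Otimes>\<^sub>M (lborel :: point measure))"
    "(\<lambda>a. fst (snd a)) \<in> borel_measurable (freq_measure \<Otimes>\<^sub>M (lborel :: point measure))"
    "(\<lambda>a. fst (snd (snd a))) \<in> borel_measurable (freq_measure \<Otimes>\<^sub>M (lborel :: point measure))"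
    "(\<lambda>a. snd (snd (snd a))) \<in> borel_measurable (freq_measure \<Otimes>\<^sub>M (lborel :: point measure))"
    by (auto intro!: measurable_compose[OF measurable_fst] measurable_compose[OF measurable_snd] measurable_compose[OF measurable_int_freq])
  have [measurable]: "(exp :: complex \<Rightarrow> complex) \<in> borel_measurable borel"
    by (intro borel_measurable_continuous_onI continuous_intros)
  show "(\<lambda>(w :: freq, z). character (- fst w) (- fst (snd w)) (- snd (snd w)) z) \<in> borel_measurable (freq_measure \<Otimes>\<^sub>M lborel)"
    "(\<lambda>(w :: freq, z). character (fst w) (fst (snd w)) (snd (snd w)) z) \<in> borel_measurable (freq_measure \<Otimes>\<^sub>M lborel)"
    unfolding character_def case_prod_beta' of_int_minus by measurable
qed

lemma fourier_eq': "fourier f w = (\<integral>z. indicator period_cell z *\<^sub>R (f z * character (- fst w) (- fst (snd w)) (- snd (snd w)) z) \<partial>lborel)"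
  by (cases w) (simp add: fourier_eq set_lebesgue_integral_def)

lemma fourier_measurable:
  assumes [measurable]: "f \<in> borel_measurable borel"
  shows "fourier f \<in> borel_measurable freq_measure"
proof -
  note [measurable] = character_pair_measurable(1)
  have "(\<lambda>w. \<integral>z. indicator period_cell z *\<^sub>R (f z * character (- fst w) (- fst (snd w)) (- snd (snd w)) z) \<partial>lborel) \<in> borel_measurable freq_measure"
    by (rule lborel.borel_measurable_lebesgue_integral) (simp add: case_prod_beta')
  then show ?thesis by (simp add: fourier_eq'[abs_def])
qed

lemma fourier_integrable:
  assumes "schwartz f" shows "integrable freq_measure (fourier f)"
proof -
  obtain C where "\<And>w. freq_weight w ^ 0 * cmod (fourier f w) \<le> C * freq_decay w"
    using fourier_freq_decay[OF assms] by blast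
  then show ?thesis
    by (intro Bochner_Integration.integrable_bound[OF integrable_mult_right[OF freq_decay_integrable, of C]]
      fourier_measurable schwartz_measurable assms AE_I2) (auto intro: order.trans[OF _ abs_ge_self])
qed

lemma measurable_of_int_freq [measurable]: "(\<lambda>w. h (fst (snd w))) \<in> borel_measurable freq_measure"
  by (rule measurable_compose[OF measurable_int_freq]) simp

lemma integral_freq_slice:
  fixes g :: "freq \<Rightarrow> complex"
  assumes [measurable]: "g \<in> borel_measurable freq_measure"
  shows "(\<integral>w. indicator {q} (fst (snd w)) *\<^sub>R g w \<partial>freq_measure) = (\<integral>s. g (fst s, q, snd s) \<partial>lborel)"
proof -
  have [measurable]: "(\<lambda>s :: real \<times> real. (fst s, q, snd s)) \<in> measurable lborel freq_measure"
  proof -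
    have "(\<lambda>s :: real \<times> real. (fst s, q, snd s)) \<in> measurable lborel (borel \<Otimes>\<^sub>M (count_space UNIV \<Otimes>\<^sub>M borel))"
      by measurable
    then show ?thesis by (simp only: measurable_cong_sets[OF refl sets_freq_measure])
  qed
  have [measurable]: "(\<lambda>w :: freq. indicator {q} (fst (snd w)) :: real) \<in> borel_measurable freq_measure"
    "(\<lambda>w :: freq. indicator {q} (fst (snd w)) :: ennreal) \<in> borel_measurable freq_measure"
    by (rule measurable_of_int_freq)+
  have "distr lborel freq_measure (\<lambda>s. (fst s, q, snd s)) = density freq_measure (\<lambda>w. indicator {q} (fst (snd w)))"
  proof (rule measure_eqI)
    fix A assume "A \<in> sets (distr lborel freq_measure (\<lambda>s :: real \<times> real. (fst s, q, snd s)))"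
    then have A [measurable]: "A \<in> sets freq_measure" by simp
    have [measurable]: "(indicator A :: _ \<Rightarrow> ennreal) \<in> borel_measurable freq_measure" by simp
    have "emeasure (distr lborel freq_measure (\<lambda>s :: real \<times> real. (fst s, q, snd s))) A = (\<integral>\<^sup>+s. indicator A (fst s, q, snd s) \<partial>lborel)"
      by (subst nn_integral_indicator[symmetric], simp, subst nn_integral_distr) simp_all
    also have "\<dots> = (\<integral>\<^sup>+x. \<integral>\<^sup>+t. indicator A (x, q, t) \<partial>lborel \<partial>lborel)"
      by (subst nn_integral_plane) auto
    also have "\<dots> = (\<integral>\<^sup>+r. (\<integral>\<^sup>+x. \<integral>\<^sup>+t. indicator A (x, r, t) \<partial>lborel \<partial>lborel) * indicator {q} r \<partial>count_space UNIV)"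
      by (simp add: nn_integral_count_space_indicator[symmetric] nn_integral_count_space_finite)
    also have "\<dots> = (\<integral>\<^sup>+w. indicator {q} (fst (snd w)) * indicator A w \<partial>freq_measure)"
      by (subst nn_integral_freq) (auto intro!: nn_integral_cong simp: indicator_def)
    also have "\<dots> = emeasure (density freq_measure (\<lambda>w. indicator {q} (fst (snd w)))) A"
      by (rule emeasure_density[symmetric]) auto
    finally show "emeasure (distr lborel freq_measure (\<lambda>s. (fst s, q, snd s))) A = emeasure (density freq_measure (\<lambda>w. indicator {q} (fst (snd w)))) A" .
  qed simp
  then have "integral\<^sup>L (distr lborel freq_measure (\<lambda>s. (fst s, q, snd s))) g = integral\<^sup>L (density freq_measure (\<lambda>w. ennreal (indicator {q} (fst (snd w))))) g"
    by (simp add: ennreal_indicator)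
  then show ?thesis by (simp add: integral_distr integral_density)
qed

text \<open>Symmetric partial sums over the lattice are the form in which
  \<open>Fourier_series_tendsto\<close> provides its limit.\<close>

lemma integral_freq_tendsto:
  fixes g :: "freq \<Rightarrow> complex"
  assumes g: "integrable freq_measure g"
  shows "(\<lambda>n. \<Sum>q\<in>{- int n..int n}. \<integral>s. g (fst s, q, snd s) \<partial>lborel) \<longlonglongrightarrow> integral\<^sup>L freq_measure g"
proof -
  have [measurable]: "g \<in> borel_measurable freq_measure" using g by auto
  have [measurable]: "(\<lambda>w :: freq. indicator Q (fst (snd w)) :: real) \<in> borel_measurable freq_measure" for Q
    by (rule measurable_of_int_freq)
  have int: "integrable freq_measure (\<lambda>w. indicator Q (fst (snd w)) *\<^sub>R g w)" for Q
    by (rule Bochner_Integration.integrable_bound[OF g]) (auto simp: indicator_def)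
  have "(\<integral>w. indicator {- int n..int n} (fst (snd w)) *\<^sub>R g w \<partial>freq_measure) = (\<Sum>q\<in>{- int n..int n}. \<integral>s. g (fst s, q, snd s) \<partial>lborel)" for n
  proof -
    have eq: "indicator {- int n..int n} (fst (snd w)) *\<^sub>R g w = (\<Sum>q\<in>{- int n..int n}. indicator {q} (fst (snd w)) *\<^sub>R g w)" for w
      by (simp add: scaleR_sum_left[symmetric] indicator_def)
    show ?thesis unfolding eq
      by (subst Bochner_Integration.integral_sum) (simp_all only: int integral_freq_slice[OF \<open>g \<in> borel_measurable freq_measure\<close>])
  qed
  moreover have "(\<lambda>n. \<integral>w. indicator {- int n..int n} (fst (snd w)) *\<^sub>R g w \<partial>freq_measure) \<longlonglongrightarrow> integral\<^sup>L freq_measure g"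
  proof (rule integral_dominated_convergence[where w="\<lambda>w. norm (g w)"])
    show "AE w in freq_measure. (\<lambda>n. indicator {- int n..int n} (fst (snd w)) *\<^sub>R g w) \<longlonglongrightarrow> g w"
    proof (rule AE_I2)
      fix w :: freq
      have "eventually (\<lambda>n. indicator {- int n..int n} (fst (snd w)) *\<^sub>R g w = g w) sequentially"
        by (rule eventually_sequentiallyI[of "nat \<bar>fst (snd w)\<bar>"]) (auto simp: indicator_def)
      then show "(\<lambda>n. indicator {- int n..int n} (fst (snd w)) *\<^sub>R g w) \<longlonglongrightarrow> g w"
        by (rule tendsto_eventually)
    qed
  qed (use g in \<open>auto simp: indicator_def\<close>)
  ultimately show ?thesis by simp
qed

text \<open>The transform is taken in \<open>y\<close> alone. By \<open>fourier_slice_coeff\<close>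
  a transform in the plane then recovers \<open>fourier\<close>, which makes
  \<open>plane_inversion\<close> applicable for each \<open>q\<close>.\<close>

definition slice_coeff :: "(point \<Rightarrow> complex) \<Rightarrow> int \<Rightarrow> real \<times> real \<Rightarrow> complex" where
  "slice_coeff f q p = (\<integral>y. harmonic 0 (- q) y * f (fst p, y, snd p) \<partial>circle)"

lemma slice_coeff_bound:
  assumes "\<And>z. cmod (f z) \<le> M * decay z" "f \<in> borel_measurable borel"
  shows "cmod (slice_coeff f q p) \<le> (2 * pi * M) * (bracket (fst p) powr (- 2) * bracket (snd p) powr (- 2))"
proof -
  have m: "measure circle (space circle) = 2 * pi"
    unfolding space_circle by (simp add: circle_def measure_restrict_space)
  let ?d = "M * (bracket (fst p) powr (- 2) * bracket (snd p) powr (- 2))"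
  have b: "cmod (harmonic 0 (- q) y * f (fst p, y, snd p)) \<le> ?d" for y
    using assms(1)[of "(fst p, y, snd p)"] by (simp add: norm_mult decay_def)
  have [measurable]: "(\<lambda>y. f (fst p, y, snd p)) \<in> borel_measurable borel"
    by (rule measurable_compose[OF _ assms(2)]) (intro borel_measurable_continuous_onI continuous_intros)
  have "cmod (slice_coeff f q p) \<le> (\<integral>y. cmod (harmonic 0 (- q) y * f (fst p, y, snd p)) \<partial>circle)"
    unfolding slice_coeff_def by (rule integral_norm_bound)
  also have "\<dots> \<le> (\<integral>y. ?d \<partial>circle)"
    by (intro integral_mono b integrable_norm integrable_circle_bounded[of _ ?d]) auto
  also have "\<dots> = (2 * pi * M) * (bracket (fst p) powr (- 2) * bracket (snd p) powr (- 2))"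
    by (simp add: m)
  finally show ?thesis .
qed

lemma slice_coeff_continuous:
  assumes "schwartz f" shows "continuous_on UNIV (slice_coeff f q)"
proof -
  obtain M where M: "\<And>z. cmod (f z) \<le> M" using bounded_smoothD(3)[OF schwartz_bounded_smooth[OF assms]] by blast
  have cont: "continuous_on UNIV f" by (rule schwartz_continuous[OF assms])
  have [measurable]: "(\<lambda>y. f (fst p, y, snd p)) \<in> borel_measurable borel" for p :: "real \<times> real"
    by (rule measurable_compose[OF _ schwartz_measurable[OF assms]]) (intro borel_measurable_continuous_onI continuous_intros)
  show ?thesis
    unfolding continuous_on_sequentially
  proof (intro allI ballI impI, elim conjE)
    fix u :: "nat \<Rightarrow> real \<times> real" and p assume u: "u \<longlonglongrightarrow> p"
    show "(slice_coeff f q \<circ> u) \<longlonglongrightarrow> slice_coeff f q p"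
      unfolding slice_coeff_def o_def
    proof (rule integral_dominated_convergence[where w="\<lambda>_. M"])
      show "AE y in circle. (\<lambda>n. harmonic 0 (- q) y * f (fst (u n), y, snd (u n))) \<longlonglongrightarrow> harmonic 0 (- q) y * f (fst p, y, snd p)"
        by (intro AE_I2 tendsto_intros continuous_on_tendsto_compose[OF cont] u) auto
      show "AE y in circle. norm (harmonic 0 (- q) y * f (fst (u n), y, snd (u n))) \<le> M" for n
        by (simp add: norm_mult M)
    qed auto
  qed
qed

lemma slice_coeff_integrable:
  assumes "schwartz f" shows "integrable lborel (slice_coeff f q)"
proof -
  obtain M where M: "\<And>z. cmod (f z) \<le> M * decay z" using schwartz_decay[OF assms] by blast
  show ?thesis
  proof (rule Bochner_Integration.integrable_bound[OF integrable_mult_right[OF plane_decay_integrable, of "2 * pi * M"]])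
    show "slice_coeff f q \<in> borel_measurable lborel"
      using borel_measurable_continuous_onI[OF slice_coeff_continuous[OF assms]] by simp
  qed (rule AE_I2, rule order.trans[OF slice_coeff_bound[OF M schwartz_measurable[OF assms]]], simp only: real_norm_def abs_ge_self)
qed

lemma fourier_slice_coeff:
  assumes f: "schwartz f"
  shows "fourier f (fst s, q, snd s) = (\<integral>p. slice_coeff f q p * exp (- \<i> * complex_of_real (s \<bullet> p)) \<partial>lborel)"
proof -
  let ?E = "character (- fst s) (- q) (- snd s)"
  define G where "G z = indicator period_cell z *\<^sub>R (f z * ?E z)" for z
  have G: "integrable lborel G"
    using schwartz_integrable[OF schwartz_mult[OF f bounded_smooth_character]] unfolding set_integrable_def G_def .
  have [measurable]: "G \<in> borel_measurable borel" using G by auto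
  have [measurable]: "G \<in> borel_measurable (borel \<Otimes>\<^sub>M (borel \<Otimes>\<^sub>M borel))" by (simp add: borel_prod)
  have inner: "(\<integral>y. G (fst p, y, snd p) \<partial>lborel) = slice_coeff f q p * exp (- \<i> * complex_of_real (s \<bullet> p))" for p
  proof -
    have "?E (fst p, y, snd p) = harmonic 0 (- q) y * exp (- \<i> * complex_of_real (s \<bullet> p))" for y
      by (simp add: character_def harmonic_def inner_prod_def exp_add[symmetric] algebra_simps flip: exp_minus)
    then have "(\<integral>y. G (fst p, y, snd p) \<partial>lborel) = (\<integral>y. indicator {0..2 * pi} y *\<^sub>R (harmonic 0 (- q) y * f (fst p, y, snd p)) * exp (- \<i> * complex_of_real (s \<bullet> p)) \<partial>lborel)"
      by (intro Bochner_Integration.integral_cong refl) (simp add: G_def mem_period_cell indicator_def)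
    also have "\<dots> = (\<integral>y. indicator {0..2 * pi} y *\<^sub>R (harmonic 0 (- q) y * f (fst p, y, snd p)) \<partial>lborel) * exp (- \<i> * complex_of_real (s \<bullet> p))"
      by (rule integral_mult_left_zero)
    finally show ?thesis by (simp add: slice_coeff_def circle_integral set_lebesgue_integral_def)
  qed
  have "fourier f (fst s, q, snd s) = integral\<^sup>L (lborel \<Otimes>\<^sub>M lborel) G"
    by (simp add: fourier_eq set_lebesgue_integral_def G_def[abs_def] lborel_prod)
  also have "\<dots> = (\<integral>x. \<integral>w. G (x, w) \<partial>lborel \<partial>lborel)"
    by (rule lborel_pair.integral_fst'[OF lborel_measurable_point[OF G], symmetric])
  also have "\<dots> = (\<integral>x. \<integral>t. \<integral>y. G (x, y, t) \<partial>lborel \<partial>lborel \<partial>lborel)"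
  proof (rule integral_cong_AE)
    \<comment> \<open>Only almost every slice is integrable, so the order of the inner integrals is
      exchanged for almost every \<open>x\<close>.\<close>
    have "AE x in lborel. integrable lborel (\<lambda>w. G (x, w))"
      by (rule lborel_pair.AE_integrable_fst'[OF lborel_measurable_point[OF G]])
    then show "AE x in lborel. (\<integral>w. G (x, w) \<partial>lborel) = (\<integral>t. \<integral>y. G (x, y, t) \<partial>lborel \<partial>lborel)"
    proof eventually_elim
      case (elim x)
      then have "integrable (lborel \<Otimes>\<^sub>M lborel) (\<lambda>(y, t). G (x, y, t))" by (simp add: lborel_prod case_prod_beta')
      then have "(\<integral>t. \<integral>y. G (x, y, t) \<partial>lborel \<partial>lborel) = (\<integral>(y, t). G (x, y, t) \<partial>(lborel \<Otimes>\<^sub>M lborel))"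
        by (rule lborel_pair.integral_snd)
      then show ?case by (simp add: lborel_prod case_prod_beta')
    qed
  qed (simp_all add: lborel.borel_measurable_lebesgue_integral)
  also have "\<dots> = (\<integral>x. \<integral>t. slice_coeff f q (x, t) * exp (- \<i> * complex_of_real (s \<bullet> (x, t))) \<partial>lborel \<partial>lborel)"
    using inner[of "(_, _)"] by simp
  also have "\<dots> = (\<integral>p. slice_coeff f q p * exp (- \<i> * complex_of_real (s \<bullet> p)) \<partial>(lborel \<Otimes>\<^sub>M lborel))"
  proof (rule lborel_pair.integral_fst')
    have "(\<lambda>p. slice_coeff f q p * exp (- \<i> * complex_of_real (s \<bullet> p))) \<in> borel_measurable borel"
      by (intro borel_measurable_continuous_onI continuous_intros slice_coeff_continuous f)
    then show "integrable (lborel \<Otimes>\<^sub>M lborel) (\<lambda>p. slice_coeff f q p * exp (- \<i> * complex_of_real (s \<bullet> p)))"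
      unfolding lborel_prod
      by (intro Bochner_Integration.integrable_bound[OF slice_coeff_integrable[OF f, of q]]) (auto simp: norm_mult)
  qed
  finally show ?thesis by (simp add: lborel_prod)
qed

lemma schwartz_Lipschitz_y:
  assumes "schwartz f"
  shows "\<exists>M. \<forall>x t y y'. cmod (f (x, y, t) - f (x, y', t)) \<le> M * \<bar>y - y'\<bar>"
proof -
  let ?e = "(0, 1, 0) :: point"
  have sd: "schwartz (dir_deriv ?e f)" by (rule schwartz_dir_deriv[OF assms]) (simp add: Basis_point)
  obtain M where M: "\<And>z. cmod (dir_deriv ?e f z) \<le> M" using bounded_smoothD(3)[OF schwartz_bounded_smooth[OF sd]] by blast
  have "cmod (f (x, y, t) - f (x, y', t)) \<le> M * norm (y - y')" for x t y y'
  proof (rule differentiable_bound[of UNIV "\<lambda>y. f (x, y, t)" "\<lambda>y d. d *\<^sub>R dir_deriv ?e f (x, y, t)"])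
    show "((\<lambda>y. f (x, y, t)) has_derivative (\<lambda>d. d *\<^sub>R dir_deriv ?e f (x, y, t))) (at y within UNIV)" for y
      using has_vector_derivative_line[OF schwartzD(2)[OF assms], of "(x, 0, t)" ?e y]
      by (simp add: has_vector_derivative_def)
    show "onorm (\<lambda>d. d *\<^sub>R dir_deriv ?e f (x, y, t)) \<le> M" for y
      by (rule onorm_le) (simp add: M mult.commute[of M] mult_left_mono)
  qed auto
  then show ?thesis by (intro exI[of _ M]) simp
qed

text \<open>For each \<open>q\<close> the plane inversion returns the coefficient in
  \<open>y\<close> of \<open>f\<close> at the given \<open>x\<close> and \<open>t\<close>; summing
  over \<open>q\<close> is the Fourier series at \<open>y0\<close>. The constants are 4 pi^2 from
  the plane and 2 pi from the circle.\<close>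

theorem fourier_inversion:
  fixes f :: "point \<Rightarrow> complex"
  assumes f: "schwartz f"
  shows "(\<integral>w. fourier f w * character (fst w) (fst (snd w)) (snd (snd w)) z \<partial>freq_measure) = (2 * pi) ^ 3 * f z"
proof -
  obtain x y0 t where z: "z = (x, y0, t)" by (metis prod_cases3)
  let ?E = "\<lambda>w. character (fst w) (fst (snd w)) (snd (snd w)) z"
  obtain M where M: "\<And>x t y y'. cmod (f (x, y, t) - f (x, y', t)) \<le> M * \<bar>y - y'\<bar>" using schwartz_Lipschitz_y[OF f] by blast
  obtain N where N: "\<And>z. cmod (f z) \<le> N * decay z" "N \<ge> 0" using schwartz_decay[OF f] by blast
  have Em: "?E \<in> borel_measurable freq_measure"
  proof -
    have "(\<lambda>w. (w, z)) \<in> measurable freq_measure (freq_measure \<Otimes>\<^sub>M lborel)" by measurable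
    from measurable_compose[OF this character_pair_measurable(2)] show ?thesis by simp
  qed
  have fm: "fourier f \<in> borel_measurable freq_measure" by (intro fourier_measurable schwartz_measurable f)
  have int: "integrable freq_measure (\<lambda>w. fourier f w * ?E w)"
    by (rule Bochner_Integration.integrable_bound[OF fourier_integrable[OF f]]) (use Em fm in \<open>auto simp: norm_mult\<close>)
  have slice: "(\<integral>s. fourier f (fst s, q, snd s) * ?E (fst s, q, snd s) \<partial>lborel) = 4 * pi\<^sup>2 * integral\<^sup>L circle (\<lambda>y. harmonic y0 (- q) y * f (x, y, t))" for q
  proof -
    obtain C where C: "\<And>w. freq_weight w ^ 0 * cmod (fourier f w) \<le> C * freq_decay w" "C \<ge> 0"
      using fourier_freq_decay[OF f] by blast
    have "(\<lambda>s :: real \<times> real. (fst s, q, snd s)) \<in> measurable lborel (borel \<Otimes>\<^sub>M (count_space UNIV \<Otimes>\<^sub>M borel))"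
      by measurable
    then have "(\<lambda>s :: real \<times> real. (fst s, q, snd s)) \<in> measurable lborel freq_measure"
      by (simp only: measurable_cong_sets[OF refl sets_freq_measure])
    from measurable_compose[OF this fm] have m: "(\<lambda>s. fourier f (fst s, q, snd s)) \<in> borel_measurable lborel" .
    have "(\<integral>s. fourier f (fst s, q, snd s) * exp (\<i> * complex_of_real (s \<bullet> (x, t))) \<partial>lborel) = 4 * pi\<^sup>2 * slice_coeff f q (x, t)"
    proof (rule plane_inversion)
      show "cmod (slice_coeff f q p) \<le> 2 * pi * N" for p
      proof -
        have "bracket (fst p) powr (- 2) * bracket (snd p) powr (- 2) \<le> 1"
          by (intro mult_le_one bracket_powr_le_1) auto
        then have "(2 * pi * N) * (bracket (fst p) powr (- 2) * bracket (snd p) powr (- 2)) \<le> 2 * pi * N"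
          using N(2) by (intro mult_left_le) auto
        with slice_coeff_bound[OF N(1) schwartz_measurable[OF f], of q p] show ?thesis by linarith
      qed
      show "integrable lborel (\<lambda>s. fourier f (fst s, q, snd s))"
      proof (rule Bochner_Integration.integrable_bound[OF integrable_mult_right[OF plane_decay_integrable, of C]])
        show "AE s in lborel. norm (fourier f (fst s, q, snd s)) \<le> norm (C * (bracket (fst s) powr (- 2) * bracket (snd s) powr (- 2)))"
        proof (rule AE_I2)
          fix s :: "real \<times> real"
          have "freq_decay (fst s, q, snd s) \<le> bracket (fst s) powr (- 2) * bracket (snd s) powr (- 2)"
            using bracket_powr_le_1[of 2 "real_of_int q"]
            by (simp add: freq_decay_def mult_right_mono mult_left_le)
          then have "C * freq_decay (fst s, q, snd s) \<le> C * (bracket (fst s) powr (- 2) * bracket (snd s) powr (- 2))"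
            using C(2) by (rule mult_left_mono)
          then show "norm (fourier f (fst s, q, snd s)) \<le> norm (C * (bracket (fst s) powr (- 2) * bracket (snd s) powr (- 2)))"
            using C(1)[of "(fst s, q, snd s)"] by (simp add: abs_mult C(2))
        qed
      qed (rule m)
    qed (use slice_coeff_continuous[OF f] slice_coeff_integrable[OF f] fourier_slice_coeff[OF f] in auto)
    moreover have "?E (fst s, q, snd s) = exp (\<i> * complex_of_real (s \<bullet> (x, t))) * exp (\<i> * complex_of_real (real_of_int q * y0))" for s :: "real \<times> real"
      by (simp add: z character_def inner_prod_def exp_add[symmetric] algebra_simps)
    ultimately have "(\<integral>s. fourier f (fst s, q, snd s) * ?E (fst s, q, snd s) \<partial>lborel) = 4 * pi\<^sup>2 * slice_coeff f q (x, t) * exp (\<i> * complex_of_real (real_of_int q * y0))"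
      by (simp only: mult.assoc[symmetric] integral_mult_left_zero)
    also have "\<dots> = 4 * pi\<^sup>2 * (exp (\<i> * complex_of_real (real_of_int q * y0)) * slice_coeff f q (x, t))" by simp
    also have "exp (\<i> * complex_of_real (real_of_int q * y0)) * slice_coeff f q (x, t) = integral\<^sup>L circle (\<lambda>y. harmonic y0 (- q) y * f (x, y, t))"
      unfolding slice_coeff_def
      by (subst integral_mult_right_zero[symmetric], intro Bochner_Integration.integral_cong refl)
         (simp add: harmonic_def exp_add[symmetric] mult.assoc[symmetric], simp add: algebra_simps)
    finally show ?thesis .
  qed
  have "(\<lambda>n. \<Sum>q\<in>{- int n..int n}. \<integral>s. fourier f (fst s, q, snd s) * ?E (fst s, q, snd s) \<partial>lborel) \<longlonglongrightarrow> (\<integral>w. fourier f w * ?E w \<partial>freq_measure)"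
    by (rule integral_freq_tendsto[OF int])
  moreover have "(\<lambda>n. \<Sum>q\<in>{- int n..int n}. \<integral>s. fourier f (fst s, q, snd s) * ?E (fst s, q, snd s) \<partial>lborel) \<longlonglongrightarrow> 4 * pi\<^sup>2 * (2 * pi * f (x, y0, t))"
  proof -
    have "(\<lambda>n. \<Sum>q\<in>{- int n..int n}. integral\<^sup>L circle (\<lambda>y. harmonic y0 (- q) y * f (x, y, t))) \<longlonglongrightarrow> 2 * pi * f (x, y0, t)"
    proof (rule Fourier_series_tendsto[where M=M])
      show "f (x, y + 2 * pi, t) = f (x, y, t)" for y using schwartzD(1)[OF f] by (simp add: y_periodic_def)
      show "continuous_on UNIV (\<lambda>y. f (x, y, t))"
        by (intro continuous_on_compose2[OF schwartz_continuous[OF f]] continuous_intros) auto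
    qed (rule M)
    then have "(\<lambda>n. 4 * pi\<^sup>2 * (\<Sum>q\<in>{- int n..int n}. integral\<^sup>L circle (\<lambda>y. harmonic y0 (- q) y * f (x, y, t)))) \<longlonglongrightarrow> 4 * pi\<^sup>2 * (2 * pi * f (x, y0, t))"
      by (rule tendsto_mult_left)
    then show ?thesis unfolding slice sum_distrib_left .
  qed
  ultimately have "(\<integral>w. fourier f w * ?E w \<partial>freq_measure) = 4 * pi\<^sup>2 * (2 * pi * f (x, y0, t))" by (rule LIMSEQ_unique)
  then show ?thesis by (simp add: z power2_eq_square power3_eq_cube)
qed

section \<open>The bilinear estimate for Schwartz-type functions\<close>

interpretation freq_point: pair_sigma_finite freq_measure "lborel :: point measure" ..

text \<open>Inversion is inserted for \<open>f\<close> and the integrals are exchanged. With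
  \<open>h\<close> equal to \<open>g\<close> times a character this becomes the convolution formula,
  and with the conjugate of \<open>f\<close> it becomes Plancherel.\<close>

lemma fourier_pairing:
  fixes f h :: "point \<Rightarrow> complex"
  assumes f: "schwartz f" and h: "set_integrable lborel period_cell h"
  shows "(2 * pi) ^ 3 * (LINT z:period_cell|lborel. f z * h z) =
    (\<integral>w. fourier f w * (LINT z:period_cell|lborel. h z * character (fst w) (fst (snd w)) (snd (snd w)) z) \<partial>freq_measure)"
proof -
  let ?E = "\<lambda>w. character (fst w) (fst (snd w)) (snd (snd w))"
  define H where "H z = indicator period_cell z *\<^sub>R h z" for z
  have H: "integrable lborel H" using h unfolding set_integrable_def H_def .
  have [measurable]: "H \<in> borel_measurable lborel" using H by auto
  have [measurable]: "fourier f \<in> borel_measurable freq_measure" by (intro fourier_measurable schwartz_measurable f)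
  note [measurable] = character_pair_measurable(2)
  let ?F = "\<lambda>w z. fourier f w * (H z * ?E w z)"
  have meas: "(\<lambda>(w, z). ?F w z) \<in> borel_measurable (freq_measure \<Otimes>\<^sub>M lborel)"
  proof -
    have "(\<lambda>wz. ?E (fst wz) (snd wz)) \<in> borel_measurable (freq_measure \<Otimes>\<^sub>M lborel)"
      using character_pair_measurable(2) by (simp add: case_prod_beta')
    then have "(\<lambda>wz. fourier f (fst wz) * (H (snd wz) * ?E (fst wz) (snd wz))) \<in> borel_measurable (freq_measure \<Otimes>\<^sub>M lborel)"
      by measurable
    then show ?thesis by (simp add: case_prod_beta')
  qed
  have HE: "integrable lborel (\<lambda>z. H z * ?E w z)" for w
  proof (rule Bochner_Integration.integrable_bound[OF H])
    show "(\<lambda>z. H z * ?E w z) \<in> borel_measurable lborel"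
      using bounded_smooth_measurable[OF bounded_smooth_character] by measurable
  qed (simp add: norm_mult)
  have int: "integrable (freq_measure \<Otimes>\<^sub>M lborel) (\<lambda>(w, z). ?F w z)"
  proof (rule freq_point.Fubini_integrable[OF meas])
    have "(\<lambda>w. \<integral>z. cmod (?F w z) \<partial>lborel) = (\<lambda>w. cmod (fourier f w) * (\<integral>z. cmod (H z) \<partial>lborel))"
      by (simp add: norm_mult fun_eq_iff)
    then show "integrable freq_measure (\<lambda>w. \<integral>z. cmod (case (w, z) of (w, z) \<Rightarrow> ?F w z) \<partial>lborel)"
      using fourier_integrable[OF f] by (simp only: prod.case) (intro integrable_mult_left integrable_norm)
    show "AE w in freq_measure. integrable lborel (\<lambda>z. case (w, z) of (w, z) \<Rightarrow> ?F w z)"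
      by (simp only: prod.case) (intro AE_I2 integrable_mult_right HE)
  qed
  have "(\<integral>w. fourier f w * (LINT z:period_cell|lborel. h z * ?E w z) \<partial>freq_measure) = (\<integral>w. \<integral>z. ?F w z \<partial>lborel \<partial>freq_measure)"
    by (simp only: integral_mult_right_zero set_lebesgue_integral_def H_def scaleR_conv_of_real mult.assoc)
  also have "\<dots> = (\<integral>z. \<integral>w. ?F w z \<partial>freq_measure \<partial>lborel)"
    using freq_point.Fubini_integral[OF int] by simp
  also have "\<dots> = (\<integral>z. H z * (\<integral>w. fourier f w * ?E w z \<partial>freq_measure) \<partial>lborel)"
    by (subst integral_mult_right_zero[symmetric], intro Bochner_Integration.integral_cong refl) (simp only: mult_ac)
  also have "\<dots> = (\<integral>z. (2 * pi) ^ 3 * (indicator period_cell z *\<^sub>R (f z * h z)) \<partial>lborel)"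
    unfolding fourier_inversion[OF f] by (intro Bochner_Integration.integral_cong refl) (simp add: H_def indicator_def)
  also have "\<dots> = (2 * pi) ^ 3 * (LINT z:period_cell|lborel. f z * h z)"
    unfolding set_lebesgue_integral_def by (rule integral_mult_right_zero)
  finally show ?thesis by simp
qed

lemma character_mult: "character \<xi> q \<tau> z * character \<xi>' q' \<tau>' z = character (\<xi> + \<xi>') (q + q') (\<tau> + \<tau>') z"
  by (simp add: character_def exp_add[symmetric] algebra_simps)

lemma cnj_character: "cnj (character \<xi> q \<tau> z) = character (- \<xi>) (- q) (- \<tau>) z"
  by (simp add: character_def exp_cnj algebra_simps)

lemma fourier_eq_set: "fourier f w = (LINT z:period_cell|lborel. f z * character (- fst w) (- fst (snd w)) (- snd (snd w)) z)"
  by (cases w) (simp add: fourier_eq)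

lemma fourier_mult:
  assumes f: "schwartz f" and g: "schwartz g"
  shows "(2 * pi) ^ 3 * fourier (\<lambda>z. f z * g z) w = (\<integral>v. fourier f v * fourier g (w - v) \<partial>freq_measure)"
proof -
  let ?h = "\<lambda>z. g z * character (- fst w) (- fst (snd w)) (- snd (snd w)) z"
  have h: "set_integrable lborel period_cell ?h"
    by (intro schwartz_integrable schwartz_mult g bounded_smooth_character)
  have "(LINT z:period_cell|lborel. ?h z * character (fst v) (fst (snd v)) (snd (snd v)) z) = fourier g (w - v)" for v
    unfolding fourier_eq_set by (simp add: mult.assoc character_mult)
  then have "(\<integral>v. fourier f v * fourier g (w - v) \<partial>freq_measure) = (2 * pi) ^ 3 * (LINT z:period_cell|lborel. f z * ?h z)"
    using fourier_pairing[OF f h] by simp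
  then show ?thesis by (simp add: fourier_eq_set mult.assoc)
qed

lemma fourier_mult_bound:
  assumes f: "schwartz f" and g: "schwartz g"
  shows "ennreal (cmod (fourier (\<lambda>z. f z * g z) w)) \<le>
    (\<integral>\<^sup>+v. ennreal (cmod (fourier f v)) * ennreal (cmod (fourier g (w - v))) \<partial>freq_measure)"
proof -
  \<comment> \<open>The normalising constant exceeds 1, so it can be absorbed in an upper
    bound.\<close>
  have c: "1 \<le> (2 * pi) ^ 3" using pi_gt3 by (intro one_le_power) simp
  have int: "integrable freq_measure (\<lambda>v. fourier f v * fourier g (w - v))"
  proof -
    obtain M where M: "\<And>w. cmod (fourier g w) \<le> M" using fourier_bounded[OF g] by blast
    have [measurable]: "fourier f \<in> borel_measurable freq_measure" "fourier g \<in> borel_measurable freq_measure"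
      by (intro fourier_measurable schwartz_measurable f g)+
    have "integrable freq_measure (\<lambda>v. M *\<^sub>R fourier f v)" using fourier_integrable[OF f] by simp
    then show ?thesis
      by (rule Bochner_Integration.integrable_bound, measurable)
         (auto simp: norm_mult mult.commute[of _ "cmod (fourier f _)"] intro!: mult_left_mono order.trans[OF M])
  qed
  have "ennreal (cmod (fourier (\<lambda>z. f z * g z) w)) \<le> ennreal (cmod ((2 * pi) ^ 3 * fourier (\<lambda>z. f z * g z) w))"
    using mult_right_mono[OF c, of "cmod (fourier (\<lambda>z. f z * g z) w)"] by (intro ennreal_leI) (simp add: norm_mult norm_power)
  also have "\<dots> \<le> (\<integral>\<^sup>+v. ennreal (cmod (fourier f v * fourier g (w - v))) \<partial>freq_measure)"
    unfolding fourier_mult[OF f g] by (rule integral_norm_bound_ennreal[OF int])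
  finally show ?thesis by (simp add: norm_mult ennreal_mult)
qed

section \<open>Weighted norms on the Fourier side\<close>

definition X_weight :: "real \<Rightarrow> real \<Rightarrow> freq \<Rightarrow> real" where
  "X_weight s b w = modulation w powr (2 * b) * japanese w powr (2 * s)"

lemma X_weight_measurable [measurable]: "X_weight s b \<in> borel_measurable freq_measure"
  unfolding X_weight_def[abs_def] by measurable

lemma modulation_nz [simp]: "modulation w \<noteq> 0" and japanese_nz [simp]: "japanese w \<noteq> 0"
  using modulation_pos[of w] japanese_pos[of w] by linarith+

lemma X_weight_nonneg [simp]: "0 \<le> X_weight s b w"
  by (simp add: X_weight_def)

lemma schwartz_norm_eq: "schwartz_norm s b f = sqrt (\<integral>w. X_weight s b w * (cmod (fourier f w))\<^sup>2 \<partial>freq_measure)"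
  by (simp add: schwartz_norm_def X_weight_def modulation_def japanese_def case_prod_beta')

lemma schwartz_norm_nonneg: "0 \<le> schwartz_norm s b f"
  by (simp add: schwartz_norm_eq integral_nonneg_AE)

lemma bracket_le_powr_abs:
  fixes x y a :: real
  shows "1 \<le> x \<Longrightarrow> x \<le> y \<Longrightarrow> x powr a \<le> y powr \<bar>a\<bar>"
proof -
  assume "1 \<le> x" "x \<le> y"
  then have "x powr a \<le> x powr \<bar>a\<bar>" by (intro powr_mono) auto
  also have "\<dots> \<le> y powr \<bar>a\<bar>" using \<open>1 \<le> x\<close> \<open>x \<le> y\<close> by (intro powr_mono2) auto
  finally show ?thesis .
qed

lemma modulation_le: "modulation w \<le> freq_weight w ^ 3"
proof -
  obtain \<xi> q \<tau> where w: "w = (\<xi>, q, \<tau>)" by (metis prod_cases3)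
  define a b c where "a = \<bar>\<xi>\<bar>" "b = \<bar>real_of_int q\<bar>" "c = \<bar>\<tau>\<bar>"
  have n: "0 \<le> a" "0 \<le> b" "0 \<le> c" by (auto simp: a_b_c_def)
  have "\<bar>\<tau> - dispersion \<xi> q\<bar> \<le> c + (a ^ 3 + a * b\<^sup>2)"
    unfolding dispersion_def a_b_c_def
    using abs_triangle_ineq4[of \<tau> "\<xi> ^ 3 + \<xi> * (real_of_int q)\<^sup>2"] abs_triangle_ineq[of "\<xi> ^ 3" "\<xi> * (real_of_int q)\<^sup>2"]
    by (simp add: abs_mult power_abs)
  then have "modulation w \<le> 1 + c + (a ^ 3 + a * b\<^sup>2)" by (simp add: modulation_def bracket_def w)
  also have "\<dots> \<le> (1 + a) ^ 3 * (1 + b) ^ 3 * (1 + c)"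
  proof -
    have "1 + a ^ 3 + a * b\<^sup>2 \<le> (1 + a) ^ 3 * (1 + b) ^ 3"
    proof -
      have "1 + a ^ 3 + a * b\<^sup>2 \<le> (1 + a) ^ 3 * (1 + b\<^sup>2)"
        using n by (simp add: power3_eq_cube power2_eq_square algebra_simps add_nonneg_nonneg)
      also have "1 + b\<^sup>2 \<le> (1 + b) ^ 3"
        using n by (simp add: power3_eq_cube power2_eq_square algebra_simps add_nonneg_nonneg)
      finally show ?thesis using n by (simp add: mult_left_mono)
    qed
    then have "(1 + a ^ 3 + a * b\<^sup>2) * (1 + c) \<le> (1 + a) ^ 3 * (1 + b) ^ 3 * (1 + c)"
      using n by (intro mult_right_mono) auto
    moreover have "1 + c + (a ^ 3 + a * b\<^sup>2) \<le> (1 + a ^ 3 + a * b\<^sup>2) * (1 + c)"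
      using n by (simp add: algebra_simps)
    ultimately show ?thesis by linarith
  qed
  also have "\<dots> \<le> (1 + a) ^ 3 * (1 + b) ^ 3 * (1 + c) ^ 3"
    using n power_increasing[of 1 3 "1 + c"] by (intro mult_left_mono) auto
  also have "\<dots> = freq_weight w ^ 3" by (simp add: freq_weight_def bracket_def w a_b_c_def power_mult_distrib)
  finally show ?thesis .
qed

lemma japanese_le: "japanese w \<le> 2 * freq_weight w"
proof -
  obtain \<xi> q \<tau> where w: "w = (\<xi>, q, \<tau>)" by (metis prod_cases3)
  define a b c where "a = \<bar>\<xi>\<bar>" "b = \<bar>real_of_int q\<bar>" "c = \<bar>\<tau>\<bar>"
  have n: "0 \<le> a" "0 \<le> b" "0 \<le> c" by (auto simp: a_b_c_def)
  have "freq_size \<xi> q \<le> 2 * a + b"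
    unfolding freq_size_def
  proof (rule real_le_lsqrt)
    have ab: "0 \<le> a * b" using n by simp
    have sq: "\<xi>\<^sup>2 = a\<^sup>2" "(real_of_int q)\<^sup>2 = b\<^sup>2" by (auto simp: a_b_c_def)
    have "(2 * a + b)\<^sup>2 = 4 * a\<^sup>2 + 4 * (a * b) + b\<^sup>2" by (simp add: power2_eq_square algebra_simps)
    then show "3 * \<xi>\<^sup>2 + (real_of_int q)\<^sup>2 \<le> (2 * a + b)\<^sup>2"
      unfolding sq using ab zero_le_power2[of a] by linarith
  qed (use n in auto)
  then have "japanese w \<le> 1 + (2 * a + b)" by (simp add: japanese_def bracket_def w)
  also have "\<dots> \<le> 2 * ((1 + a) * (1 + b)) * 1" using n by (simp add: algebra_simps)
  also have "\<dots> \<le> 2 * ((1 + a) * (1 + b)) * (1 + c)" using n by (intro mult_left_mono) auto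
  also have "\<dots> = 2 * freq_weight w" by (simp add: freq_weight_def bracket_def w a_b_c_def)
  finally show ?thesis .
qed

text \<open>Polynomial growth of the weight against rapid decay of the transform makes all norms of
  Schwartz-type functions finite, for every real \<open>s\<close> and \<open>b\<close>.\<close>

lemma X_weight_le: "\<exists>K\<ge>0. \<exists>m. \<forall>w. X_weight s b w \<le> K * freq_weight w ^ m"
proof -
  \<comment> \<open>The modulation is at most the cube of \<open>freq_weight\<close> and enters with
    exponent \<open>2 * b\<close>, hence \<open>6 * \<bar>b\<bar>\<close>.\<close>
  define m where "m = nat \<lceil>6 * \<bar>b\<bar> + 2 * \<bar>s\<bar>\<rceil>"
  have m: "6 * \<bar>b\<bar> + 2 * \<bar>s\<bar> \<le> real m" unfolding m_def by (simp add: real_nat_ceiling_ge)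
  have "X_weight s b w \<le> 2 powr (2 * \<bar>s\<bar>) * freq_weight w ^ m" for w
  proof -
    have fw: "1 \<le> freq_weight w" by (rule freq_weight_ge_1)
    have "modulation w powr (2 * b) \<le> (freq_weight w ^ 3) powr \<bar>2 * b\<bar>"
      by (rule bracket_le_powr_abs[OF _ modulation_le]) (simp add: modulation_def bracket_ge_1)
    also have "\<dots> = freq_weight w powr (6 * \<bar>b\<bar>)"
    proof -
      have "freq_weight w ^ 3 = freq_weight w powr 3" using fw by simp
      then show ?thesis by (simp only: powr_powr) (simp add: abs_mult)
    qed
    finally have 1: "modulation w powr (2 * b) \<le> freq_weight w powr (6 * \<bar>b\<bar>)" .
    have "japanese w powr (2 * s) \<le> (2 * freq_weight w) powr \<bar>2 * s\<bar>"
      by (rule bracket_le_powr_abs[OF _ japanese_le]) (simp add: japanese_def bracket_ge_1)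
    also have "\<dots> = 2 powr (2 * \<bar>s\<bar>) * freq_weight w powr (2 * \<bar>s\<bar>)"
      using fw by (simp add: powr_mult abs_mult)
    finally have "X_weight s b w \<le> freq_weight w powr (6 * \<bar>b\<bar>) * (2 powr (2 * \<bar>s\<bar>) * freq_weight w powr (2 * \<bar>s\<bar>))"
      unfolding X_weight_def using 1 by (intro mult_mono) auto
    also have "\<dots> = 2 powr (2 * \<bar>s\<bar>) * freq_weight w powr (6 * \<bar>b\<bar> + 2 * \<bar>s\<bar>)" by (simp add: powr_add)
    also have "\<dots> \<le> 2 powr (2 * \<bar>s\<bar>) * freq_weight w powr (real m)"
      using fw m by (intro mult_left_mono powr_mono) auto
    finally show ?thesis using fw by (simp add: powr_realpow)
  qed
  then show ?thesis by (intro exI[of _ "2 powr (2 * \<bar>s\<bar>)"] conjI exI[of _ m]) auto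
qed

lemma X_integrable:
  assumes f: "schwartz f"
  shows "integrable freq_measure (\<lambda>w. X_weight s b w * (cmod (fourier f w))\<^sup>2)"
proof -
  obtain K m where K: "K \<ge> 0" "\<And>w. X_weight s b w \<le> K * freq_weight w ^ m" using X_weight_le[of s b] by blast
  obtain C where C: "C \<ge> 0" "\<And>w. freq_weight w ^ m * cmod (fourier f w) \<le> C * freq_decay w"
    using fourier_freq_decay[OF f] by blast
  obtain B where B: "\<And>w. cmod (fourier f w) \<le> B" using fourier_bounded[OF f] by blast
  have B0: "0 \<le> B" using order.trans[OF norm_ge_zero B[of 0]] .
  have [measurable]: "fourier f \<in> borel_measurable freq_measure" by (intro fourier_measurable schwartz_measurable f)
  have le: "X_weight s b w * (cmod (fourier f w))\<^sup>2 \<le> (K * C * B) * freq_decay w" for w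
  proof -
    have "X_weight s b w * (cmod (fourier f w))\<^sup>2 \<le> (K * freq_weight w ^ m) * (cmod (fourier f w))\<^sup>2"
      by (intro mult_right_mono K) auto
    also have "\<dots> = K * ((freq_weight w ^ m * cmod (fourier f w)) * cmod (fourier f w))"
      by (simp add: power2_eq_square)
    also have "\<dots> \<le> K * ((C * freq_decay w) * B)"
      using K(1) C(1) freq_decay_pos[of w] by (intro mult_left_mono mult_mono C(2) B) auto
    finally show ?thesis by (simp add: mult_ac)
  qed
  show ?thesis
  proof (rule Bochner_Integration.integrable_bound[OF integrable_mult_right[OF freq_decay_integrable, of "K * C * B"]])
    show "AE w in freq_measure. norm (X_weight s b w * (cmod (fourier f w))\<^sup>2) \<le> norm (K * C * B * freq_decay w)"
      by (rule AE_I2) (rule order.trans[OF _ order.trans[OF le abs_ge_self[of "K * C * B * freq_decay _", folded real_norm_def]]], simp)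
  qed measurable
qed

lemma schwartz_norm_power2:
  "(schwartz_norm s b f)\<^sup>2 = (\<integral>w. X_weight s b w * (cmod (fourier f w))\<^sup>2 \<partial>freq_measure)"
  unfolding schwartz_norm_eq by (simp add: integral_nonneg_AE)

lemma schwartz_norm_nn:
  assumes "schwartz f"
  shows "(\<integral>\<^sup>+w. ennreal (X_weight s b w * (cmod (fourier f w))\<^sup>2) \<partial>freq_measure) = ennreal ((schwartz_norm s b f)\<^sup>2)"
  unfolding schwartz_norm_power2 by (rule nn_integral_eq_integral[OF X_integrable[OF assms]]) simp

text \<open>The hypothesis concerns the moduli of the transforms, so one lemma serves both orders of
  a difference and the decomposition of a product in
  \<open>schwartz_norm_product_diff\<close>.\<close>

lemma schwartz_norm_triangle_gen:
  assumes f: "schwartz f" and g: "schwartz g" and h: "schwartz h"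
    and le: "\<And>w. cmod (fourier f w) \<le> cmod (fourier g w) + cmod (fourier h w)"
  shows "schwartz_norm s b f \<le> schwartz_norm s b g + schwartz_norm s b h"
proof -
  let ?r = "X_weight s b" and ?G = "\<lambda>w. cmod (fourier g w)" and ?H = "\<lambda>w. cmod (fourier h w)"
  have [measurable]: "fourier f \<in> borel_measurable freq_measure" "fourier g \<in> borel_measurable freq_measure" "fourier h \<in> borel_measurable freq_measure"
    by (intro fourier_measurable schwartz_measurable f g h)+
  have iGH: "integrable freq_measure (\<lambda>w. ?r w * (?G w * ?H w))"
  proof (rule Bochner_Integration.integrable_bound[OF Bochner_Integration.integrable_add[OF X_integrable[OF g] X_integrable[OF h]]])
    show "AE w in freq_measure. norm (?r w * (?G w * ?H w)) \<le> norm (?r w * (?G w)\<^sup>2 + ?r w * (?H w)\<^sup>2)"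
    proof (rule AE_I2)
      fix w
      have "?G w * ?H w \<le> (?G w)\<^sup>2 + (?H w)\<^sup>2"
      proof -
        have "0 \<le> ?G w * ?H w" by simp
        then show ?thesis using sum_squares_bound[of "?G w" "?H w"] unfolding mult.assoc by linarith
      qed
      then have "?r w * (?G w * ?H w) \<le> ?r w * ((?G w)\<^sup>2 + (?H w)\<^sup>2)" by (intro mult_left_mono) auto
      then show "norm (?r w * (?G w * ?H w)) \<le> norm (?r w * (?G w)\<^sup>2 + ?r w * (?H w)\<^sup>2)"
        by (simp add: abs_mult distrib_left)
    qed
  qed measurable
  have CS: "(\<integral>w. ?r w * (?G w * ?H w) \<partial>freq_measure) \<le> schwartz_norm s b g * schwartz_norm s b h"
  proof -
    let ?I = "\<integral>w. ?r w * (?G w * ?H w) \<partial>freq_measure"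
    have "ennreal (?I\<^sup>2) = (\<integral>\<^sup>+w. ennreal (sqrt (?r w) * ?G w) * ennreal (sqrt (?r w) * ?H w) \<partial>freq_measure)\<^sup>2"
    proof -
      have "ennreal ?I = (\<integral>\<^sup>+w. ennreal (?r w * (?G w * ?H w)) \<partial>freq_measure)"
        by (rule nn_integral_eq_integral[OF iGH, symmetric]) simp
      also have "\<dots> = (\<integral>\<^sup>+w. ennreal (sqrt (?r w) * ?G w) * ennreal (sqrt (?r w) * ?H w) \<partial>freq_measure)"
      proof (rule nn_integral_cong)
        fix w
        have "?r w * (?G w * ?H w) = (sqrt (?r w) * ?G w) * (sqrt (?r w) * ?H w)"
          using real_sqrt_mult_self[of "?r w"] by (simp add: algebra_simps)
        then show "ennreal (?r w * (?G w * ?H w)) = ennreal (sqrt (?r w) * ?G w) * ennreal (sqrt (?r w) * ?H w)"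
          by (simp only: ennreal_mult real_sqrt_ge_zero X_weight_nonneg norm_ge_zero mult_nonneg_nonneg)
      qed
      finally show ?thesis by (simp add: ennreal_power[symmetric] integral_nonneg_AE)
    qed
    also have "\<dots> \<le> (\<integral>\<^sup>+w. (ennreal (sqrt (?r w) * ?G w))\<^sup>2 \<partial>freq_measure) * (\<integral>\<^sup>+w. (ennreal (sqrt (?r w) * ?H w))\<^sup>2 \<partial>freq_measure)"
      by (rule Cauchy_Schwarz_nn_integral) measurable
    also have "\<dots> = ennreal ((schwartz_norm s b g)\<^sup>2) * ennreal ((schwartz_norm s b h)\<^sup>2)"
      by (simp add: ennreal_power power_mult_distrib schwartz_norm_nn g h)
    also have "\<dots> = ennreal ((schwartz_norm s b g * schwartz_norm s b h)\<^sup>2)"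
      by (simp add: ennreal_mult power_mult_distrib)
    finally have "?I\<^sup>2 \<le> (schwartz_norm s b g * schwartz_norm s b h)\<^sup>2" by simp
    then show ?thesis by (rule power2_le_imp_le) (simp add: schwartz_norm_nonneg)
  qed
  have "(schwartz_norm s b f)\<^sup>2 \<le> (\<integral>w. ?r w * (?G w)\<^sup>2 + ?r w * (?H w)\<^sup>2 + 2 * (?r w * (?G w * ?H w)) \<partial>freq_measure)"
    unfolding schwartz_norm_power2
  proof (rule integral_mono[OF X_integrable[OF f]])
    show "integrable freq_measure (\<lambda>w. ?r w * (?G w)\<^sup>2 + ?r w * (?H w)\<^sup>2 + 2 * (?r w * (?G w * ?H w)))"
      by (intro Bochner_Integration.integrable_add X_integrable g h integrable_mult_right iGH)
    fix w
    have "(cmod (fourier f w))\<^sup>2 \<le> (?G w + ?H w)\<^sup>2" by (intro power_mono le) auto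
    then have "?r w * (cmod (fourier f w))\<^sup>2 \<le> ?r w * (?G w + ?H w)\<^sup>2" by (intro mult_left_mono) auto
    then show "?r w * (cmod (fourier f w))\<^sup>2 \<le> ?r w * (?G w)\<^sup>2 + ?r w * (?H w)\<^sup>2 + 2 * (?r w * (?G w * ?H w))"
      by (simp add: power2_eq_square algebra_simps)
  qed
  also have "\<dots> = (schwartz_norm s b g)\<^sup>2 + (schwartz_norm s b h)\<^sup>2 + 2 * (\<integral>w. ?r w * (?G w * ?H w) \<partial>freq_measure)"
    unfolding schwartz_norm_power2
    by (subst Bochner_Integration.integral_add; (subst Bochner_Integration.integral_add)?)
       (auto intro!: X_integrable g h iGH Bochner_Integration.integrable_add)
  also have "\<dots> \<le> (schwartz_norm s b g + schwartz_norm s b h)\<^sup>2"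
    using CS by (simp add: power2_eq_square algebra_simps)
  finally show ?thesis by (rule power2_le_imp_le) (simp add: schwartz_norm_nonneg)
qed

lemma schwartz_norm_diff_triangle:
  assumes f: "schwartz f" and g: "schwartz g"
  shows "\<bar>schwartz_norm s b f - schwartz_norm s b g\<bar> \<le> schwartz_norm s b (\<lambda>z. f z - g z)"
proof -
  have d: "schwartz (\<lambda>z. f z - g z)" by (rule schwartz_diff[OF f g])
  have "schwartz_norm s b f \<le> schwartz_norm s b (\<lambda>z. f z - g z) + schwartz_norm s b g"
    using f g by (intro schwartz_norm_triangle_gen d) (simp_all add: fourier_diff norm_triangle_sub add.commute)
  moreover have "schwartz_norm s b g \<le> schwartz_norm s b (\<lambda>z. f z - g z) + schwartz_norm s b f"
    using f g by (intro schwartz_norm_triangle_gen d) (simp_all add: fourier_diff norm_minus_commute[of "fourier f _"] norm_triangle_sub add.commute)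
  ultimately show ?thesis by linarith
qed

section \<open>Reduction of the weights to the squared kernel\<close>

text \<open>By the triangle inequality the quotient R = c / (a b) is at most 1/a + 1/b, hence at
  most 2. Of its 2s powers, 2s - 2 are estimated by powers of 2, which is where
  \<open>s \<ge> 1\<close> enters; the last two give the sum of inverse squares in
  \<open>kernel_sq\<close>.\<close>

lemma japanese_product_le:
  assumes s: "s \<ge> 1"
  shows "japanese w powr (2 * s) \<le> 2 powr (2 * s - 1) *
    (japanese v powr (2 * s) * japanese (w - v) powr (2 * s) * (japanese v powr (- 2) + japanese (w - v) powr (- 2)))"
proof -
  define a where "a = japanese v" define b where "b = japanese (w - v)" define c where "c = japanese w"
  have ge: "1 \<le> a" "1 \<le> b" "1 \<le> c" by (auto simp: a_def b_def c_def japanese_def bracket_ge_1)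
  have "freq_size (fst w) (fst (snd w)) \<le> freq_size (fst v) (fst (snd v)) + freq_size (fst (w - v)) (fst (snd (w - v)))"
    using freq_size_triangle[of "fst v" "fst (w - v)" "fst (snd v)" "fst (snd (w - v))"] by simp
  then have "c \<le> a + b" by (simp add: a_def b_def c_def japanese_def bracket_def)
  define R where "R = c / (a * b)"
  have R0: "0 < R" using ge by (simp add: R_def)
  have "R \<le> (a + b) / (a * b)" using \<open>c \<le> a + b\<close> ge by (simp add: R_def divide_right_mono)
  also have "\<dots> = 1 / a + 1 / b" using ge by (simp add: field_simps)
  finally have R1: "R \<le> 1 / a + 1 / b" .
  then have R2: "R \<le> 2" using ge by (smt (verit) divide_le_eq_1_pos)
  have "R\<^sup>2 \<le> (1 / a + 1 / b)\<^sup>2" using R0 R1 by (intro power_mono) auto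
  also have "\<dots> \<le> 2 * ((1 / a)\<^sup>2 + (1 / b)\<^sup>2)"
  proof -
    have "(x + y)\<^sup>2 \<le> 2 * (x\<^sup>2 + y\<^sup>2)" for x y :: real
      using zero_le_power2[of "x - y"] by (simp add: power2_eq_square algebra_simps)
    then show ?thesis .
  qed
  finally have sq: "R\<^sup>2 \<le> 2 * (a powr (- 2) + b powr (- 2))"
    using ge by (simp add: powr_minus_divide power_divide)
  have "R powr (2 * s) = R powr (2 * s - 2) * R powr 2" by (simp add: powr_add[symmetric])
  also have "R powr 2 = R\<^sup>2" using R0 by simp
  also have "R powr (2 * s - 2) * R\<^sup>2 \<le> 2 powr (2 * s - 2) * (2 * (a powr (- 2) + b powr (- 2)))"
    using s R0 R2 sq by (intro mult_mono powr_mono2) auto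
  also have "\<dots> = 2 powr (2 * s - 1) * (a powr (- 2) + b powr (- 2))"
  proof -
    have "2 powr (2 * s - 1) = 2 powr (2 * s - 2) * 2 powr (1::real)" by (simp only: powr_add[symmetric]) simp
    then show ?thesis by simp
  qed
  finally have R: "R powr (2 * s) \<le> 2 powr (2 * s - 1) * (a powr (- 2) + b powr (- 2))" .
  have "c powr (2 * s) = (a * b * R) powr (2 * s)" using ge by (simp add: R_def)
  also have "\<dots> = (a powr (2 * s) * b powr (2 * s)) * R powr (2 * s)"
    using ge R0 by (simp add: powr_mult)
  also have "\<dots> \<le> (a powr (2 * s) * b powr (2 * s)) * (2 powr (2 * s - 1) * (a powr (- 2) + b powr (- 2)))"
    by (intro mult_left_mono R) auto
  finally show ?thesis by (simp add: a_def b_def c_def mult_ac)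
qed

lemma X_weight_product_le:
  assumes s: "s \<ge> 1"
  shows "sqrt (X_weight s (- 17/36) w) * \<bar>fst w\<bar> \<le>
    sqrt (2 powr (2 * s - 1)) * (sqrt (X_weight s (37/72) v) * sqrt (X_weight s (37/72) (w - v)) * sqrt (kernel_sq w v))"
proof -
  let ?J = "japanese v powr (2 * s) * japanese (w - v) powr (2 * s) * (japanese v powr (- 2) + japanese (w - v) powr (- 2))"
  have m1: "modulation u powr (37/36) * modulation u powr (- (37/36)) = 1" for u
    by (simp add: powr_add[symmetric])
  have "X_weight s (- 17/36) w * (fst w)\<^sup>2 \<le> 2 powr (2 * s - 1) * ?J * (modulation w powr (- (17/18)) * (fst w)\<^sup>2)"
    using mult_right_mono[OF japanese_product_le[OF s, of w v], of "modulation w powr (- (17/18)) * (fst w)\<^sup>2"]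
    by (simp add: X_weight_def mult_ac)
  also have "\<dots> = 2 powr (2 * s - 1) * (?J * (modulation w powr (- (17/18)) * (fst w)\<^sup>2)
      * (modulation v powr (37/36) * modulation v powr (- (37/36))) * (modulation (w - v) powr (37/36) * modulation (w - v) powr (- (37/36))))"
    unfolding m1 by simp
  also have "\<dots> = 2 powr (2 * s - 1) * (X_weight s (37/72) v * X_weight s (37/72) (w - v) * kernel_sq w v)"
    by (simp only: X_weight_def kernel_sq_def) (simp add: mult_ac)
  finally have "sqrt (X_weight s (- 17/36) w * (fst w)\<^sup>2) \<le> sqrt (2 powr (2 * s - 1) * (X_weight s (37/72) v * X_weight s (37/72) (w - v) * kernel_sq w v))"
    by simp
  then show ?thesis by (simp only: real_sqrt_mult real_sqrt_abs)
qed

text \<open>Duality with the output as its own test function: taking for \<open>h\<close> the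
  weighted transform of the output bounds the square of \<open>P\<close> by a constant times
  \<open>P * A * B\<close>, where all three are squared norms. As \<open>P\<close> is finite, one
  factor cancels.\<close>

theorem schwartz_bilinear:
  assumes s: "s \<ge> 1"
  shows "\<exists>C>0. \<forall>f g. schwartz f \<longrightarrow> schwartz g \<longrightarrow>
    schwartz_norm s (- 17/36) (partial_x (\<lambda>z. f z * g z)) \<le> C * schwartz_norm s (37/72) f * schwartz_norm s (37/72) g"
proof -
  obtain C0 where C0: "C0 \<ge> 0" "\<And>f g h. f \<in> borel_measurable freq_measure \<Longrightarrow> g \<in> borel_measurable freq_measure \<Longrightarrow> h \<in> borel_measurable freq_measure \<Longrightarrow>
    (\<integral>\<^sup>+z. \<integral>\<^sup>+w. h z * f w * g (z - w) * ennreal (sqrt (kernel_sq z w)) \<partial>freq_measure \<partial>freq_measure)\<^sup>2 \<le>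
    ennreal C0 * (\<integral>\<^sup>+z. (h z)\<^sup>2 \<partial>freq_measure) * (\<integral>\<^sup>+z. (f z)\<^sup>2 \<partial>freq_measure) * (\<integral>\<^sup>+z. (g z)\<^sup>2 \<partial>freq_measure)"
    using bilinear_nn_integral by blast
  define k where "k = sqrt (2 powr (2 * s - 1))"
  have k: "k \<ge> 0" by (simp add: k_def)
  \<comment> \<open>The summand 1 keeps \<open>C\<close> positive when
    \<open>C0 = 0\<close>.\<close>
  define C where "C = sqrt (k\<^sup>2 * C0) + 1"
  have "schwartz_norm s (- 17/36) (partial_x (\<lambda>z. f z * g z)) \<le> C * schwartz_norm s (37/72) f * schwartz_norm s (37/72) g"
    if f: "schwartz f" and g: "schwartz g" for f g
  proof -
    let ?F = "partial_x (\<lambda>z. f z * g z)"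
    have fg: "schwartz (\<lambda>z. f z * g z)" by (intro schwartz_mult f schwartz_bounded_smooth g)
    have F: "schwartz ?F" unfolding partial_x_def by (intro schwartz_dir_deriv fg) (simp add: Basis_point)
    have [measurable]: "fourier f \<in> borel_measurable freq_measure" "fourier g \<in> borel_measurable freq_measure" "fourier ?F \<in> borel_measurable freq_measure"
      by (intro fourier_measurable schwartz_measurable f g F)+
    define h where "h w = ennreal (sqrt (X_weight s (- 17/36) w) * cmod (fourier ?F w))" for w
    define a where "a w = ennreal (sqrt (X_weight s (37/72) w) * cmod (fourier f w))" for w
    define b where "b w = ennreal (sqrt (X_weight s (37/72) w) * cmod (fourier g w))" for w
    have [measurable]: "h \<in> borel_measurable freq_measure" "a \<in> borel_measurable freq_measure" "b \<in> borel_measurable freq_measure"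
      unfolding h_def a_def b_def by measurable
    define P where "P = (schwartz_norm s (- 17/36) ?F)\<^sup>2"
    define A where "A = (schwartz_norm s (37/72) f)\<^sup>2"
    define B where "B = (schwartz_norm s (37/72) g)\<^sup>2"
    have nn: "0 \<le> P" "0 \<le> A" "0 \<le> B" by (auto simp: P_def A_def B_def)
    have hP: "(\<integral>\<^sup>+w. (h w)\<^sup>2 \<partial>freq_measure) = ennreal P"
      by (simp add: h_def P_def ennreal_power power_mult_distrib schwartz_norm_nn[OF F])
    have aA: "(\<integral>\<^sup>+w. (a w)\<^sup>2 \<partial>freq_measure) = ennreal A"
      by (simp add: a_def A_def ennreal_power power_mult_distrib schwartz_norm_nn[OF f])
    have bB: "(\<integral>\<^sup>+w. (b w)\<^sup>2 \<partial>freq_measure) = ennreal B"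
      by (simp add: b_def B_def ennreal_power power_mult_distrib schwartz_norm_nn[OF g])
    have hle: "h w \<le> ennreal k * (\<integral>\<^sup>+v. a v * b (w - v) * ennreal (sqrt (kernel_sq w v)) \<partial>freq_measure)" for w
    proof -
      have "h w = ennreal (sqrt (X_weight s (- 17/36) w) * \<bar>fst w\<bar>) * ennreal (cmod (fourier (\<lambda>z. f z * g z) w))"
        unfolding h_def fourier_partial_x[OF fg] by (simp add: norm_mult ennreal_mult mult.assoc)
      also have "\<dots> \<le> ennreal (sqrt (X_weight s (- 17/36) w) * \<bar>fst w\<bar>) *
         (\<integral>\<^sup>+v. ennreal (cmod (fourier f v)) * ennreal (cmod (fourier g (w - v))) \<partial>freq_measure)"
        by (intro mult_left_mono fourier_mult_bound f g) auto
      also have "\<dots> = (\<integral>\<^sup>+v. ennreal (sqrt (X_weight s (- 17/36) w) * \<bar>fst w\<bar>) * (ennreal (cmod (fourier f v)) * ennreal (cmod (fourier g (w - v)))) \<partial>freq_measure)"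
        by (rule nn_integral_cmult[symmetric]) measurable
      also have "\<dots> \<le> (\<integral>\<^sup>+v. ennreal k * (a v * b (w - v) * ennreal (sqrt (kernel_sq w v))) \<partial>freq_measure)"
      proof (rule nn_integral_mono)
        fix v
        have "(sqrt (X_weight s (- 17/36) w) * \<bar>fst w\<bar>) * (cmod (fourier f v) * cmod (fourier g (w - v))) \<le>
          (k * (sqrt (X_weight s (37/72) v) * sqrt (X_weight s (37/72) (w - v)) * sqrt (kernel_sq w v))) * (cmod (fourier f v) * cmod (fourier g (w - v)))"
          unfolding k_def by (intro mult_right_mono X_weight_product_le s) auto
        also have "\<dots> = k * ((sqrt (X_weight s (37/72) v) * cmod (fourier f v)) * (sqrt (X_weight s (37/72) (w - v)) * cmod (fourier g (w - v))) * sqrt (kernel_sq w v))"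
          by (simp add: mult_ac)
        finally have "ennreal ((sqrt (X_weight s (- 17/36) w) * \<bar>fst w\<bar>) * (cmod (fourier f v) * cmod (fourier g (w - v)))) \<le>
          ennreal (k * ((sqrt (X_weight s (37/72) v) * cmod (fourier f v)) * (sqrt (X_weight s (37/72) (w - v)) * cmod (fourier g (w - v))) * sqrt (kernel_sq w v)))"
          by (rule ennreal_leI)
        then show "ennreal (sqrt (X_weight s (- 17/36) w) * \<bar>fst w\<bar>) * (ennreal (cmod (fourier f v)) * ennreal (cmod (fourier g (w - v)))) \<le>
          ennreal k * (a v * b (w - v) * ennreal (sqrt (kernel_sq w v)))"
          unfolding a_def b_def using k by (simp only: ennreal_mult real_sqrt_ge_zero X_weight_nonneg kernel_sq_nonneg norm_ge_zero abs_ge_zero mult_nonneg_nonneg)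
      qed
      also have "\<dots> = ennreal k * (\<integral>\<^sup>+v. a v * b (w - v) * ennreal (sqrt (kernel_sq w v)) \<partial>freq_measure)"
        by (rule nn_integral_cmult) measurable
      finally show ?thesis .
    qed
    have "ennreal P \<le> ennreal k * (\<integral>\<^sup>+w. \<integral>\<^sup>+v. h w * a v * b (w - v) * ennreal (sqrt (kernel_sq w v)) \<partial>freq_measure \<partial>freq_measure)"
    proof -
      have "ennreal P \<le> (\<integral>\<^sup>+w. h w * (ennreal k * (\<integral>\<^sup>+v. a v * b (w - v) * ennreal (sqrt (kernel_sq w v)) \<partial>freq_measure)) \<partial>freq_measure)"
        unfolding hP[symmetric] power2_eq_square by (intro nn_integral_mono mult_left_mono hle) auto
      also have "\<dots> = (\<integral>\<^sup>+w. ennreal k * (\<integral>\<^sup>+v. h w * a v * b (w - v) * ennreal (sqrt (kernel_sq w v)) \<partial>freq_measure) \<partial>freq_measure)"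
      proof (rule nn_integral_cong)
        fix w
        have "(\<integral>\<^sup>+v. h w * a v * b (w - v) * ennreal (sqrt (kernel_sq w v)) \<partial>freq_measure) = h w * (\<integral>\<^sup>+v. a v * b (w - v) * ennreal (sqrt (kernel_sq w v)) \<partial>freq_measure)"
          by (subst nn_integral_cmult[symmetric]) (auto simp: mult.assoc)
        then show "h w * (ennreal k * (\<integral>\<^sup>+v. a v * b (w - v) * ennreal (sqrt (kernel_sq w v)) \<partial>freq_measure)) = ennreal k * (\<integral>\<^sup>+v. h w * a v * b (w - v) * ennreal (sqrt (kernel_sq w v)) \<partial>freq_measure)"
          by (simp add: mult_ac)
      qed
      also have "\<dots> = ennreal k * (\<integral>\<^sup>+w. \<integral>\<^sup>+v. h w * a v * b (w - v) * ennreal (sqrt (kernel_sq w v)) \<partial>freq_measure \<partial>freq_measure)"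
        by (rule nn_integral_cmult) measurable
      finally show ?thesis .
    qed
    then have "(ennreal P)\<^sup>2 \<le> (ennreal k * (\<integral>\<^sup>+w. \<integral>\<^sup>+v. h w * a v * b (w - v) * ennreal (sqrt (kernel_sq w v)) \<partial>freq_measure \<partial>freq_measure))\<^sup>2"
      by (rule power_mono) simp
    also have "\<dots> \<le> (ennreal k)\<^sup>2 * (ennreal C0 * ennreal P * ennreal A * ennreal B)"
      unfolding power_mult_distrib using C0(2)[of a b h] by (intro mult_left_mono) (auto simp: hP aA bB)
    also have "\<dots> = ennreal (k\<^sup>2 * (C0 * P * A * B))"
      using nn C0(1) k by (simp add: ennreal_mult ennreal_power mult_nonneg_nonneg)
    finally have "P\<^sup>2 \<le> k\<^sup>2 * (C0 * P * A * B)"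
      using nn C0(1) k by (simp add: ennreal_power)
    then have "P \<le> (k\<^sup>2 * C0) * (A * B)"
    proof (cases "P = 0")
      case False
      then have "P > 0" using nn by simp
      moreover have "P * P \<le> P * ((k\<^sup>2 * C0) * (A * B))"
        using \<open>P\<^sup>2 \<le> k\<^sup>2 * (C0 * P * A * B)\<close> by (simp add: power2_eq_square mult_ac)
      ultimately show ?thesis by simp
    qed (use nn C0(1) in simp)
    then have "sqrt P \<le> sqrt ((k\<^sup>2 * C0) * (A * B))" by simp
    also have "\<dots> = sqrt (k\<^sup>2 * C0) * (schwartz_norm s (37/72) f * schwartz_norm s (37/72) g)"
      by (simp only: A_def B_def real_sqrt_mult real_sqrt_abs abs_of_nonneg schwartz_norm_nonneg)
    also have "\<dots> \<le> C * (schwartz_norm s (37/72) f * schwartz_norm s (37/72) g)"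
      by (intro mult_right_mono) (auto simp: C_def schwartz_norm_nonneg)
    finally show ?thesis by (simp add: P_def schwartz_norm_nonneg mult.assoc)
  qed
  moreover have "C > 0" using C0(1) by (simp add: C_def add_nonneg_pos)
  ultimately show ?thesis by blast
qed

section \<open>Schwartz-type functions separate integrable functions\<close>

text \<open>The derivative of tanh is 1 - tanh^2, so the ring generated by these bounded coordinates
  is closed under derivatives and consists of multipliers.\<close>

inductive_set trig_ring :: "(point \<Rightarrow> complex) set" where
  const: "(\<lambda>z. c) \<in> trig_ring"
| tanh_x: "(\<lambda>z. complex_of_real (tanh (fst z))) \<in> trig_ring"
| tanh_t: "(\<lambda>z. complex_of_real (tanh (snd (snd z)))) \<in> trig_ring"
| cos_y: "(\<lambda>z. complex_of_real (cos (fst (snd z)))) \<in> trig_ring"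
| sin_y: "(\<lambda>z. complex_of_real (sin (fst (snd z)))) \<in> trig_ring"
| add: "f \<in> trig_ring \<Longrightarrow> g \<in> trig_ring \<Longrightarrow> (\<lambda>z. f z + g z) \<in> trig_ring"
| mult: "f \<in> trig_ring \<Longrightarrow> g \<in> trig_ring \<Longrightarrow> (\<lambda>z. f z * g z) \<in> trig_ring"

lemma of_real_chain:
  assumes "(g has_real_derivative g') (at (l z))" "bounded_linear l"
  shows "((\<lambda>z. complex_of_real (g (l z))) has_derivative (\<lambda>h. complex_of_real (l h * g'))) (at z)"
proof -
  have "(l has_derivative l) (at z)" by (rule bounded_linear_imp_has_derivative[OF assms(2)])
  from has_derivative_compose[OF this assms(1)[THEN has_field_derivative_imp_has_derivative]]
  have "((\<lambda>z. g (l z)) has_derivative (\<lambda>h. l h * g')) (at z)" by (simp add: mult.commute)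
  then show ?thesis by (rule has_derivative_of_real)
qed

lemma tanh_has_real_derivative: "(tanh has_real_derivative 1 - tanh x * tanh x) (at (x :: real))"
  by (auto intro!: derivative_eq_intros simp: power2_eq_square)

lemma bl_point: "bounded_linear (\<lambda>z :: point. fst z)" "bounded_linear (\<lambda>z :: point. fst (snd z))" "bounded_linear (\<lambda>z :: point. snd (snd z))"
  by (intro bounded_linear_intros)+

lemma trig_ring_smooth:
  assumes "f \<in> trig_ring"
  shows "y_periodic f \<and> (\<forall>z. f differentiable (at z)) \<and> (\<exists>M. \<forall>z. cmod (f z) \<le> M) \<and> (\<forall>e. dir_deriv e f \<in> trig_ring)"
  using assms
proof induction
  case (const c)
  then show ?case by (auto simp: y_periodic_def dir_deriv_const intro: trig_ring.const)
next
  case tanh_x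
  note d = of_real_chain[of tanh _ "\<lambda>z :: point. fst z", OF tanh_has_real_derivative bl_point(1)]
  have e: "dir_deriv e (\<lambda>z. complex_of_real (tanh (fst z))) = (\<lambda>z. complex_of_real (fst e) * (1 + (- 1) * (complex_of_real (tanh (fst z)) * complex_of_real (tanh (fst z)))))" for e
    by (rule ext) (subst dir_deriv_eqI[OF d], simp)
  show ?case
  proof (intro conjI allI)
    show "\<exists>M. \<forall>z :: point. cmod (complex_of_real (tanh (fst z))) \<le> M"
      by (intro exI[of _ 1]) (auto simp: abs_le_iff less_imp_le tanh_real_lt_1 intro: order.strict_implies_order[OF tanh_real_gt_neg1] minus_le_iff[THEN iffD1])
    show "dir_deriv e (\<lambda>z. complex_of_real (tanh (fst z))) \<in> trig_ring" for e
      unfolding e by (intro trig_ring.intros)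
  qed (use d in \<open>auto simp: y_periodic_def differentiable_def\<close>)
next
  case tanh_t
  note d = of_real_chain[of tanh _ "\<lambda>z :: point. snd (snd z)", OF tanh_has_real_derivative bl_point(3)]
  have e: "dir_deriv e (\<lambda>z. complex_of_real (tanh (snd (snd z)))) = (\<lambda>z. complex_of_real (snd (snd e)) * (1 + (- 1) * (complex_of_real (tanh (snd (snd z))) * complex_of_real (tanh (snd (snd z))))))" for e
    by (rule ext) (subst dir_deriv_eqI[OF d], simp)
  show ?case
  proof (intro conjI allI)
    show "\<exists>M. \<forall>z :: point. cmod (complex_of_real (tanh (snd (snd z)))) \<le> M"
      by (intro exI[of _ 1]) (auto simp: abs_le_iff less_imp_le tanh_real_lt_1 intro: order.strict_implies_order[OF tanh_real_gt_neg1] minus_le_iff[THEN iffD1])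
    show "dir_deriv e (\<lambda>z. complex_of_real (tanh (snd (snd z)))) \<in> trig_ring" for e
      unfolding e by (intro trig_ring.intros)
  qed (use d in \<open>auto simp: y_periodic_def differentiable_def\<close>)
next
  case cos_y
  note d = of_real_chain[of cos _ "\<lambda>z :: point. fst (snd z)", OF DERIV_cos bl_point(2)]
  have e: "dir_deriv e (\<lambda>z. complex_of_real (cos (fst (snd z)))) = (\<lambda>z. complex_of_real (- fst (snd e)) * complex_of_real (sin (fst (snd z))))" for e
    by (rule ext) (subst dir_deriv_eqI[OF d], simp)
  show ?case
  proof (intro conjI allI)
    show "\<exists>M. \<forall>z :: point. cmod (complex_of_real (cos (fst (snd z)))) \<le> M" by (intro exI[of _ 1]) simp
    show "dir_deriv e (\<lambda>z. complex_of_real (cos (fst (snd z)))) \<in> trig_ring" for e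
      unfolding e by (intro trig_ring.intros)
  qed (use d in \<open>auto simp: y_periodic_def differentiable_def\<close>)
next
  case sin_y
  note d = of_real_chain[of sin _ "\<lambda>z :: point. fst (snd z)", OF DERIV_sin bl_point(2)]
  have e: "dir_deriv e (\<lambda>z. complex_of_real (sin (fst (snd z)))) = (\<lambda>z. complex_of_real (fst (snd e)) * complex_of_real (cos (fst (snd z))))" for e
    by (rule ext) (subst dir_deriv_eqI[OF d], simp)
  show ?case
  proof (intro conjI allI)
    show "\<exists>M. \<forall>z :: point. cmod (complex_of_real (sin (fst (snd z)))) \<le> M" by (intro exI[of _ 1]) simp
    show "dir_deriv e (\<lambda>z. complex_of_real (sin (fst (snd z)))) \<in> trig_ring" for e
      unfolding e by (intro trig_ring.intros)
  qed (use d in \<open>auto simp: y_periodic_def differentiable_def\<close>)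
next
  case (add f g)
  then obtain M N where M: "\<And>z. cmod (f z) \<le> M" and N: "\<And>z. cmod (g z) \<le> N" by blast
  have "cmod (f z + g z) \<le> M + N" for z by (meson M N add_mono norm_triangle_le)
  moreover have fd: "\<And>z. f differentiable (at z)" "\<And>z. g differentiable (at z)" "\<And>e. dir_deriv e f \<in> trig_ring" "\<And>e. dir_deriv e g \<in> trig_ring"
    using add.IH by blast+
  moreover have "dir_deriv e (\<lambda>z. f z + g z) \<in> trig_ring" for e
    unfolding dir_deriv_add[OF fd(1,2)] by (intro trig_ring.add fd)
  moreover have "y_periodic (\<lambda>z. f z + g z)" using add.IH by (simp add: y_periodic_def)
  ultimately show ?case by (intro conjI allI differentiable_add) blast+
next
  case (mult f g)
  then obtain M N where M: "\<And>z. cmod (f z) \<le> M" and N: "\<And>z. cmod (g z) \<le> N" by blast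
  have "cmod (f z * g z) \<le> M * N" for z
    unfolding norm_mult using order.trans[OF norm_ge_zero M[of z]] by (intro mult_mono M N) auto
  moreover have fd: "\<And>z. f differentiable (at z)" "\<And>z. g differentiable (at z)" "\<And>e. dir_deriv e f \<in> trig_ring" "\<And>e. dir_deriv e g \<in> trig_ring"
    using mult.IH by blast+
  moreover have "dir_deriv e (\<lambda>z. f z * g z) \<in> trig_ring" for e
    unfolding dir_deriv_mult[OF fd(1,2)] by (intro trig_ring.add trig_ring.mult fd mult.hyps)
  moreover have "y_periodic (\<lambda>z. f z * g z)" using mult.IH by (simp add: y_periodic_def)
  ultimately show ?case by (intro conjI allI differentiable_mult) blast+
qed

lemma trig_ring_bounded_smooth: "f \<in> trig_ring \<Longrightarrow> bounded_smooth f"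
  by (rule bounded_smooth_coinduct[of _ trig_ring]) (use trig_ring_smooth in blast)+

text \<open>A Schwartz-type function without zeros: multiplying by it makes a tested function
  integrable, and it can be divided out again at the end.\<close>

definition sech2 :: "point \<Rightarrow> complex" where
  "sech2 z = complex_of_real (inverse (cosh (fst z))) * complex_of_real (inverse (cosh (snd (snd z))))"

lemma sech2_nz: "sech2 z \<noteq> 0"
  by (simp add: sech2_def)

lemma sech_has_real_derivative: "((\<lambda>x. inverse (cosh x)) has_real_derivative - (tanh x * inverse (cosh x))) (at (x :: real))"
  by (auto intro!: derivative_eq_intros simp: tanh_def field_simps)

lemma sech2_has_derivative:
  "(sech2 has_derivative (\<lambda>h. (complex_of_real (- fst h) * complex_of_real (tanh (fst z)) + complex_of_real (- snd (snd h)) * complex_of_real (tanh (snd (snd z)))) * sech2 z)) (at z)"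
  unfolding sech2_def
  by (rule has_derivative_eq_rhs[OF has_derivative_mult[OF
        of_real_chain[of "\<lambda>x. inverse (cosh x)" _ "\<lambda>z :: point. fst z", OF sech_has_real_derivative bl_point(1)]
        of_real_chain[of "\<lambda>x. inverse (cosh x)" _ "\<lambda>z :: point. snd (snd z)", OF sech_has_real_derivative bl_point(3)]]])
     (simp add: fun_eq_iff algebra_simps)

lemma power_le_fact_exp: "0 \<le> x \<Longrightarrow> x ^ k \<le> fact k * exp (x :: real)"
proof -
  assume x: "0 \<le> x"
  have "(\<Sum>n\<in>{k}. x ^ n /\<^sub>R fact n) \<le> (\<Sum>n. x ^ n /\<^sub>R fact n)"
    by (rule sum_le_suminf[OF summable_exp_generic]) (use x in auto)
  then show ?thesis by (simp add: exp_def field_simps)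
qed

lemma sech_le: "inverse (cosh x) \<le> 2 * exp (- \<bar>x\<bar> :: real)"
proof -
  have "exp \<bar>x\<bar> \<le> 2 * cosh x"
    by (cases "x \<ge> 0") (auto simp: cosh_def scaleR_conv_of_real)
  then show ?thesis using cosh_real_pos[of x] by (simp add: exp_minus field_simps)
qed

text \<open>The \<open>trig_ring\<close> multiples of \<open>sech2\<close> are closed under
  derivatives, since the logarithmic derivatives of \<open>sech2\<close> are combinations of tanh.
  Exponential decay beats every power of \<open>weight\<close>.\<close>

lemma sech2_schwartz: "schwartz sech2"
proof (rule schwartz_coinduct[of _ "{\<lambda>z. r z * sech2 z | r. r \<in> trig_ring}"])
  have diff: "sech2 differentiable (at z)" for z using sech2_has_derivative by (rule differentiableI)
  show "sech2 \<in> {\<lambda>z. r z * sech2 z | r. r \<in> trig_ring}"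
    using trig_ring.const[of 1] by (auto intro!: exI[of _ "\<lambda>z. 1"])
  fix h assume "h \<in> {\<lambda>z. r z * sech2 z | r. r \<in> trig_ring}"
  then obtain r where h: "h = (\<lambda>z. r z * sech2 z)" and r: "r \<in> trig_ring" by blast
  note sm = trig_ring_smooth[OF r]
  show "dir_deriv e h \<in> {\<lambda>z. r z * sech2 z | r. r \<in> trig_ring}" for e
  proof -
    let ?s = "\<lambda>z. complex_of_real (- fst e) * complex_of_real (tanh (fst z)) + complex_of_real (- snd (snd e)) * complex_of_real (tanh (snd (snd z)))"
    have "dir_deriv e sech2 = (\<lambda>z. ?s z * sech2 z)"
      by (rule ext) (rule dir_deriv_eqI[OF sech2_has_derivative])
    then have "dir_deriv e h = (\<lambda>z. (r z * ?s z + dir_deriv e r z) * sech2 z)"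
      unfolding h using sm diff by (subst dir_deriv_mult) (auto simp: algebra_simps)
    moreover have "(\<lambda>z. r z * ?s z + dir_deriv e r z) \<in> trig_ring"
      by (intro trig_ring.intros r) (use sm in blast)
    ultimately show ?thesis
      by (intro CollectI exI[of _ "\<lambda>z. r z * ?s z + dir_deriv e r z"]) simp
  qed
  show "y_periodic h" using sm by (simp add: h y_periodic_def sech2_def)
  show "h differentiable (at z)" for z unfolding h by (intro differentiable_mult diff) (use sm in blast)
  show "\<exists>M. \<forall>z. weight z ^ k * cmod (h z) \<le> M" for k
  proof -
    obtain N where N: "\<And>z. cmod (r z) \<le> N" using sm by blast
    have N0: "0 \<le> N" using order.trans[OF norm_ge_zero N[of 0]] .
    have "weight z ^ k * cmod (h z) \<le> N * (4 * (fact k * exp 1))" for z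
    proof -
      have "cmod (sech2 z) = inverse (cosh (fst z)) * inverse (cosh (snd (snd z)))"
        by (simp add: sech2_def norm_mult norm_inverse)
      also have "\<dots> \<le> (2 * exp (- \<bar>fst z\<bar>)) * (2 * exp (- \<bar>snd (snd z)\<bar>))"
        by (intro mult_mono sech_le) (auto simp: cosh_real_nonneg)
      also have "\<dots> = 4 * exp (1 - weight z)"
        by (simp add: weight_def exp_add[symmetric] exp_diff exp_minus field_simps)
      finally have s: "cmod (sech2 z) \<le> 4 * exp (1 - weight z)" .
      have "weight z ^ k * cmod (h z) \<le> (fact k * exp (weight z)) * (N * (4 * exp (1 - weight z)))"
        unfolding h norm_mult using weight_ge_1[of z] N0
        by (intro mult_mono power_le_fact_exp N s) auto
      also have "\<dots> = N * (4 * (fact k * (exp (weight z) * exp (1 - weight z))))" by simp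
      also have "exp (weight z) * exp (1 - weight z) = exp 1" by (simp add: exp_add[symmetric])
      finally show ?thesis .
    qed
    then show ?thesis by blast
  qed
qed

section \<open>Separation through bounded coordinates\<close>

definition embed :: "point \<Rightarrow> real \<times> real \<times> real \<times> real" where
  "embed z = (tanh (fst z), cos (fst (snd z)), sin (fst (snd z)), tanh (snd (snd z)))"

lemma real_polynomial_embed:
  assumes "real_polynomial_function p"
  shows "(\<lambda>z. complex_of_real (p (embed z))) \<in> trig_ring"
  using assms
proof (induction p rule: real_polynomial_function.induct)
  case (linear l)
  then interpret l: bounded_linear l .
  have e: "embed z = tanh (fst z) *\<^sub>R (1, 0, 0, 0) + (cos (fst (snd z)) *\<^sub>R (0, 1, 0, 0) + (sin (fst (snd z)) *\<^sub>R (0, 0, 1, 0) + tanh (snd (snd z)) *\<^sub>R (0, 0, 0, 1)))" for z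
    by (simp add: embed_def)
  have "(\<lambda>z. complex_of_real (l (embed z))) = (\<lambda>z. complex_of_real (tanh (fst z)) * complex_of_real (l (1, 0, 0, 0)) +
      (complex_of_real (cos (fst (snd z))) * complex_of_real (l (0, 1, 0, 0)) +
       (complex_of_real (sin (fst (snd z))) * complex_of_real (l (0, 0, 1, 0)) + complex_of_real (tanh (snd (snd z))) * complex_of_real (l (0, 0, 0, 1)))))"
    unfolding e l.add l.scaleR by simp
  also have "\<dots> \<in> trig_ring" by (intro trig_ring.intros)
  finally show ?case .
next
  case (const c)
  then show ?case by (rule trig_ring.const)
next
  case (add f g)
  then show ?case using trig_ring.add by simp
next
  case (mult f g)
  then show ?case using trig_ring.mult by simp
qed

lemma embed_continuous: "continuous_on UNIV embed"
  unfolding embed_def by (intro continuous_intros) auto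

lemma embed_in_box: "embed z \<in> cbox (-1, -1, -1, -1) (1, 1, 1, 1)"
  by (simp add: embed_def cbox_Pair_eq less_imp_le[OF tanh_real_lt_1] less_imp_le[OF tanh_real_gt_neg1])

text \<open>Inside the cell the only coincidences are between the edges \<open>y = 0\<close> and
  \<open>y = 2 * pi\<close>; the strict bounds on \<open>z'\<close> exclude them.\<close>

lemma embed_inj:
  assumes "embed z = embed z'" "0 < fst (snd z')" "fst (snd z') < 2 * pi" "0 \<le> fst (snd z)" "fst (snd z) \<le> 2 * pi"
  shows "z = z'"
proof -
  have eq: "tanh (fst z) = tanh (fst z')" "tanh (snd (snd z)) = tanh (snd (snd z'))"
    "cos (fst (snd z)) = cos (fst (snd z'))" "sin (fst (snd z)) = sin (fst (snd z'))"
    using assms(1) by (auto simp: embed_def)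
  obtain n :: int where n: "fst (snd z) = fst (snd z') + 2 * pi * n"
    using sin_cos_eq_iff[of "fst (snd z)" "fst (snd z')"] eq by auto
  have "n = 0"
  proof (rule ccontr)
    assume "n \<noteq> 0"
    then consider "real_of_int n \<ge> 1" | "real_of_int n \<le> - 1" by linarith
    then show False
    proof cases
      case 1
      then have "2 * pi * 1 \<le> 2 * pi * real_of_int n" by (intro mult_left_mono) auto
      then show False using n assms by linarith
    next
      case 2
      then have "2 * pi * real_of_int n \<le> 2 * pi * (- 1)" by (intro mult_left_mono) auto
      then show False using n assms by linarith
    qed
  qed
  then show ?thesis using n eq by (simp add: prod_eq_iff)
qed

text \<open>Built on the completed measure, as \<open>dist_of\<close> and \<open>X_fun\<close> are,
  whereas \<open>fourier\<close> is an integral over \<open>lborel\<close>.\<close>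

definition cell :: "point measure" where
  "cell = restrict_space lebesgue period_cell"

lemma space_cell: "space cell = period_cell"
  by (simp add: cell_def space_restrict_space)

lemma measurable_cell: "f \<in> borel_measurable lebesgue \<Longrightarrow> f \<in> borel_measurable cell"
  unfolding cell_def by (rule measurable_restrict_space1) simp

lemma measurable_cell_borel: "f \<in> borel_measurable borel \<Longrightarrow> f \<in> borel_measurable lebesgue"
  by (metis borel_measurable_if_I lborelD measurable_completion measurable_lborel2)

lemma integrable_cell: "integrable cell f \<longleftrightarrow> set_integrable lebesgue period_cell f" for f :: "point \<Rightarrow> 'a :: {banach, second_countable_topology}"
  unfolding cell_def set_integrable_def by (subst integrable_restrict_space) auto

lemma integral_cell: "integral\<^sup>L cell f = (LINT z:period_cell|lebesgue. f z)" for f :: "point \<Rightarrow> 'a :: {banach, second_countable_topology}"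
  unfolding cell_def set_lebesgue_integral_def by (subst integral_restrict_space) auto

lemma dist_of_cell: "dist_of f \<psi> = integral\<^sup>L cell (\<lambda>z. f z * \<psi> z)"
  by (simp add: dist_of_def integral_cell)

lemma AE_cell: "(AE z in cell. P z) \<longleftrightarrow> (AE z in lebesgue. z \<in> period_cell \<longrightarrow> P z)"
  unfolding cell_def by (subst AE_restrict_space_iff) auto

text \<open>The functions \<open>F n\<close> are continuous and decrease to the indicator of the
  image of \<open>K\<close>. On the box they are uniform limits of polynomials in the bounded
  coordinates, which are multipliers, so each of them integrates to 0 against \<open>h\<close>.
  Injectivity of \<open>embed\<close> pulls the indicator back to that of \<open>K\<close>.\<close>

lemma bounded_smooth_integral_zero_compact:
  fixes h :: "point \<Rightarrow> complex"
  assumes h: "integrable cell h" and z: "\<And>m. bounded_smooth m \<Longrightarrow> (\<integral>z. h z * m z \<partial>cell) = 0"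
    and K: "compact K" "\<And>z. z \<in> K \<Longrightarrow> 0 < fst (snd z) \<and> fst (snd z) < 2 * pi"
  shows "(\<integral>z. indicator K z *\<^sub>R h z \<partial>cell) = 0"
proof (cases "K = {}")
  case False
  have [measurable]: "h \<in> borel_measurable cell" using h by auto
  let ?K = "embed ` K"
  have cK: "compact ?K" by (rule compact_continuous_image[OF continuous_on_subset[OF embed_continuous] K(1)]) simp
  have neK: "?K \<noteq> {}" using False by simp
  define F where "F n v = max 0 (1 - real n * infdist v ?K)" for n v
  have Fc: "continuous_on UNIV (F n)" for n
    unfolding F_def by (intro continuous_intros)
  have Fb: "0 \<le> F n v" "F n v \<le> 1" for n v
    by (auto simp: F_def infdist_nonneg)
  have em: "embed \<in> borel_measurable cell"
    by (intro measurable_cell measurable_cell_borel borel_measurable_continuous_onI embed_continuous)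
  have [measurable]: "(\<lambda>z. F n (embed z)) \<in> borel_measurable cell" for n
    by (rule measurable_compose[OF em borel_measurable_continuous_onI[OF Fc]])
  have zero: "(\<integral>z. F n (embed z) *\<^sub>R h z \<partial>cell) = 0" for n
  proof -
    have iF: "integrable cell (\<lambda>z. F n (embed z) *\<^sub>R h z)"
      by (rule Bochner_Integration.integrable_bound[OF h]) (auto simp: Fb abs_of_nonneg intro!: mult_left_le_one_le)
    have "cmod (\<integral>z. F n (embed z) *\<^sub>R h z \<partial>cell) \<le> \<epsilon> * (\<integral>z. cmod (h z) \<partial>cell)" if eps: "\<epsilon> > 0" for \<epsilon>
    proof -
      obtain p where p: "real_polynomial_function p" "\<And>v. v \<in> cbox (-1, -1, -1, -1) (1, 1, 1, 1) \<Longrightarrow> \<bar>F n v - p v\<bar> < \<epsilon>"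
        using Stone_Weierstrass_real_polynomial_function[OF compact_cbox continuous_on_subset[OF Fc subset_UNIV] eps] by blast
      have bs: "bounded_smooth (\<lambda>z. complex_of_real (p (embed z)))"
        by (intro trig_ring_bounded_smooth real_polynomial_embed p)
      obtain M where M: "\<And>z. cmod (complex_of_real (p (embed z))) \<le> M" using bounded_smoothD(3)[OF bs] by blast
      have pm: "(\<lambda>z. complex_of_real (p (embed z))) \<in> borel_measurable cell"
        by (intro measurable_cell measurable_cell_borel bounded_smooth_measurable bs)
      have ip: "integrable cell (\<lambda>z. h z * complex_of_real (p (embed z)))"
      proof (rule Bochner_Integration.integrable_bound[OF integrable_mult_right[OF h, of "complex_of_real M"]])
        show "AE z in cell. norm (h z * complex_of_real (p (embed z))) \<le> norm (complex_of_real M * h z)"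
        proof (rule AE_I2)
          fix z
          have "cmod (h z) * cmod (complex_of_real (p (embed z))) \<le> cmod (h z) * \<bar>M\<bar>"
            using M[of z] by (intro mult_left_mono) auto
          then show "norm (h z * complex_of_real (p (embed z))) \<le> norm (complex_of_real M * h z)"
            by (simp only: norm_mult norm_of_real mult.commute)
        qed
      qed (use pm in measurable)
      have "(\<integral>z. F n (embed z) *\<^sub>R h z \<partial>cell) = (\<integral>z. F n (embed z) *\<^sub>R h z - h z * complex_of_real (p (embed z)) \<partial>cell)"
        by (subst Bochner_Integration.integral_diff[OF iF ip]) (simp only: z[OF bs] diff_zero)
      also have "cmod \<dots> \<le> (\<integral>z. cmod (F n (embed z) *\<^sub>R h z - h z * complex_of_real (p (embed z))) \<partial>cell)"
        by (rule integral_norm_bound)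
      also have "\<dots> \<le> (\<integral>z. \<epsilon> * cmod (h z) \<partial>cell)"
      proof (rule integral_mono)
        fix z
        have "F n (embed z) *\<^sub>R h z - h z * complex_of_real (p (embed z)) = complex_of_real (F n (embed z) - p (embed z)) * h z"
          by (simp add: scaleR_conv_of_real algebra_simps)
        then show "cmod (F n (embed z) *\<^sub>R h z - h z * complex_of_real (p (embed z))) \<le> \<epsilon> * cmod (h z)"
          using p(2)[OF embed_in_box[of z]] by (simp only: norm_mult norm_of_real) (intro mult_right_mono, auto)
      qed (use iF ip h in auto)
      finally show ?thesis by simp
    qed
    then have le: "\<And>\<epsilon>. \<epsilon> > 0 \<Longrightarrow> cmod (\<integral>z. F n (embed z) *\<^sub>R h z \<partial>cell) \<le> \<epsilon> * (\<integral>z. cmod (h z) \<partial>cell)" .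
    define H where "H = (\<integral>z. cmod (h z) \<partial>cell)"
    have H: "H \<ge> 0" by (simp add: H_def)
    have "cmod (\<integral>z. F n (embed z) *\<^sub>R h z \<partial>cell) \<le> 0 + \<epsilon>" if "\<epsilon> > 0" for \<epsilon>
    proof -
      \<comment> \<open>Dividing by \<open>H + 1\<close> keeps the tolerance finite and positive
        when \<open>H = 0\<close>.\<close>
      have "cmod (\<integral>z. F n (embed z) *\<^sub>R h z \<partial>cell) \<le> (\<epsilon> / (H + 1)) * H"
        unfolding H_def using that H by (intro le) (simp add: H_def[symmetric])
      also have "\<dots> \<le> \<epsilon>" using that H by (simp add: field_simps)
      finally show ?thesis by simp
    qed
    then have "cmod (\<integral>z. F n (embed z) *\<^sub>R h z \<partial>cell) \<le> 0" by (rule field_le_epsilon)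
    then show ?thesis by simp
  qed
  have "(\<lambda>n. \<integral>z. F n (embed z) *\<^sub>R h z \<partial>cell) \<longlonglongrightarrow> (\<integral>z. indicator K z *\<^sub>R h z \<partial>cell)"
  proof (rule integral_dominated_convergence[where w="\<lambda>z. cmod (h z)"])
    have "K \<in> sets lebesgue" using compact_imp_closed[OF K(1)] by simp
    then have [measurable]: "(indicator K :: point \<Rightarrow> real) \<in> borel_measurable cell"
      by (intro measurable_cell) simp
    show "(\<lambda>z. indicator K z *\<^sub>R h z) \<in> borel_measurable cell" by measurable
    show "AE z in cell. (\<lambda>n. F n (embed z) *\<^sub>R h z) \<longlonglongrightarrow> indicator K z *\<^sub>R h z"
    proof (rule AE_I2)
      fix z assume "z \<in> space cell"
      then have zc: "0 \<le> fst (snd z)" "fst (snd z) \<le> 2 * pi" by (auto simp: space_cell period_cell_def)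
      have "(\<lambda>n. F n (embed z)) \<longlonglongrightarrow> indicator K z"
      proof (cases "z \<in> K")
        case True
        then have "F n (embed z) = 1" for n by (simp add: F_def)
        then show ?thesis using True by simp
      next
        case False
        have "embed z \<notin> ?K"
        proof
          assume "embed z \<in> ?K"
          then obtain z' where "z' \<in> K" "embed z = embed z'" by auto
          then show False using embed_inj[of z z'] K(2)[of z'] zc False by blast
        qed
        then have d: "infdist (embed z) ?K > 0"
          using in_closed_iff_infdist_zero[OF compact_imp_closed[OF cK] neK] infdist_nonneg[of "embed z" ?K] by (metis less_eq_real_def)
        obtain N where N: "1 / infdist (embed z) ?K < real N" using reals_Archimedean2 by blast
        have "F n (embed z) = 0" if "n \<ge> N" for n
        proof -
          have "1 < real N * infdist (embed z) ?K" using N d by (simp add: field_simps)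
          also have "\<dots> \<le> real n * infdist (embed z) ?K" using that d by (intro mult_right_mono) auto
          finally show ?thesis by (simp add: F_def)
        qed
        then have "eventually (\<lambda>n. F n (embed z) = 0) sequentially" by (auto simp: eventually_sequentially)
        then show ?thesis using False by (simp add: tendsto_eventually)
      qed
      then show "(\<lambda>n. F n (embed z) *\<^sub>R h z) \<longlonglongrightarrow> indicator K z *\<^sub>R h z" by (intro tendsto_intros)
    qed
    show "AE z in cell. norm (F n (embed z) *\<^sub>R h z) \<le> cmod (h z)" for n
      by (auto simp: Fb abs_of_nonneg intro!: mult_left_le_one_le)
  qed (use h in auto)
  then show ?thesis unfolding zero by (simp add: LIMSEQ_const_iff)
qed simp

text \<open>Up to a null set the part of the open strip where \<open>g\<close> is positive is a
  countable union of compact sets. On each of these a positive function has integral 0, so each is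
  null.\<close>

lemma AE_zero_of_compact_integrals_zero:
  fixes g :: "point \<Rightarrow> real"
  assumes g: "integrable cell g" and gm: "g \<in> borel_measurable lebesgue"
    and z: "\<And>K. compact K \<Longrightarrow> (\<And>z. z \<in> K \<Longrightarrow> 0 < fst (snd z) \<and> fst (snd z) < 2 * pi) \<Longrightarrow> (\<integral>z. indicator K z *\<^sub>R g z \<partial>cell) = 0"
  shows "AE z in lebesgue. 0 < fst (snd z) \<and> fst (snd z) < 2 * pi \<longrightarrow> \<not> 0 < g z"
proof -
  define U where "U = {z :: point. 0 < fst (snd z) \<and> fst (snd z) < 2 * pi}"
  have U: "U \<in> sets lebesgue"
  proof -
    have "open U" unfolding U_def by (intro open_Collect_conj open_Collect_less continuous_intros)
    then show ?thesis by simp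
  qed
  define S where "S = {z \<in> space lebesgue. 0 < g z} \<inter> U"
  have S: "S \<in> sets lebesgue" unfolding S_def using gm U by (intro sets.Int) measurable
  have null: "K \<in> null_sets lebesgue" if K: "compact K" "K \<subseteq> S" for K
  proof -
    have Kc: "K \<in> sets lebesgue" using compact_imp_closed[OF K(1)] by simp
    have sub: "K \<subseteq> period_cell" using K(2) by (auto simp: S_def U_def period_cell_def)
    have [measurable]: "(indicator K :: point \<Rightarrow> real) \<in> borel_measurable cell" using Kc by (intro measurable_cell) simp
    have gc: "g \<in> borel_measurable cell" using g by auto
    have int: "integrable cell (\<lambda>z. indicator K z *\<^sub>R g z)"
    proof (rule Bochner_Integration.integrable_bound[OF g])
      show "(\<lambda>z. indicator K z *\<^sub>R g z) \<in> borel_measurable cell" using gc by measurable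
    qed (auto simp: indicator_def)
    have "(\<integral>z. indicator K z *\<^sub>R g z \<partial>cell) = 0" using K(2) by (intro z K(1)) (auto simp: S_def U_def)
    moreover have "AE z in cell. 0 \<le> indicator K z *\<^sub>R g z"
      using K(2) by (intro AE_I2) (auto simp: indicator_def S_def)
    ultimately have "AE z in cell. indicator K z *\<^sub>R g z = 0"
      using integral_nonneg_eq_0_iff_AE[OF int] by blast
    then have "AE z in cell. z \<notin> K"
      by (rule AE_mp) (use K(2) in \<open>auto intro!: AE_I2 simp: indicator_def S_def split: if_splits\<close>)
    then have "AE z in lebesgue. z \<notin> K" unfolding AE_cell by (rule AE_mp) (use sub in \<open>auto intro!: AE_I2\<close>)
    then show ?thesis using Kc by (simp add: AE_iff_null_sets)
  qed
  obtain C T where CT: "fsigma C" "T \<in> null_sets lebesgue" "C \<union> T = S"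
    using lebesgue_set_almost_fsigma[OF S] by metis
  obtain \<F> :: "nat \<Rightarrow> point set" where F: "range \<F> \<subseteq> Collect compact" "\<Union>(range \<F>) = C"
    using fsigma_Union_compact[of C] CT(1) by blast
  have "(\<Union>n. \<F> n) \<in> null_sets lebesgue"
    using F CT(3) by (intro null_sets_UN null) auto
  then have "C \<in> null_sets lebesgue" using F(2) by simp
  then have "S \<in> null_sets lebesgue" using CT(2,3) null_sets.Un by blast
  then have "AE z in lebesgue. z \<notin> S" using S by (simp add: AE_iff_null_sets)
  then show ?thesis by (rule AE_mp) (auto intro!: AE_I2 simp: S_def U_def)
qed

text \<open>The product of \<open>w\<close> and \<open>sech2\<close> is integrable, and testing
  \<open>w\<close> with \<open>sech2\<close> times a multiplier shows that this product is
  orthogonal to all multipliers, hence has integral 0 over compact subsets of the open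
  strip.\<close>

theorem schwartz_determining:
  fixes w :: "point \<Rightarrow> complex"
  assumes wm: "w \<in> borel_measurable lebesgue"
    and int: "\<And>\<psi>. schwartz \<psi> \<Longrightarrow> integrable cell (\<lambda>z. w z * \<psi> z)"
    and zero: "\<And>\<psi>. schwartz \<psi> \<Longrightarrow> (\<integral>z. w z * \<psi> z \<partial>cell) = 0"
  shows "AE z in cell. w z = 0"
proof -
  define h where "h z = w z * sech2 z" for z
  have h: "integrable cell h" unfolding h_def by (intro int sech2_schwartz)
  have hm: "h \<in> borel_measurable lebesgue"
    unfolding h_def using wm measurable_cell_borel[OF schwartz_measurable[OF sech2_schwartz]] by measurable
  have hz: "(\<integral>z. h z * m z \<partial>cell) = 0" if "bounded_smooth m" for m
    using zero[OF schwartz_mult[OF sech2_schwartz that]] by (simp add: h_def mult.assoc)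
  have hK: "(\<integral>z. indicator K z *\<^sub>R h z \<partial>cell) = 0" if "compact K" "\<And>z. z \<in> K \<Longrightarrow> 0 < fst (snd z) \<and> fst (snd z) < 2 * pi" for K
    by (rule bounded_smooth_integral_zero_compact[OF h hz that])
  have iK: "integrable cell (\<lambda>z. indicator K z *\<^sub>R h z)" if "compact K" for K
  proof (rule Bochner_Integration.integrable_bound[OF h])
    have "K \<in> sets lebesgue" using compact_imp_closed[OF that] by simp
    then have [measurable]: "(indicator K :: point \<Rightarrow> real) \<in> borel_measurable cell" by (intro measurable_cell) simp
    have "h \<in> borel_measurable cell" using h by auto
    then show "(\<lambda>z. indicator K z *\<^sub>R h z) \<in> borel_measurable cell" by measurable
  qed (auto simp: indicator_def)
  \<comment> \<open>Applied to plus and minus the real and imaginary parts, which together force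
    \<open>h z = 0\<close>.\<close>
  let ?Q = "\<lambda>l. AE z in lebesgue. 0 < fst (snd z) \<and> fst (snd z) < 2 * pi \<longrightarrow> \<not> 0 < l (h z)"
  have Q: "?Q l" if l: "bounded_linear l" for l :: "complex \<Rightarrow> real"
  proof (rule AE_zero_of_compact_integrals_zero)
    interpret bounded_linear l by (rule l)
    show "integrable cell (\<lambda>z. l (h z))" by (rule integrable_bounded_linear[OF l h])
    show "(\<lambda>z. l (h z)) \<in> borel_measurable lebesgue"
      by (rule measurable_compose[OF hm borel_measurable_continuous_onI]) (rule linear_continuous_on[OF l])
    fix K :: "point set" assume K: "compact K" "\<And>z. z \<in> K \<Longrightarrow> 0 < fst (snd z) \<and> fst (snd z) < 2 * pi"
    have "(\<integral>z. indicator K z *\<^sub>R l (h z) \<partial>cell) = (\<integral>z. l (indicator K z *\<^sub>R h z) \<partial>cell)" by (simp add: scaleR)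
    also have "\<dots> = l (\<integral>z. indicator K z *\<^sub>R h z \<partial>cell)" by (rule integral_bounded_linear[OF l iK[OF K(1)]])
    finally show "(\<integral>z. indicator K z *\<^sub>R l (h z) \<partial>cell) = 0" using hK[OF K] by (simp add: zero)
  qed
  \<comment> \<open>The two edges of the cell, where \<open>embed\<close> is not injective, lie in
    hyperplanes and are null.\<close>
  have nb: "AE z in (lebesgue :: point measure). fst (snd z) \<noteq> 0 \<and> fst (snd z) \<noteq> (2 * pi :: real)"
  proof -
    have "negligible {z :: point. (0, 1, 0) \<bullet> z = c}" for c
      by (rule negligible_hyperplane) (simp add: zero_prod_def)
    then have "negligible {z :: point. fst (snd z) = c}" for c by (simp add: inner_prod_def)
    then have "{z :: point. fst (snd z) = c} \<in> null_sets lebesgue" for c by (simp add: negligible_iff_null_sets)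
    from AE_not_in[OF this[of 0]] AE_not_in[OF this[of "2 * pi"]] show ?thesis by eventually_elim auto
  qed
  have "AE z in lebesgue. z \<in> period_cell \<longrightarrow> w z = 0"
    using Q[OF bounded_linear_Re] Q[OF bounded_linear_minus[OF bounded_linear_Re]] Q[OF bounded_linear_Im] Q[OF bounded_linear_minus[OF bounded_linear_Im]] nb
  proof eventually_elim
    case (elim z)
    show ?case
    proof
      assume "z \<in> period_cell"
      then have "0 < fst (snd z) \<and> fst (snd z) < 2 * pi" using elim(5) by (auto simp: period_cell_def)
      then have "Re (h z) = 0" "Im (h z) = 0" using elim by auto
      then have "h z = 0" by (simp add: complex_eq_iff)
      then show "w z = 0" using sech2_nz[of z] by (simp add: h_def)
    qed
  qed
  then show ?thesis unfolding AE_cell .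
qed

section \<open>Completeness of the square-integrable functions\<close>

lemma schwartz_measurable_cell: "schwartz f \<Longrightarrow> f \<in> borel_measurable cell"
  by (intro measurable_cell measurable_cell_borel schwartz_measurable)

lemma set_integrable_lebesgue_lborel:
  fixes f :: "point \<Rightarrow> complex"
  assumes [measurable]: "f \<in> borel_measurable borel"
  shows "set_integrable lebesgue period_cell f \<longleftrightarrow> set_integrable lborel period_cell f"
    "(LINT z:period_cell|lebesgue. f z) = (LINT z:period_cell|lborel. f z)"
  unfolding set_integrable_def set_lebesgue_integral_def
  by (simp_all add: integrable_completion integral_completion)

lemma schwartz_integrable_cell: "schwartz f \<Longrightarrow> integrable cell f"
  unfolding integrable_cell
  by (simp add: set_integrable_lebesgue_lborel schwartz_measurable schwartz_integrable)

lemma bounded_smooth_cnj: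
  assumes "bounded_smooth f" shows "bounded_smooth (\<lambda>z. cnj (f z))"
proof (rule bounded_smooth_coinduct[of _ "{\<lambda>z. cnj (f z) | f. bounded_smooth f}"])
  fix h assume "h \<in> {\<lambda>z. cnj (f z) | f. bounded_smooth f}"
  then obtain f where h: "h = (\<lambda>z. cnj (f z))" and f: "bounded_smooth f" by blast
  have d: "(h has_derivative (\<lambda>k. cnj (frechet_derivative f (at z) k))) (at z)" for z
    unfolding h by (intro has_derivative_cnj has_derivative_frechet bounded_smoothD(2) f)
  then show "h differentiable (at z)" for z by (rule differentiableI)
  show "dir_deriv e h \<in> {\<lambda>z. cnj (f z) | f. bounded_smooth f}" if e: "e \<in> Basis" for e
  proof -
    have "dir_deriv e h = (\<lambda>z. cnj (dir_deriv e f z))"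
      by (rule ext) (subst dir_deriv_eqI[OF d], simp add: dir_deriv_def)
    then show ?thesis using bounded_smooth_dir_deriv[OF f e] by blast
  qed
  show "y_periodic h" using bounded_smoothD(1)[OF f] by (simp add: h y_periodic_def)
  show "\<exists>M. \<forall>z. cmod (h z) \<le> M" using bounded_smoothD(3)[OF f] by (simp add: h)
qed (use assms in blast)

lemma schwartz_Plancherel:
  assumes f: "schwartz f"
  shows "(2 * pi) ^ 3 * (\<integral>z. (cmod (f z))\<^sup>2 \<partial>cell) = (\<integral>w. (cmod (fourier f w))\<^sup>2 \<partial>freq_measure)"
proof -
  have bs: "bounded_smooth (\<lambda>z. cnj (f z))" by (intro bounded_smooth_cnj schwartz_bounded_smooth f)
  have ff: "schwartz (\<lambda>z. f z * cnj (f z))" by (intro schwartz_mult f bs)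
  have si: "set_integrable lborel period_cell (\<lambda>z. cnj (f z))"
    using integrable_cnj[OF schwartz_integrable[OF f, unfolded set_integrable_def]]
    unfolding set_integrable_def by (simp only: complex_cnj_scaleR)
  have "(LINT z:period_cell|lborel. cnj (f z) * character (fst w) (fst (snd w)) (snd (snd w)) z) = cnj (fourier f w)" for w
    unfolding fourier_eq_set set_lebesgue_integral_def
    by (subst Bochner_Integration.integral_cnj[symmetric], intro Bochner_Integration.integral_cong refl)
       (simp add: cnj_character complex_cnj_scaleR)
  then have "(2 * pi) ^ 3 * (LINT z:period_cell|lborel. f z * cnj (f z)) = (\<integral>w. fourier f w * cnj (fourier f w) \<partial>freq_measure)"
    using fourier_pairing[OF f si] by simp
  also have "(LINT z:period_cell|lborel. f z * cnj (f z)) = (\<integral>z. f z * cnj (f z) \<partial>cell)"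
    unfolding integral_cell by (rule set_integrable_lebesgue_lborel(2)[symmetric, OF schwartz_measurable[OF ff]])
  also have "\<dots> = complex_of_real (\<integral>z. (cmod (f z))\<^sup>2 \<partial>cell)"
    by (subst integral_complex_of_real[symmetric]) (simp only: complex_norm_square)
  also have "(\<integral>w. fourier f w * cnj (fourier f w) \<partial>freq_measure) = complex_of_real (\<integral>w. (cmod (fourier f w))\<^sup>2 \<partial>freq_measure)"
    by (subst integral_complex_of_real[symmetric]) (simp only: complex_norm_square)
  finally have "complex_of_real ((2 * pi) ^ 3 * (\<integral>z. (cmod (f z))\<^sup>2 \<partial>cell)) = complex_of_real (\<integral>w. (cmod (fourier f w))\<^sup>2 \<partial>freq_measure)"
    by simp
  then show ?thesis by (simp only: of_real_eq_iff)
qed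

text \<open>Kept as a square with values in \<open>ennreal\<close>, so that it makes sense for
  limits before they are known to be square integrable.\<close>

definition sq_norm :: "(point \<Rightarrow> complex) \<Rightarrow> ennreal" where
  "sq_norm f = (\<integral>\<^sup>+z. ennreal ((cmod (f z))\<^sup>2) \<partial>cell)"

text \<open>For nonnegative \<open>s\<close> and \<open>b\<close> the weight is at least 1, so
  Plancherel gives the comparison; the factor \<open>(2 * pi) ^ 3\<close> only helps.\<close>

lemma sq_norm_schwartz:
  assumes f: "schwartz f" and s: "0 \<le> s" "0 \<le> b"
  shows "sq_norm f \<le> ennreal ((schwartz_norm s b f)\<^sup>2)"
proof -
  have bs: "bounded_smooth (\<lambda>z. cnj (f z))" by (intro bounded_smooth_cnj schwartz_bounded_smooth f)
  have "integrable cell (\<lambda>z. f z * cnj (f z))" by (intro schwartz_integrable_cell schwartz_mult f bs)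
  then have "integrable cell (\<lambda>z. cmod (f z * cnj (f z)))" by (rule integrable_norm)
  then have i: "integrable cell (\<lambda>z. (cmod (f z))\<^sup>2)" by (simp add: norm_mult power2_eq_square)
  have "sq_norm f = ennreal (\<integral>z. (cmod (f z))\<^sup>2 \<partial>cell)"
    unfolding sq_norm_def by (rule nn_integral_eq_integral[OF i]) simp
  also have "\<dots> \<le> ennreal ((schwartz_norm s b f)\<^sup>2)"
  proof (rule ennreal_leI)
    have c: "1 \<le> (2 * pi) ^ 3" using pi_gt3 by (intro one_le_power) simp
    have "1 * (\<integral>z. (cmod (f z))\<^sup>2 \<partial>cell) \<le> (2 * pi) ^ 3 * (\<integral>z. (cmod (f z))\<^sup>2 \<partial>cell)"
      using c by (intro mult_right_mono) auto
    also have "\<dots> = (\<integral>w. (cmod (fourier f w))\<^sup>2 \<partial>freq_measure)" by (rule schwartz_Plancherel[OF f])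
    also have "\<dots> \<le> (schwartz_norm s b f)\<^sup>2"
      unfolding schwartz_norm_power2
    proof (rule integral_mono[OF _ X_integrable[OF f]])
      show "integrable freq_measure (\<lambda>w. (cmod (fourier f w))\<^sup>2)"
        using X_integrable[OF f, of 0 0] by (simp add: X_weight_def)
      fix w
      have "1 * 1 \<le> X_weight s b w"
        unfolding X_weight_def using s
        by (intro mult_mono ge_one_powr_ge_zero) (auto simp: modulation_def japanese_def bracket_ge_1)
      then show "(cmod (fourier f w))\<^sup>2 \<le> X_weight s b w * (cmod (fourier f w))\<^sup>2"
        using mult_right_mono[of 1 "X_weight s b w" "(cmod (fourier f w))\<^sup>2"] by simp
    qed
    finally show "(\<integral>z. (cmod (f z))\<^sup>2 \<partial>cell) \<le> (schwartz_norm s b f)\<^sup>2" by simp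
  qed
  finally show ?thesis .
qed

lemma sq_norm_add_le:
  assumes [measurable]: "f \<in> borel_measurable cell" "g \<in> borel_measurable cell"
    and le: "\<And>z. cmod (h z) \<le> cmod (f z) + cmod (g z)"
  shows "sq_norm h \<le> 2 * (sq_norm f + sq_norm g)"
proof -
  have "ennreal ((cmod (h z))\<^sup>2) \<le> 2 * (ennreal ((cmod (f z))\<^sup>2) + ennreal ((cmod (g z))\<^sup>2))" for z
  proof -
    have "(cmod (h z))\<^sup>2 \<le> (cmod (f z) + cmod (g z))\<^sup>2" by (intro power_mono le) auto
    also have "\<dots> \<le> 2 * ((cmod (f z))\<^sup>2 + (cmod (g z))\<^sup>2)"
      using zero_le_power2[of "cmod (f z) - cmod (g z)"] by (simp add: power2_eq_square algebra_simps)
    finally have "ennreal ((cmod (h z))\<^sup>2) \<le> ennreal (2 * ((cmod (f z))\<^sup>2 + (cmod (g z))\<^sup>2))" by (rule ennreal_leI)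
    also have "\<dots> = 2 * (ennreal ((cmod (f z))\<^sup>2) + ennreal ((cmod (g z))\<^sup>2))"
      by (subst ennreal_mult) auto
    finally show ?thesis .
  qed
  then have "sq_norm h \<le> (\<integral>\<^sup>+z. 2 * (ennreal ((cmod (f z))\<^sup>2) + ennreal ((cmod (g z))\<^sup>2)) \<partial>cell)"
    unfolding sq_norm_def by (intro nn_integral_mono)
  also have "\<dots> = 2 * (sq_norm f + sq_norm g)"
    unfolding sq_norm_def by (simp add: nn_integral_cmult nn_integral_add)
  finally show ?thesis .
qed

lemma sq_norm_finite:
  assumes [measurable]: "\<And>n. f n \<in> borel_measurable cell" "g \<in> borel_measurable cell"
    and fin: "\<And>n :: nat. sq_norm (f n) < \<infinity>" and lim: "(\<lambda>n. sq_norm (\<lambda>z. f n z - g z)) \<longlonglongrightarrow> 0"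
  shows "sq_norm g < \<infinity>"
proof -
  have "eventually (\<lambda>n. sq_norm (\<lambda>z. f n z - g z) < 1) sequentially" using lim by (rule order_tendstoD) simp
  then obtain n where n: "sq_norm (\<lambda>z. f n z - g z) < 1" by (auto simp: eventually_sequentially)
  have "sq_norm g \<le> 2 * (sq_norm (f n) + sq_norm (\<lambda>z. f n z - g z))"
    by (rule sq_norm_add_le) (auto simp: norm_triangle_sub norm_minus_commute)
  also have "\<dots> < \<infinity>" using fin[of n] n by (simp add: ennreal_mult_less_top less_trans[OF n])
  finally show ?thesis .
qed

lemma ennreal_pos_below:
  fixes a :: ennreal
  assumes "0 < a"
  shows "\<exists>e>0. ennreal e < a"
proof -
  obtain d where d: "0 < d" "d < a" using dense[OF assms] by blast
  obtain e where "d = ennreal e" "0 \<le> e" using d by (cases d) auto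
  then show ?thesis using d by (intro exI[of _ e]) auto
qed

lemma tendsto_zero_of_square:
  fixes X Y :: "nat \<Rightarrow> ennreal"
  assumes "\<And>n. (X n)\<^sup>2 \<le> Y n" "Y \<longlonglongrightarrow> 0"
  shows "X \<longlonglongrightarrow> 0"
proof (rule order_tendstoI)
  fix a :: ennreal assume a: "0 < a"
  obtain e where e: "0 < e" "ennreal e < a"
    using ennreal_pos_below[OF a] by blast
  have "eventually (\<lambda>n. Y n < ennreal (e\<^sup>2)) sequentially" using assms(2) by (rule order_tendstoD) (use e in simp)
  then show "eventually (\<lambda>n. X n < a) sequentially"
  proof eventually_elim
    case (elim n)
    have "X n \<le> ennreal e"
    proof (rule ccontr)
      assume "\<not> X n \<le> ennreal e"
      then have "(ennreal e)\<^sup>2 \<le> (X n)\<^sup>2" by (intro power_mono) auto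
      then show False using elim assms(1)[of n] e by (simp add: ennreal_power)
    qed
    then show ?case using e(2) by simp
  qed
qed simp

text \<open>The difference is written as \<open>(f n - F) * g n + F * (g n - G)\<close> and
  Cauchy-Schwarz is applied to both terms; \<open>sq_norm (g n)\<close> is controlled through its
  limit.\<close>

lemma pairing_tendsto:
  assumes [measurable]: "\<And>n. f n \<in> borel_measurable cell" "\<And>n. g n \<in> borel_measurable cell" "F \<in> borel_measurable cell" "G \<in> borel_measurable cell"
    and fin: "\<And>n :: nat. sq_norm (f n) < \<infinity>" "\<And>n. sq_norm (g n) < \<infinity>"
    and lim: "(\<lambda>n. sq_norm (\<lambda>z. f n z - F z)) \<longlonglongrightarrow> 0" "(\<lambda>n. sq_norm (\<lambda>z. g n z - G z)) \<longlonglongrightarrow> 0"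
  shows "integrable cell (\<lambda>z. F z * G z)" "(\<lambda>n. \<integral>z. f n z * g n z \<partial>cell) \<longlonglongrightarrow> (\<integral>z. F z * G z \<partial>cell)"
proof -
  have F: "sq_norm F < \<infinity>" by (rule sq_norm_finite[OF assms(1) assms(3) fin(1) lim(1)])
  have G: "sq_norm G < \<infinity>" by (rule sq_norm_finite[OF assms(2) assms(4) fin(2) lim(2)])
  note FG = F G
  have CS: "(\<integral>\<^sup>+z. ennreal (cmod (a z * b z)) \<partial>cell)\<^sup>2 \<le> sq_norm a * sq_norm b"
    if [measurable]: "a \<in> borel_measurable cell" "b \<in> borel_measurable cell" for a b
    using Cauchy_Schwarz_nn_integral[of "\<lambda>z. ennreal (cmod (a z))" cell "\<lambda>z. ennreal (cmod (b z))"]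
    by (simp add: sq_norm_def norm_mult ennreal_mult ennreal_power)
  have int: "integrable cell (\<lambda>z. a z * b z)"
    if [measurable]: "a \<in> borel_measurable cell" "b \<in> borel_measurable cell" and "sq_norm a < \<infinity>" "sq_norm b < \<infinity>" for a b
  proof (rule integrableI_bounded)
    have "(\<integral>\<^sup>+z. ennreal (cmod (a z * b z)) \<partial>cell)\<^sup>2 < \<infinity>"
      by (rule order.strict_trans1[OF CS[OF that(1,2)]]) (use that(3,4) in \<open>simp add: ennreal_mult_less_top\<close>)
    then show "(\<integral>\<^sup>+z. ennreal (cmod (a z * b z)) \<partial>cell) < \<infinity>"
      by (simp add: power_less_top_ennreal)
  qed measurable
  show "integrable cell (\<lambda>z. F z * G z)" by (intro int FG) measurable
  have ifg: "integrable cell (\<lambda>z. f n z * g n z)" for n by (intro int fin) measurable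
  have gb: "sq_norm (g n) \<le> 2 * (sq_norm (\<lambda>z. g n z - G z) + sq_norm G)" for n
  proof (rule sq_norm_add_le)
    show "cmod (g n z) \<le> cmod (g n z - G z) + cmod (G z)" for z
      using norm_triangle_ineq[of "g n z - G z" "G z"] by simp
  qed measurable
  define X where "X n = (\<integral>\<^sup>+z. ennreal (cmod ((f n z - F z) * g n z)) \<partial>cell)" for n
  define Y where "Y n = (\<integral>\<^sup>+z. ennreal (cmod (F z * (g n z - G z))) \<partial>cell)" for n
  have "X \<longlonglongrightarrow> 0"
  proof (rule tendsto_zero_of_square)
    show "(X n)\<^sup>2 \<le> sq_norm (\<lambda>z. f n z - F z) * (2 * (sq_norm (\<lambda>z. g n z - G z) + sq_norm G))" for n
      unfolding X_def by (rule order.trans[OF CS mult_left_mono[OF gb]]) auto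
    have "(\<lambda>n. sq_norm (\<lambda>z. f n z - F z) * (2 * (sq_norm (\<lambda>z. g n z - G z) + sq_norm G))) \<longlonglongrightarrow> 0 * (2 * (0 + sq_norm G))"
      using FG by (intro tendsto_mult_ennreal ennreal_tendsto_cmult tendsto_add lim tendsto_const) (auto simp: ennreal_mult_eq_top_iff)
    then show "(\<lambda>n. sq_norm (\<lambda>z. f n z - F z) * (2 * (sq_norm (\<lambda>z. g n z - G z) + sq_norm G))) \<longlonglongrightarrow> 0" by simp
  qed
  moreover have "Y \<longlonglongrightarrow> 0"
  proof (rule tendsto_zero_of_square)
    show "(Y n)\<^sup>2 \<le> sq_norm F * sq_norm (\<lambda>z. g n z - G z)" for n
      unfolding Y_def by (rule CS) auto
    have "(\<lambda>n. sq_norm F * sq_norm (\<lambda>z. g n z - G z)) \<longlonglongrightarrow> sq_norm F * 0"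
      using FG by (intro ennreal_tendsto_cmult lim) auto
    then show "(\<lambda>n. sq_norm F * sq_norm (\<lambda>z. g n z - G z)) \<longlonglongrightarrow> 0" by simp
  qed
  ultimately have XY: "(\<lambda>n. X n + Y n) \<longlonglongrightarrow> 0" using tendsto_add[of X 0 sequentially Y 0] by simp
  have le: "ennreal (cmod ((\<integral>z. f n z * g n z \<partial>cell) - (\<integral>z. F z * G z \<partial>cell))) \<le> X n + Y n" for n
  proof -
    have FGi: "integrable cell (\<lambda>z. F z * G z)" by (intro int FG) measurable
    have "ennreal (cmod ((\<integral>z. f n z * g n z \<partial>cell) - (\<integral>z. F z * G z \<partial>cell))) = ennreal (cmod (\<integral>z. f n z * g n z - F z * G z \<partial>cell))"
      by (subst Bochner_Integration.integral_diff[OF ifg FGi]) (rule refl)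
    also have "\<dots> \<le> (\<integral>\<^sup>+z. ennreal (cmod (f n z * g n z - F z * G z)) \<partial>cell)"
      by (rule integral_norm_bound_ennreal[OF Bochner_Integration.integrable_diff[OF ifg FGi]])
    also have "\<dots> \<le> (\<integral>\<^sup>+z. ennreal (cmod ((f n z - F z) * g n z)) + ennreal (cmod (F z * (g n z - G z))) \<partial>cell)"
    proof (rule nn_integral_mono)
      fix z
      have "f n z * g n z - F z * G z = (f n z - F z) * g n z + F z * (g n z - G z)" by (simp add: algebra_simps)
      then have "cmod (f n z * g n z - F z * G z) \<le> cmod ((f n z - F z) * g n z) + cmod (F z * (g n z - G z))"
        by (metis norm_triangle_ineq)
      then show "ennreal (cmod (f n z * g n z - F z * G z)) \<le> ennreal (cmod ((f n z - F z) * g n z)) + ennreal (cmod (F z * (g n z - G z)))"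
        by (simp add: ennreal_plus[symmetric] ennreal_leI del: ennreal_plus)
    qed
    also have "\<dots> = X n + Y n" unfolding X_def Y_def by (rule nn_integral_add) measurable
    finally show ?thesis .
  qed
  have "(\<lambda>n. ennreal (cmod ((\<integral>z. f n z * g n z \<partial>cell) - (\<integral>z. F z * G z \<partial>cell)))) \<longlonglongrightarrow> ennreal 0"
    by (rule tendsto_sandwich[OF _ _ tendsto_const XY[folded ennreal_0]]) (auto simp: le)
  then have "(\<lambda>n. cmod ((\<integral>z. f n z * g n z \<partial>cell) - (\<integral>z. F z * G z \<partial>cell))) \<longlonglongrightarrow> 0"
    by (subst (asm) tendsto_ennreal_iff) auto
  then have "(\<lambda>n. (\<integral>z. f n z * g n z \<partial>cell) - (\<integral>z. F z * G z \<partial>cell)) \<longlonglongrightarrow> 0"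
    by (rule tendsto_norm_zero_cancel)
  then show "(\<lambda>n. \<integral>z. f n z * g n z \<partial>cell) \<longlonglongrightarrow> (\<integral>z. F z * G z \<partial>cell)"
    by (rule LIM_zero_cancel)
qed

text \<open>The Riesz-Fischer argument: a rapidly Cauchy subsequence converges almost everywhere by
  Borel-Cantelli, and Fatou's lemma bounds the distance from \<open>\<phi> n\<close> to the
  limit.\<close>

lemma sq_norm_complete:
  assumes \<phi>: "\<And>n. schwartz (\<phi> n)" and s: "0 \<le> s" "0 \<le> b"
    and cauchy: "\<forall>\<epsilon>>0. \<exists>N. \<forall>m\<ge>N. \<forall>n\<ge>N. schwartz_norm s b (\<lambda>z. \<phi> m z - \<phi> n z) < \<epsilon>"
  shows "\<exists>F \<in> borel_measurable lebesgue. (\<lambda>n. sq_norm (\<lambda>z. \<phi> n z - F z)) \<longlonglongrightarrow> 0"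
proof -
  have "\<exists>N. \<forall>k. \<forall>m\<ge>N k. \<forall>n\<ge>N k. schwartz_norm s b (\<lambda>z. \<phi> m z - \<phi> n z) < (1/4) ^ k"
    using cauchy by (intro choice allI) simp
  then obtain N where N: "\<And>k m n. m \<ge> N k \<Longrightarrow> n \<ge> N k \<Longrightarrow> schwartz_norm s b (\<lambda>z. \<phi> m z - \<phi> n z) < (1/4) ^ k" by blast
  \<comment> \<open>The sum makes \<open>r\<close> monotone and at least \<open>N k\<close>; the
    summand \<open>k\<close> makes it unbounded.\<close>
  define r where "r k = (\<Sum>i\<le>k. N i) + k" for k
  have rN: "N k \<le> r k" for k unfolding r_def by (simp add: member_le_sum trans_le_add1)
  have rk: "k \<le> r k" "r k \<le> r (Suc k)" for k by (auto simp: r_def)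
  have sq: "sq_norm (\<lambda>z. \<phi> m z - \<phi> n z) \<le> ennreal (\<epsilon>\<^sup>2)" if "schwartz_norm s b (\<lambda>z. \<phi> m z - \<phi> n z) < \<epsilon>" for m n \<epsilon>
  proof -
    have "(schwartz_norm s b (\<lambda>z. \<phi> m z - \<phi> n z))\<^sup>2 \<le> \<epsilon>\<^sup>2"
      using that schwartz_norm_nonneg by (intro power_mono) auto
    then show ?thesis using sq_norm_schwartz[OF schwartz_diff[OF \<phi> \<phi>] s] by (meson ennreal_leI order.trans)
  qed
  have [measurable]: "\<phi> n \<in> borel_measurable cell" "\<phi> n \<in> borel_measurable lebesgue" for n
    by (intro schwartz_measurable_cell measurable_cell_borel schwartz_measurable \<phi>)+
  define A where "A k = {z \<in> space cell. (1/2) ^ k \<le> cmod (\<phi> (r (Suc k)) z - \<phi> (r k) z)}" for k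
  have A [measurable]: "A k \<in> sets cell" for k unfolding A_def by measurable
  \<comment> \<open>Chebyshev's inequality: the increment has squared norm at most the square of
    (1/4)^k, while its square is at least (1/4)^k on \<open>A k\<close>.\<close>
  have emA: "emeasure cell (A k) \<le> ennreal ((1/4) ^ k)" for k
  proof -
    have "schwartz_norm s b (\<lambda>z. \<phi> (r (Suc k)) z - \<phi> (r k) z) < (1/4) ^ k"
      using rN[of k] rk(2)[of k] by (intro N) auto
    note D = sq[OF this]
    have "ennreal ((1/4) ^ k) * emeasure cell (A k) = (\<integral>\<^sup>+z. ennreal ((1/4) ^ k) * indicator (A k) z \<partial>cell)"
      by (rule nn_integral_cmult_indicator[symmetric]) measurable
    also have "\<dots> \<le> sq_norm (\<lambda>z. \<phi> (r (Suc k)) z - \<phi> (r k) z)"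
      unfolding sq_norm_def
    proof (rule nn_integral_mono)
      fix z
      have "(1/4) ^ k \<le> (cmod (\<phi> (r (Suc k)) z - \<phi> (r k) z))\<^sup>2" if "z \<in> A k"
      proof -
        have "((1/2) ^ k)\<^sup>2 \<le> (cmod (\<phi> (r (Suc k)) z - \<phi> (r k) z))\<^sup>2"
          using that by (intro power_mono) (auto simp: A_def)
        moreover have "((1/2 :: real) ^ k)\<^sup>2 = (1/4) ^ k" by (simp add: power2_eq_square power_mult_distrib[symmetric])
        ultimately show ?thesis by simp
      qed
      then show "ennreal ((1/4) ^ k) * indicator (A k) z \<le> ennreal ((cmod (\<phi> (r (Suc k)) z - \<phi> (r k) z))\<^sup>2)"
        by (auto simp: indicator_def intro: ennreal_leI)
    qed
    also have "\<dots> \<le> ennreal (((1/4) ^ k)\<^sup>2)" by (rule D)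
    also have "\<dots> = ennreal ((1/4) ^ k) * ennreal ((1/4) ^ k)" by (simp add: power2_eq_square ennreal_mult)
    finally show ?thesis
      by (subst (asm) ennreal_mult_le_mult_iff) auto
  qed
  have "AE z in cell. eventually (\<lambda>k. z \<in> space cell - A k) sequentially"
  proof (rule borel_cantelli_AE1)
    show fin: "emeasure cell (A k) < \<infinity>" for k using emA[of k] by (simp add: order.strict_trans1)
    have "measure cell (A k) \<le> (1/4) ^ k" for k
      using emA[of k] fin[of k] by (simp add: emeasure_eq_ennreal_measure)
    then show "summable (\<lambda>k. measure cell (A k))"
      by (intro summable_comparison_test'[OF summable_geometric[of "1/4"], of 0]) auto
  qed measurable
  then have conv: "AE z in cell. convergent (\<lambda>k. \<phi> (r k) z)"
  proof eventually_elim
    case (elim z)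
    then obtain K where "\<forall>k\<ge>K. z \<in> space cell - A k" by (auto simp: eventually_sequentially)
    then have K: "cmod (\<phi> (r (Suc k)) z - \<phi> (r k) z) \<le> (1/2) ^ k" if "k \<ge> K" for k
      using that by (force simp: A_def not_le)
    have "summable (\<lambda>k. \<phi> (r (Suc k)) z - \<phi> (r k) z)"
      by (rule summable_comparison_test'[OF summable_geometric[of "1/2"], of K]) (use K in auto)
    then have "convergent (\<lambda>n. \<Sum>k<n. \<phi> (r (Suc k)) z - \<phi> (r k) z)" by (simp add: summable_iff_convergent)
    moreover have "(\<Sum>k<n. \<phi> (r (Suc k)) z - \<phi> (r k) z) = \<phi> (r n) z - \<phi> (r 0) z" for n
      by (rule sum_lessThan_telescope[of "\<lambda>k. \<phi> (r k) z"])
    ultimately have "convergent (\<lambda>n. \<phi> (r n) z - \<phi> (r 0) z)" by simp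
    from convergent_add[OF this convergent_const[of "\<phi> (r 0) z"]] show ?case by simp
  qed
  \<comment> \<open>Where the subsequence diverges \<open>lim\<close> has an unspecified value; this
    happens only on a null set.\<close>
  define F where "F z = lim (\<lambda>k. \<phi> (r k) z)" for z
  have F [measurable]: "F \<in> borel_measurable lebesgue" unfolding F_def by (intro borel_measurable_lim_metric) measurable
  have [measurable]: "F \<in> borel_measurable cell" by (rule measurable_cell[OF F])
  have "(\<lambda>n. sq_norm (\<lambda>z. \<phi> n z - F z)) \<longlonglongrightarrow> 0"
  proof (rule order_tendstoI)
    fix a :: ennreal assume a: "0 < a"
    obtain e where e: "0 < e" "ennreal e < a"
      using ennreal_pos_below[OF a] by blast
    obtain M where M: "\<And>m n. m \<ge> M \<Longrightarrow> n \<ge> M \<Longrightarrow> schwartz_norm s b (\<lambda>z. \<phi> m z - \<phi> n z) < sqrt e"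
      using cauchy e(1) by (meson real_sqrt_gt_zero)
    have "sq_norm (\<lambda>z. \<phi> n z - F z) \<le> ennreal e" if n: "n \<ge> M" for n
    proof -
      have "sq_norm (\<lambda>z. \<phi> n z - F z) = (\<integral>\<^sup>+z. liminf (\<lambda>k. ennreal ((cmod (\<phi> n z - \<phi> (r k) z))\<^sup>2)) \<partial>cell)"
        unfolding sq_norm_def
      proof (rule nn_integral_cong_AE)
        show "AE z in cell. ennreal ((cmod (\<phi> n z - F z))\<^sup>2) = liminf (\<lambda>k. ennreal ((cmod (\<phi> n z - \<phi> (r k) z))\<^sup>2))"
          using conv
        proof eventually_elim
          case (elim z)
          then have "(\<lambda>k. \<phi> (r k) z) \<longlonglongrightarrow> F z" unfolding F_def by (simp add: convergent_LIMSEQ_iff)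
          then have "(\<lambda>k. ennreal ((cmod (\<phi> n z - \<phi> (r k) z))\<^sup>2)) \<longlonglongrightarrow> ennreal ((cmod (\<phi> n z - F z))\<^sup>2)"
            by (intro tendsto_ennrealI tendsto_intros)
          from lim_imp_Liminf[OF _ this] show ?case by simp
        qed
      qed
      also have "\<dots> \<le> liminf (\<lambda>k. sq_norm (\<lambda>z. \<phi> n z - \<phi> (r k) z))"
        unfolding sq_norm_def by (rule nn_integral_liminf) measurable
      also have "\<dots> \<le> ennreal e"
      proof (rule Liminf_le)
        show "eventually (\<lambda>k. sq_norm (\<lambda>z. \<phi> n z - \<phi> (r k) z) \<le> ennreal e) sequentially"
        proof (rule eventually_sequentiallyI[of M])
          fix k assume "M \<le> k"
          then have "r k \<ge> M" using rk(1)[of k] by simp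
          from sq[OF M[OF n this]] e(1) show "sq_norm (\<lambda>z. \<phi> n z - \<phi> (r k) z) \<le> ennreal e" by simp
        qed
      qed simp
      finally show ?thesis .
    qed
    then show "eventually (\<lambda>n. sq_norm (\<lambda>z. \<phi> n z - F z) < a) sequentially"
      using e(2) by (intro eventually_sequentiallyI[of M]) (auto intro: order.strict_trans1)
  qed simp
  then show ?thesis using F by blast
qed

text \<open>The sequence has an L^2 limit \<open>F\<close>, and testing shows that \<open>F\<close>
  and \<open>u\<close> define the same distribution, so \<open>schwartz_determining\<close>
  identifies them almost everywhere. Convergence as distributions is thereby strengthened to the L^2
  convergence that products require.\<close>

lemma X_approx_sq_norm:
  assumes u: "u \<in> X_fun s b" and \<phi>: "X_approx s b \<phi> (real_dist u)" and s: "0 \<le> s" "0 \<le> b"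
  shows "(\<lambda>n. sq_norm (\<lambda>z. \<phi> n z - complex_of_real (u z))) \<longlonglongrightarrow> 0"
proof -
  have sch: "\<And>n. schwartz (\<phi> n)" and cauchy: "\<forall>\<epsilon>>0. \<exists>N. \<forall>m\<ge>N. \<forall>n\<ge>N. schwartz_norm s b (\<lambda>z. \<phi> m z - \<phi> n z) < \<epsilon>"
    and dist: "\<And>\<psi>. schwartz \<psi> \<Longrightarrow> (\<lambda>n. dist_of (\<phi> n) \<psi>) \<longlonglongrightarrow> real_dist u \<psi>"
    using \<phi> by (auto simp: X_approx_def)
  obtain F where F: "F \<in> borel_measurable lebesgue" and lim: "(\<lambda>n. sq_norm (\<lambda>z. \<phi> n z - F z)) \<longlonglongrightarrow> 0"
    using sq_norm_complete[OF sch s cauchy] by blast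
  have um: "(\<lambda>z. complex_of_real (u z)) \<in> borel_measurable lebesgue"
    using u unfolding X_fun_def by auto
  have fin: "sq_norm \<psi> < \<infinity>" if "schwartz \<psi>" for \<psi>
    using sq_norm_schwartz[OF that s] by (simp add: order.strict_trans1)
  have FP: "integrable cell (\<lambda>z. F z * \<psi> z)" "(\<lambda>n. \<integral>z. \<phi> n z * \<psi> z \<partial>cell) \<longlonglongrightarrow> (\<integral>z. F z * \<psi> z \<partial>cell)" if \<psi>: "schwartz \<psi>" for \<psi>
    using pairing_tendsto[of \<phi> "\<lambda>_. \<psi>" F \<psi>] sch \<psi> fin lim measurable_cell[OF F] schwartz_measurable_cell
    by (auto simp: sq_norm_def)
  have uP: "integrable cell (\<lambda>z. complex_of_real (u z) * \<psi> z)" if "schwartz \<psi>" for \<psi>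
    using u that unfolding X_fun_def integrable_cell by blast
  have "AE z in cell. complex_of_real (u z) - F z = 0"
  proof (rule schwartz_determining)
    show "(\<lambda>z. complex_of_real (u z) - F z) \<in> borel_measurable lebesgue" using um F by measurable
    fix \<psi> assume \<psi>: "schwartz \<psi>"
    show "integrable cell (\<lambda>z. (complex_of_real (u z) - F z) * \<psi> z)"
      unfolding left_diff_distrib by (intro Bochner_Integration.integrable_diff uP FP \<psi>)
    have "(\<lambda>n. \<integral>z. \<phi> n z * \<psi> z \<partial>cell) \<longlonglongrightarrow> (\<integral>z. complex_of_real (u z) * \<psi> z \<partial>cell)"
      using dist[OF \<psi>] by (simp add: real_dist_def dist_of_cell)
    then have "(\<integral>z. complex_of_real (u z) * \<psi> z \<partial>cell) = (\<integral>z. F z * \<psi> z \<partial>cell)"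
      using FP(2)[OF \<psi>] by (rule LIMSEQ_unique)
    then show "(\<integral>z. (complex_of_real (u z) - F z) * \<psi> z \<partial>cell) = 0"
      unfolding left_diff_distrib by (subst Bochner_Integration.integral_diff[OF uP[OF \<psi>] FP(1)[OF \<psi>]]) simp
  qed
  then have "sq_norm (\<lambda>z. \<phi> n z - complex_of_real (u z)) = sq_norm (\<lambda>z. \<phi> n z - F z)" for n
    unfolding sq_norm_def by (intro nn_integral_cong_AE) (auto elim!: AE_mp)
  then show ?thesis using lim by simp
qed

section \<open>The bilinear estimate on the completion\<close>

lemma partial_x_schwartz: "schwartz f \<Longrightarrow> schwartz (partial_x f)"
  unfolding partial_x_def by (rule schwartz_dir_deriv) (simp_all add: Basis_point)

lemma schwartz_product: "schwartz f \<Longrightarrow> schwartz g \<Longrightarrow> schwartz (\<lambda>z. f z * g z)"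
  by (intro schwartz_mult schwartz_bounded_smooth)

lemma dist_of_partial_x:
  assumes F: "schwartz F" and \<eta>: "schwartz \<eta>"
  shows "dist_of (partial_x F) \<eta> = - dist_of F (partial_x \<eta>)"
proof -
  have "partial_x (\<lambda>z. F z * \<eta> z) = (\<lambda>z. F z * partial_x \<eta> z + partial_x F z * \<eta> z)"
    unfolding partial_x_def using schwartzD(2)[OF F] schwartzD(2)[OF \<eta>] by (rule dir_deriv_mult)
  moreover have "(LINT z:period_cell|lborel. partial_x (\<lambda>z. F z * \<eta> z) z) = 0"
    unfolding partial_x_def by (rule integral_dir_deriv_zero[OF schwartz_product[OF F \<eta>]]) (simp add: Basis_point)
  moreover have i: "set_integrable lborel period_cell (\<lambda>z. F z * partial_x \<eta> z)" "set_integrable lborel period_cell (\<lambda>z. partial_x F z * \<eta> z)"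
    by (intro schwartz_integrable schwartz_product partial_x_schwartz F \<eta>)+
  ultimately have z: "(LINT z:period_cell|lborel. F z * partial_x \<eta> z) + (LINT z:period_cell|lborel. partial_x F z * \<eta> z) = 0"
    by (simp add: set_integral_add(2))
  have leb: "dist_of f g = (LINT z:period_cell|lborel. f z * g z)" if "schwartz f" "schwartz g" for f g
  proof -
    have [measurable]: "(\<lambda>z. f z * g z) \<in> borel_measurable borel"
      by (intro schwartz_measurable schwartz_product that)
    show ?thesis unfolding dist_of_def set_lebesgue_integral_def by (rule integral_completion) measurable
  qed
  show ?thesis
    using z by (simp add: leb F \<eta> partial_x_schwartz eq_neg_iff_add_eq_0 add.commute)
qed

text \<open>Bilinearity through f g - h k = (f - h) g - h (k - g). The derivatives are compared on
  the Fourier side, where \<open>partial_x\<close> is a multiplication.\<close>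

lemma schwartz_norm_product_diff:
  assumes C: "\<And>f g. schwartz f \<Longrightarrow> schwartz g \<Longrightarrow>
      schwartz_norm s b' (partial_x (\<lambda>z. f z * g z)) \<le> C * schwartz_norm s b f * schwartz_norm s b g"
    and f: "schwartz f" "schwartz g" "schwartz h" "schwartz k"
  shows "schwartz_norm s b' (\<lambda>z. partial_x (\<lambda>z. f z * g z) z - partial_x (\<lambda>z. h z * k z) z) \<le>
    C * schwartz_norm s b (\<lambda>z. f z - h z) * schwartz_norm s b g + C * schwartz_norm s b h * schwartz_norm s b (\<lambda>z. k z - g z)"
proof -
  let ?A = "\<lambda>z. (f z - h z) * g z" and ?B = "\<lambda>z. h z * (k z - g z)"
  have S: "schwartz (\<lambda>z. f z * g z)" "schwartz (\<lambda>z. h z * k z)" "schwartz ?A" "schwartz ?B"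
    by (intro schwartz_product schwartz_diff f)+
  have eq: "(\<lambda>z. f z * g z - h z * k z) = (\<lambda>z. ?A z - ?B z)" by (simp add: fun_eq_iff algebra_simps)
  have "schwartz_norm s b' (\<lambda>z. partial_x (\<lambda>z. f z * g z) z - partial_x (\<lambda>z. h z * k z) z)
     \<le> schwartz_norm s b' (partial_x ?A) + schwartz_norm s b' (partial_x ?B)"
  proof (rule schwartz_norm_triangle_gen)
    show "cmod (fourier (\<lambda>z. partial_x (\<lambda>z. f z * g z) z - partial_x (\<lambda>z. h z * k z) z) w)
      \<le> cmod (fourier (partial_x ?A) w) + cmod (fourier (partial_x ?B) w)" for w
    proof -
      have "fourier (\<lambda>z. f z * g z) w - fourier (\<lambda>z. h z * k z) w = fourier ?A w - fourier ?B w"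
        using fourier_diff[OF S(1,2), of w] fourier_diff[OF S(3,4), of w] unfolding eq by simp
      then have "fourier (\<lambda>z. partial_x (\<lambda>z. f z * g z) z - partial_x (\<lambda>z. h z * k z) z) w
          = fourier (partial_x ?A) w - fourier (partial_x ?B) w"
        by (simp only: fourier_diff[OF partial_x_schwartz partial_x_schwartz, OF S(1,2)] fourier_partial_x S right_diff_distrib[symmetric])
      then show ?thesis by (simp add: norm_triangle_ineq4)
    qed
  qed (intro schwartz_diff partial_x_schwartz S)+
  also have "\<dots> \<le> C * schwartz_norm s b (\<lambda>z. f z - h z) * schwartz_norm s b g + C * schwartz_norm s b h * schwartz_norm s b (\<lambda>z. k z - g z)"
    by (intro add_mono C schwartz_diff f)
  finally show ?thesis .
qed

lemma X_approx_norm_convergent: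
  assumes "X_approx s b \<phi> T"
  shows "convergent (\<lambda>n. schwartz_norm s b (\<phi> n))"
proof -
  have "Cauchy (\<lambda>n. schwartz_norm s b (\<phi> n))"
  proof (rule CauchyI)
    fix e :: real assume "0 < e"
    then obtain N where N: "\<And>m n. m \<ge> N \<Longrightarrow> n \<ge> N \<Longrightarrow> schwartz_norm s b (\<lambda>z. \<phi> m z - \<phi> n z) < e"
      using assms unfolding X_approx_def by meson
    have "norm (schwartz_norm s b (\<phi> m) - schwartz_norm s b (\<phi> n)) < e" if "m \<ge> N" "n \<ge> N" for m n
      using schwartz_norm_diff_triangle[of "\<phi> m" "\<phi> n" s b] N[OF that] assms unfolding X_approx_def by simp
    then show "\<exists>M. \<forall>m\<ge>M. \<forall>n\<ge>M. norm (schwartz_norm s b (\<phi> m) - schwartz_norm s b (\<phi> n)) < e" by blast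
  qed
  then show ?thesis by (simp add: Cauchy_convergent_iff)
qed

lemma X_norm_le:
  assumes "X_approx s b \<phi> T" "(\<lambda>n. schwartz_norm s b (\<phi> n)) \<longlonglongrightarrow> r"
  shows "X_norm s b T \<le> r"
  unfolding X_norm_def
  by (rule cInf_lower) (use assms in \<open>auto intro!: bdd_belowI[of _ 0] LIMSEQ_le_const schwartz_norm_nonneg\<close>)

text \<open>Norms along the two sequences are bounded, so each term of
  \<open>schwartz_norm_product_diff\<close> can be made smaller than half of \<epsilon>.\<close>

lemma X_approx_product_cauchy:
  assumes C: "0 < C" "\<And>f g. schwartz f \<Longrightarrow> schwartz g \<Longrightarrow>
      schwartz_norm s b' (partial_x (\<lambda>z. f z * g z)) \<le> C * schwartz_norm s b f * schwartz_norm s b g"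
    and \<phi>: "X_approx s b \<phi> T" and \<psi>: "X_approx s b \<psi> T'" and \<epsilon>: "0 < \<epsilon>"
  shows "\<exists>N. \<forall>m\<ge>N. \<forall>n\<ge>N. schwartz_norm s b' (\<lambda>z. partial_x (\<lambda>z. \<phi> m z * \<psi> m z) z - partial_x (\<lambda>z. \<phi> n z * \<psi> n z) z) < \<epsilon>"
proof -
  have sch: "\<And>n. schwartz (\<phi> n)" "\<And>n. schwartz (\<psi> n)" using \<phi> \<psi> by (auto simp: X_approx_def)
  have bd: "\<exists>K>0. \<forall>n. schwartz_norm s b (\<alpha> n) \<le> K" if \<alpha>: "X_approx s b \<alpha> S" for \<alpha> S
  proof -
    obtain K where "K > 0" "\<And>n. norm (schwartz_norm s b (\<alpha> n)) \<le> K"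
      using convergent_imp_Bseq[OF X_approx_norm_convergent[OF \<alpha>]] by (auto elim: BseqE)
    then show ?thesis by (metis abs_le_D1 real_norm_def)
  qed
  obtain K where K: "K > 0" "\<And>n. schwartz_norm s b (\<phi> n) \<le> K" using bd[OF \<phi>] by blast
  obtain L where L: "L > 0" "\<And>n. schwartz_norm s b (\<psi> n) \<le> L" using bd[OF \<psi>] by blast
  have "\<epsilon> / (2 * C * L) > 0" "\<epsilon> / (2 * C * K) > 0" using \<epsilon> C K L by auto
  then obtain N N' where N: "\<And>m n. m \<ge> N \<Longrightarrow> n \<ge> N \<Longrightarrow> schwartz_norm s b (\<lambda>z. \<phi> m z - \<phi> n z) < \<epsilon> / (2 * C * L)"
    and N': "\<And>m n. m \<ge> N' \<Longrightarrow> n \<ge> N' \<Longrightarrow> schwartz_norm s b (\<lambda>z. \<psi> m z - \<psi> n z) < \<epsilon> / (2 * C * K)"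
    using \<phi> \<psi> unfolding X_approx_def by meson
  have "schwartz_norm s b' (\<lambda>z. partial_x (\<lambda>z. \<phi> m z * \<psi> m z) z - partial_x (\<lambda>z. \<phi> n z * \<psi> n z) z) < \<epsilon>"
    if mn: "m \<ge> max N N'" "n \<ge> max N N'" for m n
  proof -
    have "schwartz_norm s b' (\<lambda>z. partial_x (\<lambda>z. \<phi> m z * \<psi> m z) z - partial_x (\<lambda>z. \<phi> n z * \<psi> n z) z)
      \<le> C * schwartz_norm s b (\<lambda>z. \<phi> m z - \<phi> n z) * schwartz_norm s b (\<psi> m) + C * schwartz_norm s b (\<phi> n) * schwartz_norm s b (\<lambda>z. \<psi> n z - \<psi> m z)"
      by (rule schwartz_norm_product_diff[OF C(2)]) (auto intro: sch)
    also have "\<dots> \<le> C * schwartz_norm s b (\<lambda>z. \<phi> m z - \<phi> n z) * L + C * K * schwartz_norm s b (\<lambda>z. \<psi> n z - \<psi> m z)"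
      using C(1) K L by (intro add_mono mult_mono) (auto simp: schwartz_norm_nonneg)
    also have "\<dots> < C * (\<epsilon> / (2 * C * L)) * L + C * K * (\<epsilon> / (2 * C * K))"
      using C(1) K(1) L(1) N[of m n] N'[of n m] mn by (intro add_strict_mono mult_strict_right_mono mult_strict_left_mono) auto
    also have "\<dots> = \<epsilon>" using C(1) K(1) L(1) by (simp add: field_simps)
    finally show ?thesis .
  qed
  then show ?thesis by blast
qed

lemma sq_norm_mult_bounded:
  assumes [measurable]: "f \<in> borel_measurable cell" and m: "\<And>z. cmod (m z) \<le> M"
  shows "sq_norm (\<lambda>z. f z * m z) \<le> ennreal (M\<^sup>2) * sq_norm f"
proof -
  have "sq_norm (\<lambda>z. f z * m z) \<le> (\<integral>\<^sup>+z. ennreal (M\<^sup>2) * ennreal ((cmod (f z))\<^sup>2) \<partial>cell)"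
    unfolding sq_norm_def
  proof (rule nn_integral_mono)
    fix z
    have "(cmod (f z * m z))\<^sup>2 \<le> M\<^sup>2 * (cmod (f z))\<^sup>2"
      using mult_left_mono[OF power_mono[OF m[of z], of 2], of "(cmod (f z))\<^sup>2"] by (simp add: norm_mult power_mult_distrib mult.commute)
    then show "ennreal ((cmod (f z * m z))\<^sup>2) \<le> ennreal (M\<^sup>2) * ennreal ((cmod (f z))\<^sup>2)"
      by (simp add: ennreal_mult[symmetric] ennreal_leI)
  qed
  also have "\<dots> = ennreal (M\<^sup>2) * sq_norm f" unfolding sq_norm_def by (rule nn_integral_cmult) measurable
  finally show ?thesis .
qed

text \<open>The test function is attached to the second factor. Multiplication by a bounded function
  preserves L^2 convergence, so \<open>pairing_tendsto\<close> applies to \<open>\<phi> n\<close>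
  and \<open>\<psi> n * \<eta>\<close>.\<close>

lemma product_pairing_tendsto:
  assumes s: "0 \<le> s" "0 \<le> b" and u: "u \<in> X_fun s b" and v: "v \<in> X_fun s b"
    and \<phi>: "X_approx s b \<phi> (real_dist u)" and \<psi>: "X_approx s b \<psi> (real_dist v)" and \<eta>: "schwartz \<eta>"
  shows "(\<lambda>n. dist_of (\<lambda>z. \<phi> n z * \<psi> n z) \<eta>) \<longlonglongrightarrow> real_dist (\<lambda>z. u z * v z) \<eta>"
proof -
  have sch: "\<And>n. schwartz (\<phi> n)" "\<And>n. schwartz (\<psi> n)" using \<phi> \<psi> by (auto simp: X_approx_def)
  obtain M where M: "\<And>z. cmod (\<eta> z) \<le> M" using bounded_smoothD(3)[OF schwartz_bounded_smooth[OF \<eta>]] by blast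
  have um: "(\<lambda>z. complex_of_real (u z)) \<in> borel_measurable cell" "(\<lambda>z. complex_of_real (v z)) \<in> borel_measurable cell"
    using u v unfolding X_fun_def by (auto intro: measurable_cell)
  note [measurable] = um schwartz_measurable_cell[OF \<eta>] schwartz_measurable_cell[OF sch(1)] schwartz_measurable_cell[OF sch(2)]
  have fin: "sq_norm f < \<infinity>" if "schwartz f" for f
    using sq_norm_schwartz[OF that s] by (simp add: order.strict_trans1)
  have lim: "(\<lambda>n. sq_norm (\<lambda>z. \<psi> n z * \<eta> z - complex_of_real (v z) * \<eta> z)) \<longlonglongrightarrow> 0"
  proof (rule tendsto_sandwich[OF _ _ tendsto_const])
    show "\<forall>\<^sub>F n in sequentially. sq_norm (\<lambda>z. \<psi> n z * \<eta> z - complex_of_real (v z) * \<eta> z) \<le> ennreal (M\<^sup>2) * sq_norm (\<lambda>z. \<psi> n z - complex_of_real (v z))"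
      unfolding left_diff_distrib[symmetric] by (intro always_eventually allI sq_norm_mult_bounded M) measurable
    show "(\<lambda>n. ennreal (M\<^sup>2) * sq_norm (\<lambda>z. \<psi> n z - complex_of_real (v z))) \<longlonglongrightarrow> 0"
      using ennreal_tendsto_cmult[OF _ X_approx_sq_norm[OF v \<psi> s], of "ennreal (M\<^sup>2)"] by simp
  qed simp
  have "(\<lambda>n. \<integral>z. \<phi> n z * (\<psi> n z * \<eta> z) \<partial>cell) \<longlonglongrightarrow> (\<integral>z. complex_of_real (u z) * (complex_of_real (v z) * \<eta> z) \<partial>cell)"
    by (rule pairing_tendsto(2)[OF _ _ _ _ fin fin X_approx_sq_norm[OF u \<phi> s] lim])
       (auto intro: sch schwartz_product \<eta>)
  then show ?thesis by (simp add: real_dist_def dist_of_cell mult.assoc)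
qed

text \<open>Integration by parts moves the derivative to the test function, so convergence follows
  from \<open>product_pairing_tendsto\<close> tested with \<open>partial_x \<eta>\<close>.\<close>

lemma X_approx_product:
  assumes s: "0 \<le> s" "0 \<le> b" and C: "0 < C" "\<And>f g. schwartz f \<Longrightarrow> schwartz g \<Longrightarrow>
      schwartz_norm s b' (partial_x (\<lambda>z. f z * g z)) \<le> C * schwartz_norm s b f * schwartz_norm s b g"
    and u: "u \<in> X_fun s b" and v: "v \<in> X_fun s b"
    and \<phi>: "X_approx s b \<phi> (real_dist u)" and \<psi>: "X_approx s b \<psi> (real_dist v)"
  shows "X_approx s b' (\<lambda>n. partial_x (\<lambda>z. \<phi> n z * \<psi> n z)) (dist_dx (real_dist (\<lambda>z. u z * v z)))"
  unfolding X_approx_def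
proof (intro conjI allI impI)
  have sch: "\<And>n. schwartz (\<phi> n)" "\<And>n. schwartz (\<psi> n)" using \<phi> \<psi> by (auto simp: X_approx_def)
  show "schwartz (partial_x (\<lambda>z. \<phi> n z * \<psi> n z))" for n
    by (intro partial_x_schwartz schwartz_product sch)
  show "\<exists>N. \<forall>m\<ge>N. \<forall>n\<ge>N. schwartz_norm s b' (\<lambda>z. partial_x (\<lambda>z. \<phi> m z * \<psi> m z) z - partial_x (\<lambda>z. \<phi> n z * \<psi> n z) z) < \<epsilon>"
    if "0 < \<epsilon>" for \<epsilon>
    using C \<phi> \<psi> that by (rule X_approx_product_cauchy)
  show "(\<lambda>n. dist_of (partial_x (\<lambda>z. \<phi> n z * \<psi> n z)) \<eta>) \<longlonglongrightarrow> dist_dx (real_dist (\<lambda>z. u z * v z)) \<eta>"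
    if \<eta>: "schwartz \<eta>" for \<eta>
    using tendsto_minus[OF product_pairing_tendsto[OF s u v \<phi> \<psi> partial_x_schwartz[OF \<eta>]]]
    by (simp add: dist_of_partial_x schwartz_product sch \<eta> dist_dx_def)
qed

lemma le_mult_Inf:
  fixes A :: "real set"
  assumes "A \<noteq> {}" "0 \<le> c" "\<And>a. a \<in> A \<Longrightarrow> x \<le> c * a"
  shows "x \<le> c * Inf A"
proof (cases "c = 0")
  case True
  then show ?thesis using assms by auto
next
  case False
  then have "x / c \<le> Inf A" using assms by (intro cInf_greatest) (auto simp: field_simps)
  then show ?thesis using False assms(2) by (simp add: field_simps)
qed

lemma X_norm_nonneg:
  assumes "T \<in> X_space s b" shows "0 \<le> X_norm s b T"
    and "{r. \<exists>\<phi>. X_approx s b \<phi> T \<and> (\<lambda>n. schwartz_norm s b (\<phi> n)) \<longlonglongrightarrow> r} \<noteq> {}"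
proof -
  show ne: "{r. \<exists>\<phi>. X_approx s b \<phi> T \<and> (\<lambda>n. schwartz_norm s b (\<phi> n)) \<longlonglongrightarrow> r} \<noteq> {}"
    using assms X_approx_norm_convergent unfolding X_space_def convergent_def by blast
  show "0 \<le> X_norm s b T"
    unfolding X_norm_def by (rule cInf_greatest[OF ne]) (auto intro!: LIMSEQ_le_const schwartz_norm_nonneg)
qed

text \<open>The estimate passes to the limit along every pair of approximating sequences. The infima
  in \<open>X_norm\<close> are then taken one factor at a time, the other factor being
  nonnegative.\<close>

lemma bilinear_X:
  assumes s: "0 \<le> s" "0 \<le> b" and C: "0 < C" "\<And>f g. schwartz f \<Longrightarrow> schwartz g \<Longrightarrow>
      schwartz_norm s b' (partial_x (\<lambda>z. f z * g z)) \<le> C * schwartz_norm s b f * schwartz_norm s b g"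
    and u: "u \<in> X_fun s b" and v: "v \<in> X_fun s b"
  shows "dist_dx (real_dist (\<lambda>z. u z * v z)) \<in> X_space s b'"
    and "X_norm s b' (dist_dx (real_dist (\<lambda>z. u z * v z))) \<le> C * X_norm s b (real_dist u) * X_norm s b (real_dist v)"
proof -
  let ?T = "dist_dx (real_dist (\<lambda>z. u z * v z))"
  have approx: "X_approx s b' (\<lambda>n. partial_x (\<lambda>z. \<phi> n z * \<psi> n z)) ?T"
    if "X_approx s b \<phi> (real_dist u)" "X_approx s b \<psi> (real_dist v)" for \<phi> \<psi>
    by (rule X_approx_product[OF s C(1) _ u v that]) (rule C(2))
  have X: "real_dist u \<in> X_space s b" "real_dist v \<in> X_space s b" using u v unfolding X_fun_def by auto
  show "?T \<in> X_space s b'" using X approx unfolding X_space_def by blast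
  have le: "X_norm s b' ?T \<le> C * p * q"
    if \<phi>: "X_approx s b \<phi> (real_dist u)" "(\<lambda>n. schwartz_norm s b (\<phi> n)) \<longlonglongrightarrow> p"
      and \<psi>: "X_approx s b \<psi> (real_dist v)" "(\<lambda>n. schwartz_norm s b (\<psi> n)) \<longlonglongrightarrow> q" for \<phi> \<psi> p q
  proof -
    obtain r where r: "(\<lambda>n. schwartz_norm s b' (partial_x (\<lambda>z. \<phi> n z * \<psi> n z))) \<longlonglongrightarrow> r"
      using X_approx_norm_convergent[OF approx[OF \<phi>(1) \<psi>(1)]] unfolding convergent_def by blast
    have "X_norm s b' ?T \<le> r" by (rule X_norm_le[OF approx[OF \<phi>(1) \<psi>(1)] r])
    also have "r \<le> C * p * q"
    proof (rule LIMSEQ_le[OF r])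
      show "(\<lambda>n. C * schwartz_norm s b (\<phi> n) * schwartz_norm s b (\<psi> n)) \<longlonglongrightarrow> C * p * q"
        by (intro tendsto_intros \<phi> \<psi>)
      show "\<exists>N. \<forall>n\<ge>N. schwartz_norm s b' (partial_x (\<lambda>z. \<phi> n z * \<psi> n z)) \<le> C * schwartz_norm s b (\<phi> n) * schwartz_norm s b (\<psi> n)"
        by (intro exI allI impI C(2)) (use \<phi>(1) \<psi>(1) in \<open>simp_all add: X_approx_def\<close>)
    qed
    finally show ?thesis .
  qed
  have "X_norm s b' ?T \<le> C * X_norm s b (real_dist u) * q"
    if \<psi>: "X_approx s b \<psi> (real_dist v)" "(\<lambda>n. schwartz_norm s b (\<psi> n)) \<longlonglongrightarrow> q" for \<psi> q
  proof -
    have "0 \<le> q" by (rule LIMSEQ_le_const[OF \<psi>(2)]) (simp add: schwartz_norm_nonneg)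
    moreover have "X_norm s b' ?T \<le> C * q * p"
      if "X_approx s b \<phi> (real_dist u)" "(\<lambda>n. schwartz_norm s b (\<phi> n)) \<longlonglongrightarrow> p" for \<phi> p
      using le[OF that \<psi>] by (simp add: mult_ac)
    ultimately have "X_norm s b' ?T \<le> C * q * X_norm s b (real_dist u)"
      unfolding X_norm_def[of s b] using C(1) by (intro le_mult_Inf X_norm_nonneg(2) X) auto
    then show ?thesis by (simp add: mult_ac)
  qed
  then show "X_norm s b' ?T \<le> C * X_norm s b (real_dist u) * X_norm s b (real_dist v)"
    unfolding X_norm_def[of s b "real_dist v"] using C(1) X_norm_nonneg(1)[OF X(1)]
    by (intro le_mult_Inf X_norm_nonneg(2) X) auto
qed

theorem proposition5p1:
  fixes s :: real
  assumes "s \<ge> 1"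
  shows "\<exists>\<delta>>0. \<exists>C>0. \<forall>u \<in> X_fun s (1/2 + \<delta>). \<forall>v \<in> X_fun s (1/2 + \<delta>).
    dist_dx (real_dist (\<lambda>z. u z * v z)) \<in> X_space s (- 1/2 + 2 * \<delta>) \<and>
    X_norm s (- 1/2 + 2 * \<delta>) (dist_dx (real_dist (\<lambda>z. u z * v z)))
      \<le> C * X_norm s (1/2 + \<delta>) (real_dist u) * X_norm s (1/2 + \<delta>) (real_dist v)"
proof (rule exI[of _ "1 / 72"], intro conjI)
  obtain C where C: "0 < C" "\<And>f g. schwartz f \<Longrightarrow> schwartz g \<Longrightarrow>
      schwartz_norm s (- 17/36) (partial_x (\<lambda>z. f z * g z)) \<le> C * schwartz_norm s (37/72) f * schwartz_norm s (37/72) g"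
    using schwartz_bilinear[OF assms] by auto
  have e: "1/2 + 1/72 = (37/72 :: real)" "- 1/2 + 2 * (1/72) = (- 17/36 :: real)" by simp_all
  have s: "0 \<le> s" "(0 :: real) \<le> 37/72" using assms by simp_all
  show "\<exists>C>0. \<forall>u \<in> X_fun s (1/2 + 1/72). \<forall>v \<in> X_fun s (1/2 + 1/72).
    dist_dx (real_dist (\<lambda>z. u z * v z)) \<in> X_space s (- 1/2 + 2 * (1/72)) \<and>
    X_norm s (- 1/2 + 2 * (1/72)) (dist_dx (real_dist (\<lambda>z. u z * v z)))
      \<le> C * X_norm s (1/2 + 1/72) (real_dist u) * X_norm s (1/2 + 1/72) (real_dist v)"
    unfolding e 
  proof (intro exI[of _ C] conjI ballI C(1))
    fix u v assume "u \<in> X_fun s (37/72)" "v \<in> X_fun s (37/72)"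
    note * = bilinear_X[OF s C(1) _ this]
    show "dist_dx (real_dist (\<lambda>z. u z * v z)) \<in> X_space s (- 17/36)"
      by (rule *(1)) (rule C(2))
    show "X_norm s (- 17/36) (dist_dx (real_dist (\<lambda>z. u z * v z)))
      \<le> C * X_norm s (37/72) (real_dist u) * X_norm s (37/72) (real_dist v)"
      by (rule *(2)) (rule C(2))
  qed
qed simp

end
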